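(* Fix $w \in W$. Let $P$ be an MV polytope of highest vertex $w$, i.e. $P \in \mathcal{P}_w$, with vertex data $(\mu_v)_{v \in W}$. Then $\mu_v = \mu_{v_w}$ for every $v \in W$, where $v_w$ denotes the unique element of maximal length in $[e,v]_R \cap [e,w]$.
   Context: $G$ is a semisimple, simply connected complex algebraic group with maximal torus $T$, Weyl group $W$ generated by simple reflections $s_i$ ($i\in I$), length function $\ell$, longest element $w_0$. Simple coroots are $\alpha_i^\vee$, fundamental weights $\omega_i$, $\mathfrak{t}_{\mathbb{R}} = X_*(T)\otimes\mathbb{R}$. An MV (Mirković–Vilonen) polytope is meant in the sense of Kamnitzer: a polytope $P=\mathrm{conv}\{\mu_v : v\in W\}\subset \mathfrak{t}_{\mathbb{R}}$ with vertex data $(\mu_v)_{v\in W}$ in the coroot lattice, whose hyperplane data $M_{v\omega_i}=\langle \mu_v, v\omega_i\rangle$ form a Berenstein–Zelevinsky datum (equivalently, $P$ is the moment polytope of a stable MV cycle). $\mathcal{P}_w$ is the set of MV polytopes with $\mu_w=\mu_{w_0}$. The right weak order: $u \le_R x$ iff $\ell(u)+\ell(u^{-1}x)=\ell(x)$; $[e,v]_R=\{x: x\le_R v\}$; $\le$ is the (strong) Bruhat order and $[e,w]=\{x : x\le w\}$. The set $[e,v]_R\cap[e,w]$ has a unique element of maximal length, denoted $v_w$. *)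

theory Defs
  imports "HOL-Analysis.Convex"
begin

text \<open>
  The group $G$ enters only through its root datum. Since $G$ is semisimple and simply connected,
  the simple coroots are a basis of the cocharacter lattice $X_*(T)$, the fundamental weights are
  the dual basis of the weight lattice, and the datum amounts to a Cartan matrix of finite type,
  \<^term>\<open>a i j\<close> $= \langle \alpha_i^\vee, \alpha_j \rangle$, together with the space
  $X_*(T) \otimes R$ spanned by the simple coroots. Weights are functions on that space.
\<close>

definition finite_type_cartan :: "'i set \<Rightarrow> ('i \<Rightarrow> 'i \<Rightarrow> int) \<Rightarrow> bool" where
  "finite_type_cartan I a \<longleftrightarrow>
     finite I \<and>
     (\<forall>i\<in>I. a i i = 2) \<and>
     (\<forall>i\<in>I. \<forall>j\<in>I. i \<noteq> j \<longrightarrow> a i j \<le> 0) \<and>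
     (\<forall>i\<in>I. \<forall>j\<in>I. a i j = 0 \<longleftrightarrow> a j i = 0) \<and>
     (\<exists>d :: 'i \<Rightarrow> real.
        (\<forall>i\<in>I. d i > 0) \<and>
        (\<forall>i\<in>I. \<forall>j\<in>I. d i * of_int (a i j) = d j * of_int (a j i)) \<and>
        (\<forall>x :: 'i \<Rightarrow> real. (\<exists>i\<in>I. x i \<noteq> 0) \<longrightarrow>
           (\<Sum>i\<in>I. \<Sum>j\<in>I. d i * of_int (a i j) * x i * x j) > 0))"

text \<open>
  Tropicalisation, in the (min,+) semifield, of the Berenstein--Zelevinsky transition
  $x_i(t_1) x_j(t_2) \cdots x_j(t_6) = x_j(p_1) x_i(p_2) \cdots x_i(p_6)$ in type $G_2$ with
  $\langle \alpha_i^\vee, \alpha_j \rangle = -3$. The numbers \<^term>\<open>pi1\<close>, \dots, \<^term>\<open>pi4\<close>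
  tropicalise their polynomials $\pi_1, \dots, \pi_4$.
\<close>

definition G2_transition :: "int \<Rightarrow> int \<Rightarrow> int \<Rightarrow> int \<Rightarrow> int \<Rightarrow> int \<Rightarrow> int list" where
  "G2_transition t1 t2 t3 t4 t5 t6 =
     (let q = min t1 t3 + min t3 t5;
          pi1 = Min {t1 + t2 + 2*t3 + t4,
                     t1 + t2 + 2 * min t3 t5 + t6,
                     min t1 t3 + t4 + 2*t5 + t6};
          pi2 = Min {2*t1 + 2*t2 + 3*t3 + t4,
                     2*t1 + 2*t2 + 3 * min t3 t5 + t6,
                     2 * min t1 t3 + 2*t4 + 3*t5 + t6,
                     t1 + t2 + t4 + 2*t5 + t6 + q};
          pi3 = Min {3*t1 + 2*t2 + 3*t3 + t4,
                     3*t1 + 2*t2 + 3 * min t3 t5 + t6,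
                     3 * min t1 t3 + 2*t4 + 3*t5 + t6,
                     2*t1 + t2 + t4 + 2*t5 + t6 + q};
          pi4 = Min {2*t1 + 2*t2 + 3*t3 + t4 +
                       Min {t1 + t2 + 3*t3 + t4, t1 + t2 + 3 * min t3 t5 + t6, q + t4 + 2*t5 + t6},
                     2*t6 + 3 * min (t1 + t2 + 2 * min t3 t5) (min t1 t3 + t4 + 2*t5)}
      in [t2 + 3*t3 + 2*t4 + 3*t5 + t6 - pi3,
          pi3 - pi2,
          3*pi2 - pi3 - pi4,
          pi4 - pi1 - pi2,
          3*pi1 - pi4,
          t1 + t2 + 2*t3 + t4 + t5 - pi1])"

locale root_datum =
  fixes I :: "'i set"
    and a :: "'i \<Rightarrow> 'i \<Rightarrow> int"
    and coroot :: "'i \<Rightarrow> 'v::real_vector"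
  assumes cartan: "finite_type_cartan I a"
    and coroot_inj: "inj_on coroot I"
    and coroot_independent: "independent (coroot ` I)"
    and coroot_span: "span (coroot ` I) = UNIV"
begin

definition fund_weight :: "'i \<Rightarrow> 'v \<Rightarrow> real" where
  "fund_weight i h = representation (coroot ` I) h (coroot i)"

definition root :: "'i \<Rightarrow> 'v \<Rightarrow> real" where
  "root j h = (\<Sum>i\<in>I. of_int (a i j) * fund_weight i h)"

definition coroot_lattice :: "'v set" where
  "coroot_lattice = {(\<Sum>i\<in>I. of_int (c i) *\<^sub>R coroot i) | c :: 'i \<Rightarrow> int. True}"

subsection \<open>The Weyl group, acting on the space of cocharacters\<close>

definition srefl :: "'i \<Rightarrow> 'v \<Rightarrow> 'v" where
  "srefl i h = h - root i h *\<^sub>R coroot i"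

definition word :: "'i list \<Rightarrow> 'v \<Rightarrow> 'v" where
  "word ks = foldr (\<lambda>i f. srefl i \<circ> f) ks id"

definition weyl :: "('v \<Rightarrow> 'v) set" where
  "weyl = word ` lists I"

definition len :: "('v \<Rightarrow> 'v) \<Rightarrow> nat" where
  "len w = (LEAST n. \<exists>ks\<in>lists I. length ks = n \<and> word ks = w)"

definition longest :: "('v \<Rightarrow> 'v) set \<Rightarrow> 'v \<Rightarrow> 'v" where
  "longest S = (THE x. x \<in> S \<and> (\<forall>y\<in>S. y \<noteq> x \<longrightarrow> len y < len x))"

definition w0 :: "'v \<Rightarrow> 'v" where
  "w0 = longest weyl"

definition reflections :: "('v \<Rightarrow> 'v) set" where
  "reflections = {w \<circ> srefl i \<circ> inv w | w i. w \<in> weyl \<and> i \<in> I}"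

definition bruhat_step :: "('v \<Rightarrow> 'v) \<Rightarrow> ('v \<Rightarrow> 'v) \<Rightarrow> bool" where
  "bruhat_step u x \<longleftrightarrow> u \<in> weyl \<and> (\<exists>t\<in>reflections. x = u \<circ> t) \<and> len u < len x"

definition bruhat_le :: "('v \<Rightarrow> 'v) \<Rightarrow> ('v \<Rightarrow> 'v) \<Rightarrow> bool" where
  "bruhat_le = bruhat_step\<^sup>*\<^sup>*"

definition weak_le :: "('v \<Rightarrow> 'v) \<Rightarrow> ('v \<Rightarrow> 'v) \<Rightarrow> bool" where
  "weak_le u x \<longleftrightarrow> len u + len (inv u \<circ> x) = len x"

definition bruhat_interval :: "('v \<Rightarrow> 'v) \<Rightarrow> ('v \<Rightarrow> 'v) set" where
  "bruhat_interval w = {x \<in> weyl. bruhat_le x w}"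

definition weak_interval :: "('v \<Rightarrow> 'v) \<Rightarrow> ('v \<Rightarrow> 'v) set" where
  "weak_interval v = {x \<in> weyl. weak_le x v}"

text \<open>The element $v_w$.\<close>

definition max_below :: "('v \<Rightarrow> 'v) \<Rightarrow> ('v \<Rightarrow> 'v) \<Rightarrow> 'v \<Rightarrow> 'v" where
  "max_below v w = longest (weak_interval v \<inter> bruhat_interval w)"

subsection \<open>Berenstein--Zelevinsky data and MV polytopes\<close>

text \<open>The chamber weight $w \omega_i$, via the contragredient action on weights.\<close>

definition chamber_weight :: "('v \<Rightarrow> 'v) \<Rightarrow> 'i \<Rightarrow> 'v \<Rightarrow> real" where
  "chamber_weight w i = fund_weight i \<circ> inv w"

text \<open>
  If $M$ is the hyperplane datum of $(\mu_v)$, this is the number $c$ with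
  $\mu_{w s_i} - \mu_w = c \cdot w \alpha_i^\vee$.
\<close>

definition edge_length :: "(('v \<Rightarrow> real) \<Rightarrow> int) \<Rightarrow> ('v \<Rightarrow> 'v) \<Rightarrow> 'i \<Rightarrow> int" where
  "edge_length M w i =
     - M (chamber_weight w i) - M (chamber_weight (w \<circ> srefl i) i)
     - (\<Sum>j\<in>I - {i}. a j i * M (chamber_weight w j))"

definition edge_inequalities :: "(('v \<Rightarrow> real) \<Rightarrow> int) \<Rightarrow> bool" where
  "edge_inequalities M \<longleftrightarrow> (\<forall>w\<in>weyl. \<forall>i\<in>I. edge_length M w i \<ge> 0)"

text \<open>
  The relations for $a_{ij} a_{ji} \le 2$ are Kamnitzer's. For $G_2$ the relation is stated through
  the edge lengths along the two reduced words of the longest element of the rank 2 subgroup;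
  the case $a_{ij} = -1$, $a_{ji} = -3$ is the same condition with $i$ and $j$ exchanged.
\<close>

definition tropical_pluecker_at ::
    "(('v \<Rightarrow> real) \<Rightarrow> int) \<Rightarrow> ('v \<Rightarrow> 'v) \<Rightarrow> 'i \<Rightarrow> 'i \<Rightarrow> bool" where
  "tropical_pluecker_at M w i j \<longleftrightarrow>
     (let m = (\<lambda>ks k. M (chamber_weight (w \<circ> word ks) k));
          e = (\<lambda>ks k. edge_length M (w \<circ> word ks) k)
      in
      (a i j = -1 \<and> a j i = -1 \<longrightarrow>
         m [i] i + m [j] j = min (m [] i + m [i,j] j) (m [j,i] i + m [] j)) \<and>
      (a i j = -1 \<and> a j i = -2 \<longrightarrow>
         m [j] j + m [i,j] j + m [i] i =
           Min {2 * m [i,j] j + m [] i,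
                2 * m [] j + m [i,j,i] i,
                m [] j + m [j,i,j] j + m [i] i} \<and>
         m [j,i] i + 2 * m [i,j] j + m [i] i =
           Min {2 * m [] j + 2 * m [i,j,i] i,
                2 * m [j,i,j] j + 2 * m [i] i,
                m [i,j,i] i + 2 * m [i,j] j + m [] i}) \<and>
      (a i j = -2 \<and> a j i = -1 \<longrightarrow>
         m [j,i] i + m [i] i + m [i,j] j =
           Min {2 * m [i] i + m [j,i,j] j,
                2 * m [i,j,i] i + m [] j,
                m [i,j,i] i + m [] i + m [i,j] j} \<and>
         m [j] j + 2 * m [i] i + m [i,j] j =
           Min {2 * m [i,j,i] i + 2 * m [] j,
                2 * m [] i + 2 * m [i,j] j,
                m [] j + 2 * m [i] i + m [j,i,j] j}) \<and>
      (a i j = -3 \<and> a j i = -1 \<longrightarrow>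
         [e [] j, e [j] i, e [j,i] j, e [j,i,j] i, e [j,i,j,i] j, e [j,i,j,i,j] i] =
         G2_transition (e [] i) (e [i] j) (e [i,j] i) (e [i,j,i] j) (e [i,j,i,j] i)
           (e [i,j,i,j,i] j)))"

definition tropical_pluecker :: "(('v \<Rightarrow> real) \<Rightarrow> int) \<Rightarrow> bool" where
  "tropical_pluecker M \<longleftrightarrow>
     (\<forall>w\<in>weyl. \<forall>i\<in>I. \<forall>j\<in>I.
        i \<noteq> j \<and> len w < len (w \<circ> srefl i) \<and> len w < len (w \<circ> srefl j) \<longrightarrow>
        tropical_pluecker_at M w i j)"

text \<open>Only the values of $M$ at chamber weights matter.\<close>

definition BZ_datum :: "(('v \<Rightarrow> real) \<Rightarrow> int) \<Rightarrow> bool" where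
  "BZ_datum M \<longleftrightarrow> edge_inequalities M \<and> tropical_pluecker M"

text \<open>\<open>MV_polytope P \<mu>\<close>: $P$ is an MV polytope with vertex data $(\mu_v)_{v \in W}$.\<close>

definition MV_polytope :: "'v set \<Rightarrow> (('v \<Rightarrow> 'v) \<Rightarrow> 'v) \<Rightarrow> bool" where
  "MV_polytope P \<mu> \<longleftrightarrow>
     P = convex hull (\<mu> ` weyl) \<and>
     (\<forall>v\<in>weyl. \<mu> v \<in> coroot_lattice) \<and>
     (\<exists>M. BZ_datum M \<and>
        (\<forall>v\<in>weyl. \<forall>i\<in>I. of_int (M (chamber_weight v i)) = chamber_weight v i (\<mu> v)))"

definition MV_polytopes_highest :: "('v \<Rightarrow> 'v) \<Rightarrow> 'v set set" where
  "MV_polytopes_highest w = {P. \<exists>\<mu>. MV_polytope P \<mu> \<and> \<mu> w = \<mu> w0}"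

end

end

theory Submission
  imports Defs
begin

text \<open>
  Write \<open>z(v)\<close> for the element with \<open>v_w = v z(v)\<close>; it comes from \<open>inv v\<close> by successively passing to
  \<open>min(x, x s_j)\<close> along a reduced word of \<open>w\<close>. The theorem is proved by downward induction on the length of \<open>v\<close>:
  if \<open>v < v s = Y\<close>, then \<open>v z(v) = Y z(Y)\<close>, and the claim follows because vertices move monotonically along weak
  order intervals, or \<open>z(v) = z(Y) = g\<close>, and one has to see that vanishing of all edges from \<open>Y\<close> to \<open>Y g\<close> forces
  vanishing of all edges from \<open>Y s\<close> to \<open>Y s g\<close>. This follows from the inequality
  \<open>M(Y g \<omega>) \<le> M(Y s g \<omega>) + \<langle>\<alpha>_s, g \<omega>\<rangle> (M(Y \<omega>_s) - M(Y s \<omega>_s))\<close>. To prove it, the datum below \<open>Y\<close> is realised as the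
  exponents of the minors of a one-parameter family of real flags that are positive by the Pluecker relations; the minor
  at \<open>g \<omega>\<close> is a polynomial in the last parameter whose leading coefficient is governed by the minor at \<open>s g \<omega>\<close>,
  and positivity for several values of the parameter bounds this coefficient. The minors live in the space of
  real functions on words in the simple roots, with the shuffle product as multiplication of sections and explicit raising
  and lowering operators. A factor of type \<open>G_2\<close> splits off and is handled by the
  tropical transition map directly.
\<close>

text \<open>The hypothesis \<open>\<mu> w = \<mu> w0\<close> is the claim at \<open>v = w0\<close>,
  because \<open>w0 z(w0) = w\<close>; this is why the induction runs downward. Equality of vertices
  comes from combining the inequality for minors with an opposite one: \<open>M\<close> at a chamber
  weight is the minimum of that weight over all vertices. The tropical relations link only chamber
  weights of one rank 2 coset. Real flags turn them into identities between minors, and then a whole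
  polynomial in one parameter is at hand. The exponent of a minor is a two-sided bound
  \<open>c q^m \<le> f \<le> C q^m\<close> for \<open>0 < q \<le> 1\<close>. Such bounds pass
  through sums, products and quotients of positive quantities, so every relation has to be used in
  subtraction-free form. The parameters are fixed by prescribing the values
  \<open>(n+1) q^x\<close>, which have the same order for all \<open>n\<close>; so each choice
  realises the same datum, and a finite difference over \<open>n = 0, ..., c\<close> isolates the
  leading coefficient. Triple bonds are kept out of this model because the lifts of the simple
  reflections are controlled only on commutator strings of at most three operators, and Pluecker
  relations are available only in types \<open>A_2\<close> and \<open>B_2\<close>.\<close>

fun rank2_coeffs :: "int \<Rightarrow> int \<Rightarrow> nat \<Rightarrow> int \<times> int" where
  "rank2_coeffs b c 0 = (1, 0)"
| "rank2_coeffs b c (Suc k) = (let (p, q) = rank2_coeffs b c k in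
     if even k then (p, - q - b * p) else (- p - c * q, q))"

text \<open>The pairs hold the coefficients of \<open>root s h\<close> and \<open>root t h\<close>
  in the displacement of \<open>h\<close> along \<open>coroot s\<close> and along
  \<open>coroot t\<close>. As in \<open>rank2_coeffs\<close>, \<open>b = a s t\<close> and
  \<open>c = a t s\<close>; integer recursions allow each Cartan type to be settled by
  evaluation.\<close>

fun rank2_shifts :: "int \<Rightarrow> int \<Rightarrow> nat \<Rightarrow> (int \<times> int) \<times> (int \<times> int)" where
  "rank2_shifts b c 0 = ((0, 0), (0, 0))"
| "rank2_shifts b c (Suc k) = (let ((x1, x2), (y1, y2)) = rank2_shifts b c k in
     if even k then ((x1, x2), (- y1 - b * x1, - y2 - 1 - b * x2))
     else ((- x1 - 1 - c * y1, - x2 - c * y2), (y1, y2)))"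

lemma rank2_coeffs_numeral [simp]:
  "rank2_coeffs b c (numeral v) = (let (p, q) = rank2_coeffs b c (pred_numeral v) in
     if even (pred_numeral v) then (p, - q - b * p) else (- p - c * q, q))"
  by (subst numeral_eq_Suc) simp

lemma rank2_shifts_numeral [simp]:
  "rank2_shifts b c (numeral v) = (let ((x1, x2), (y1, y2)) = rank2_shifts b c (pred_numeral v) in
     if even (pred_numeral v) then ((x1, x2), (- y1 - b * x1, - y2 - 1 - b * x2))
     else ((- x1 - 1 - c * y1, - x2 - c * y2), (y1, y2)))"
  by (subst numeral_eq_Suc) simp

text \<open>The word grows at its front: its last letter, which acts first in \<open>word\<close>,
  is always \<open>x\<close>, and parity decides its first letter.\<close>

fun alt :: "nat \<Rightarrow> 'i \<Rightarrow> 'i \<Rightarrow> 'i list" where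
  "alt 0 x y = []"
| "alt (Suc k) x y = (if even k then x else y) # alt k x y"

lemma length_alt [simp]: "length (alt k x y) = k"
  by (induction k) auto

lemma set_alt: "set (alt k x y) \<subseteq> {x, y}"
  by (induction k) auto

lemma alt_last: "alt (Suc k) x y = alt k y x @ [x]"
  by (induction k) auto

lemma alt_add: "\<exists>pre. alt (k + n) x y = pre @ alt k x y \<and> set pre \<subseteq> {x, y} \<and> length pre = n"
proof (induction n)
  case (Suc n)
  then obtain pre where "alt (k + n) x y = pre @ alt k x y" "set pre \<subseteq> {x, y}" "length pre = n" by auto
  then show ?case by (intro exI[of _ "(if even (k + n) then x else y) # pre"]) auto
qed auto

context root_datum
begin

lemma finite_I [simp]: "finite I"
  using cartan unfolding finite_type_cartan_def by blast

lemma cartan_diag [simp]: "i \<in> I \<Longrightarrow> a i i = 2"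
  using cartan unfolding finite_type_cartan_def by blast

lemma cartan_nonpos: "i \<in> I \<Longrightarrow> j \<in> I \<Longrightarrow> i \<noteq> j \<Longrightarrow> a i j \<le> 0"
  using cartan unfolding finite_type_cartan_def by blast

lemma cartan_zero: "i \<in> I \<Longrightarrow> j \<in> I \<Longrightarrow> a i j = 0 \<longleftrightarrow> a j i = 0"
  using cartan unfolding finite_type_cartan_def by blast

definition symmetrizer :: "'i \<Rightarrow> real" where
  "symmetrizer = (SOME d. (\<forall>i\<in>I. d i > 0) \<and>
        (\<forall>i\<in>I. \<forall>j\<in>I. d i * of_int (a i j) = d j * of_int (a j i)) \<and>
        (\<forall>x :: 'i \<Rightarrow> real. (\<exists>i\<in>I. x i \<noteq> 0) \<longrightarrow>
           (\<Sum>i\<in>I. \<Sum>j\<in>I. d i * of_int (a i j) * x i * x j) > 0))"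

lemma symmetrizer_props: "(\<forall>i\<in>I. symmetrizer i > 0) \<and>
        (\<forall>i\<in>I. \<forall>j\<in>I. symmetrizer i * of_int (a i j) = symmetrizer j * of_int (a j i)) \<and>
        (\<forall>x :: 'i \<Rightarrow> real. (\<exists>i\<in>I. x i \<noteq> 0) \<longrightarrow>
           (\<Sum>i\<in>I. \<Sum>j\<in>I. symmetrizer i * of_int (a i j) * x i * x j) > 0)"
proof -
  have "\<exists>d :: 'i \<Rightarrow> real. (\<forall>i\<in>I. d i > 0) \<and>
        (\<forall>i\<in>I. \<forall>j\<in>I. d i * of_int (a i j) = d j * of_int (a j i)) \<and>
        (\<forall>x :: 'i \<Rightarrow> real. (\<exists>i\<in>I. x i \<noteq> 0) \<longrightarrow>
           (\<Sum>i\<in>I. \<Sum>j\<in>I. d i * of_int (a i j) * x i * x j) > 0)"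
    using cartan unfolding finite_type_cartan_def by blast
  from someI_ex[OF this] show ?thesis unfolding symmetrizer_def .
qed

lemma symmetrizer_pos: "i \<in> I \<Longrightarrow> symmetrizer i > 0"
  using symmetrizer_props by blast

lemma symmetrizer_sym: "i \<in> I \<Longrightarrow> j \<in> I \<Longrightarrow> symmetrizer i * of_int (a i j) = symmetrizer j * of_int (a j i)"
  using symmetrizer_props by blast

lemma symmetrizer_definite: "i \<in> I \<Longrightarrow> x i \<noteq> 0 \<Longrightarrow>
    (\<Sum>i\<in>I. \<Sum>j\<in>I. symmetrizer i * of_int (a i j) * x i * x j) > 0"
  using symmetrizer_props by blast

lemma cartan_product:
  assumes "i \<in> I" "j \<in> I" "i \<noteq> j"
  shows "a i j * a j i < 4"
proof -
  let ?d = symmetrizer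
  \<comment> \<open>This vector annihilates the \<open>i\<close>-th factor
    \<open>2 * x i + a i j * x j\<close>, so that the form reduces to
    \<open>2 * ?d j * (4 - a i j * a j i)\<close>.\<close>
  define x where "x = (\<lambda>k. if k = i then - real_of_int (a i j) else if k = j then 2 else (0::real))"
  have x0: "x k = 0" if "k \<noteq> i" "k \<noteq> j" for k using that by (simp add: x_def)
  have inner: "(\<Sum>l\<in>I. ?d k * of_int (a k l) * x k * x l) = ?d k * x k * (of_int (a k i) * x i + of_int (a k j) * x j)" for k
  proof -
    have "(\<Sum>l\<in>I. ?d k * of_int (a k l) * x k * x l) = (\<Sum>l\<in>{i,j}. ?d k * of_int (a k l) * x k * x l)"
      by (rule sum.mono_neutral_right) (use assms x0 in auto)
    also have "\<dots> = ?d k * x k * (of_int (a k i) * x i + of_int (a k j) * x j)"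
      using assms by (simp add: algebra_simps)
    finally show ?thesis .
  qed
  have "(\<Sum>k\<in>I. \<Sum>l\<in>I. ?d k * of_int (a k l) * x k * x l) = (\<Sum>k\<in>{i,j}. ?d k * x k * (of_int (a k i) * x i + of_int (a k j) * x j))"
    unfolding inner by (rule sum.mono_neutral_right) (use assms x0 in auto)
  also have "\<dots> = ?d i * x i * (2 * x i + of_int (a i j) * x j) + ?d j * x j * (of_int (a j i) * x i + 2 * x j)"
    using assms by simp
  also have "\<dots> = ?d j * 2 * (4 - of_int (a i j * a j i))"
    using assms(3) by (simp add: x_def algebra_simps)
  finally have "?d j * 2 * (4 - of_int (a i j * a j i)) > 0"
    using symmetrizer_definite[of j x] assms by (simp add: x_def)
  then have "4 - real_of_int (a i j * a j i) > 0"
    using symmetrizer_pos[OF assms(2)] by (simp add: zero_less_mult_iff)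
  then show ?thesis by linarith
qed

lemma cartan_cases:
  assumes "i \<in> I" "j \<in> I" "i \<noteq> j"
  obtains "a i j = 0" "a j i = 0" | "a i j = -1" "a j i = -1"
    | "a i j = -1" "a j i = -2" | "a i j = -2" "a j i = -1"
    | "a i j = -1" "a j i = -3" | "a i j = -3" "a j i = -1"
proof (cases "a i j = 0")
  case True then show ?thesis using that(1) cartan_zero assms by auto
next
  case False
  then have 1: "a i j \<le> -1" "a j i \<le> -1"
    using False assms cartan_nonpos[of i j] cartan_nonpos[of j i] cartan_zero[of i j] by auto
  have p: "a i j * a j i < 4" using cartan_product assms by blast
  have "a i j \<ge> -3"
  proof (rule ccontr)
    assume "\<not> ?thesis"
    then have "(- a i j) * (- a j i) \<ge> 4 * 1" using 1 by (intro mult_mono) auto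
    then show False using p by simp
  qed
  moreover have "a j i \<ge> -3"
  proof (rule ccontr)
    assume "\<not> ?thesis"
    then have "(- a i j) * (- a j i) \<ge> 1 * 4" using 1 by (intro mult_mono) auto
    then show False using p by simp
  qed
  ultimately have "a i j = -1 \<or> a i j = -2 \<or> a i j = -3" "a j i = -1 \<or> a j i = -2 \<or> a j i = -3" using 1 by linarith+
  then show ?thesis using that p by (elim disjE) simp_all
qed

subsection \<open>Coordinates\<close>

lemma in_span [simp]: "x \<in> span (coroot ` I)" using coroot_span by simp

lemma linear_fund_weight: "linear (fund_weight i)"
  unfolding fund_weight_def
  by (intro linearI) (simp_all add: representation_add representation_scale coroot_independent)

lemma fund_weight_coroot: "i \<in> I \<Longrightarrow> j \<in> I \<Longrightarrow> fund_weight i (coroot j) = (if i = j then 1 else 0)"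
  unfolding fund_weight_def
  using coroot_inj by (auto simp: representation_basis coroot_independent inj_on_def)

lemma expand: "h = (\<Sum>i\<in>I. fund_weight i h *\<^sub>R coroot i)"
proof -
  have "(\<Sum>b\<in>coroot ` I. representation (coroot ` I) h b *\<^sub>R b) = h"
    by (rule sum_representation_eq) (auto simp: coroot_independent)
  then show ?thesis by (simp add: fund_weight_def sum.reindex[OF coroot_inj])
qed

lemma fund_weight_eqI: "(\<And>i. i \<in> I \<Longrightarrow> fund_weight i x = fund_weight i y) \<Longrightarrow> x = y"
  by (subst (1 2) expand) (simp cong: sum.cong)

lemmas fund_weight_simps [simp] =
  linear_add[OF linear_fund_weight] linear_diff[OF linear_fund_weight]
  linear_scale[OF linear_fund_weight] linear_0[OF linear_fund_weight]
  linear_neg[OF linear_fund_weight] linear_sum[OF linear_fund_weight]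

lemma linear_root: "linear (root j)"
  by (intro linearI) (simp_all add: root_def sum.distrib sum_distrib_left algebra_simps)

lemmas root_simps [simp] =
  linear_add[OF linear_root] linear_diff[OF linear_root]
  linear_scale[OF linear_root] linear_0[OF linear_root]
  linear_neg[OF linear_root] linear_sum[OF linear_root]

lemma root_coroot [simp]: "i \<in> I \<Longrightarrow> root j (coroot i) = of_int (a i j)"
  by (simp add: root_def fund_weight_coroot if_distrib sum.If_cases cong: if_cong)

lemma linear_srefl: "linear (srefl i)"
  by (intro linearI) (simp_all add: srefl_def algebra_simps)

lemma srefl_invol [simp]: "i \<in> I \<Longrightarrow> srefl i (srefl i h) = h"
  by (simp add: srefl_def algebra_simps)

lemma srefl_comp_self [simp]: "i \<in> I \<Longrightarrow> srefl i \<circ> srefl i = id"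
  by (auto simp: fun_eq_iff)

lemma srefl_comp_self' [simp]: "i \<in> I \<Longrightarrow> w \<circ> srefl i \<circ> srefl i = w"
  by (auto simp: fun_eq_iff)

lemma word_Nil [simp]: "word [] = id" by (simp add: word_def)
lemma word_Cons [simp]: "word (k # ks) = srefl k \<circ> word ks" by (simp add: word_def)
lemma word_append [simp]: "word (xs @ ys) = word xs \<circ> word ys" by (induction xs) (auto simp: fun_eq_iff)

lemma word_singleton [simp]: "word [k] = srefl k" by (simp only: word_Cons word_Nil comp_id)

lemma word_snoc [simp]: "word (xs @ [k]) = word xs \<circ> srefl k"
  unfolding word_append word_Cons word_Nil comp_id ..

lemma word_rev_left: "ks \<in> lists I \<Longrightarrow> word (rev ks) \<circ> word ks = id"
  by (induction ks) (auto simp: fun_eq_iff)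

lemma word_rev_right: "ks \<in> lists I \<Longrightarrow> word ks \<circ> word (rev ks) = id"
  using word_rev_left[of "rev ks"] by (metis in_lists_conv_set rev_rev_ident set_rev)

lemma inv_word: "ks \<in> lists I \<Longrightarrow> inv (word ks) = word (rev ks)"
  by (rule inv_unique_comp) (simp_all add: word_rev_left word_rev_right)

lemma bij_word: "ks \<in> lists I \<Longrightarrow> bij (word ks)"
  using o_bij word_rev_left word_rev_right by blast

lemma weyl_word [intro]: "ks \<in> lists I \<Longrightarrow> word ks \<in> weyl" by (auto simp: weyl_def)

lemma weylE: assumes "w \<in> weyl" obtains ks where "ks \<in> lists I" "w = word ks"
  using assms by (auto simp: weyl_def)

lemma weyl_id [simp]: "id \<in> weyl" using weyl_word[of "[]"] by simp

lemma weyl_srefl [simp]: "i \<in> I \<Longrightarrow> srefl i \<in> weyl" using weyl_word[of "[i]"] by simp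

lemma weyl_comp [simp]: "x \<in> weyl \<Longrightarrow> y \<in> weyl \<Longrightarrow> x \<circ> y \<in> weyl"
  by (elim weylE) (metis append_in_lists_conv weyl_word word_append)

lemma weyl_inv [simp]: "x \<in> weyl \<Longrightarrow> inv x \<in> weyl"
  by (elim weylE) (metis inv_word in_lists_conv_set set_rev weyl_word)

lemma weyl_bij: "x \<in> weyl \<Longrightarrow> bij x" by (elim weylE) (simp add: bij_word)

lemma weyl_inv_left [simp]: "x \<in> weyl \<Longrightarrow> inv x \<circ> x = id"
  by (simp add: weyl_bij bij_is_inj)

lemma weyl_inv_right [simp]: "x \<in> weyl \<Longrightarrow> x \<circ> inv x = id"
  by (simp add: fun_eq_iff bij_is_surj surj_f_inv_f weyl_bij)

lemma weyl_inv_left' [simp]: "x \<in> weyl \<Longrightarrow> inv x (x h) = h"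
  by (simp add: bij_is_inj weyl_bij)

lemma weyl_inv_right' [simp]: "x \<in> weyl \<Longrightarrow> x (inv x h) = h"
  by (simp add: bij_is_surj surj_f_inv_f weyl_bij)

lemma inv_srefl [simp]: "i \<in> I \<Longrightarrow> inv (srefl i) = srefl i"
  using inv_word[of "[i]"] by simp

lemma inv_inv_weyl [simp]: "x \<in> weyl \<Longrightarrow> inv (inv x) = x"
  by (simp add: weyl_bij inv_inv_eq)

lemma inv_comp: "x \<in> weyl \<Longrightarrow> y \<in> weyl \<Longrightarrow> inv (x \<circ> y) = inv y \<circ> inv x"
  by (simp add: o_inv_distrib weyl_bij)

lemma linear_word: "linear (word ks)"
proof (induction ks)
  case (Cons k ks)
  have "linear (srefl k \<circ> word ks)" using linear_compose[OF Cons linear_srefl] by (simp only: comp_def)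
  then show ?case by (simp only: word_Cons)
qed (simp only: word_Nil linear_id)

lemma weyl_linear: "x \<in> weyl \<Longrightarrow> linear x"
  by (elim weylE) (simp add: linear_word)

subsection \<open>Length\<close>

lemma len_word_le: "ks \<in> lists I \<Longrightarrow> len (word ks) \<le> length ks"
  unfolding len_def by (rule Least_le) auto

lemma reduced_word: assumes "w \<in> weyl" obtains ks where "ks \<in> lists I" "word ks = w" "length ks = len w"
proof -
  obtain ls where "ls \<in> lists I" "word ls = w" using assms by (auto elim: weylE)
  then have "\<exists>n. \<exists>ks\<in>lists I. length ks = n \<and> word ks = w" by blast
  from LeastI_ex[OF this] show ?thesis using that unfolding len_def by blast
qed

lemma len_id [simp]: "len id = 0" using len_word_le[of "[]"] by simp

lemma len_eq_0: "w \<in> weyl \<Longrightarrow> len w = 0 \<longleftrightarrow> w = id"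
  by (metis len_id length_0_conv reduced_word word_Nil)

lemma len_comp_le: "x \<in> weyl \<Longrightarrow> y \<in> weyl \<Longrightarrow> len (x \<circ> y) \<le> len x + len y"
  by (metis append_in_lists_conv len_word_le length_append reduced_word word_append)

lemma len_inv_le: "x \<in> weyl \<Longrightarrow> len (inv x) \<le> len x"
  by (metis inv_word in_lists_conv_set len_word_le length_rev reduced_word set_rev)

lemma len_inv [simp]: "x \<in> weyl \<Longrightarrow> len (inv x) = len x"
  using len_inv_le[of x] len_inv_le[of "inv x"] by simp

lemma len_srefl_le: "i \<in> I \<Longrightarrow> len (srefl i) \<le> 1"
  using len_word_le[of "[i]"] by simp

lemma len_right_le: "w \<in> weyl \<Longrightarrow> i \<in> I \<Longrightarrow> len (w \<circ> srefl i) \<le> Suc (len w)"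
  using len_comp_le[of w "srefl i"] len_srefl_le[of i] by simp

lemma len_right_ge: "w \<in> weyl \<Longrightarrow> i \<in> I \<Longrightarrow> len w \<le> Suc (len (w \<circ> srefl i))"
  using len_right_le[of "w \<circ> srefl i" i] by simp

section \<open>Dihedral subgroups and the sign criterion for the length\<close>

text \<open>The Coxeter exponent. The default 6 stands for product 3, the only remaining value by
  \<open>cartan_product\<close>.\<close>

definition mm :: "'i \<Rightarrow> 'i \<Rightarrow> nat" where
  "mm i j = (let p = a i j * a j i in if p = 0 then 2 else if p = 1 then 3 else if p = 2 then 4 else 6)"

lemma mm_sym: "mm i j = mm j i" by (simp add: mm_def mult.commute)

lemma srefl_shift_left:
  assumes "s \<in> I" "t \<in> I"
  shows "srefl s (h + p *\<^sub>R coroot s + q *\<^sub>R coroot t) = h + (- p - root s h - of_int (a t s) * q) *\<^sub>R coroot s + q *\<^sub>R coroot t"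
proof -
  have e: "- p - root s h - of_int (a t s) * q = p - root s (h + p *\<^sub>R coroot s + q *\<^sub>R coroot t)"
    using assms by simp
  show ?thesis unfolding e srefl_def scaleR_left_diff_distrib by simp
qed

lemma srefl_shift_right:
  assumes "s \<in> I" "t \<in> I"
  shows "srefl t (h + p *\<^sub>R coroot s + q *\<^sub>R coroot t) = h + p *\<^sub>R coroot s + (- q - root t h - of_int (a s t) * p) *\<^sub>R coroot t"
  using srefl_shift_left[OF assms(2,1), of h q p] by (simp add: add_ac)

lemma srefl_rank2_left:
  assumes "s \<in> I" "t \<in> I"
  shows "srefl s (p *\<^sub>R coroot s + q *\<^sub>R coroot t) = (- p - of_int (a t s) * q) *\<^sub>R coroot s + q *\<^sub>R coroot t"
  using srefl_shift_left[OF assms, of 0] by simp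

lemma srefl_rank2_right:
  assumes "s \<in> I" "t \<in> I"
  shows "srefl t (p *\<^sub>R coroot s + q *\<^sub>R coroot t) = p *\<^sub>R coroot s + (- q - of_int (a s t) * p) *\<^sub>R coroot t"
  using srefl_shift_right[OF assms, of 0] by simp

lemma rank2_coeffs:
  assumes "s \<in> I" "t \<in> I"
  shows "word (alt k t s) (coroot s) =
    of_int (fst (rank2_coeffs (a s t) (a t s) k)) *\<^sub>R coroot s + of_int (snd (rank2_coeffs (a s t) (a t s) k)) *\<^sub>R coroot t"
  using assms by (induction k) (auto simp: srefl_rank2_left srefl_rank2_right case_prod_unfold Let_def)

text \<open>A finite check: at most six values of \<open>k\<close> in each of the six rank 2 Cartan
  types.\<close>

lemma rank2_nonneg:
  assumes "s \<in> I" "t \<in> I" "s \<noteq> t" "k < mm s t"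
  shows "\<exists>p q. p \<ge> 0 \<and> q \<ge> 0 \<and> word (alt k t s) (coroot s) = p *\<^sub>R coroot s + q *\<^sub>R coroot t"
proof -
  have k: "k = 0 \<or> k = 1 \<or> k = 2 \<or> k = 3 \<or> k = 4 \<or> k = 5" if "k < 6" for k :: nat using that by auto
  have k6: "k < 6" using assms by (auto simp: mm_def Let_def split: if_splits)
  have "fst (rank2_coeffs (a s t) (a t s) k) \<ge> 0 \<and> snd (rank2_coeffs (a s t) (a t s) k) \<ge> 0"
    using assms(1-3)
    by (cases rule: cartan_cases)
       (use k[OF k6] assms(4) in \<open>auto simp: mm_def\<close>)
  then show ?thesis using rank2_coeffs[OF assms(1,2)] by (metis of_int_0_le_iff)
qed

lemma rank2_shifts:
  assumes "s \<in> I" "t \<in> I"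
  shows "word (alt k t s) h = (case rank2_shifts (a s t) (a t s) k of ((x1, x2), (y1, y2)) \<Rightarrow>
    h + (of_int x1 * root s h + of_int x2 * root t h) *\<^sub>R coroot s + (of_int y1 * root s h + of_int y2 * root t h) *\<^sub>R coroot t)"
proof (induction k)
  case (Suc k)
  obtain x1 x2 y1 y2 where e: "rank2_shifts (a s t) (a t s) k = ((x1, x2), (y1, y2))"
    by (metis prod.exhaust)
  define P where "P = of_int x1 * root s h + of_int x2 * root t h"
  define R where "R = of_int y1 * root s h + of_int y2 * root t h"
  have IH: "word (alt k t s) h = h + P *\<^sub>R coroot s + R *\<^sub>R coroot t"
    using Suc.IH e by (simp add: P_def R_def)
  show ?case
  proof (cases "even k")
    case True
    then have "word (alt (Suc k) t s) h = srefl t (word (alt k t s) h)" by simp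
    also have "\<dots> = h + P *\<^sub>R coroot s + (- R - root t h - of_int (a s t) * P) *\<^sub>R coroot t"
      unfolding IH by (rule srefl_shift_right[OF assms])
    finally show ?thesis using True e by (simp add: P_def R_def algebra_simps)
  next
    case False
    then have "word (alt (Suc k) t s) h = srefl s (word (alt k t s) h)" by simp
    also have "\<dots> = h + (- P - root s h - of_int (a t s) * R) *\<^sub>R coroot s + R *\<^sub>R coroot t"
      unfolding IH by (rule srefl_shift_left[OF assms])
    finally show ?thesis using False e by (simp add: P_def R_def algebra_simps)
  qed
qed auto

text \<open>Obtained for the actual action on the space, by evaluating the displacement of a vector
  under both words, and not from a presentation of the group.\<close>

lemma braid:
  assumes "s \<in> I" "t \<in> I" "s \<noteq> t"
  shows "word (alt (mm s t) s t) = word (alt (mm s t) t s)"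
proof
  fix h
  show "word (alt (mm s t) s t) h = word (alt (mm s t) t s) h"
    unfolding rank2_shifts[OF assms(1,2)] rank2_shifts[OF assms(2,1)]
    using assms
    by (cases rule: cartan_cases) (simp_all add: mm_def algebra_simps)
qed

text \<open>Splitting off the longest alternating tail with additive length leaves a minimal
  representative of the dihedral coset. The inequalities for \<open>w'\<close> are weak because
  equal lengths are excluded only later.\<close>

lemma rank2_decomp:
  assumes w: "w \<in> weyl" and st: "s \<in> I" "t \<in> I" "s \<noteq> t" and wt: "len (w \<circ> srefl t) < len w"
  obtains k w' where "w' \<in> weyl" "k > 0" "w = w' \<circ> word (alt k t s)" "len w = len w' + k"
    "len w' \<le> len (w' \<circ> srefl s)" "len w' \<le> len (w' \<circ> srefl t)"
proof -
  define Q where "Q = (\<lambda>k. \<exists>w'\<in>weyl. w = w' \<circ> word (alt k t s) \<and> len w = len w' + k)"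
  have "len w = len (w \<circ> srefl t) + 1" using wt len_right_ge[OF w st(2)] by simp
  then have Q1: "Q 1" unfolding Q_def using w st by (intro bexI[of _ "w \<circ> srefl t"]) auto
  define k where "k = (GREATEST k. Q k)"
  have bd: "\<And>k. Q k \<Longrightarrow> k \<le> len w" by (auto simp: Q_def)
  have Qk: "Q k" unfolding k_def using Q1 bd by (blast intro: GreatestI_nat)
  have mx: "\<And>j. Q j \<Longrightarrow> j \<le> k" unfolding k_def using bd by (blast intro: Greatest_le_nat)
  then have k0: "k > 0" using Q1 by fastforce
  obtain w' where w': "w' \<in> weyl" "w = w' \<circ> word (alt k t s)" "len w = len w' + k"
    using Qk by (auto simp: Q_def)
  have "len w' \<le> len (w' \<circ> srefl c)" if c: "c = s \<or> c = t" for c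
  proof (rule ccontr)
    assume "\<not> ?thesis"
    then have lt: "len w' = len (w' \<circ> srefl c) + 1" using len_right_ge[of w' c] w' c st by auto
    have cI: "c \<in> I" using c st by auto
    show False
    \<comment> \<open>If \<open>c\<close> continues the alternation, the tail was not the longest;
      otherwise \<open>c\<close> cancels the first letter of the tail, and \<open>w\<close> would be
      too short.\<close>
    proof (cases "c = (if even k then t else s)")
      case True
      have "Q (Suc k)" unfolding Q_def
        by (rule bexI[of _ "w' \<circ> srefl c"]) (use w' lt True cI in \<open>auto simp: fun_eq_iff\<close>)
      then show False using mx by fastforce
    next
      case False
      obtain j where j: "k = Suc j" using k0 by (cases k) auto
      have "alt k t s = c # alt j t s" using False c j by auto
      then have "w = (w' \<circ> srefl c) \<circ> word (alt j t s)" using w' by (auto simp: fun_eq_iff)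
      moreover have "alt j t s \<in> lists I" using set_alt[of j t s] st by auto
      ultimately have "len w \<le> len (w' \<circ> srefl c) + j"
        using len_comp_le[of "w' \<circ> srefl c" "word (alt j t s)"] len_word_le[of "alt j t s"] w' cI by fastforce
      then show False using w' lt j by simp
    qed
  qed
  then show ?thesis using that w' k0 by blast
qed

lemma alt_lists: "s \<in> I \<Longrightarrow> t \<in> I \<Longrightarrow> alt k s t \<in> lists I"
  using set_alt[of k s t] by auto

definition nonneg :: "'v \<Rightarrow> bool" where "nonneg x \<longleftrightarrow> (\<forall>k\<in>I. fund_weight k x \<ge> 0)"

lemma nonneg_add: "nonneg x \<Longrightarrow> nonneg y \<Longrightarrow> nonneg (x + y)" by (simp add: nonneg_def)
lemma nonneg_scale: "c \<ge> 0 \<Longrightarrow> nonneg x \<Longrightarrow> nonneg (c *\<^sub>R x)" by (simp add: nonneg_def)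
lemma nonneg_coroot: "i \<in> I \<Longrightarrow> nonneg (coroot i)" by (simp add: nonneg_def fund_weight_coroot)
lemma nonneg_0 [simp]: "nonneg 0" by (simp add: nonneg_def)
lemma nonneg_antisym: "nonneg x \<Longrightarrow> nonneg (- x) \<Longrightarrow> x = 0"
  by (rule fund_weight_eqI) (force simp: nonneg_def)

lemma coroot_nonzero: "i \<in> I \<Longrightarrow> coroot i \<noteq> 0"
  using fund_weight_coroot[of i i] by auto

lemma weyl_coroot_nonzero: "w \<in> weyl \<Longrightarrow> i \<in> I \<Longrightarrow> w (coroot i) \<noteq> 0"
  by (metis coroot_nonzero linear_0 weyl_inv_left' weyl_linear weyl_inv)

text \<open>Were the dihedral tail as long as the Coxeter exponent, the braid relation would let it
  end in \<open>s\<close>, and \<open>w \<circ> srefl s\<close> would be shorter than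
  \<open>w\<close>. So \<open>rank2_nonneg\<close> applies to the tail and the induction hypothesis
  to \<open>w'\<close>. The weak inequality in the hypothesis is what later excludes equal
  lengths.\<close>

lemma ascent_nonneg_weak:
  assumes "w \<in> weyl" "s \<in> I" "len w \<le> len (w \<circ> srefl s)"
  shows "nonneg (w (coroot s))"
  using assms
proof (induction "len w" arbitrary: w s rule: less_induct)
  case less
  show ?case
  proof (cases "w = id")
    case True then show ?thesis using less nonneg_coroot by simp
  next
    case False
    obtain ks where ks: "ks \<in> lists I" "word ks = w" "length ks = len w" using reduced_word less by blast
    with False obtain ls t where l: "ks = ls @ [t]" by (metis rev_exhaust word_Nil)
    then have t: "t \<in> I" "ls \<in> lists I" using ks by auto
    have "w = word ls \<circ> srefl t" using ks l by (simp add: fun_eq_iff)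
    then have t2: "w \<circ> srefl t = word ls" using t by simp
    then have lt: "len (w \<circ> srefl t) < len w" using len_word_le[of ls] ks l t2 by simp
    then have ne: "s \<noteq> t" using less by auto
    obtain k w' where w': "w' \<in> weyl" "k > 0" "w = w' \<circ> word (alt k t s)" "len w = len w' + k"
      "len w' \<le> len (w' \<circ> srefl s)" "len w' \<le> len (w' \<circ> srefl t)"
      using rank2_decomp[OF less(2,3) t(1) ne lt] by blast
    have "k < mm s t"
    proof (rule ccontr)
      assume "\<not> ?thesis"
      define n where "n = k - mm s t"
      then have n: "k = mm s t + n" using \<open>\<not> k < mm s t\<close> by simp
      obtain pre where pre: "alt k t s = pre @ alt (mm s t) t s" "set pre \<subseteq> {t, s}" "length pre = n"
        using alt_add[of "mm s t" n t s] unfolding n[symmetric] by blast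
      have "mm s t \<noteq> 0" by (simp add: mm_def Let_def)
      then obtain m where m: "mm s t = Suc m" using not0_implies_Suc by blast
      have "word (alt k t s) \<circ> srefl s = word (pre @ alt m t s)"
        unfolding pre word_append braid[OF less(3) t(1) ne, symmetric] unfolding m alt_last word_append
        using less(3) by (auto simp: fun_eq_iff)
      then have "w \<circ> srefl s = w' \<circ> word (pre @ alt m t s)" using w'(3) by (simp add: comp_assoc)
      moreover have "pre @ alt m t s \<in> lists I" using pre(2) less(3) t(1) alt_lists[OF t(1) less(3)] by auto
      ultimately have "len (w \<circ> srefl s) \<le> len w' + (n + m)"
        using len_comp_le[OF w'(1) weyl_word, of "pre @ alt m t s"] len_word_le[of "pre @ alt m t s"] pre(3)
        by (simp del: word_append)
      then show False using less(4) w'(4) n m by simp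
    qed
    then obtain p q where pq: "p \<ge> 0" "q \<ge> 0" "word (alt k t s) (coroot s) = p *\<^sub>R coroot s + q *\<^sub>R coroot t"
      using rank2_nonneg less(3) t(1) ne by blast
    have "nonneg (w' (coroot s))" "nonneg (w' (coroot t))"
      using less(1)[of w' s] less(1)[of w' t] w' less(3) t(1) by auto
    then show ?thesis using w'(3) pq linear_add[OF weyl_linear[OF w'(1)]] linear_scale[OF weyl_linear[OF w'(1)]]
      by (simp add: nonneg_add nonneg_scale)
  qed
qed

text \<open>With equal lengths the weak criterion would apply to both \<open>w\<close> and
  \<open>w \<circ> srefl s\<close>, which send \<open>coroot s\<close> to opposite vectors. This
  takes the place of the sign character.\<close>

lemma len_right_neq: assumes "w \<in> weyl" "s \<in> I" shows "len (w \<circ> srefl s) \<noteq> len w"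
proof
  assume e: "len (w \<circ> srefl s) = len w"
  have 1: "nonneg (w (coroot s))" using ascent_nonneg_weak assms e by simp
  have 2: "nonneg ((w \<circ> srefl s) (coroot s))" using ascent_nonneg_weak[of "w \<circ> srefl s" s] assms e by simp
  have "(w \<circ> srefl s) (coroot s) = - w (coroot s)"
    using assms by (simp add: srefl_def scaleR_2 linear_neg[OF weyl_linear])
  then show False using 1 2 nonneg_antisym weyl_coroot_nonzero assms by auto
qed

lemma srefl_coroot_self: "s \<in> I \<Longrightarrow> srefl s (coroot s) = - coroot s"
  by (simp add: srefl_def scaleR_2)

lemma ascent_iff:
  assumes "w \<in> weyl" "s \<in> I"
  shows "len w < len (w \<circ> srefl s) \<longleftrightarrow> nonneg (w (coroot s))"
proof
  assume "nonneg (w (coroot s))"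
  show "len w < len (w \<circ> srefl s)"
  proof (rule ccontr)
    assume "\<not> ?thesis"
    then have "nonneg ((w \<circ> srefl s) (coroot s))"
      using ascent_nonneg_weak[of "w \<circ> srefl s" s] assms by simp
    then have "nonneg (- w (coroot s))" using assms by (simp add: srefl_coroot_self linear_neg[OF weyl_linear])
    then show False using \<open>nonneg (w (coroot s))\<close> assms nonneg_antisym weyl_coroot_nonzero by blast
  qed
qed (use ascent_nonneg_weak assms in auto)

lemma descent_iff:
  assumes "w \<in> weyl" "s \<in> I"
  shows "len (w \<circ> srefl s) < len w \<longleftrightarrow> nonneg (- w (coroot s))"
  using ascent_iff[of "w \<circ> srefl s" s] assms
  by (simp add: srefl_coroot_self linear_neg[OF weyl_linear])

lemma ascent_or_descent:
  assumes "w \<in> weyl" "s \<in> I"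
  shows "len (w \<circ> srefl s) = Suc (len w) \<or> len w = Suc (len (w \<circ> srefl s))"
  using len_right_neq len_right_le len_right_ge assms by (meson le_antisym not_less_eq_eq)

lemma nonneg_or: "w \<in> weyl \<Longrightarrow> s \<in> I \<Longrightarrow> nonneg (w (coroot s)) \<or> nonneg (- w (coroot s))"
  using ascent_iff descent_iff len_right_neq by (meson nat_neq_iff)

end

context root_datum
begin

subsection \<open>The invariant form\<close>

text \<open>The invariant inner product, normalised so that \<open>symmetrizer j\<close> times
  \<open>coroot j\<close> represents the functional \<open>root j\<close>.\<close>

definition form :: "'v \<Rightarrow> 'v \<Rightarrow> real" where
  "form x y = (\<Sum>j\<in>I. fund_weight j y * root j x / symmetrizer j)"

lemma form_sum: "form x y = (\<Sum>j\<in>I. \<Sum>i\<in>I. of_int (a i j) / symmetrizer j * fund_weight i x * fund_weight j y)"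
  unfolding form_def root_def by (simp add: sum_distrib_left sum_distrib_right sum_divide_distrib mult_ac)

lemma form_sym: "form x y = form y x"
proof -
  have "of_int (a i j) / symmetrizer j = of_int (a j i) / symmetrizer i" if "i \<in> I" "j \<in> I" for i j
    using symmetrizer_sym[OF that] symmetrizer_pos[OF that(1)] symmetrizer_pos[OF that(2)] by (simp add: field_simps)
  then have "form x y = (\<Sum>j\<in>I. \<Sum>i\<in>I. of_int (a j i) / symmetrizer i * fund_weight i x * fund_weight j y)"
    unfolding form_sum by (intro sum.cong) auto
  also have "\<dots> = form y x" unfolding form_sum by (subst sum.swap) (simp add: mult_ac)
  finally show ?thesis .
qed

lemma form_add_left [simp]: "form (x + y) z = form x z + form y z"
  by (simp add: form_def sum.distrib algebra_simps add_divide_distrib)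
lemma form_diff_left [simp]: "form (x - y) z = form x z - form y z"
  by (simp add: form_def sum_subtractf algebra_simps diff_divide_distrib)
lemma form_scale_left [simp]: "form (c *\<^sub>R x) z = c * form x z"
  by (simp add: form_def sum_distrib_left algebra_simps)
lemma form_diff_right [simp]: "form z (x - y) = form z x - form z y"
  using form_diff_left form_sym by metis
lemma form_add_right [simp]: "form z (x + y) = form z x + form z y"
  using form_add_left form_sym by metis
lemma form_scale_right [simp]: "form z (c *\<^sub>R x) = c * form z x"
  using form_scale_left form_sym by metis

lemma form_0_right [simp]: "form x 0 = 0" using form_scale_right[of x 0 0] by simp

lemma form_coroot: "j \<in> I \<Longrightarrow> form x (coroot j) = root j x / symmetrizer j"
proof -
  assume j: "j \<in> I"
  have "form x (coroot j) = (\<Sum>k\<in>I. if k = j then root k x / symmetrizer k else 0)"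
    unfolding form_def by (intro sum.cong) (auto simp: fund_weight_coroot j)
  then show ?thesis using j by simp
qed

lemma form_pos: assumes "x \<noteq> 0" shows "form x x > 0"
proof -
  obtain i where i: "i \<in> I" "fund_weight i x \<noteq> 0" using fund_weight_eqI[of x 0] assms by auto
  define y where "y = (\<lambda>i. fund_weight i x / symmetrizer i)"
  have "form x x = (\<Sum>j\<in>I. \<Sum>i\<in>I. symmetrizer i * of_int (a i j) * y i * y j)"
    unfolding form_sum y_def by (intro sum.cong refl) (use symmetrizer_pos in \<open>force simp: field_simps\<close>)
  also have "\<dots> = (\<Sum>i\<in>I. \<Sum>j\<in>I. symmetrizer i * of_int (a i j) * y i * y j)"
    by (rule sum.swap)
  finally show ?thesis using symmetrizer_definite[of i y] i symmetrizer_pos[of i] by (simp add: y_def)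
qed

lemma form_srefl: assumes "i \<in> I" shows "form (srefl i x) (srefl i y) = form x y"
proof -
  have c: "form (coroot i) z = root i z / symmetrizer i" for z using form_coroot assms form_sym by metis
  show ?thesis unfolding srefl_def using assms
    by (simp add: form_coroot c algebra_simps add_divide_distrib[symmetric])
qed

lemma form_weyl: "w \<in> weyl \<Longrightarrow> form (w x) (w y) = form x y"
proof (elim weylE)
  fix ks assume "ks \<in> lists I" "w = word ks"
  then show ?thesis by (induction ks arbitrary: w) (auto simp: form_srefl)
qed

lemma root_form: "i \<in> I \<Longrightarrow> root i x = 2 * form x (coroot i) / form (coroot i) (coroot i)"
  using symmetrizer_pos[of i] by (simp add: form_coroot)

text \<open>The right-hand side depends only on the line through \<open>w (coroot i)\<close>; this
  is how two reflections are recognised as equal.\<close>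

lemma reflection_formula:
  assumes "w \<in> weyl" "i \<in> I"
  shows "(w \<circ> srefl i \<circ> inv w) h = h - (2 * form h (w (coroot i)) / form (w (coroot i)) (w (coroot i))) *\<^sub>R w (coroot i)"
proof -
  have "form h (w (coroot i)) = form (inv w h) (coroot i)"
    using form_weyl[of w "inv w h" "coroot i"] assms by simp
  then show ?thesis using assms
    by (simp add: srefl_def linear_diff[OF weyl_linear] linear_scale[OF weyl_linear] root_form form_weyl)
qed

lemma reflection_line:
  assumes "w \<in> weyl" "i \<in> I" "k \<in> I" "w (coroot i) = c *\<^sub>R coroot k"
  shows "w \<circ> srefl i \<circ> inv w = srefl k"
proof
  fix h
  have c: "c \<noteq> 0" using weyl_coroot_nonzero[OF assms(1,2)] assms(4) by auto
  show "(w \<circ> srefl i \<circ> inv w) h = srefl k h"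
    unfolding reflection_formula[OF assms(1,2)] assms(4) srefl_def root_form[OF assms(3)]
    using c by (simp add: field_simps)
qed

subsection \<open>Exchange and Bruhat order\<close>

text \<open>\<open>srefl k\<close> alters only the \<open>k\<close>-th coordinate. A positive vector
  that it makes negative has no other nonzero coordinate, hence is a multiple of
  \<open>coroot k\<close>.\<close>

lemma sign_change:
  assumes "x \<in> weyl" "i \<in> I" "k \<in> I" "nonneg (x (coroot i))" "nonneg (- srefl k (x (coroot i)))"
  shows "x \<circ> srefl i \<circ> inv x = srefl k"
proof -
  have "x (coroot i) = fund_weight k (x (coroot i)) *\<^sub>R coroot k"
  proof (rule fund_weight_eqI)
    fix j assume j: "j \<in> I"
    show "fund_weight j (x (coroot i)) = fund_weight j (fund_weight k (x (coroot i)) *\<^sub>R coroot k)"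
    proof (cases "j = k")
      case False
      then have "fund_weight j (srefl k (x (coroot i))) = fund_weight j (x (coroot i))"
        using j assms by (simp add: srefl_def fund_weight_coroot)
      then have "fund_weight j (x (coroot i)) = 0" using assms(4,5) j unfolding nonneg_def by fastforce
      then show ?thesis using False j assms by (simp add: fund_weight_coroot)
    qed (use assms in \<open>simp add: fund_weight_coroot\<close>)
  qed
  then show ?thesis using reflection_line assms by blast
qed

text \<open>Follow the positive root through the letters from right to left. At the letter where it
  turns negative, \<open>sign_change\<close> identifies the conjugated reflection with that letter,
  which can then be deleted.\<close>

lemma strong_exchange:
  assumes "ks \<in> lists I" "x \<in> weyl" "i \<in> I" "nonneg (x (coroot i))" "nonneg (- word ks (x (coroot i)))"
  shows "\<exists>xs k ys. ks = xs @ k # ys \<and> word ks \<circ> (x \<circ> srefl i \<circ> inv x) = word (xs @ ys)"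
  using assms(1,5)
proof (induction ks)
  case Nil
  then show ?case using assms nonneg_antisym weyl_coroot_nonzero by (metis id_apply word_Nil)
next
  case (Cons k ks)
  then have k: "k \<in> I" "ks \<in> lists I" by auto
  have ww: "word ks \<circ> x \<in> weyl" using k assms by (simp add: weyl_word)
  show ?case
  proof (cases "nonneg (- word ks (x (coroot i)))")
    case True
    then obtain xs l ys where A: "ks = xs @ l # ys" and B: "word ks \<circ> (x \<circ> srefl i \<circ> inv x) = word (xs @ ys)"
      using Cons k by blast
    have "word (k # ks) \<circ> (x \<circ> srefl i \<circ> inv x) = srefl k \<circ> (word ks \<circ> (x \<circ> srefl i \<circ> inv x))"
      by (simp only: word_Cons comp_assoc)
    then have "word (k # ks) \<circ> (x \<circ> srefl i \<circ> inv x) = word ((k # xs) @ ys)"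
      unfolding B by (simp only: append_Cons word_Cons)
    moreover have "k # ks = (k # xs) @ l # ys" using A by simp
    ultimately show ?thesis by blast
  next
    case False
    then have "nonneg ((word ks \<circ> x) (coroot i))" using nonneg_or[OF ww assms(3)] by simp
    moreover have "nonneg (- srefl k ((word ks \<circ> x) (coroot i)))" using Cons.prems by simp
    ultimately have e: "(word ks \<circ> x) \<circ> srefl i \<circ> inv (word ks \<circ> x) = srefl k"
      using sign_change[OF ww assms(3) k(1)] by blast
    have wk: "word ks \<in> weyl" using k by (rule_tac weyl_word)
    have "srefl k (word ks h) = word ks (x (srefl i (inv x h)))" for h
      unfolding e[symmetric] inv_comp[OF wk assms(2)] using wk by simp
    then have "word (k # ks) \<circ> (x \<circ> srefl i \<circ> inv x) = word ([] @ ks)"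
      by (intro ext) (metis append_Nil comp_apply k(1) srefl_invol word_Cons)
    moreover have "k # ks = [] @ k # ks" by simp
    ultimately show ?thesis by blast
  qed
qed

lemma reflection_invol: "x \<in> weyl \<Longrightarrow> i \<in> I \<Longrightarrow> (x \<circ> srefl i \<circ> inv x) \<circ> (x \<circ> srefl i \<circ> inv x) = id"
  by (simp add: fun_eq_iff)

lemma reflection_descent:
  assumes "w \<in> weyl" "x \<in> weyl" "i \<in> I" "nonneg (x (coroot i))" "nonneg (- w (x (coroot i)))"
  shows "len (w \<circ> (x \<circ> srefl i \<circ> inv x)) < len w"
proof -
  obtain ks where ks: "ks \<in> lists I" "word ks = w" "length ks = len w" using reduced_word assms by blast
  then obtain xs k ys where e: "ks = xs @ k # ys" "word ks \<circ> (x \<circ> srefl i \<circ> inv x) = word (xs @ ys)"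
    using strong_exchange[of ks x i] assms by blast
  then have "len (w \<circ> (x \<circ> srefl i \<circ> inv x)) \<le> length (xs @ ys)"
    using len_word_le[of "xs @ ys"] ks by auto
  then show ?thesis using e ks by simp
qed

lemma reflection_ascent:
  assumes "w \<in> weyl" "x \<in> weyl" "i \<in> I" "nonneg (x (coroot i))" "nonneg (w (x (coroot i)))"
  shows "len w < len (w \<circ> (x \<circ> srefl i \<circ> inv x))"
proof -
  let ?t = "x \<circ> srefl i \<circ> inv x"
  have "nonneg (- (w \<circ> ?t) (x (coroot i)))"
    using assms by (simp add: srefl_coroot_self linear_neg[OF weyl_linear])
  then have "len ((w \<circ> ?t) \<circ> ?t) < len (w \<circ> ?t)" using reflection_descent[of "w \<circ> ?t"] assms by simp
  moreover have "(w \<circ> ?t) \<circ> ?t = w" using reflection_invol[OF assms(2,3)] by (metis comp_assoc comp_id)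
  ultimately show ?thesis by simp
qed

lemma reflection_positive:
  assumes "t \<in> reflections"
  obtains x i where "x \<in> weyl" "i \<in> I" "t = x \<circ> srefl i \<circ> inv x" "nonneg (x (coroot i))"
proof -
  obtain x i where x: "x \<in> weyl" "i \<in> I" "t = x \<circ> srefl i \<circ> inv x"
    using assms unfolding reflections_def by blast
  show ?thesis
  proof (cases "nonneg (x (coroot i))")
    case False
    then have "nonneg ((x \<circ> srefl i) (coroot i))"
      using nonneg_or[OF x(1,2)] x by (simp add: srefl_coroot_self linear_neg[OF weyl_linear])
    moreover have "t = (x \<circ> srefl i) \<circ> srefl i \<circ> inv (x \<circ> srefl i)"
      using x by (simp add: inv_comp fun_eq_iff)
    ultimately show ?thesis using that[of "x \<circ> srefl i" i] x by simp
  qed (use that x in blast)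
qed

lemma bruhat_step_weyl: "bruhat_step x y \<Longrightarrow> x \<in> weyl \<and> y \<in> weyl"
  unfolding bruhat_step_def reflections_def by auto

lemma bruhat_le_refl [simp]: "bruhat_le x x" by (simp add: bruhat_le_def)
lemma bruhat_le_trans: "bruhat_le x y \<Longrightarrow> bruhat_le y z \<Longrightarrow> bruhat_le x z"
  unfolding bruhat_le_def by (rule rtranclp_trans)
lemma bruhat_step_le: "bruhat_step x y \<Longrightarrow> bruhat_le x y" unfolding bruhat_le_def by (rule r_into_rtranclp)

lemma bruhat_le_len: "bruhat_le x y \<Longrightarrow> x = y \<or> len x < len y"
  unfolding bruhat_le_def by (induction rule: rtranclp_induct) (auto simp: bruhat_step_def)

lemma srefl_reflection: "j \<in> I \<Longrightarrow> srefl j \<in> reflections"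
  unfolding reflections_def by (rule CollectI, rule exI[of _ id], rule exI[of _ j]) auto

lemma bruhat_right: "x \<in> weyl \<Longrightarrow> j \<in> I \<Longrightarrow> len x < len (x \<circ> srefl j) \<Longrightarrow> bruhat_le x (x \<circ> srefl j)"
  by (rule bruhat_step_le) (auto simp: bruhat_step_def intro: srefl_reflection)

definition right_min :: "('v \<Rightarrow> 'v) \<Rightarrow> 'i \<Rightarrow> 'v \<Rightarrow> 'v" where
  "right_min x j = (if len (x \<circ> srefl j) < len x then x \<circ> srefl j else x)"

definition right_max :: "('v \<Rightarrow> 'v) \<Rightarrow> 'i \<Rightarrow> 'v \<Rightarrow> 'v" where
  "right_max x j = (if len (x \<circ> srefl j) < len x then x else x \<circ> srefl j)"

lemma right_min_le: "x \<in> weyl \<Longrightarrow> j \<in> I \<Longrightarrow> bruhat_le (right_min x j) x"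
  using bruhat_right[of "x \<circ> srefl j" j] by (auto simp: right_min_def)

lemma right_max_ge: "x \<in> weyl \<Longrightarrow> j \<in> I \<Longrightarrow> bruhat_le x (right_max x j)"
  using bruhat_right[of x j] len_right_neq[of x j] by (auto simp: right_max_def)

text \<open>Conjugation by \<open>srefl j\<close> keeps the root of the reflection positive unless
  the reflection is \<open>srefl j\<close> itself. Outside that case right multiplication by
  \<open>srefl j\<close> preserves the direction of the step.\<close>

lemma bruhat_step_srefl:
  assumes "bruhat_step x y" "j \<in> I"
  shows "y = x \<circ> srefl j \<or> bruhat_le (x \<circ> srefl j) (y \<circ> srefl j)"
proof -
  obtain t where t: "x \<in> weyl" "t \<in> reflections" "y = x \<circ> t" "len x < len y"
    using assms unfolding bruhat_step_def by blast
  obtain z i where z: "z \<in> weyl" "i \<in> I" "t = z \<circ> srefl i \<circ> inv z" "nonneg (z (coroot i))"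
    using reflection_positive[OF t(2)] by blast
  have xz: "x \<circ> z \<in> weyl" using t z by simp
  have pos: "nonneg (x (z (coroot i)))"
    using nonneg_or[OF xz z(2)] reflection_descent[OF t(1) z(1,2,4)] t(3,4) z(3) by auto
  show ?thesis
  proof (cases "nonneg (- srefl j (z (coroot i)))")
    case True
    then show ?thesis using sign_change[OF z(1,2) assms(2) z(4)] z(3) t(3) by simp
  next
    case False
    let ?z = "srefl j \<circ> z"
    have zw: "?z \<in> weyl" using z assms by simp
    then have p: "nonneg (?z (coroot i))" using False nonneg_or[of ?z i] z by simp
    let ?t = "?z \<circ> srefl i \<circ> inv ?z"
    have e: "y \<circ> srefl j = (x \<circ> srefl j) \<circ> ?t"
      using assms z t by (simp add: inv_comp fun_eq_iff)
    have "len (x \<circ> srefl j) < len ((x \<circ> srefl j) \<circ> ?t)"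
      by (rule reflection_ascent) (use t assms z zw p pos in auto)
    moreover have "?t \<in> reflections" unfolding reflections_def using zw z(2) by blast
    ultimately have "bruhat_step (x \<circ> srefl j) (y \<circ> srefl j)"
      unfolding bruhat_step_def e using t(1) assms(2) by (metis weyl_comp weyl_srefl)
    then show ?thesis using bruhat_step_le by blast
  qed
qed

text \<open>The lifting property in monotone form, which can be iterated along a word.\<close>

lemma bruhat_right_min:
  assumes "bruhat_le x y" "j \<in> I"
  shows "bruhat_le (right_min x j) (right_min y j)"
  using assms(1)[unfolded bruhat_le_def]
proof (induction rule: rtranclp_induct)
  case (step y z)
  have w: "y \<in> weyl" "z \<in> weyl" using bruhat_step_weyl step by auto
  have "bruhat_le (right_min y j) (right_min z j)"
  proof (cases "z = y \<circ> srefl j")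
    case True
    have "len y < len z" using step by (auto simp: bruhat_step_def)
    then have "right_min y j = y" "right_min z j = y" using True assms(2) by (auto simp: right_min_def)
    then show ?thesis by simp
  next
    case False
    then have s: "bruhat_le (y \<circ> srefl j) (z \<circ> srefl j)" using bruhat_step_srefl step assms by blast
    have yz: "bruhat_le y z" using bruhat_step_le step by blast
    show ?thesis
    proof (cases "len (z \<circ> srefl j) < len z")
      case False
      then show ?thesis using right_min_le[OF w(1) assms(2)] yz bruhat_le_trans by (auto simp: right_min_def[of z])
    next
      case True
      show ?thesis
      proof (cases "len (y \<circ> srefl j) < len y")
        case False
        then have "bruhat_le y (y \<circ> srefl j)" using bruhat_right w assms len_right_neq by (meson nat_neq_iff)
        then show ?thesis using False True s bruhat_le_trans by (auto simp: right_min_def)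
      qed (use True s in \<open>auto simp: right_min_def\<close>)
    qed
  qed
  then show ?case using step bruhat_le_trans by blast
qed simp

lemma bruhat_right_max:
  assumes "bruhat_le x y" "j \<in> I"
  shows "bruhat_le (right_max x j) (right_max y j)"
  using assms(1)[unfolded bruhat_le_def]
proof (induction rule: rtranclp_induct)
  case (step y z)
  have w: "y \<in> weyl" "z \<in> weyl" using bruhat_step_weyl step by auto
  have "bruhat_le (right_max y j) (right_max z j)"
  proof (cases "z = y \<circ> srefl j")
    case True
    have "len y < len z" using step by (auto simp: bruhat_step_def)
    then have "right_max y j = z" "right_max z j = z" using True assms(2) by (auto simp: right_max_def)
    then show ?thesis by simp
  next
    case False
    then have s: "bruhat_le (y \<circ> srefl j) (z \<circ> srefl j)" using bruhat_step_srefl step assms by blast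
    have yz: "bruhat_le y z" using bruhat_step_le step by blast
    have zm: "bruhat_le z (right_max z j)" using right_max_ge w assms by blast
    have zm': "bruhat_le (z \<circ> srefl j) (right_max z j)"
      using bruhat_right[of "z \<circ> srefl j" j] w assms by (auto simp: right_max_def)
    show ?thesis
      using bruhat_le_trans[OF yz zm] bruhat_le_trans[OF s zm'] by (simp add: right_max_def[of y])
  qed
  then show ?case using step bruhat_le_trans by blast
qed simp


subsection \<open>Finiteness and the longest element\<close>

text \<open>Its surjectivity provides, for each fundamental weight, a vector that represents it
  through \<open>form\<close>.\<close>

definition dual_map :: "'v \<Rightarrow> 'v" where
  "dual_map x = (\<Sum>j\<in>I. root j x *\<^sub>R coroot j)"

lemma linear_dual_map: "linear dual_map"
  by (intro linearI) (simp_all add: dual_map_def sum.distrib scaleR_sum_right algebra_simps)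

lemma fund_weight_dual_map: "j \<in> I \<Longrightarrow> fund_weight j (dual_map x) = root j x"
  by (simp add: dual_map_def fund_weight_coroot if_distrib sum.If_cases cong: if_cong)

lemma dual_map_inj: "inj dual_map"
proof -
  have "x = 0" if "dual_map x = 0" for x
  proof -
    have "root j x = 0" if "j \<in> I" for j using fund_weight_dual_map[OF that, of x] \<open>dual_map x = 0\<close> by simp
    then have "form x x = 0" by (simp add: form_def)
    then show ?thesis using form_pos[of x] by auto
  qed
  then show ?thesis using linear_injective_0[OF linear_dual_map] by blast
qed

lemma dual_map_surj: "surj dual_map"
proof -
  interpret fd: finite_dimensional_vector_space "(*\<^sub>R) :: real \<Rightarrow> 'v \<Rightarrow> 'v" "coroot ` I"
    by unfold_locales (use coroot_independent coroot_span in \<open>auto simp: dependent_raw_def span_raw_def\<close>)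
  show ?thesis
    by (rule fd.linear_inj_imp_surj) (use linear_dual_map dual_map_inj in \<open>auto simp: linear_def\<close>)
qed

lemma form_bound:
  "(form x y)\<^sup>2 \<le> form x x * form y y"
proof (cases "y = 0")
  case True then show ?thesis by simp
next
  case False
  let ?c = "form x y / form y y"
  have p: "form y y > 0" using form_pos False by blast
  have n: "form z z \<ge> 0" for z using form_pos[of z] by (cases "z = 0") auto
  have "0 \<le> form (x - ?c *\<^sub>R y) (x - ?c *\<^sub>R y)" by (rule n)
  also have "\<dots> = form x x - (form x y)\<^sup>2 / form y y"
    using p by (simp add: form_sym[of y x] field_simps power2_eq_square)
  finally show ?thesis using p by (simp add: field_simps)
qed

lemma fund_weight_weyl_int:
  assumes "w \<in> weyl" "i \<in> I" "k \<in> I"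
  shows "fund_weight k (w (coroot i)) \<in> \<int>"
proof -
  obtain ks where ks: "ks \<in> lists I" "w = word ks" using assms by (auto elim: weylE)
  have "\<forall>k\<in>I. fund_weight k (word ks (coroot i)) \<in> \<int>" using ks(1)
  proof (induction ks)
    case Nil
    then show ?case using assms by (simp add: fund_weight_coroot)
  next
    case (Cons l ls)
    then have "root l (word ls (coroot i)) \<in> \<int>" unfolding root_def by (intro Ints_sum Ints_mult) auto
    then show ?case using Cons by (auto simp: srefl_def fund_weight_coroot)
  qed
  then show ?thesis using ks assms by blast
qed

text \<open>An element is determined by the coordinates of the images of the simple coroots. These
  are integers, and the Cauchy-Schwarz inequality for the invariant form bounds them independently
  of the element.\<close>

lemma finite_weyl: "finite weyl"
proof -
  have "\<exists>x. \<forall>y. form x y = fund_weight k y" if "k \<in> I" for k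
  proof -
    \<comment> \<open>The factor \<open>symmetrizer k\<close> cancels the division in
      \<open>form\<close>.\<close>
    obtain x where x: "dual_map x = symmetrizer k *\<^sub>R coroot k" using dual_map_surj by (metis surjD)
    have "root j x = (if j = k then symmetrizer k else 0)" if "j \<in> I" for j
      using fund_weight_dual_map[OF that, of x] x \<open>k \<in> I\<close> that by (auto simp: fund_weight_coroot)
    then have "form x y = (\<Sum>j\<in>I. if j = k then fund_weight k y else 0)" for y
      unfolding form_def by (intro sum.cong) (use symmetrizer_pos[OF that] in auto)
    then show ?thesis using that by (intro exI[of _ x]) simp
  qed
  then obtain X where X: "\<And>k y. k \<in> I \<Longrightarrow> form (X k) y = fund_weight k y" by metis
  define B where "B = Max (insert 0 ((\<lambda>(k, i). form (X k) (X k) * form (coroot i) (coroot i)) ` (I \<times> I)))"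
  have bnd: "(fund_weight k (w (coroot i)))\<^sup>2 \<le> B" if "w \<in> weyl" "i \<in> I" "k \<in> I" for w i k
  proof -
    have "(fund_weight k (w (coroot i)))\<^sup>2 \<le> form (X k) (X k) * form (coroot i) (coroot i)"
      using form_bound[of "X k" "w (coroot i)"] X[OF that(3)] form_weyl[OF that(1)] by simp
    also have "\<dots> \<le> B" unfolding B_def by (rule Max_ge) (use that in auto)
    finally show ?thesis .
  qed
  define N where "N = {x \<in> \<int>. \<bar>x\<bar> \<le> B + 1 \<and> x \<in> (range of_int :: real set)}"
  have "finite ((of_int :: int \<Rightarrow> real) ` {- \<lceil>B + 1\<rceil>..\<lceil>B + 1\<rceil>})" by simp
  moreover have "N \<subseteq> of_int ` {- \<lceil>B + 1\<rceil>..\<lceil>B + 1\<rceil>}"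
  proof
    fix x assume "x \<in> N"
    then obtain n where n: "x = of_int n" "\<bar>x\<bar> \<le> B + 1" unfolding N_def by auto
    then have "n \<le> \<lceil>B + 1\<rceil>" "- n \<le> \<lceil>B + 1\<rceil>" by linarith+
    then show "x \<in> of_int ` {- \<lceil>B + 1\<rceil>..\<lceil>B + 1\<rceil>}" using n by auto
  qed
  ultimately have fN: "finite N" using finite_subset by blast
  define \<Phi> where "\<Phi> = (\<lambda>w. restrict (\<lambda>(k, i). fund_weight k (w (coroot i))) (I \<times> I))"
  have "\<Phi> ` weyl \<subseteq> (I \<times> I) \<rightarrow>\<^sub>E N"
  proof (rule image_subsetI)
    fix w assume w: "w \<in> weyl"
    have "fund_weight k (w (coroot i)) \<in> N" if "k \<in> I" "i \<in> I" for k i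
    proof -
      let ?x = "fund_weight k (w (coroot i))"
      have "\<bar>?x\<bar> \<le> ?x\<^sup>2 + 1"
        using zero_le_power2[of "\<bar>?x\<bar> - 1"] by (simp add: power2_diff)
      then show ?thesis using bnd[OF w that(2,1)] fund_weight_weyl_int[OF w that(2,1)] unfolding N_def
        by (auto elim!: Ints_cases)
    qed
    then show "\<Phi> w \<in> (I \<times> I) \<rightarrow>\<^sub>E N" by (auto simp: \<Phi>_def)
  qed
  then have "finite (\<Phi> ` weyl)" using fN finite_PiE finite_subset finite_I by (metis finite_cartesian_product)
  moreover have "inj_on \<Phi> weyl"
  proof (rule inj_onI)
    fix v w assume vw: "v \<in> weyl" "w \<in> weyl" "\<Phi> v = \<Phi> w"
    have "fund_weight k (v (coroot i)) = fund_weight k (w (coroot i))" if "k \<in> I" "i \<in> I" for k i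
      using fun_cong[OF vw(3), of "(k, i)"] that by (simp add: \<Phi>_def)
    then have "v (coroot i) = w (coroot i)" if "i \<in> I" for i using that by (intro fund_weight_eqI) auto
    then have "v h = w h" for h
      using vw by (subst (1 2) expand[of h]) (simp add: linear_sum[OF weyl_linear] linear_scale[OF weyl_linear])
    then show "v = w" by auto
  qed
  ultimately show ?thesis using finite_imageD by blast
qed

text \<open>If all simple coroots become negative under \<open>w\<close>, so do all nonnegative
  vectors; every further letter of a reduced word of \<open>x\<close> then lowers the length of the
  product by one.\<close>

lemma len_all_descents:
  assumes w: "w \<in> weyl" "\<And>s. s \<in> I \<Longrightarrow> len (w \<circ> srefl s) < len w" and x: "x \<in> weyl"
  shows "len (w \<circ> x) + len x = len w"
proof -
  have neg: "nonneg (- w y)" if "nonneg y" for y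
  proof -
    have "w y = (\<Sum>i\<in>I. fund_weight i y *\<^sub>R w (coroot i))"
      by (subst expand[of y]) (simp add: linear_sum[OF weyl_linear] linear_scale[OF weyl_linear] w)
    then have e: "- w y = (\<Sum>i\<in>I. fund_weight i y *\<^sub>R (- w (coroot i)))" by (simp add: sum_negf)
    have "nonneg (- w (coroot i))" if "i \<in> I" for i using w(2)[OF that] descent_iff[OF w(1) that] by blast
    then have "0 \<le> (\<Sum>i\<in>I. fund_weight i y * fund_weight k (- w (coroot i)))" if "k \<in> I" for k
      using \<open>nonneg y\<close> that unfolding nonneg_def by (intro sum_nonneg mult_nonneg_nonneg) auto
    then show ?thesis unfolding e nonneg_def by (simp only: fund_weight_simps real_scaleR_def simp_thms ball_simps) blast
  qed
  obtain ks where ks: "ks \<in> lists I" "word ks = x" "length ks = len x" using reduced_word x by blast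
  have "len (w \<circ> word ks) + length ks = len w" using ks
  proof (induction ks arbitrary: x rule: rev_induct)
    case (snoc k ks)
    then have k: "k \<in> I" "ks \<in> lists I" by auto
    have r: "len (word ks) = length ks"
    proof -
      have "len (word (ks @ [k])) \<le> Suc (len (word ks))" unfolding word_snoc using len_right_le[of "word ks" k] k weyl_word by blast
      moreover have "len (word (ks @ [k])) = Suc (length ks)" using snoc.prems(2,3) by (metis length_append_singleton)
      ultimately show ?thesis using len_word_le[OF k(2)] by linarith
    qed
    have wk: "word ks \<in> weyl" using k weyl_word by blast
    have IH: "len (w \<circ> word ks) + length ks = len w" using snoc.IH[of "word ks"] k r by (simp add: comp_def)
    have "len (word (ks @ [k])) = Suc (length ks)" using snoc.prems(2,3) by (metis length_append_singleton)
    then have "len (word ks) < len (word ks \<circ> srefl k)" unfolding word_snoc using r by linarith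
    then have "nonneg (word ks (coroot k))" using ascent_iff wk k by blast
    then have "len (w \<circ> word ks \<circ> srefl k) < len (w \<circ> word ks)" using descent_iff[of "w \<circ> word ks" k] neg wk w k by simp
    then have "Suc (len (w \<circ> word ks \<circ> srefl k)) = len (w \<circ> word ks)"
      using ascent_or_descent[of "w \<circ> word ks" k] wk w k by auto
    then have "len (w \<circ> (word ks \<circ> srefl k)) + length (ks @ [k]) = len w" using IH by (simp add: comp_assoc)
    then show ?case unfolding word_snoc by (simp only: comp_def)
  qed simp
  then show ?thesis using ks by simp
qed

lemma longest_eqI:
  assumes "u \<in> S" "\<And>y. y \<in> S \<Longrightarrow> y \<noteq> u \<Longrightarrow> len y < len u"
  shows "longest S = u"
  unfolding longest_def
proof (rule the_equality)
  fix x assume x: "x \<in> S \<and> (\<forall>y\<in>S. y \<noteq> x \<longrightarrow> len y < len x)"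
  show "x = u"
  proof (rule ccontr)
    assume "x \<noteq> u"
    then have "len u < len x" "len x < len u" using x assms by auto
    then show False by simp
  qed
qed (use assms in blast)

lemma w0_props:
  shows w0_weyl: "w0 \<in> weyl" and len_w0: "\<And>x. x \<in> weyl \<Longrightarrow> len (w0 \<circ> x) + len x = len w0"
proof -
  have "len ` weyl \<noteq> {}" using weyl_id by blast
  then have "Max (len ` weyl) \<in> len ` weyl" using Max_in finite_weyl by blast
  then obtain w where w: "w \<in> weyl" "len w = Max (len ` weyl)" by auto
  then have mx: "len y \<le> len w" if "y \<in> weyl" for y using that finite_weyl by simp
  have "len (w \<circ> srefl s) < len w" if "s \<in> I" for s
    using mx[of "w \<circ> srefl s"] len_right_neq[OF w(1) that] w that by simp
  then have all: "len (w \<circ> x) + len x = len w" if "x \<in> weyl" for x using len_all_descents w that by blast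
  have "longest weyl = w"
  proof (rule longest_eqI[OF w(1)])
    fix y assume y: "y \<in> weyl" "y \<noteq> w"
    have "w \<circ> (inv w \<circ> y) = y" using w by (simp add: fun_eq_iff)
    moreover have "inv w \<circ> y \<noteq> id" using y w calculation by auto
    ultimately show "len y < len w" using all[of "inv w \<circ> y"] y w len_eq_0[of "inv w \<circ> y"] by auto
  qed
  then have "w0 = w" by (simp add: w0_def)
  then show "w0 \<in> weyl" "\<And>x. x \<in> weyl \<Longrightarrow> len (w0 \<circ> x) + len x = len w0" using w all by auto
qed

subsection \<open>The Demazure quotient\<close>

text \<open>\<open>residual v js\<close> is the Bruhat-minimal element of $\{v^{-1} y : y \le w\}$, where \<open>js\<close> is a
  reduced word of $w$; the element $v_w$ is $v$ times it.\<close>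

definition residual :: "('v \<Rightarrow> 'v) \<Rightarrow> 'i list \<Rightarrow> 'v \<Rightarrow> 'v" where
  "residual v js = foldl right_min (inv v) js"

lemma right_min_weyl [simp]: "x \<in> weyl \<Longrightarrow> j \<in> I \<Longrightarrow> right_min x j \<in> weyl"
  by (simp add: right_min_def)

lemma residual_snoc [simp]: "residual v (js @ [j]) = right_min (residual v js) j"
  by (simp add: residual_def)

lemma residual_weyl: "v \<in> weyl \<Longrightarrow> js \<in> lists I \<Longrightarrow> residual v js \<in> weyl"
proof (induction js rule: rev_induct)
  case Nil then show ?case by (simp add: residual_def)
qed auto

lemma reduced_prefix:
  assumes "js @ ls \<in> lists I" "len (word (js @ ls)) = length (js @ ls)"
  shows "len (word js) = length js"
proof -
  have "len (word (js @ ls)) \<le> len (word js) + len (word ls)"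
    using len_comp_le[of "word js" "word ls"] assms(1) weyl_word by auto
  then show ?thesis using assms len_word_le[of js] len_word_le[of ls] by auto
qed

text \<open>Additivity of lengths and the Bruhat bound place \<open>v \<circ> residual v js\<close>
  in both intervals; minimality makes it the longest element there. When a letter is appended,
  \<open>bruhat_right_max\<close> carries the bound and \<open>bruhat_right_min\<close> the
  minimality.\<close>

lemma residual_props:
  assumes "v \<in> weyl" "js \<in> lists I" "len (word js) = length js"
  shows "len (v \<circ> residual v js) + len (residual v js) = len v"
    and "bruhat_le (v \<circ> residual v js) (word js)"
    and "\<And>y. y \<in> weyl \<Longrightarrow> bruhat_le y (word js) \<Longrightarrow> bruhat_le (residual v js) (inv v \<circ> y)"
proof -
  have "len (v \<circ> residual v js) + len (residual v js) = len v \<and> bruhat_le (v \<circ> residual v js) (word js) \<and>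
     (\<forall>y\<in>weyl. bruhat_le y (word js) \<longrightarrow> bruhat_le (residual v js) (inv v \<circ> y))"
    using assms(2,3)
  proof (induction js rule: rev_induct)
    case Nil
    have e: "residual v [] = inv v" by (simp add: residual_def)
    have y: "y = id" if "bruhat_le y id" for y using bruhat_le_len[OF that] by auto
    have "len (v \<circ> inv v) + len (inv v) = len v" using assms(1) by (simp only: weyl_inv_right len_id len_inv add_0)
    moreover have "bruhat_le (v \<circ> inv v) (word [])"
      using assms(1) by (simp only: weyl_inv_right word_Nil bruhat_le_refl)
    moreover have "bruhat_le (inv v) (inv v \<circ> y)" if "bruhat_le y (word [])" for y
      using y[OF that[unfolded word_Nil]] by (simp only: comp_id bruhat_le_refl)
    ultimately show ?case unfolding e by blast
  next
    case (snoc j js)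
    then have j: "j \<in> I" "js \<in> lists I" by auto
    have r: "len (word js) = length js" by (rule reduced_prefix[of js "[j]", OF snoc.prems])
    let ?z = "residual v js" and ?w = "word js"
    have z: "?z \<in> weyl" using residual_weyl assms(1) j by blast
    have w: "?w \<in> weyl" using j weyl_word by blast
    have IH: "len (v \<circ> ?z) + len ?z = len v \<and> bruhat_le (v \<circ> ?z) ?w \<and>
        (\<forall>y\<in>weyl. bruhat_le y ?w \<longrightarrow> bruhat_le ?z (inv v \<circ> y))"
      using snoc.IH[OF j(2) r] unfolding comp_def .
    have up: "len ?w < len (?w \<circ> srefl j)" proof -
      have "len (word (js @ [j])) = Suc (length js)" using snoc.prems(2) by (metis length_append_singleton)
      then show ?thesis unfolding word_snoc using r by linarith
    qed
    have wj: "word (js @ [j]) = ?w \<circ> srefl j" by simp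
    have le: "bruhat_le ?w (?w \<circ> srefl j)" using bruhat_right w j up by blast
    have A: "len (v \<circ> right_min ?z j) + len (right_min ?z j) = len v \<and> bruhat_le (v \<circ> right_min ?z j) (?w \<circ> srefl j)"
    proof (cases "len (?z \<circ> srefl j) < len ?z")
      case False
      then show ?thesis using IH bruhat_le_trans[OF _ le] by (auto simp: right_min_def)
    next
      case True
      have l: "len ?z = Suc (len (?z \<circ> srefl j))" using True ascent_or_descent[OF z j(1)] by auto
      have u: "v \<circ> ?z \<in> weyl" using assms(1) z by simp
      have e: "v \<circ> (?z \<circ> srefl j) = (v \<circ> ?z) \<circ> srefl j" by (simp only: comp_assoc)
      have "v = (v \<circ> (?z \<circ> srefl j)) \<circ> inv (?z \<circ> srefl j)" using z j by (simp add: fun_eq_iff inv_comp)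
      then have "len v \<le> len (v \<circ> (?z \<circ> srefl j)) + len (?z \<circ> srefl j)"
        using len_comp_le[of "v \<circ> (?z \<circ> srefl j)" "inv (?z \<circ> srefl j)"] assms(1) z j
        by (metis len_inv weyl_comp weyl_inv weyl_srefl)
      moreover have "len (v \<circ> (?z \<circ> srefl j)) \<le> Suc (len (v \<circ> ?z))" unfolding e using len_right_le u j by blast
      ultimately have 1: "len (v \<circ> (?z \<circ> srefl j)) + len (?z \<circ> srefl j) = len v" "len (v \<circ> ?z) < len (v \<circ> ?z \<circ> srefl j)"
        using IH l unfolding e by auto
      have "bruhat_le (right_max (v \<circ> ?z) j) (right_max ?w j)" using bruhat_right_max IH j by blast
      then show ?thesis using 1 up True by (simp add: right_max_def right_min_def comp_assoc)
    qed
    have B: "bruhat_le (right_min ?z j) (inv v \<circ> y)" if y: "y \<in> weyl" "bruhat_le y (?w \<circ> srefl j)" for y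
    proof -
      have m: "right_min (?w \<circ> srefl j) j = ?w" using up j by (simp add: right_min_def)
      have "bruhat_le (right_min y j) ?w" using bruhat_right_min[OF y(2) j(1)] m by simp
      then have b: "bruhat_le ?z (inv v \<circ> right_min y j)" using IH y j by simp
      let ?X = "inv v \<circ> right_min y j"
      have X: "?X \<in> weyl" using assms(1) y j by simp
      have c1: "bruhat_le (right_min ?z j) (right_min ?X j)" using bruhat_right_min b j by blast
      have c2: "bruhat_le (right_min ?X j) ?X" using right_min_le X j by blast
      have c3: "bruhat_le (right_min ?X j) (?X \<circ> srefl j)"
      proof (cases "len (?X \<circ> srefl j) < len ?X")
        case False
        then have "len ?X < len (?X \<circ> srefl j)" using len_right_neq X j by (meson nat_neq_iff)
        then show ?thesis using bruhat_right X j by (simp add: right_min_def)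
      qed (simp add: right_min_def)
      have "inv v \<circ> y = ?X \<or> inv v \<circ> y = ?X \<circ> srefl j" using j by (auto simp: right_min_def fun_eq_iff)
      then show ?thesis using c1 c2 c3 bruhat_le_trans by metis
    qed
    have "len (v \<circ> residual v (js @ [j])) + len (residual v (js @ [j])) = len v \<and>
        bruhat_le (v \<circ> residual v (js @ [j])) (word (js @ [j])) \<and>
        (\<forall>y\<in>weyl. bruhat_le y (word (js @ [j])) \<longrightarrow> bruhat_le (residual v (js @ [j])) (inv v \<circ> y))"
      using A B unfolding wj residual_snoc by blast
    then show ?case unfolding comp_def .
  qed
  then show "len (v \<circ> residual v js) + len (residual v js) = len v" "bruhat_le (v \<circ> residual v js) (word js)"
    "\<And>y. y \<in> weyl \<Longrightarrow> bruhat_le y (word js) \<Longrightarrow> bruhat_le (residual v js) (inv v \<circ> y)" by auto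
qed

text \<open>For \<open>y\<close> in the weak interval of \<open>v\<close> the lengths of
  \<open>y\<close> and \<open>inv v \<circ> y\<close> add up to \<open>len v\<close>. So the longest
  \<open>y\<close> has the shortest \<open>inv v \<circ> y\<close>, and a Bruhat-minimal element is
  strictly shorter than all others.\<close>

lemma max_below_residual:
  assumes v: "v \<in> weyl" and js: "js \<in> lists I" "len (word js) = length js"
  shows "max_below v (word js) = v \<circ> residual v js"
  unfolding max_below_def
proof (rule longest_eqI)
  let ?z = "residual v js" and ?u = "v \<circ> residual v js"
  note rp = residual_props[OF v js]
  have z: "?z \<in> weyl" using residual_weyl v js by blast
  have "inv ?u \<circ> v = inv ?z" using v z by (simp add: inv_comp fun_eq_iff)
  then show "?u \<in> weak_interval v \<inter> bruhat_interval (word js)"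
    using rp z v by (simp add: weak_interval_def bruhat_interval_def weak_le_def)
  fix y assume "y \<in> weak_interval v \<inter> bruhat_interval (word js)" and ne: "y \<noteq> ?u"
  then have y: "y \<in> weyl" "len y + len (inv y \<circ> v) = len v" "bruhat_le y (word js)"
    by (auto simp: weak_interval_def bruhat_interval_def weak_le_def)
  have "inv (inv y \<circ> v) = inv v \<circ> y" using y v by (simp add: inv_comp)
  then have l: "len (inv v \<circ> y) = len (inv y \<circ> v)" using y v len_inv[of "inv y \<circ> v"] by simp
  have "y = v \<circ> (inv v \<circ> y)" using v by (simp add: fun_eq_iff)
  then have "inv v \<circ> y \<noteq> ?z" using ne by metis
  then have "len ?z < len (inv v \<circ> y)" using rp(3)[OF y(1,3)] bruhat_le_len by metis
  then show "len y < len ?u" using y l rp(1) by simp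
qed

text \<open>The dichotomy behind the main induction. The first alternative can turn into the second
  only when \<open>srefl s \<circ> X \<circ> srefl j\<close> drops in length while
  \<open>X \<circ> srefl j\<close> does not; then \<open>sign_change\<close> yields
  \<open>srefl s \<circ> X \<circ> srefl j = X\<close>. The inequality is the invariant that keeps
  the induction going.\<close>

lemma residual_ascent:
  assumes v: "v \<in> weyl" "s \<in> I" "len v < len (v \<circ> srefl s)" and js: "js \<in> lists I"
  shows "(residual (v \<circ> srefl s) js = srefl s \<circ> residual v js \<and> len (residual v js) < len (srefl s \<circ> residual v js))
    \<or> (residual (v \<circ> srefl s) js = residual v js \<and> len (residual v js) < len (srefl s \<circ> residual v js))"
  using js
proof (induction js rule: rev_induct)
  case Nil
  have "inv (v \<circ> srefl s) = srefl s \<circ> inv v" using v by (simp add: inv_comp)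
  moreover have "len (srefl s \<circ> inv v) = len (v \<circ> srefl s)" using v calculation len_inv[of "v \<circ> srefl s"] by simp
  moreover have "residual (v \<circ> srefl s) [] = inv (v \<circ> srefl s)" "residual v [] = inv v" by (simp_all only: residual_def foldl_Nil)
  ultimately show ?case using v by (simp only: len_inv simp_thms)
next
  case (snoc j js)
  then have j: "j \<in> I" "js \<in> lists I" by auto
  define X where "X = residual v js"
  define Y where "Y = residual (v \<circ> srefl s) js"
  have X: "X \<in> weyl" unfolding X_def using residual_weyl v j by blast
  have sX: "srefl s \<circ> X \<in> weyl" using X v by simp
  have IH: "(Y = srefl s \<circ> X \<or> Y = X)" "len X < len (srefl s \<circ> X)" using snoc.IH[OF j(2)] unfolding X_def Y_def comp_def by blast+
  have left: "len (srefl s \<circ> z) = Suc (len z) \<or> len z = Suc (len (srefl s \<circ> z))" if "z \<in> weyl" for z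
  proof -
    have "len (srefl s \<circ> z) = len (inv z \<circ> srefl s)" using len_inv[of "srefl s \<circ> z"] that v by (simp add: inv_comp)
    then show ?thesis using ascent_or_descent[of "inv z" s] that v by simp
  qed
  have lsX: "len (srefl s \<circ> X) = Suc (len X)" using left[OF X] IH by auto
  have "(right_min Y j = srefl s \<circ> right_min X j \<or> right_min Y j = right_min X j) \<and> len (right_min X j) < len (srefl s \<circ> right_min X j)"
  proof (cases "len (X \<circ> srefl j) < len X")
    case True
    then have m: "right_min X j = X \<circ> srefl j" by (simp add: right_min_def)
    have lXj: "len X = Suc (len (X \<circ> srefl j))" using True ascent_or_descent[OF X j(1)] by auto
    have "len (srefl s \<circ> (X \<circ> srefl j)) \<ge> len X"
      using len_right_ge[OF sX j(1)] lsX by (simp add: comp_assoc)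
    then have g: "len (X \<circ> srefl j) < len (srefl s \<circ> (X \<circ> srefl j))" using lXj by simp
    have "len (srefl s \<circ> (X \<circ> srefl j)) = len X" using left[of "X \<circ> srefl j"] g lXj X j by simp
    then have "right_min (srefl s \<circ> X) j = srefl s \<circ> (X \<circ> srefl j)" using lsX by (simp add: right_min_def comp_assoc)
    then show ?thesis using IH m g by auto
  next
    case False
    then have m: "right_min X j = X" by (simp add: right_min_def)
    have up: "nonneg (X (coroot j))" using False ascent_or_descent[OF X j(1)] ascent_iff[OF X j(1)] by auto
    have "right_min (srefl s \<circ> X) j = srefl s \<circ> X \<or> right_min (srefl s \<circ> X) j = X"
    proof (cases "len (srefl s \<circ> X \<circ> srefl j) < len (srefl s \<circ> X)")
      case True
      then have "nonneg (- srefl s (X (coroot j)))" using descent_iff[OF sX j(1)] by simp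
      then have e: "X \<circ> srefl j \<circ> inv X = srefl s" using sign_change X j v up by blast
      have "srefl s (X h) = X (srefl j h)" for h unfolding e[symmetric] using X by simp
      then have "srefl s \<circ> X \<circ> srefl j = X" using j by (auto simp: fun_eq_iff)
      then show ?thesis using True by (simp add: right_min_def)
    qed (simp add: right_min_def)
    then show ?thesis using IH m by auto
  qed
  then show ?case unfolding X_def Y_def residual_snoc comp_def by blast
qed

text \<open>Left multiplication by \<open>inv w0\<close> reverses lengths, so each letter of the
  reduced word is a descent and is absorbed. This is the starting point of the main
  induction.\<close>

lemma residual_id: "js \<in> lists I \<Longrightarrow> len (word js) = length js \<Longrightarrow> residual w0 js = inv w0 \<circ> word js"
proof (induction js rule: rev_induct)
  case Nil
  then show ?case by (simp add: residual_def)
next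
  case (snoc j js)
  then have j: "j \<in> I" "js \<in> lists I" by auto
  have r: "len (word js) = length js" by (rule reduced_prefix[of js "[j]", OF snoc.prems])
  have lw: "len (inv w0 \<circ> x) + len x = len w0" if x: "x \<in> weyl" for x
  proof -
    have "len (inv w0 \<circ> x) = len (inv x \<circ> w0)" using len_inv[of "inv w0 \<circ> x"] w0_weyl x by (simp add: inv_comp)
    have "w0 \<circ> (inv w0 \<circ> x) = x" using w0_weyl by (simp add: fun_eq_iff)
    then show ?thesis using len_w0[of "inv w0 \<circ> x"] w0_weyl x by simp
  qed
  have "len (inv w0 \<circ> word js \<circ> srefl j) < len (inv w0 \<circ> word js)"
  proof -
    have "word (js @ [j]) = word js \<circ> srefl j" by simp
    then have "len (word js \<circ> srefl j) = Suc (length js)" using snoc.prems by (metis length_append_singleton)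
    moreover have "word js \<in> weyl" using j weyl_word by blast
    ultimately show ?thesis
      using lw[of "word js"] lw[of "word js \<circ> srefl j"] r j by (simp add: comp_assoc)
  qed
  then have "right_min (inv w0 \<circ> word js) j = inv w0 \<circ> word js \<circ> srefl j" by (simp only: right_min_def if_True)
  moreover have "residual w0 js = inv w0 \<circ> word js" using snoc.IH[OF j(2) r] by (simp only: comp_def)
  ultimately have "residual w0 (js @ [j]) = inv w0 \<circ> word (js @ [j])"
    unfolding residual_snoc word_snoc by (simp only: comp_assoc)
  then show ?case by (simp only: comp_def)
qed

end

lemma rev_alt: "rev (alt k x y) = (if even k then alt k y x else alt k x y)"
proof (induction k arbitrary: x y)
  case (Suc k)
  have "rev (alt (Suc k) x y) = x # rev (alt k y x)" unfolding alt_last by simp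
  also have "\<dots> = x # (if even k then alt k x y else alt k y x)" using Suc[of y x] by simp
  also have "\<dots> = (if even (Suc k) then alt (Suc k) y x else alt (Suc k) x y)" by simp
  finally show ?case .
qed simp

section \<open>Reduced words and braid moves\<close>

inductive braid_step :: "('i \<Rightarrow> 'i \<Rightarrow> nat) \<Rightarrow> 'i list \<Rightarrow> 'i list \<Rightarrow> bool" for m where
  braid_stepI: "s \<noteq> t \<Longrightarrow> braid_step m (xs @ alt (m s t) s t @ ys) (xs @ alt (m s t) t s @ ys)"

lemma braid_step_Cons: "braid_step m xs ys \<Longrightarrow> braid_step m (k # xs) (k # ys)"
proof (induction rule: braid_step.induct)
  case (braid_stepI s t xs ys)
  show ?case using braid_step.braid_stepI[OF braid_stepI, of m "k # xs" ys] by simp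
qed

lemma braid_steps_Cons: "(braid_step m)\<^sup>*\<^sup>* xs ys \<Longrightarrow> (braid_step m)\<^sup>*\<^sup>* (k # xs) (k # ys)"
  by (induction rule: rtranclp_induct) (auto intro: rtranclp.rtrancl_into_rtrancl braid_step_Cons)

context root_datum
begin

definition reduced :: "'i list \<Rightarrow> bool" where
  "reduced ks \<longleftrightarrow> ks \<in> lists I \<and> len (word ks) = length ks"

lemma reduced_lists: "reduced ks \<Longrightarrow> ks \<in> lists I" by (simp add: reduced_def)
lemma reduced_len: "reduced ks \<Longrightarrow> len (word ks) = length ks" by (simp add: reduced_def)

lemma reduced_appendD:
  assumes "reduced (xs @ ys)" shows "reduced xs" "reduced ys"
proof -
  have l: "xs \<in> lists I" "ys \<in> lists I" using assms by (auto simp: reduced_def)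
  have "len (word xs \<circ> word ys) \<le> len (word xs) + len (word ys)"
    using len_comp_le[of "word xs" "word ys"] l weyl_word by blast
  moreover have "len (word xs \<circ> word ys) = length xs + length ys" using assms unfolding reduced_def word_append by simp
  ultimately have "len (word xs) = length xs \<and> len (word ys) = length ys" using len_word_le[OF l(1)] len_word_le[OF l(2)] by linarith
  then show "reduced xs" "reduced ys" using l by (auto simp: reduced_def)
qed

lemma reduced_snoc_ascent:
  assumes "reduced (xs @ [k])" shows "len (word xs) < len (word xs \<circ> srefl k)"
  using reduced_appendD(1)[OF assms] assms unfolding reduced_def word_snoc by simp

lemma obtain_reduced: assumes "w \<in> weyl" obtains ks where "reduced ks" "word ks = w" "length ks = len w"
  using reduced_word[OF assms] unfolding reduced_def by metis

lemma fund_weight_word: "k \<in> I \<Longrightarrow> ks \<in> lists (I - {k}) \<Longrightarrow> fund_weight k (word ks h) = fund_weight k h"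
  by (induction ks) (auto simp: srefl_def fund_weight_coroot)

text \<open>Reflections in other letters leave the coordinate at \<open>k\<close> unchanged. For the
  last letter \<open>k\<close> outside \<open>J\<close>, the vector \<open>b\<close> has
  \<open>k\<close>-coordinate 1, but its image under the reduced word \<open>ls\<close> is the
  negative of a positive vector, while a word in \<open>J\<close> would preserve the 1.\<close>

lemma reduced_support:
  assumes J: "J \<subseteq> I" and ks: "ks \<in> lists J" and ls: "reduced ls" and eq: "word ls = word ks"
  shows "ls \<in> lists J"
proof (rule ccontr)
  assume "ls \<notin> lists J"
  then have "\<exists>k\<in>set ls. k \<notin> J" by (auto simp: lists_eq_set)
  then obtain xs k ys where l: "ls = xs @ k # ys" "k \<notin> J" "\<forall>y\<in>set ys. \<not> y \<notin> J"
    by (rule split_list_last_propE)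
  have I: "ls \<in> lists I" using ls reduced_lists by blast
  have k: "k \<in> I" and ysI: "ys \<in> lists I" and xsI: "xs \<in> lists I" using I l by auto
  have ys: "rev ys \<in> lists (I - {k})" using l(2,3) ysI by auto
  define b where "b = word (rev ys) (coroot k)"
  have 1: "fund_weight k b = 1" unfolding b_def using fund_weight_word[OF k ys] k by (simp add: fund_weight_coroot)
  have yb: "word ys b = coroot k" unfolding b_def using word_rev_right[OF ysI] by (metis comp_apply id_apply)
  have 2: "word ls b = - word xs (coroot k)"
    using yb k unfolding l(1) by (simp add: srefl_coroot_self linear_neg[OF linear_word])
  have "reduced (xs @ [k])" using reduced_appendD(1)[of "xs @ [k]" ys] ls l(1) by simp
  then have "nonneg (word xs (coroot k))" using reduced_snoc_ascent ascent_iff[of "word xs" k] k xsI weyl_word by blast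
  then have "fund_weight k (word ls b) \<le> 0" unfolding 2 using k by (simp add: nonneg_def)
  moreover have "ks \<in> lists (I - {k})" using ks l(2) J by auto
  ultimately show False using 1 fund_weight_word[OF k, of ks b] eq by simp
qed

text \<open>A dihedral tail shorter than the Coxeter exponent would keep \<open>coroot s\<close>
  positive, against the descent at \<open>s\<close>.\<close>

lemma rank2_descents:
  assumes w: "w \<in> weyl" and st: "s \<in> I" "t \<in> I" "s \<noteq> t"
    and d: "len (w \<circ> srefl s) < len w" "len (w \<circ> srefl t) < len w"
  shows "\<exists>w'\<in>weyl. w = w' \<circ> word (alt (mm s t) t s) \<and> len w = len w' + mm s t"
proof -
  obtain k w' where w': "w' \<in> weyl" "k > 0" "w = w' \<circ> word (alt k t s)" "len w = len w' + k"
    "len w' \<le> len (w' \<circ> srefl s)" "len w' \<le> len (w' \<circ> srefl t)"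
    using rank2_decomp[OF w st d(2)] by blast
  have k: "\<not> k < mm s t"
  proof
    assume "k < mm s t"
    then obtain p q where pq: "p \<ge> 0" "q \<ge> 0" "word (alt k t s) (coroot s) = p *\<^sub>R coroot s + q *\<^sub>R coroot t"
      using rank2_nonneg st by blast
    have "nonneg (w' (coroot s))" "nonneg (w' (coroot t))" using ascent_nonneg_weak w' st by auto
    then have "nonneg (w (coroot s))"
      using w'(3) pq linear_add[OF weyl_linear[OF w'(1)]] linear_scale[OF weyl_linear[OF w'(1)]]
      by (simp add: nonneg_add nonneg_scale)
    then show False using ascent_iff[OF w st(1)] d(1) by simp
  qed
  define n where "n = k - mm s t"
  then have n: "k = mm s t + n" using k by simp
  obtain pre where pre: "alt k t s = pre @ alt (mm s t) t s" "set pre \<subseteq> {t, s}" "length pre = n"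
    using alt_add[of "mm s t" n t s] unfolding n[symmetric] by blast
  have pI: "pre \<in> lists I" using pre(2) st by auto
  let ?w = "w' \<circ> word pre"
  have W: "?w \<in> weyl" using weyl_comp[OF w'(1) weyl_word[OF pI]] .
  have e: "w = ?w \<circ> word (alt (mm s t) t s)" using w'(3) unfolding pre(1) by (simp add: comp_assoc)
  have "len w \<le> len ?w + mm s t"
    unfolding e using len_comp_le[OF W weyl_word[OF alt_lists[OF st(2,1)]], of "mm s t"] len_word_le[OF alt_lists[OF st(2,1)], of "mm s t"]
    by simp
  moreover have "len ?w \<le> len w' + n" using len_comp_le[OF w'(1) weyl_word[OF pI]] len_word_le[OF pI] pre(3) by simp
  ultimately have "len w = len ?w + mm s t" using w'(4) n by simp
  then have "len w = len ?w + mm s t" .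
  from conjI[OF e this] show ?thesis using W by (rule bexI[where x = ?w])
qed

lemma rank2_left_descents:
  assumes w: "w \<in> weyl" and st: "s \<in> I" "t \<in> I" "s \<noteq> t"
    and d: "len (srefl s \<circ> w) < len w" "len (srefl t \<circ> w) < len w"
  shows "\<exists>us. reduced (alt (mm s t) s t @ us) \<and> reduced (alt (mm s t) t s @ us)
    \<and> word (alt (mm s t) s t @ us) = w \<and> word (alt (mm s t) t s @ us) = w"
proof -
  have l: "len (inv w \<circ> srefl c) = len (srefl c \<circ> w)" if "c \<in> I" for c
    using len_inv[of "srefl c \<circ> w"] w that by (simp add: inv_comp)
  obtain w' where w': "w' \<in> weyl" "inv w = w' \<circ> word (alt (mm s t) t s)" "len (inv w) = len w' + mm s t"
    using rank2_descents[of "inv w" s t] w st d l[OF st(1)] l[OF st(2)] by (metis len_inv weyl_inv)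
  have L: "alt (mm s t) t s \<in> lists I" using alt_lists st by blast
  have "w = inv (w' \<circ> word (alt (mm s t) t s))" using w'(2) w by (metis inv_inv_weyl)
  also have "\<dots> = word (rev (alt (mm s t) t s)) \<circ> inv w'" using inv_comp[OF w'(1) weyl_word[OF L]] inv_word[OF L] by simp
  also have "word (rev (alt (mm s t) t s)) = word (alt (mm s t) s t)"
    unfolding rev_alt using braid[OF st] by auto
  finally have e: "w = word (alt (mm s t) s t) \<circ> inv w'" .
  obtain us where us: "reduced us" "word us = inv w'" "length us = len (inv w')"
    using obtain_reduced w' weyl_inv by metis
  have 1: "word (alt (mm s t) s t @ us) = w" unfolding word_append us(2) using e by simp
  then have 2: "word (alt (mm s t) t s @ us) = w" unfolding word_append braid[OF st] .
  have "len w = mm s t + length us" using us(3) len_inv[OF w] len_inv[OF w'(1)] w'(3) by linarith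
  then show ?thesis using 1 2 reduced_lists[OF us(1)] alt_lists st by (intro exI[of _ us]) (auto simp: reduced_def simp del: word_append)
qed

lemma reduced_word_left:
  assumes "reduced (s # ks)" shows "len (srefl s \<circ> word (s # ks)) < len (word (s # ks))"
proof -
  have s: "s \<in> I" using reduced_lists[OF assms] by simp
  have "srefl s \<circ> word (s # ks) = word ks" using s by (simp add: fun_eq_iff)
  then show ?thesis using reduced_appendD(2)[of "[s]" ks] assms unfolding reduced_def by simp
qed

text \<open>If the first letters \<open>s\<close> and \<open>t\<close> differ, both are left
  descents, so the element also has reduced words beginning with the two full alternating words. One
  braid move links these, and words with a common first letter are handled by induction.\<close>

lemma matsumoto:
  assumes "reduced ks" "reduced ls" "word ks = word ls"
  shows "(braid_step mm)\<^sup>*\<^sup>* ks ls"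
  using assms
proof (induction "length ks" arbitrary: ks ls)
  case 0
  then have k: "ks = []" by simp
  then have "len (word ls) = 0" using 0(4) by (metis len_id word_Nil)
  then show ?case using reduced_len[OF 0(3)] k by simp
next
  case (Suc n)
  have len: "length ls = Suc n" using Suc by (metis reduced_len)
  obtain s ks' where ks: "ks = s # ks'" using Suc(2) by (cases ks) auto
  obtain t ls' where ls: "ls = t # ls'" using len by (cases ls) auto
  have st: "s \<in> I" "t \<in> I" using Suc.prems ks ls by (auto simp: reduced_def)
  have red: "reduced ks'" "reduced ls'" using reduced_appendD(2)[of "[s]" ks'] reduced_appendD(2)[of "[t]" ls'] Suc.prems ks ls by auto
  have tail: "word xs = word ys" if "c \<in> I" "word (c # xs) = word (c # ys)" for c xs ys
  proof -
    have "srefl c (word xs h) = srefl c (word ys h)" for h using fun_cong[OF that(2), of h] by simp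
    then show ?thesis using that(1) by (intro ext) (metis srefl_invol)
  qed
  have IH: "(braid_step mm)\<^sup>*\<^sup>* (c # xs) (c # ys)"
    if "reduced (c # xs)" "reduced (c # ys)" "word (c # xs) = word (c # ys)" "length xs = n" for c xs ys
  proof -
    have "reduced xs" "reduced ys" using reduced_appendD(2)[of "[c]"] that by auto
    moreover have "word xs = word ys" using tail[OF _ that(3)] that(1) by (auto simp: reduced_def)
    ultimately show ?thesis using Suc(1)[of xs ys] that(4) by (intro braid_steps_Cons) auto
  qed
  show ?case
  proof (cases "s = t")
    case True
    then show ?thesis using IH[of s ks' ls'] Suc.prems Suc(2) ks ls by simp
  next
    case False
    define w where "w = word ks"
    have w: "w \<in> weyl" unfolding w_def using Suc.prems reduced_lists weyl_word by blast
    have d: "len (srefl s \<circ> w) < len w" "len (srefl t \<circ> w) < len w"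
      using reduced_word_left[of s ks'] reduced_word_left[of t ls'] Suc.prems ks ls unfolding w_def by auto
    define m where "m = mm s t"
    obtain us where us: "reduced (alt m s t @ us)" "reduced (alt m t s @ us)" "word (alt m s t @ us) = w" "word (alt m t s @ us) = w"
      using rank2_left_descents[OF w st False d] unfolding m_def by blast
    have "m \<noteq> 0" unfolding m_def by (simp add: mm_def Let_def)
    then obtain m' where m': "m = Suc m'" using not0_implies_Suc by blast
    have bs: "braid_step mm (alt m s t @ us) (alt m t s @ us)" "braid_step mm (alt m t s @ us) (alt m s t @ us)"
      using braid_stepI[of s t mm "[]" us] braid_stepI[of t s mm "[]" us] False mm_sym[of s t] unfolding m_def by auto
    have "\<exists>xs ys. reduced (s # xs) \<and> reduced (t # ys) \<and> word (s # xs) = w \<and> word (t # ys) = w \<and> braid_step mm (s # xs) (t # ys)"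
    proof (cases "even m'")
      case True
      then show ?thesis using us bs unfolding m' by (intro exI[of _ "alt m' s t @ us"] exI[of _ "alt m' t s @ us"]) (auto simp del: word_append)
    next
      case False
      then show ?thesis using us bs unfolding m'
        by (rule_tac exI[of _ "alt m' t s @ us"], rule_tac exI[of _ "alt m' s t @ us"]) (auto simp del: word_append)
    qed
    then obtain xs ys where xy: "reduced (s # xs)" "reduced (t # ys)" "word (s # xs) = w" "word (t # ys) = w" "braid_step mm (s # xs) (t # ys)"
      by blast
    have lw: "len w = Suc n" unfolding w_def using Suc by (metis reduced_len)
    have "length xs = n" "length ys = n" using lw reduced_len[OF xy(1)] reduced_len[OF xy(2)] xy(3,4) by auto
    then have "(braid_step mm)\<^sup>*\<^sup>* ks (s # xs)" "(braid_step mm)\<^sup>*\<^sup>* (t # ys) ls"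
      using IH[of s ks' xs] IH[of t ys ls'] xy Suc.prems Suc(2) ks ls unfolding w_def by auto
    then show ?thesis using xy(5) by (meson rtranclp.rtrancl_into_rtrancl rtranclp_trans)
  qed
qed

end

subsection \<open>Exponentials of locally nilpotent operators\<close>

text \<open>For linear \<open>D\<close> the index set is finite exactly when \<open>D\<close> is
  nilpotent on \<open>x\<close>; no bound on the order has to be carried along.\<close>

definition ex :: "real \<Rightarrow> ('v::real_vector \<Rightarrow> 'v) \<Rightarrow> 'v \<Rightarrow> 'v" where
  "ex t D x = (\<Sum>n | (D ^^ n) x \<noteq> 0. (t ^ n / fact n) *\<^sub>R (D ^^ n) x)"

definition nil :: "('v::real_vector \<Rightarrow> 'v) \<Rightarrow> 'v \<Rightarrow> bool" where
  "nil D x \<longleftrightarrow> (\<exists>n. (D ^^ n) x = 0)"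

text \<open>Exponentials of locally nilpotent operators are additive where the operator is
  nilpotent, so linearity is relative to a subset.\<close>

definition linear_within :: "'v::real_vector set \<Rightarrow> ('v \<Rightarrow> 'w::real_vector) \<Rightarrow> bool" where
  "linear_within S f \<longleftrightarrow> (\<forall>x\<in>S. \<forall>y\<in>S. f (x + y) = f x + f y) \<and> (\<forall>x\<in>S. \<forall>c. f (c *\<^sub>R x) = c *\<^sub>R f x)"

lemma linear_withinD:
  assumes "linear_within S f"
  shows "x \<in> S \<Longrightarrow> y \<in> S \<Longrightarrow> f (x + y) = f x + f y" "x \<in> S \<Longrightarrow> f (c *\<^sub>R x) = c *\<^sub>R f x"
  using assms by (auto simp: linear_within_def)

lemma linear_within_0: "linear_within S f \<Longrightarrow> subspace S \<Longrightarrow> f 0 = 0"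
  using linear_withinD(2)[of S f 0 0] subspace_0 by force

lemma linear_within_sum:
  assumes f: "linear_within S f" and S: "subspace S" and x: "\<And>i. i \<in> A \<Longrightarrow> x i \<in> S"
  shows "f (\<Sum>i\<in>A. c i *\<^sub>R x i) = (\<Sum>i\<in>A. c i *\<^sub>R f (x i))"
  using x
proof (induction A rule: infinite_finite_induct)
  case (insert i A)
  have "(\<Sum>i\<in>A. c i *\<^sub>R x i) \<in> S" using insert by (intro subspace_sum[OF S] subspace_scale[OF S]) auto
  then show ?case using insert linear_withinD[OF f] subspace_scale[OF S] by simp
qed (simp_all add: linear_within_0[OF f S])

lemma funpow_linear:
  fixes D :: "'v::real_vector \<Rightarrow> 'v"
  shows "linear D \<Longrightarrow> linear (D ^^ n)"
proof (induction n)
  case 0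
  then show ?case by (auto intro!: linearI)
next
  case (Suc n)
  then have "linear (D \<circ> D ^^ n)" using linear_compose by blast
  then show ?case unfolding funpow.simps .
qed

lemma funpow_zero_mono:
  fixes D :: "'v::real_vector \<Rightarrow> 'v"
  shows "linear D \<Longrightarrow> (D ^^ n) x = 0 \<Longrightarrow> n \<le> m \<Longrightarrow> (D ^^ m) x = 0"
proof (induction m)
  case (Suc m)
  then show ?case using linear_0[OF Suc.prems(1)] by (cases "n = Suc m") auto
qed simp

lemma funpow_closed: "(\<And>y. y \<in> S \<Longrightarrow> D y \<in> S) \<Longrightarrow> x \<in> S \<Longrightarrow> (D ^^ n) x \<in> S"
  by (induction n) auto

lemma ex_sum:
  assumes "linear D" "(D ^^ N) x = 0"
  shows "ex t D x = (\<Sum>n<N. (t ^ n / fact n) *\<^sub>R (D ^^ n) x)"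
proof -
  have "{n. (D ^^ n) x \<noteq> 0} \<subseteq> {..<N}" using funpow_zero_mono[OF assms] by (metis (mono_tags) lessThan_iff mem_Collect_eq not_le subsetI)
  then show ?thesis unfolding ex_def by (intro sum.mono_neutral_left) auto
qed

lemma nil_0: "nil D 0" unfolding nil_def by (rule exI[of _ 0]) simp

lemma nil_add: assumes "linear D" "nil D x" "nil D y" shows "nil D (x + y)"
proof -
  obtain n m where "(D ^^ n) x = 0" "(D ^^ m) y = 0" using assms by (auto simp: nil_def)
  then have "(D ^^ (n + m)) x = 0" "(D ^^ (n + m)) y = 0" using funpow_zero_mono[OF assms(1)] by (metis le_add1, metis le_add2)
  then have "(D ^^ (n + m)) (x + y) = 0" using linear_add[OF funpow_linear[OF assms(1)]] by simp
  then show ?thesis unfolding nil_def by blast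
qed

lemma nil_scale: assumes "linear D" "nil D x" shows "nil D (c *\<^sub>R x)"
  using assms linear_scale[OF funpow_linear[OF assms(1)]] unfolding nil_def by (metis scaleR_zero_right)

lemma nil_step: "nil D (D x) \<Longrightarrow> nil D x"
  unfolding nil_def by (metis funpow_Suc_right o_apply)

lemma nil_app: assumes "linear D" "nil D x" shows "nil D (D x)"
proof -
  obtain n where "(D ^^ n) x = 0" using assms by (auto simp: nil_def)
  then have "(D ^^ n) (D x) = 0" using linear_0[OF assms(1)] by (metis funpow_swap1)
  then show ?thesis by (auto simp: nil_def)
qed

text \<open>Induction on the order of nilpotency of \<open>x\<close>: \<open>D (X x)\<close> is
  \<open>X (D x)\<close> plus a term that is nilpotent by assumption.\<close>

lemma nil_commutator:
  assumes D: "linear D" and X: "X 0 = 0" and S: "\<And>y. y \<in> S \<Longrightarrow> D y \<in> S"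
    and c: "\<And>y. y \<in> S \<Longrightarrow> D (X y) = X (D y) + Y y"
    and Y: "\<And>y. y \<in> S \<Longrightarrow> nil D y \<Longrightarrow> nil D (Y y)" and x: "x \<in> S" "nil D x"
  shows "nil D (X x)"
proof -
  have "(D ^^ n) x = 0 \<Longrightarrow> x \<in> S \<Longrightarrow> nil D (X x)" for n
  proof (induction n arbitrary: x)
    case 0
    then show ?case by (simp add: X nil_0)
  next
    case (Suc n)
    have "(D ^^ n) (D x) = 0" using Suc.prems(1) by (metis funpow_Suc_right o_apply)
    then have "nil D (X (D x))" using Suc S by blast
    moreover have "nil D x" using Suc.prems unfolding nil_def by blast
    ultimately have "nil D (D (X x))" using c[OF Suc.prems(2)] Y[OF Suc.prems(2)] nil_add[OF D] by metis
    then show ?case by (rule nil_step)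
  qed
  then show ?thesis using x by (auto simp: nil_def)
qed

lemma ex_0: assumes "linear D" "nil D x" shows "ex 0 D x = x"
proof -
  obtain N where N: "(D ^^ N) x = 0" using assms(2) by (auto simp: nil_def)
  have "(D ^^ Suc N) x = 0" using funpow_zero_mono[OF assms(1) N, of "Suc N"] by linarith
  then have "ex 0 D x = (\<Sum>n<Suc N. (0 ^ n / fact n) *\<^sub>R (D ^^ n) x)" using ex_sum[OF assms(1)] by blast
  also have "\<dots> = x" unfolding sum.lessThan_Suc_shift by simp
  finally show ?thesis .
qed

lemma ex_fixed: assumes "linear D" "D x = 0" shows "ex t D x = x"
  using ex_sum[OF assms(1), of 1 x t] assms(2) by simp

lemma ex_add: assumes "linear D" "nil D x" "nil D y" shows "ex t D (x + y) = ex t D x + ex t D y"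
proof -
  obtain n m where "(D ^^ n) x = 0" "(D ^^ m) y = 0" using assms by (auto simp: nil_def)
  then have N: "(D ^^ (n + m)) x = 0" "(D ^^ (n + m)) y = 0" using funpow_zero_mono[OF assms(1)] by (metis le_add1, metis le_add2)
  then have "(D ^^ (n + m)) (x + y) = 0" using linear_add[OF funpow_linear[OF assms(1)]] by simp
  then show ?thesis by (simp add: ex_sum[OF assms(1) N(1)] ex_sum[OF assms(1) N(2)] ex_sum[OF assms(1), of "n + m" "x + y"] linear_add[OF funpow_linear[OF assms(1)]] scaleR_add_right sum.distrib)
qed

lemma ex_scale: assumes "linear D" "nil D x" shows "ex t D (c *\<^sub>R x) = c *\<^sub>R ex t D x"
proof -
  obtain n where N: "(D ^^ n) x = 0" using assms by (auto simp: nil_def)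
  then have "(D ^^ n) (c *\<^sub>R x) = 0" using linear_scale[OF funpow_linear[OF assms(1)]] by simp
  then show ?thesis by (simp add: ex_sum[OF assms(1) N] ex_sum[OF assms(1), of n "c *\<^sub>R x"] linear_scale[OF funpow_linear[OF assms(1)]] scaleR_sum_right mult.commute)
qed

lemma ex_closed:
  assumes "linear D" "nil D x" "subspace S" "\<And>y. y \<in> S \<Longrightarrow> D y \<in> S" "x \<in> S" shows "ex t D x \<in> S"
  unfolding ex_def using assms by (intro subspace_sum subspace_scale funpow_closed) auto

lemma linear_within_ex: assumes "linear D" "\<And>x. x \<in> S \<Longrightarrow> nil D x" shows "linear_within S (ex t D)"
  using assms by (auto simp: linear_within_def ex_add ex_scale)

lemma ex_intertwine:
  assumes D: "linear D" "linear D'" and S: "subspace S" "\<And>y. y \<in> S \<Longrightarrow> D y \<in> S" and T: "linear_within S T"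
    and c: "\<And>y. y \<in> S \<Longrightarrow> T (D y) = D' (T y)" and x: "x \<in> S" "nil D x"
  shows "T (ex t D x) = ex t D' (T x)"
proof -
  obtain N where N: "(D ^^ N) x = 0" using x by (auto simp: nil_def)
  have p: "T ((D ^^ n) x) = (D' ^^ n) (T x)" for n
    by (induction n) (auto simp: c funpow_closed[of S D] S x)
  have N': "(D' ^^ N) (T x) = 0" using p[of N] N linear_within_0[OF T S(1)] by simp
  have "T (ex t D x) = (\<Sum>n<N. (t ^ n / fact n) *\<^sub>R T ((D ^^ n) x))"
    unfolding ex_sum[OF D(1) N] using funpow_closed[of S D] S x by (intro linear_within_sum[OF T S(1)]) auto
  then show ?thesis unfolding ex_sum[OF D(2) N'] p .
qed

text \<open>\<open>u k l\<close> stands for the product of the \<open>k\<close>-th divided power of a derivation on the first factor and the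
  \<open>l\<close>-th one on the second: products of vectors, operators acting on vectors, and powers of one operator.\<close>

lemma array_power:
  fixes u :: "nat \<Rightarrow> nat \<Rightarrow> 'v::real_vector"
  assumes D: "linear D" and step: "\<And>k l. t *\<^sub>R D (u k l) = real (Suc k) *\<^sub>R u (Suc k) l + real (Suc l) *\<^sub>R u k (Suc l)"
  shows "t ^ n *\<^sub>R (D ^^ n) (u 0 0) = fact n *\<^sub>R (\<Sum>k\<le>n. u k (n - k))"
proof (induction n)
  case (Suc n)
  have "t ^ Suc n *\<^sub>R (D ^^ Suc n) (u 0 0) = t *\<^sub>R D (t ^ n *\<^sub>R (D ^^ n) (u 0 0))"
    by (simp add: linear_scale[OF D])
  also have "\<dots> = fact n *\<^sub>R (\<Sum>k\<le>n. t *\<^sub>R D (u k (n - k)))"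
    unfolding Suc by (simp add: linear_scale[OF D] linear_sum[OF D] scaleR_sum_right mult.commute)
  also have "(\<Sum>k\<le>n. t *\<^sub>R D (u k (n - k)))
      = (\<Sum>k\<le>n. real (Suc k) *\<^sub>R u (Suc k) (Suc n - Suc k)) + (\<Sum>k\<le>n. real (Suc n - k) *\<^sub>R u k (Suc n - k))"
    unfolding step sum.distrib by (simp add: Suc_diff_le)
  also have "(\<Sum>k\<le>n. real (Suc k) *\<^sub>R u (Suc k) (Suc n - Suc k)) = (\<Sum>k\<le>Suc n. real k *\<^sub>R u k (Suc n - k))"
    unfolding sum.atMost_Suc_shift by simp
  also have "(\<Sum>k\<le>n. real (Suc n - k) *\<^sub>R u k (Suc n - k)) = (\<Sum>k\<le>Suc n. real (Suc n - k) *\<^sub>R u k (Suc n - k))"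
    by simp
  also have "(\<Sum>k\<le>Suc n. real k *\<^sub>R u k (Suc n - k)) + (\<Sum>k\<le>Suc n. real (Suc n - k) *\<^sub>R u k (Suc n - k))
      = (\<Sum>k\<le>Suc n. real (Suc n) *\<^sub>R u k (Suc n - k))"
    unfolding sum.distrib[symmetric] scaleR_add_left[symmetric] by (intro sum.cong) (auto simp: of_nat_diff)
  also have "fact n *\<^sub>R \<dots> = fact (Suc n) *\<^sub>R (\<Sum>k\<le>Suc n. u k (Suc n - k))"
    unfolding scaleR_sum_right[symmetric] scaleR_scaleR by (simp only: fact_Suc mult.commute)
  finally show ?case .
qed simp

text \<open>The \<open>n\<close>-th exponential term is the \<open>n\<close>-th antidiagonal of the
  array. All nonzero entries lie in a finite rectangle, so the sum over a large triangle is the sum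
  over that rectangle.\<close>

lemma ex_array:
  fixes u :: "nat \<Rightarrow> nat \<Rightarrow> 'v::real_vector"
  assumes D: "linear D" and step: "\<And>k l. t *\<^sub>R D (u k l) = real (Suc k) *\<^sub>R u (Suc k) l + real (Suc l) *\<^sub>R u k (Suc l)"
    and nil: "nil D (u 0 0)" and z: "\<And>k l. k \<ge> K \<Longrightarrow> u k l = 0" "\<And>k l. l \<ge> L \<Longrightarrow> u k l = 0"
  shows "ex t D (u 0 0) = (\<Sum>k<K. \<Sum>l<L. u k l)"
proof -
  obtain N where N: "(D ^^ N) (u 0 0) = 0" using nil by (auto simp: nil_def)
  define M where "M = N + K + L"
  have M: "(D ^^ M) (u 0 0) = 0" using funpow_zero_mono[OF D N] by (simp add: M_def)
  have "ex t D (u 0 0) = (\<Sum>n<M. (1 / fact n) *\<^sub>R (t ^ n *\<^sub>R (D ^^ n) (u 0 0)))"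
    unfolding ex_sum[OF D M] by simp
  also have "\<dots> = (\<Sum>n<M. \<Sum>k\<le>n. u k (n - k))"
    unfolding array_power[OF D step] by simp
  also have "\<dots> = (\<Sum>(k, l)\<in>{(k, l). k + l < M}. u k l)"
    by (rule sum.triangle_reindex[symmetric])
  also have "\<dots> = (\<Sum>(k, l)\<in>{..<K} \<times> {..<L}. u k l)"
  proof (rule sum.mono_neutral_right)
    have "{(k, l). k + l < M} \<subseteq> {..<M} \<times> {..<M}" by auto
    then show "finite {(k, l). k + l < M}" by (rule finite_subset) simp
    show "{..<K} \<times> {..<L} \<subseteq> {(k, l). k + l < M}" by (auto simp: M_def)
    show "\<forall>p\<in>{(k, l). k + l < M} - {..<K} \<times> {..<L}. (case p of (k, l) \<Rightarrow> u k l) = 0"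
    proof
      fix p assume "p \<in> {(k, l). k + l < M} - {..<K} \<times> {..<L}"
      then have "fst p \<ge> K \<or> snd p \<ge> L" by (auto simp: not_less)
      then show "(case p of (k, l) \<Rightarrow> u k l) = 0" unfolding case_prod_unfold using z by blast
    qed
  qed
  finally show ?thesis by (simp add: sum.cartesian_product)
qed

lemma ex_ex:
  assumes D: "linear D" and x: "nil D x"
  shows "ex s D (ex t D x) = ex (s + t) D x"
proof -
  obtain N where N: "(D ^^ N) x = 0" using x by (auto simp: nil_def)
  have z: "(D ^^ n) x = 0" if "n \<ge> N" for n using funpow_zero_mono[OF D N that] .
  define u where "u = (\<lambda>k l. (s ^ k / fact k * (t ^ l / fact l)) *\<^sub>R (D ^^ (k + l)) x)"
  have "(s + t) *\<^sub>R D (u k l) = real (Suc k) *\<^sub>R u (Suc k) l + real (Suc l) *\<^sub>R u k (Suc l)" for k l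
  proof -
    have "(s + t) *\<^sub>R D (u k l) = (s * (s ^ k / fact k * (t ^ l / fact l)) + t * (s ^ k / fact k * (t ^ l / fact l))) *\<^sub>R (D ^^ Suc (k + l)) x"
      unfolding u_def by (simp add: linear_scale[OF D] distrib_right add_divide_distrib)
    also have "s * (s ^ k / fact k * (t ^ l / fact l)) = real (Suc k) * (s ^ Suc k / fact (Suc k) * (t ^ l / fact l))"
      by (simp add: field_simps del: of_nat_Suc)
    also have "t * (s ^ k / fact k * (t ^ l / fact l)) = real (Suc l) * (s ^ k / fact k * (t ^ Suc l / fact (Suc l)))"
      by (simp add: field_simps del: of_nat_Suc)
    finally show ?thesis unfolding u_def by (simp add: scaleR_add_left del: of_nat_Suc)
  qed
  then have "ex (s + t) D (u 0 0) = (\<Sum>k<N. \<Sum>l<N. u k l)"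
    by (rule ex_array[OF D]) (auto simp: u_def z x)
  also have "\<dots> = (\<Sum>k<N. (s ^ k / fact k) *\<^sub>R (D ^^ k) (ex t D x))"
    unfolding ex_sum[OF D N] u_def
    by (simp add: linear_sum[OF funpow_linear[OF D]] linear_scale[OF funpow_linear[OF D]] scaleR_sum_right funpow_add)
  also have "\<dots> = ex s D (ex t D x)"
  proof (rule ex_sum[OF D, symmetric])
    show "(D ^^ N) (ex t D x) = 0" unfolding ex_sum[OF D N]
      using z by (simp add: linear_sum[OF funpow_linear[OF D]] linear_scale[OF funpow_linear[OF D]] funpow_add[symmetric, THEN fun_cong, unfolded o_apply])
  qed
  finally show ?thesis by (simp add: u_def)
qed

text \<open>The Hadamard formula for \<open>exp(tD) X exp(-tD)\<close>, cut off after the quadratic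
  term because the third commutator vanishes. The factor 2 makes \<open>Z\<close> half of the second
  commutator.\<close>

lemma ex_conj:
  assumes D: "linear D" and S: "\<And>y. y \<in> S \<Longrightarrow> D y \<in> S"
    and lin: "linear X" "linear Y" "linear Z"
    and X: "\<And>y. y \<in> S \<Longrightarrow> D (X y) = X (D y) + Y y"
    and Y: "\<And>y. y \<in> S \<Longrightarrow> D (Y y) = Y (D y) + 2 *\<^sub>R Z y"
    and Z: "\<And>y. y \<in> S \<Longrightarrow> D (Z y) = Z (D y)"
    and x: "x \<in> S" "nil D x"
  shows "ex t D (X x) = X (ex t D x) + t *\<^sub>R Y (ex t D x) + t ^ 2 *\<^sub>R Z (ex t D x)"
proof -
  obtain N where N: "(D ^^ N) x = 0" using x by (auto simp: nil_def)
  have z: "(D ^^ n) x = 0" if "n \<ge> N" for n using funpow_zero_mono[OF D N that] .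
  have pS: "(D ^^ n) x \<in> S" for n using funpow_closed S x by metis
  have nZ: "nil D (Z y)" if "y \<in> S" "nil D y" for y
    by (rule nil_commutator[where X = Z and Y = "\<lambda>_. 0" and S = S]) (use D linear_0[OF lin(3)] S Z that nil_0 in auto)
  have nY: "nil D (Y y)" if "y \<in> S" "nil D y" for y
    by (rule nil_commutator[where X = Y and Y = "\<lambda>y. 2 *\<^sub>R Z y" and S = S])
      (use D linear_0[OF lin(2)] S Y that nZ nil_scale[OF D] in auto)
  have nX: "nil D (X x)"
    by (rule nil_commutator[where X = X and Y = Y and S = S]) (use D linear_0[OF lin(1)] S X nY x in auto)
  define A where "A = (\<lambda>(k::nat) y. if k = 0 then X y else if k = 1 then t *\<^sub>R Y y else if k = 2 then t ^ 2 *\<^sub>R Z y else (0::'a))"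
  define u where "u = (\<lambda>k l. (t ^ l / fact l) *\<^sub>R A k ((D ^^ l) x))"
  have A: "t *\<^sub>R D (A k y) = t *\<^sub>R A k (D y) + real (Suc k) *\<^sub>R A (Suc k) y" if "y \<in> S" for k :: nat and y
    using X[OF that] Y[OF that] Z[OF that]
    by (auto simp: A_def linear_scale[OF D] linear_0[OF D] scaleR_add_right power2_eq_square)
  have step: "t *\<^sub>R D (u k l) = real (Suc k) *\<^sub>R u (Suc k) l + real (Suc l) *\<^sub>R u k (Suc l)" for k l
  proof -
    have "t *\<^sub>R D (u k l) = (t ^ l / fact l) *\<^sub>R (t *\<^sub>R D (A k ((D ^^ l) x)))"
      unfolding u_def by (simp add: linear_scale[OF D])
    also have "\<dots> = (t ^ l / fact l) *\<^sub>R (t *\<^sub>R A k ((D ^^ Suc l) x)) + (t ^ l / fact l) *\<^sub>R (real (Suc k) *\<^sub>R A (Suc k) ((D ^^ l) x))"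
      unfolding A[OF pS] by (simp add: scaleR_add_right)
    also have "(t ^ l / fact l) *\<^sub>R (t *\<^sub>R A k ((D ^^ Suc l) x)) = real (Suc l) *\<^sub>R u k (Suc l)"
      unfolding u_def scaleR_scaleR by (rule arg_cong2[where f = scaleR]) (simp_all add: field_simps del: of_nat_Suc)
    finally show ?thesis unfolding u_def by (simp add: mult.commute)
  qed
  have A0: "A k 0 = 0" for k using lin by (simp add: A_def linear_0)
  have A3: "A k y = 0" if "k \<ge> 3" for k y using that by (simp add: A_def)
  have "ex t D (u 0 0) = (\<Sum>k<3. \<Sum>l<N. u k l)"
  proof (rule ex_array[OF D step])
    show "nil D (u 0 0)" using nX by (simp add: u_def A_def)
    show "u k l = 0" if "k \<ge> 3" for k l using A3[OF that] by (simp add: u_def)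
    show "u k l = 0" if "l \<ge> N" for k l using z[OF that] A0 by (simp add: u_def)
  qed
  also have "\<dots> = (\<Sum>l<N. u 0 l) + (\<Sum>l<N. u 1 l) + (\<Sum>l<N. u 2 l)"
    by (simp add: numeral_3_eq_3 numeral_2_eq_2)
  also have "\<dots> = X (ex t D x) + t *\<^sub>R Y (ex t D x) + t ^ 2 *\<^sub>R Z (ex t D x)"
    unfolding ex_sum[OF D N] u_def A_def
    by (simp add: linear_sum[OF lin(1)] linear_scale[OF lin(1)] linear_sum[OF lin(2)] linear_scale[OF lin(2)]
        linear_sum[OF lin(3)] linear_scale[OF lin(3)] scaleR_sum_right mult.commute mult.left_commute)
  finally show ?thesis by (simp add: u_def A_def)
qed

subsection \<open>Integrable representations of $sl_2$\<close>

text \<open>Local nilpotency will hold only for the integrable functions, hence the subspace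
  \<open>S\<close>; the operators themselves are defined and linear everywhere.\<close>

locale sl2_module =
  fixes S :: "'v::real_vector set" and E F H :: "'v \<Rightarrow> 'v"
  assumes lin: "linear E" "linear F" "linear H"
    and S: "subspace S"
    and clE: "\<And>x. x \<in> S \<Longrightarrow> E x \<in> S" and clF: "\<And>x. x \<in> S \<Longrightarrow> F x \<in> S"
    and nilE: "\<And>x. x \<in> S \<Longrightarrow> nil E x" and nilF: "\<And>x. x \<in> S \<Longrightarrow> nil F x"
    and EF: "\<And>x. x \<in> S \<Longrightarrow> E (F x) = F (E x) + H x"
    and HE: "\<And>x. x \<in> S \<Longrightarrow> H (E x) = E (H x) + 2 *\<^sub>R E x"
    and HF: "\<And>x. x \<in> S \<Longrightarrow> H (F x) = F (H x) - 2 *\<^sub>R F x"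
begin

text \<open>Tits's lift of the simple reflection to the normaliser of the torus; opposite signs give
  mutually inverse lifts.\<close>

definition sb :: "real \<Rightarrow> 'v \<Rightarrow> 'v" where
  "sb e x = ex (- e) E (ex e F (ex (- e) E x))"

lemma S_simps: "x \<in> S \<Longrightarrow> y \<in> S \<Longrightarrow> x + y \<in> S" "x \<in> S \<Longrightarrow> y \<in> S \<Longrightarrow> x - y \<in> S" "x \<in> S \<Longrightarrow> c *\<^sub>R x \<in> S"
  "x \<in> S \<Longrightarrow> - x \<in> S"
  using S by (auto intro: subspace_add subspace_diff subspace_scale subspace_neg)

lemma clH: assumes "x \<in> S" shows "H x \<in> S"
proof -
  have "H x = E (F x) - F (E x)" using EF[OF assms] by simp
  then show ?thesis using assms clE clF S_simps by metis
qed

lemma exE_closed: "x \<in> S \<Longrightarrow> ex t E x \<in> S" using ex_closed[OF lin(1) nilE S clE] .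
lemma exF_closed: "x \<in> S \<Longrightarrow> ex t F x \<in> S" using ex_closed[OF lin(2) nilF S clF] .

lemma sb_closed: "x \<in> S \<Longrightarrow> sb e x \<in> S" by (simp add: sb_def exE_closed exF_closed)

lemma exE_add: "x \<in> S \<Longrightarrow> y \<in> S \<Longrightarrow> ex t E (x + y) = ex t E x + ex t E y" using ex_add[OF lin(1)] nilE by blast
lemma exF_add: "x \<in> S \<Longrightarrow> y \<in> S \<Longrightarrow> ex t F (x + y) = ex t F x + ex t F y" using ex_add[OF lin(2)] nilF by blast
lemma exE_scale: "x \<in> S \<Longrightarrow> ex t E (c *\<^sub>R x) = c *\<^sub>R ex t E x" using ex_scale[OF lin(1)] nilE by blast
lemma exF_scale: "x \<in> S \<Longrightarrow> ex t F (c *\<^sub>R x) = c *\<^sub>R ex t F x" using ex_scale[OF lin(2)] nilF by blast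

lemma sb_add: "x \<in> S \<Longrightarrow> y \<in> S \<Longrightarrow> sb e (x + y) = sb e x + sb e y"
  by (simp add: sb_def exE_add exF_add exE_closed exF_closed)
lemma sb_scale: "x \<in> S \<Longrightarrow> sb e (c *\<^sub>R x) = c *\<^sub>R sb e x"
  by (simp add: sb_def exE_scale exF_scale exE_closed exF_closed)

lemma exE_inv: "x \<in> S \<Longrightarrow> ex t E (ex (- t) E x) = x" "x \<in> S \<Longrightarrow> ex (- t) E (ex t E x) = x"
  using ex_ex[OF lin(1) nilE, of x t "- t"] ex_ex[OF lin(1) nilE, of x "- t" t] ex_0[OF lin(1) nilE] by auto
lemma exF_inv: "x \<in> S \<Longrightarrow> ex t F (ex (- t) F x) = x" "x \<in> S \<Longrightarrow> ex (- t) F (ex t F x) = x"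
  using ex_ex[OF lin(2) nilF, of x t "- t"] ex_ex[OF lin(2) nilF, of x "- t" t] ex_0[OF lin(2) nilF] by auto

lemma sb_inv: "x \<in> S \<Longrightarrow> sb (- e) (sb e x) = x"
  by (simp add: sb_def exE_inv exF_inv exE_closed exF_closed)

lemma linear_within_sb: "linear_within S (sb e)"
  by (auto simp: linear_within_def sb_add sb_scale)

lemma E_conj:
  assumes "linear X" "linear Y" "linear Z" "\<And>y. y \<in> S \<Longrightarrow> E (X y) = X (E y) + Y y"
    "\<And>y. y \<in> S \<Longrightarrow> E (Y y) = Y (E y) + 2 *\<^sub>R Z y" "\<And>y. y \<in> S \<Longrightarrow> E (Z y) = Z (E y)" "x \<in> S"
  shows "ex t E (X x) = X (ex t E x) + t *\<^sub>R Y (ex t E x) + t ^ 2 *\<^sub>R Z (ex t E x)"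
  by (rule ex_conj[where S = S]) (use assms lin clE nilE in auto)

lemma F_conj:
  assumes "linear X" "linear Y" "linear Z" "\<And>y. y \<in> S \<Longrightarrow> F (X y) = X (F y) + Y y"
    "\<And>y. y \<in> S \<Longrightarrow> F (Y y) = Y (F y) + 2 *\<^sub>R Z y" "\<And>y. y \<in> S \<Longrightarrow> F (Z y) = Z (F y)" "x \<in> S"
  shows "ex t F (X x) = X (ex t F x) + t *\<^sub>R Y (ex t F x) + t ^ 2 *\<^sub>R Z (ex t F x)"
  by (rule ex_conj[where S = S]) (use assms lin clF nilF in auto)

lemma E_conj2:
  assumes "linear X" "linear Y" "\<And>y. y \<in> S \<Longrightarrow> E (X y) = X (E y) + Y y" "\<And>y. y \<in> S \<Longrightarrow> E (Y y) = Y (E y)" "x \<in> S"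
  shows "ex t E (X x) = X (ex t E x) + t *\<^sub>R Y (ex t E x)"
  using E_conj[of X Y "\<lambda>_. 0" x t] assms linear_0[OF lin(1)] linear_zero by simp

lemma F_conj2:
  assumes "linear X" "linear Y" "\<And>y. y \<in> S \<Longrightarrow> F (X y) = X (F y) + Y y" "\<And>y. y \<in> S \<Longrightarrow> F (Y y) = Y (F y)" "x \<in> S"
  shows "ex t F (X x) = X (ex t F x) + t *\<^sub>R Y (ex t F x)"
  using F_conj[of X Y "\<lambda>_. 0" x t] assms linear_0[OF lin(2)] linear_zero by simp

lemma E_conj1: "linear X \<Longrightarrow> (\<And>y. y \<in> S \<Longrightarrow> E (X y) = X (E y)) \<Longrightarrow> x \<in> S \<Longrightarrow> ex t E (X x) = X (ex t E x)"
  using E_conj2[of X "\<lambda>_. 0" x t] linear_0[OF lin(1)] linear_zero by simp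

lemma F_conj1: "linear X \<Longrightarrow> (\<And>y. y \<in> S \<Longrightarrow> F (X y) = X (F y)) \<Longrightarrow> x \<in> S \<Longrightarrow> ex t F (X x) = X (ex t F x)"
  using F_conj2[of X "\<lambda>_. 0" x t] linear_0[OF lin(2)] linear_zero by simp

text \<open>Under commutators \<open>X0\<close>, \<open>X1\<close>, \<open>X2\<close> behave like
  the adjoint representation, with \<open>X1\<close> in the middle. The reflection acts by
  \<open>-1\<close> on weight zero.\<close>

lemma conj3:
  assumes lX: "linear X0" "linear X1" "linear X2" and cl: "\<And>y. y \<in> S \<Longrightarrow> X0 y \<in> S" "\<And>y. y \<in> S \<Longrightarrow> X1 y \<in> S" "\<And>y. y \<in> S \<Longrightarrow> X2 y \<in> S"
    and E: "\<And>y. y \<in> S \<Longrightarrow> E (X0 y) = X0 (E y) + X1 y" "\<And>y. y \<in> S \<Longrightarrow> E (X1 y) = X1 (E y) + 2 *\<^sub>R X2 y" "\<And>y. y \<in> S \<Longrightarrow> E (X2 y) = X2 (E y)"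
    and F: "\<And>y. y \<in> S \<Longrightarrow> F (X2 y) = X2 (F y) + X1 y" "\<And>y. y \<in> S \<Longrightarrow> F (X1 y) = X1 (F y) + 2 *\<^sub>R X0 y" "\<And>y. y \<in> S \<Longrightarrow> F (X0 y) = X0 (F y)"
    and y: "y \<in> S"
  shows "sb 1 (X1 y) = - X1 (sb 1 y)"
proof -
  have e1: "ex t E (X1 z) = X1 (ex t E z) + (2 * t) *\<^sub>R X2 (ex t E z)" if "z \<in> S" for t z
    using E_conj2[of X1 "\<lambda>y. 2 *\<^sub>R X2 y" z t] E that lX linear_compose_scale_right[OF lX(3)]
    by (simp add: linear_scale[OF lin(1)] mult.commute)
  have e2: "ex t E (X2 z) = X2 (ex t E z)" if "z \<in> S" for t z
    using E_conj1[of X2 z t] E that lX by simp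
  have f0: "ex t F (X0 z) = X0 (ex t F z)" if "z \<in> S" for t z
    using F_conj1[of X0 z t] F that lX by simp
  have f1: "ex t F (X1 z) = X1 (ex t F z) + (2 * t) *\<^sub>R X0 (ex t F z)" if "z \<in> S" for t z
    using F_conj2[of X1 "\<lambda>y. 2 *\<^sub>R X0 y" z t] F that lX linear_compose_scale_right[OF lX(1)]
    by (simp add: linear_scale[OF lin(2)] mult.commute)
  have f2: "ex t F (X2 z) = X2 (ex t F z) + t *\<^sub>R X1 (ex t F z) + t ^ 2 *\<^sub>R X0 (ex t F z)" if "z \<in> S" for t z
    using F_conj[of X2 X1 X0 z t] F that lX by simp
  define y1 where "y1 = ex (- 1) E y"
  define y2 where "y2 = ex 1 F y1"
  have yS: "y1 \<in> S" "y2 \<in> S" using y by (simp_all add: y1_def y2_def exE_closed exF_closed)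
  have "ex (- 1) E (X1 y) = X1 y1 + (- 2) *\<^sub>R X2 y1" using e1[OF y, of "- 1"] by (simp add: y1_def)
  then have "ex 1 F (ex (- 1) E (X1 y)) = ex 1 F (X1 y1) + (- 2) *\<^sub>R ex 1 F (X2 y1)"
    using yS cl by (simp only: exF_add exF_scale S_simps)
  also have "\<dots> = (- 1) *\<^sub>R X1 y2 + (- 2) *\<^sub>R X2 y2"
    unfolding f1[OF yS(1)] f2[OF yS(1)] y2_def[symmetric] by (simp add: algebra_simps scaleR_2)
  finally have "sb 1 (X1 y) = ex (- 1) E ((- 1) *\<^sub>R X1 y2 + (- 2) *\<^sub>R X2 y2)" by (simp add: sb_def)
  also have "\<dots> = (- 1) *\<^sub>R ex (- 1) E (X1 y2) + (- 2) *\<^sub>R ex (- 1) E (X2 y2)"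
    using yS cl by (simp only: exE_add exE_scale S_simps)
  also have "\<dots> = - X1 (ex (- 1) E y2)" unfolding e1[OF yS(2)] e2[OF yS(2)] by (simp add: algebra_simps)
  finally show ?thesis by (simp add: sb_def y1_def y2_def)
qed

text \<open>Here the operators form a two-dimensional representation under commutators, which the
  lifted reflection acts on by a quarter turn.\<close>

lemma conj2:
  assumes lX: "linear X0" "linear X1" and cl: "\<And>y. y \<in> S \<Longrightarrow> X0 y \<in> S" "\<And>y. y \<in> S \<Longrightarrow> X1 y \<in> S"
    and E: "\<And>y. y \<in> S \<Longrightarrow> E (X0 y) = X0 (E y) + X1 y" "\<And>y. y \<in> S \<Longrightarrow> E (X1 y) = X1 (E y)"
    and F: "\<And>y. y \<in> S \<Longrightarrow> F (X1 y) = X1 (F y) + X0 y" "\<And>y. y \<in> S \<Longrightarrow> F (X0 y) = X0 (F y)"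
    and y: "y \<in> S"
  shows "sb 1 (X0 y) = - X1 (sb 1 y)" "sb 1 (X1 y) = X0 (sb 1 y)"
proof -
  have e0: "ex t E (X0 z) = X0 (ex t E z) + t *\<^sub>R X1 (ex t E z)" if "z \<in> S" for t z
    using E_conj2[of X0 X1 z t] E that lX by simp
  have e1: "ex t E (X1 z) = X1 (ex t E z)" if "z \<in> S" for t z
    using E_conj1[of X1 z t] E that lX by simp
  have f0: "ex t F (X0 z) = X0 (ex t F z)" if "z \<in> S" for t z
    using F_conj1[of X0 z t] F that lX by simp
  have f1: "ex t F (X1 z) = X1 (ex t F z) + t *\<^sub>R X0 (ex t F z)" if "z \<in> S" for t z
    using F_conj2[of X1 X0 z t] F that lX by simp
  define y1 where "y1 = ex (- 1) E y"
  define y2 where "y2 = ex 1 F y1"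
  have yS: "y1 \<in> S" "y2 \<in> S" using y by (simp_all add: y1_def y2_def exE_closed exF_closed)
  have "ex (- 1) E (X0 y) = X0 y1 + (- 1) *\<^sub>R X1 y1" using e0[OF y, of "- 1"] by (simp add: y1_def)
  then have "ex 1 F (ex (- 1) E (X0 y)) = ex 1 F (X0 y1) + (- 1) *\<^sub>R ex 1 F (X1 y1)"
    using yS cl by (simp only: exF_add exF_scale S_simps)
  also have "\<dots> = (- 1) *\<^sub>R X1 y2" unfolding f0[OF yS(1)] f1[OF yS(1)] y2_def[symmetric] by simp
  finally have "sb 1 (X0 y) = (- 1) *\<^sub>R ex (- 1) E (X1 y2)" 
    unfolding sb_def using exE_scale[OF cl(2)[OF yS(2)], of "- 1" "- 1"] by metis
  then show "sb 1 (X0 y) = - X1 (sb 1 y)" unfolding e1[OF yS(2)] by (simp add: sb_def y1_def y2_def)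
  have "ex 1 F (ex (- 1) E (X1 y)) = X1 y2 + X0 y2" using e1[OF y, of "- 1"] f1[OF yS(1), of 1] by (simp add: y1_def y2_def)
  then have "sb 1 (X1 y) = ex (- 1) E (X1 y2) + ex (- 1) E (X0 y2)"
    unfolding sb_def using yS cl by (simp only: exE_add)
  then show "sb 1 (X1 y) = X0 (sb 1 y)" unfolding e0[OF yS(2)] e1[OF yS(2)] by (simp add: sb_def y1_def y2_def)
qed

lemma conj1:
  assumes "linear X" "\<And>y. y \<in> S \<Longrightarrow> E (X y) = X (E y)" "\<And>y. y \<in> S \<Longrightarrow> F (X y) = X (F y)" and y: "y \<in> S"
  shows "sb e (X y) = X (sb e y)"
  using E_conj1[OF assms(1,2)] F_conj1[OF assms(1,3)] y by (simp add: sb_def exE_closed exF_closed)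

lemma sb_H: assumes "y \<in> S" shows "sb 1 (H y) = - H (sb 1 y)"
proof (rule conj3[of F H "\<lambda>y. - E y", OF lin(2) lin(3)])
  show "linear (\<lambda>y. - E y)" using linear_compose_neg[OF lin(1)] .
qed (use assms in \<open>auto simp: clE clF clH S_simps linear_neg[OF lin(1)] linear_neg[OF lin(2)] EF HE HF scaleR_2\<close>)

subsection \<open>Highest weight vectors\<close>

definition fd :: "'v \<Rightarrow> nat \<Rightarrow> 'v" where
  "fd v n = (1 / fact n) *\<^sub>R (F ^^ n) v"

context
  fixes v :: 'v and c :: real
  assumes v: "v \<in> S" "E v = 0" "H v = c *\<^sub>R v"
begin

lemma fd_Suc: "F (fd v n) = real (Suc n) *\<^sub>R fd v (Suc n)"
  by (simp add: fd_def linear_scale[OF lin(2)] del: of_nat_Suc)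

lemma fd_closed: "fd v n \<in> S"
  unfolding fd_def using S_simps(3)[OF funpow_closed[of S F, OF clF v(1)]] .

lemma fd_H: "H (fd v n) = (c - 2 * real n) *\<^sub>R fd v n"
proof (induction n)
  case 0
  then show ?case using v by (simp add: fd_def)
next
  case (Suc n)
  have "real (Suc n) *\<^sub>R H (fd v (Suc n)) = H (F (fd v n))" by (simp add: fd_Suc linear_scale[OF lin(3)])
  also have "\<dots> = (c - 2 * real (Suc n)) *\<^sub>R F (fd v n)"
    unfolding HF[OF fd_closed] Suc linear_scale[OF lin(2)] by (simp add: algebra_simps)
  also have "\<dots> = real (Suc n) *\<^sub>R ((c - 2 * real (Suc n)) *\<^sub>R fd v (Suc n))" unfolding fd_Suc by simp
  finally show ?case by (rule scaleR_left_imp_eq[rotated]) simp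
qed

lemma fd_E: "E (fd v (Suc n)) = (c - real n) *\<^sub>R fd v n"
proof (induction n)
  case 0
  show ?case using EF[OF v(1)] v linear_0[OF lin(2)] by (simp add: fd_def)
next
  case (Suc n)
  have "real (Suc (Suc n)) *\<^sub>R E (fd v (Suc (Suc n))) = E (F (fd v (Suc n)))" by (simp add: fd_Suc linear_scale[OF lin(1)])
  also have "\<dots> = (c - real n) *\<^sub>R F (fd v n) + (c - 2 * real (Suc n)) *\<^sub>R fd v (Suc n)"
    unfolding EF[OF fd_closed] Suc fd_H by (simp add: linear_scale[OF lin(2)])
  also have "\<dots> = ((c - real n) * real (Suc n) + (c - 2 * real (Suc n))) *\<^sub>R fd v (Suc n)"
    unfolding fd_Suc by (simp add: scaleR_add_left del: of_nat_Suc)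
  also have "(c - real n) * real (Suc n) + (c - 2 * real (Suc n)) = real (Suc (Suc n)) * (c - real (Suc n))"
    by (simp add: algebra_simps)
  also have "\<dots> *\<^sub>R fd v (Suc n) = real (Suc (Suc n)) *\<^sub>R ((c - real (Suc n)) *\<^sub>R fd v (Suc n))" by simp
  finally show ?case by (rule scaleR_left_imp_eq[rotated]) simp
qed

text \<open>At the last nonzero vector \<open>fd v n\<close> of the lowering string,
  \<open>fd_E\<close> gives \<open>(c - real n) *\<^sub>R fd v n = 0\<close>.\<close>

lemma weight_nat: assumes "v \<noteq> 0" obtains n where "c = real n"
proof -
  define N where "N = (LEAST n. (F ^^ n) v = 0)"
  have ex: "\<exists>n. (F ^^ n) v = 0" using nilF v by (auto simp: nil_def)
  then have N: "(F ^^ N) v = 0" unfolding N_def by (rule LeastI_ex)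
  then obtain n where n: "N = Suc n" using assms by (cases N) auto
  then have "(F ^^ n) v \<noteq> 0" using not_less_Least[of n "\<lambda>n. (F ^^ n) v = 0"] N_def by simp
  then have "fd v n \<noteq> 0" by (simp add: fd_def)
  moreover have "fd v (Suc n) = 0" using N n unfolding fd_def by simp
  ultimately have "c - real n = 0" using fd_E[of n] linear_0[OF lin(1)] by simp
  then show thesis using that by simp
qed

end

context
  fixes v :: 'v and c :: nat
  assumes v: "v \<in> S" "E v = 0" "H v = real c *\<^sub>R v"
begin

lemma fd_zero: assumes "n > c" shows "fd v n = 0"
proof (cases "v = 0")
  case True
  then show ?thesis by (simp add: fd_def linear_0[OF funpow_linear[OF lin(2)]])
next
  case False
  have nz: "fd v k \<noteq> 0 \<Longrightarrow> fd v (k + d) \<noteq> 0" if "k > c" for k d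
  proof (induction d)
    case (Suc d)
    have "fd v (Suc (k + d)) = 0 \<Longrightarrow> (real c - real (k + d)) *\<^sub>R fd v (k + d) = 0"
      using fd_E[OF v, of "k + d"] linear_0[OF lin(1)] by simp
    then show ?case using Suc that by auto
  qed simp
  obtain N where N: "(F ^^ N) v = 0" using nilF v by (auto simp: nil_def)
  have "(F ^^ (n + N)) v = 0" using funpow_zero_mono[OF lin(2) N] by simp
  then have "fd v (n + N) = 0" by (simp add: fd_def)
  then show ?thesis using nz[OF assms] by blast
qed

lemma E_power_fd: "m + l \<le> c \<Longrightarrow> (1 / fact l) *\<^sub>R (E ^^ l) (fd v (m + l)) = real ((c - m) choose l) *\<^sub>R fd v m"
proof (induction l)
  case (Suc l)
  have lc: "l < c - m" using Suc.prems by simp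
  have "(E ^^ Suc l) (fd v (m + Suc l)) = (E ^^ l) (E (fd v (Suc (m + l))))"
    by (simp add: funpow_swap1)
  also have "\<dots> = real (c - m - l) *\<^sub>R (E ^^ l) (fd v (m + l))"
    unfolding fd_E[OF v] linear_scale[OF funpow_linear[OF lin(1)]] using Suc.prems by (simp add: of_nat_diff)
  finally have "(1 / fact (Suc l)) *\<^sub>R (E ^^ Suc l) (fd v (m + Suc l))
      = (real (c - m - l) / real (Suc l)) *\<^sub>R ((1 / fact l) *\<^sub>R (E ^^ l) (fd v (m + l)))" by (simp add: field_simps)
  also have "\<dots> = (real (c - m - l) / real (Suc l) * real ((c - m) choose l)) *\<^sub>R fd v m"
    using Suc by simp
  also have "real (c - m - l) / real (Suc l) * real ((c - m) choose l) = real ((c - m) choose (Suc l))"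
  proof -
    have "Suc l * ((c - m) choose Suc l) = (c - m - l) * ((c - m) choose l)"
      by (metis binomial_absorb_comp binomial_absorption mult.commute)
    then have "real (Suc l) * real ((c - m) choose Suc l) = real (c - m - l) * real ((c - m) choose l)"
      by (metis of_nat_mult)
    then show ?thesis by (simp add: field_simps del: of_nat_Suc)
  qed
  finally show ?case .
qed simp

lemma E_power_fd_zero: assumes "l > k" shows "(E ^^ l) (fd v k) = 0"
proof (cases "k \<le> c")
  case True
  have "(1 / fact k) *\<^sub>R (E ^^ k) (fd v (0 + k)) = real ((c - 0) choose k) *\<^sub>R fd v 0" by (rule E_power_fd) (simp add: True)
  then have "(E ^^ k) (fd v k) = (fact k * real (c choose k)) *\<^sub>R v" by (simp add: fd_def vector_fraction_eq_iff)
  then have "(E ^^ Suc k) (fd v k) = 0" using v by (simp add: linear_scale[OF lin(1)])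
  then show ?thesis using funpow_zero_mono[OF lin(1), of "Suc k"] assms by simp
next
  case False
  then show ?thesis using fd_zero[of k] linear_0[OF funpow_linear[OF lin(1)]] by simp
qed

lemma ex_fd: assumes "k \<le> c"
  shows "ex t E (fd v k) = (\<Sum>l\<le>k. (t ^ l * real ((c - (k - l)) choose l)) *\<^sub>R fd v (k - l))"
proof -
  have "(E ^^ Suc k) (fd v k) = 0" by (rule E_power_fd_zero) simp
  then have "ex t E (fd v k) = (\<Sum>l<Suc k. (t ^ l / fact l) *\<^sub>R (E ^^ l) (fd v k))" by (rule ex_sum[OF lin(1)])
  also have "\<dots> = (\<Sum>l\<le>k. (t ^ l * real ((c - (k - l)) choose l)) *\<^sub>R fd v (k - l))"
    unfolding lessThan_Suc_atMost
  proof (rule sum.cong[OF refl])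
    fix l assume "l \<in> {..k}"
    then have l: "k - l + l = k" by simp
    have "(1 / fact l) *\<^sub>R (E ^^ l) (fd v (k - l + l)) = real ((c - (k - l)) choose l) *\<^sub>R fd v (k - l)"
      by (rule E_power_fd) (use assms l in simp)
    then have "t ^ l *\<^sub>R ((1 / fact l) *\<^sub>R (E ^^ l) (fd v k)) = t ^ l *\<^sub>R (real ((c - (k - l)) choose l) *\<^sub>R fd v (k - l))"
      unfolding l by (rule arg_cong)
    then show "(t ^ l / fact l) *\<^sub>R (E ^^ l) (fd v k) = (t ^ l * real ((c - (k - l)) choose l)) *\<^sub>R fd v (k - l)" by simp
  qed
  finally show ?thesis .
qed

text \<open>After expanding the exponentials, the coefficient of \<open>fd v m\<close> is, up to
  sign, the alternating sum of the binomial coefficients of \<open>c - m\<close>, which vanishes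
  unless \<open>m = c\<close>. The condition on \<open>e\<close> covers both lifts.\<close>

lemma sb_highest: assumes "e * e = 1" shows "sb e v = e ^ c *\<^sub>R fd v c"
proof -
  have "(F ^^ Suc c) v = 0" using fd_zero[of "Suc c"] by (simp add: fd_def)
  then have 1: "ex e F (ex (- e) E v) = (\<Sum>k\<le>c. e ^ k *\<^sub>R fd v k)"
    unfolding ex_fixed[OF lin(1) v(2)] ex_sum[OF lin(2) \<open>(F ^^ Suc c) v = 0\<close>] lessThan_Suc_atMost by (simp add: fd_def)
  have "sb e v = (\<Sum>k\<le>c. e ^ k *\<^sub>R ex (- e) E (fd v k))"
    unfolding sb_def 1 by (rule linear_within_sum[OF linear_within_ex[OF lin(1) nilE] S]) (assumption, rule fd_closed[OF v])
  also have "\<dots> = (\<Sum>k\<le>c. \<Sum>l\<le>k. (e ^ k * (- e) ^ l * real ((c - (k - l)) choose l)) *\<^sub>R fd v (k - l))"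
    by (rule sum.cong[OF refl]) (simp add: ex_fd scaleR_sum_right mult.assoc)
  also have "\<dots> = (\<Sum>k\<le>c. \<Sum>m\<le>k. (e ^ k * (- e) ^ (k - m) * real ((c - m) choose (k - m))) *\<^sub>R fd v m)"
  proof (rule sum.cong[OF refl])
    fix k
    show "(\<Sum>l\<le>k. (e ^ k * (- e) ^ l * real ((c - (k - l)) choose l)) *\<^sub>R fd v (k - l))
        = (\<Sum>m\<le>k. (e ^ k * (- e) ^ (k - m) * real ((c - m) choose (k - m))) *\<^sub>R fd v m)"
      by (rule sum.reindex_bij_witness[of _ "\<lambda>m. k - m" "\<lambda>m. k - m"]) auto
  qed
  also have "\<dots> = (\<Sum>m\<le>c. \<Sum>k=m..c. (e ^ k * (- e) ^ (k - m) * real ((c - m) choose (k - m))) *\<^sub>R fd v m)"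
    unfolding sum.Sigma[OF finite_atMost ballI[OF finite_atMost]] sum.Sigma[OF finite_atMost ballI[OF finite_atLeastAtMost]]
    by (rule sum.reindex_bij_witness[of _ "\<lambda>(m, k). (k, m)" "\<lambda>(k, m). (m, k)"]) auto
  also have "\<dots> = (\<Sum>m\<le>c. (if m = c then e ^ c else 0) *\<^sub>R fd v m)"
  proof (rule sum.cong[OF refl])
    fix m assume "m \<in> {..c}"
    then have m: "m \<le> c" by simp
    have "(\<Sum>k=m..c. e ^ k * (- e) ^ (k - m) * real ((c - m) choose (k - m)))
        = (\<Sum>l\<le>c - m. e ^ m * ((-1) ^ l * real ((c - m) choose l)))"
    proof (rule sum.reindex_bij_witness[of _ "\<lambda>l. l + m" "\<lambda>k. k - m"])
      fix k assume "k \<in> {m..c}"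
      then obtain l where l: "k = m + l" using le_Suc_ex by auto
      have "e ^ l * (- e) ^ l = (- 1) ^ l" using assms by (simp add: power_mult_distrib[symmetric])
      then have "e ^ k * (- e) ^ (k - m) = e ^ m * (- 1) ^ l" unfolding l power_add by (simp add: mult.assoc)
      then show "e ^ m * ((- 1) ^ (k - m) * real ((c - m) choose (k - m))) = e ^ k * (- e) ^ (k - m) * real ((c - m) choose (k - m))"
        unfolding l by (simp add: mult.assoc)
    qed (use m in auto)
    also have "\<dots> = e ^ m * (\<Sum>l\<le>c - m. (- 1) ^ l * real ((c - m) choose l))" by (simp add: sum_distrib_left)
    also have "\<dots> = (if m = c then e ^ c else 0)"
    proof (cases "m = c")
      case False
      then have "c - m > 0" using m by simp
      from choose_alternating_sum[OF this, where ?'a = real] show ?thesis using False by simp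
    qed simp
    finally show "(\<Sum>k=m..c. (e ^ k * (- e) ^ (k - m) * real ((c - m) choose (k - m))) *\<^sub>R fd v m) = (if m = c then e ^ c else 0) *\<^sub>R fd v m"
      unfolding scaleR_sum_left[symmetric] by (rule arg_cong)
  qed
  also have "\<dots> = e ^ c *\<^sub>R fd v c" by (simp add: if_distrib[of "\<lambda>r. r *\<^sub>R _"] cong: if_cong)
  finally show ?thesis .
qed

end

end

subsection \<open>Representations of a Kac--Moody type algebra and the braid relations\<close>

text \<open>The iterated commutator \<open>(ad E_i)^n E_j\<close> as an operator; its vanishing at
  \<open>n = 1 - a i j\<close> is the Serre relation.\<close>

primrec adp :: "('i \<Rightarrow> 'v::real_vector \<Rightarrow> 'v) \<Rightarrow> 'i \<Rightarrow> 'i \<Rightarrow> nat \<Rightarrow> 'v \<Rightarrow> 'v" where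
  "adp E i j 0 = E j"
| "adp E i j (Suc n) = (\<lambda>x. E i (adp E i j n x) - adp E i j n (E i x))"

locale pre_module =
  fixes a :: "'i \<Rightarrow> 'i \<Rightarrow> int" and E F H :: "'i \<Rightarrow> 'v::real_vector \<Rightarrow> 'v"
  assumes linE: "linear (E i)" and linF: "linear (F i)" and linH: "linear (H i)"
    and EF: "E i (F j x) = F j (E i x) + (if i = j then H i x else 0)"
    and HE: "H i (E j x) = E j (H i x) + of_int (a i j) *\<^sub>R E j x"
    and HF: "H i (F j x) = F j (H i x) - of_int (a i j) *\<^sub>R F j x"
begin

text \<open>The Chevalley involution: facts on raising operators transfer to lowering
  operators.\<close>

lemma dual: "pre_module a F E (\<lambda>i x. - H i x)"
  by (rule pre_module.intro) (auto simp: linE linF linH linear_compose_neg EF HE HF linear_neg[OF linE] linear_neg[OF linF])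

lemma linear_adp: "linear (adp E i j n)"
proof (induction n)
  case (Suc n)
  have "linear (\<lambda>x. E i (adp E i j n x))" "linear (\<lambda>x. adp E i j n (E i x))"
    using linear_compose[OF Suc linE] linear_compose[OF linE Suc] by (simp_all add: comp_def)
  then show ?case by (simp add: linear_compose_sub)
qed (simp add: linE)

lemma adp_H: "H k (adp E i j n x) = adp E i j n (H k x) + (of_int (a k j) + real n * of_int (a k i)) *\<^sub>R adp E i j n x"
  by (induction n arbitrary: x)
    (simp_all add: HE linear_diff[OF linH] linear_add[OF linear_adp] linear_scale[OF linear_adp] linear_add[OF linE] linear_scale[OF linE] algebra_simps)

lemma adp_F_other: "k \<noteq> i \<Longrightarrow> k \<noteq> j \<Longrightarrow> F k (adp E i j n x) = adp E i j n (F k x)"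
proof (induction n arbitrary: x)
  case 0
  then show ?case using EF[of j k x] by simp
next
  case (Suc n)
  have "F k (E i y) = E i (F k y)" for y using EF[of i k y] Suc.prems by simp
  then show ?case using Suc by (simp add: linear_diff[OF linF])
qed

text \<open>Passing \<open>F i\<close> across \<open>E i\<close> contributes the weights
  \<open>a i j + 2 m\<close> for \<open>m < n\<close>; their sum \<open>n (a i j + n - 1)\<close>
  vanishes at the Serre exponent.\<close>

lemma adp_F_left:
  assumes "a i i = 2" "i \<noteq> j"
  shows "F i (adp E i j n x) = adp E i j n (F i x) - (real n * (of_int (a i j) + real n - 1)) *\<^sub>R adp E i j (n - 1) x"
proof (induction n arbitrary: x)
  case 0
  then show ?case using assms EF[of j i x] by simp
next
  case (Suc n)
  define c where "c = real n * (of_int (a i j) + real n - 1)"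
  have FE: "F i (E i y) = E i (F i y) - H i y" for y using EF[of i i y] by simp
  have d: "E i (adp E i j (n - 1) x) - adp E i j (n - 1) (E i x) = adp E i j n x" if "n \<noteq> 0"
    using that by (cases n) auto
  have "F i (adp E i j (Suc n) x) = E i (F i (adp E i j n x)) - H i (adp E i j n x) - F i (adp E i j n (E i x))"
    by (simp add: linear_diff[OF linF] FE)
  also have "\<dots> = adp E i j (Suc n) (F i x) + adp E i j n (H i x) - H i (adp E i j n x)
      - c *\<^sub>R (E i (adp E i j (n - 1) x) - adp E i j (n - 1) (E i x))"
    unfolding Suc c_def[symmetric] by (simp add: linear_diff[OF linE] linear_scale[OF linE] FE linear_diff[OF linear_adp] algebra_simps)
  also have "c *\<^sub>R (E i (adp E i j (n - 1) x) - adp E i j (n - 1) (E i x))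
      = c *\<^sub>R adp E i j n x"
    using d by (cases "n = 0") (auto simp: c_def)
  finally have "F i (adp E i j (Suc n) x) = adp E i j (Suc n) (F i x) - (of_int (a i j) + real n * of_int (a i i) + c) *\<^sub>R adp E i j n x"
    unfolding adp_H by (simp only: scaleR_add_left) (simp add: algebra_simps)
  also have "of_int (a i j) + real n * of_int (a i i) + c = real (Suc n) * (of_int (a i j) + real (Suc n) - 1)"
    using assms(1) by (simp add: c_def algebra_simps)
  finally show ?case by simp
qed

lemma adp_F_right:
  assumes "i \<noteq> j"
  shows "F j (adp E i j 1 x) = adp E i j 1 (F j x) + of_int (a j i) *\<^sub>R E i x"
    "F j (adp E i j (Suc (Suc n)) x) = adp E i j (Suc (Suc n)) (F j x)"
proof -
  have FE: "F j (E j y) = E j (F j y) - H j y" "F j (E i y) = E i (F j y)" for y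
    using EF[of j j y] EF[of i j y] assms by auto
  show 1: "F j (adp E i j 1 x) = adp E i j 1 (F j x) + of_int (a j i) *\<^sub>R E i x" for x
    by (simp add: linear_diff[OF linF] FE linear_diff[OF linE] HE)
  show "F j (adp E i j (Suc (Suc n)) x) = adp E i j (Suc (Suc n)) (F j x)" for x
  proof (induction n arbitrary: x)
    case 0
    have "F j (adp E i j 2 x) = E i (F j (adp E i j 1 x)) - F j (adp E i j 1 (E i x))"
      by (simp add: linear_diff[OF linF] FE numeral_2_eq_2)
    also have "\<dots> = adp E i j 2 (F j x)" unfolding 1
      by (simp add: linear_add[OF linE] linear_scale[OF linE] linear_diff[OF linE] FE numeral_2_eq_2)
    finally show ?case by (simp add: numeral_2_eq_2)
  next
    case (Suc n)
    have "F j (adp E i j (Suc (Suc (Suc n))) x) = E i (F j (adp E i j (Suc (Suc n)) x)) - F j (adp E i j (Suc (Suc n)) (E i x))"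
      unfolding adp.simps(2)[of E i j "Suc (Suc n)"] by (simp only: linear_diff[OF linF] FE)
    then show ?case unfolding Suc adp.simps(2)[of E i j "Suc (Suc n)"] by (simp only: FE)
  qed
qed

text \<open>Holds before any Serre relation is imposed. For \<open>k = i\<close> the coefficient of
  \<open>adp_F_left\<close> is zero at this exponent; for \<open>k = j\<close> the correction
  disappears after two commutators, or has coefficient \<open>a j i = 0\<close>.\<close>

lemma serre_commutes:
  assumes "a i i = 2" "i \<noteq> j" "a i j \<le> 0" "a i j = 0 \<longrightarrow> a j i = 0"
  shows "F k (adp E i j (nat (1 - a i j)) x) = adp E i j (nat (1 - a i j)) (F k x)"
proof -
  consider "k = i" | "k = j" "a i j = 0" | "k = j" "a i j < 0" | "k \<noteq> i" "k \<noteq> j" using assms(3) by linarith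
  then show ?thesis
  proof cases
    case 1
    have "of_int (a i j) + real (nat (1 - a i j)) - 1 = 0" using assms(3) by simp
    then show ?thesis unfolding 1 adp_F_left[OF assms(1,2)] by simp
  next
    case 2
    then show ?thesis using adp_F_right(1)[OF assms(2), of x] assms(4) by simp
  next
    case 3
    then have "nat (1 - a i j) = Suc (Suc (nat (- 1 - a i j)))" by simp
    then show ?thesis using adp_F_right(2)[OF assms(2)] 3 by metis
  next
    case 4
    then show ?thesis by (rule adp_F_other)
  qed
qed

end

locale km_module = pre_module a E F H
  for a :: "'i \<Rightarrow> 'i \<Rightarrow> int" and E F H :: "'i \<Rightarrow> 'v::real_vector \<Rightarrow> 'v" +
  fixes J :: "'i set" and S :: "'v set"
  assumes diag: "i \<in> J \<Longrightarrow> a i i = 2"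
    and nonpos: "i \<in> J \<Longrightarrow> j \<in> J \<Longrightarrow> i \<noteq> j \<Longrightarrow> a i j \<le> 0"
    and subS: "subspace S"
    and clE: "i \<in> J \<Longrightarrow> x \<in> S \<Longrightarrow> E i x \<in> S" and clF: "i \<in> J \<Longrightarrow> x \<in> S \<Longrightarrow> F i x \<in> S"
    and nilE: "i \<in> J \<Longrightarrow> x \<in> S \<Longrightarrow> nil (E i) x" and nilF: "i \<in> J \<Longrightarrow> x \<in> S \<Longrightarrow> nil (F i) x"
    and serreE: "i \<in> J \<Longrightarrow> j \<in> J \<Longrightarrow> i \<noteq> j \<Longrightarrow> x \<in> S \<Longrightarrow> adp E i j (nat (1 - a i j)) x = 0"
    and serreF: "i \<in> J \<Longrightarrow> j \<in> J \<Longrightarrow> i \<noteq> j \<Longrightarrow> x \<in> S \<Longrightarrow> adp F i j (nat (1 - a i j)) x = 0"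
begin

lemma sl2: "i \<in> J \<Longrightarrow> sl2_module S (E i) (F i) (H i)"
  using EF[of i i] HE[of i i] HF[of i i] diag[of i]
  by (intro sl2_module.intro) (auto simp: linE linF linH subS clE clF nilE nilF)

definition sr :: "'i \<Rightarrow> real \<Rightarrow> 'v \<Rightarrow> 'v" where "sr i e = sl2_module.sb (E i) (F i) e"

lemma sr_eq: "i \<in> J \<Longrightarrow> sr i e x = ex (- e) (E i) (ex e (F i) (ex (- e) (E i) x))"
  unfolding sr_def using sl2_module.sb_def[OF sl2] by metis

lemmas sr_closed = sl2_module.sb_closed[OF sl2, folded sr_def]
lemmas sr_add = sl2_module.sb_add[OF sl2, folded sr_def]
lemmas sr_scale = sl2_module.sb_scale[OF sl2, folded sr_def]
lemmas sr_inv = sl2_module.sb_inv[OF sl2, folded sr_def]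
lemmas sr_linear = sl2_module.linear_within_sb[OF sl2, folded sr_def]

lemma sr_minus: "i \<in> J \<Longrightarrow> x \<in> S \<Longrightarrow> sr i e (- x) = - sr i e x"
  using sr_scale[of i x e "- 1"] by simp

lemma adp_closed: "i \<in> J \<Longrightarrow> j \<in> J \<Longrightarrow> x \<in> S \<Longrightarrow> adp E i j n x \<in> S \<and> adp F i j n x \<in> S"
  by (induction n arbitrary: x) (auto intro: clE clF subspace_diff[OF subS])

lemma adp_swap: "adp E i j 1 x = - adp E j i 1 x" by simp

lemma linear_adpF: "linear (adp F i j n)" using pre_module.linear_adp[OF dual] .

lemma sr_commute:
  assumes "i \<in> J" "j \<in> J" "i \<noteq> j" "a j i = 0" "y \<in> S"
  shows "sr j e (E i y) = E i (sr j e y)" "sr j e (F i y) = F i (sr j e y)"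
proof -
  interpret Z: sl2_module S "E j" "F j" "H j" using sl2 assms by blast
  have e: "E j (E i y) = E i (E j y)" "F j (F i y) = F i (F j y)" if "y \<in> S" for y
    using serreE[OF assms(2,1) assms(3)[symmetric] that] serreF[OF assms(2,1) assms(3)[symmetric] that] assms(4) by auto
  have f: "F j (E i y) = E i (F j y)" "E j (F i y) = F i (E j y)" for y
    using EF[of i j y] EF[of j i y] assms(3) by auto
  show "sr j e (E i y) = E i (sr j e y)" "sr j e (F i y) = F i (sr j e y)"
    unfolding sr_def using Z.conj1[OF linE] Z.conj1[OF linF] e f assms(5) by blast+
qed

text \<open>The Serre relation ends the string of \<open>E i\<close> under commutators with
  \<open>E j\<close> after two members, so \<open>conj2\<close> applies. For the lowering operators
  the roles of top and bottom are exchanged, hence the other placement of signs.\<close>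

lemma sr_string1:
  assumes "i \<in> J" "j \<in> J" "i \<noteq> j" "a j i = -1" "y \<in> S"
  shows "sr j 1 (E i y) = - adp E j i 1 (sr j 1 y)" "sr j 1 (adp E j i 1 y) = E i (sr j 1 y)"
    "sr j 1 (F i y) = adp F j i 1 (sr j 1 y)" "sr j 1 (adp F j i 1 y) = - F i (sr j 1 y)"
proof -
  interpret Z: sl2_module S "E j" "F j" "H j" using sl2 assms by blast
  interpret D: pre_module a F E "\<lambda>i x. - H i x" by (rule dual)
  have dj: "a j j = 2" using diag assms by blast
  have e: "E j (adp E j i 1 y) = adp E j i 1 (E j y)" "F j (adp F j i 1 y) = adp F j i 1 (F j y)" if "y \<in> S" for y
    using serreE[OF assms(2,1) assms(3)[symmetric] that] serreF[OF assms(2,1) assms(3)[symmetric] that] assms(4)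
    by (auto simp: numeral_2_eq_2)
  have f: "F j (adp E j i 1 y) = adp E j i 1 (F j y) + E i y" "E j (adp F j i 1 y) = adp F j i 1 (E j y) + F i y" for y
    using adp_F_left[OF dj assms(3)[symmetric], of 1 y] D.adp_F_left[OF dj assms(3)[symmetric], of 1 y] assms(4) by auto
  have g: "F j (E i y) = E i (F j y)" "E j (F i y) = F i (E j y)" "E j (E i y) = E i (E j y) + adp E j i 1 y"
     "F j (F i y) = F i (F j y) + adp F j i 1 y" for y
    using EF[of i j y] EF[of j i y] assms(3) by auto
  have cl: "E i y \<in> S" "F i y \<in> S" "adp E j i 1 y \<in> S" "adp F j i 1 y \<in> S" if "y \<in> S" for y
    using that assms adp_closed clE clF by blast+
  have 1: "Z.sb 1 (E i y) = - adp E j i 1 (Z.sb 1 y) \<and> Z.sb 1 (adp E j i 1 y) = E i (Z.sb 1 y)"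
    using Z.conj2[of "E i" "adp E j i 1", OF linE linear_adp cl(1,3) g(3) e(1) f(1) g(1) assms(5)] by blast
  have 2: "Z.sb 1 (adp F j i 1 y) = - F i (Z.sb 1 y) \<and> Z.sb 1 (F i y) = adp F j i 1 (Z.sb 1 y)"
    using Z.conj2[of "adp F j i 1" "F i", OF linear_adpF linF cl(4,2) f(2) g(2) g(4) e(2) assms(5)] by blast
  show "sr j 1 (E i y) = - adp E j i 1 (sr j 1 y)" "sr j 1 (adp E j i 1 y) = E i (sr j 1 y)"
    "sr j 1 (F i y) = adp F j i 1 (sr j 1 y)" "sr j 1 (adp F j i 1 y) = - F i (sr j 1 y)"
    unfolding sr_def using 1 2 by blast+
qed

text \<open>For \<open>a j i = -2\<close> the string has three members. Its middle member is the
  weight zero operator of \<open>conj3\<close>, and the factor \<open>1/2\<close> on the far end is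
  the normalisation required there.\<close>

lemma sr_string2:
  assumes "i \<in> J" "j \<in> J" "i \<noteq> j" "a j i = -2" "y \<in> S"
  shows "sr j 1 (adp E j i 1 y) = - adp E j i 1 (sr j 1 y)" "sr j 1 (adp F j i 1 y) = - adp F j i 1 (sr j 1 y)"
proof -
  interpret Z: sl2_module S "E j" "F j" "H j" using sl2 assms by blast
  interpret D: pre_module a F E "\<lambda>i x. - H i x" by (rule dual)
  have dj: "a j j = 2" using diag assms by blast
  have e: "E j (adp E j i 2 y) = adp E j i 2 (E j y)" "F j (adp F j i 2 y) = adp F j i 2 (F j y)" if "y \<in> S" for y
    using serreE[OF assms(2,1) assms(3)[symmetric] that] serreF[OF assms(2,1) assms(3)[symmetric] that] assms(4)
    by (auto simp: numeral_3_eq_3 numeral_2_eq_2)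
  have f: "F j (adp E j i 1 y) = adp E j i 1 (F j y) + 2 *\<^sub>R E i y" "E j (adp F j i 1 y) = adp F j i 1 (E j y) + 2 *\<^sub>R F i y"
    "F j (adp E j i 2 y) = adp E j i 2 (F j y) + 2 *\<^sub>R adp E j i 1 y" "E j (adp F j i 2 y) = adp F j i 2 (E j y) + 2 *\<^sub>R adp F j i 1 y" for y
    using adp_F_left[OF dj assms(3)[symmetric], of 1 y] D.adp_F_left[OF dj assms(3)[symmetric], of 1 y]
      adp_F_left[OF dj assms(3)[symmetric], of 2 y] D.adp_F_left[OF dj assms(3)[symmetric], of 2 y] assms(4) by auto
  have g: "F j (E i y) = E i (F j y)" "E j (F i y) = F i (E j y)" "E j (E i y) = E i (E j y) + adp E j i 1 y"
     "F j (F i y) = F i (F j y) + adp F j i 1 y" for y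
    using EF[of i j y] EF[of j i y] assms(3) by auto
  have g2: "E j (adp E j i 1 y) = adp E j i 1 (E j y) + adp E j i 2 y" "F j (adp F j i 1 y) = adp F j i 1 (F j y) + adp F j i 2 y" for y
    by (simp_all add: numeral_2_eq_2)
  have cl: "E i y \<in> S" "F i y \<in> S" "adp E j i n y \<in> S" "adp F j i n y \<in> S" if "y \<in> S" for y n
    using that assms adp_closed clE clF by blast+
  have h: "linear (\<lambda>y. (1/2) *\<^sub>R adp E j i 2 y)" "linear (\<lambda>y. (1/2) *\<^sub>R adp F j i 2 y)"
    using linear_compose_scale_right[OF linear_adp] linear_compose_scale_right[OF linear_adpF] by auto
  have 1: "Z.sb 1 (adp E j i 1 y) = - adp E j i 1 (Z.sb 1 y)"
    by (rule Z.conj3[of "E i" "adp E j i 1" "\<lambda>y. (1/2) *\<^sub>R adp E j i 2 y"])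
      (use h assms(5) in \<open>auto simp only: linE linear_adp cl Z.S_simps g g2 e f linear_scale[OF linE] linear_scale[OF linF] scaleR_add_right scaleR_scaleR, auto\<close>)
  have 2: "Z.sb 1 (adp F j i 1 y) = - adp F j i 1 (Z.sb 1 y)"
    by (rule Z.conj3[of "\<lambda>y. (1/2) *\<^sub>R adp F j i 2 y" "adp F j i 1" "F i"])
      (use h assms(5) in \<open>auto simp only: linF linear_adpF cl Z.S_simps g g2 e f linear_scale[OF linE] linear_scale[OF linF] scaleR_add_right scaleR_scaleR, auto\<close>)
  show "sr j 1 (adp E j i 1 y) = - adp E j i 1 (sr j 1 y)" "sr j 1 (adp F j i 1 y) = - adp F j i 1 (sr j 1 y)"
    unfolding sr_def using 1 2 by blast+
qed

lemma sr_intertwine: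
  assumes ij: "i \<in> J" "j \<in> J" and T: "linear_within S T"
    and c: "\<And>y. y \<in> S \<Longrightarrow> T (E i y) = E j (T y)" "\<And>y. y \<in> S \<Longrightarrow> T (F i y) = F j (T y)" and x: "x \<in> S"
  shows "T (sr i e x) = sr j e (T x)"
proof -
  interpret Z: sl2_module S "E i" "F i" "H i" using sl2 assms by blast
  have 1: "T (ex t (E i) y) = ex t (E j) (T y)" if "y \<in> S" for t y
    by (rule ex_intertwine[where S = S]) (use that nilE ij linE subS clE T c in auto)
  have 2: "T (ex t (F i) y) = ex t (F j) (T y)" if "y \<in> S" for t y
    by (rule ex_intertwine[where S = S]) (use that nilF ij linF subS clF T c in auto)
  show ?thesis unfolding sr_eq[OF ij(1)] sr_eq[OF ij(2)] using 1 2 x Z.exE_closed Z.exF_closed by simp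
qed

lemma linear_within_comp: "linear_within S T \<Longrightarrow> linear_within S U \<Longrightarrow> (\<And>x. x \<in> S \<Longrightarrow> U x \<in> S) \<Longrightarrow> linear_within S (\<lambda>x. T (U x))"
  by (simp add: linear_within_def)

lemma braid2:
  assumes "i \<in> J" "j \<in> J" "i \<noteq> j" "a i j = 0" "x \<in> S"
  shows "sr i 1 (sr j 1 x) = sr j 1 (sr i 1 x)"
  using sr_intertwine[OF assms(2) assms(2) sr_linear[OF assms(1)]] sr_commute[OF assms(2,1)] assms by simp

text \<open>The product of two lifts carries \<open>E i\<close> and \<open>F i\<close> to
  \<open>E j\<close> and \<open>F j\<close>, hence the lift of \<open>i\<close> to the lift of
  \<open>j\<close>; this is the braid relation. All lengths are treated by this intertwining
  argument.\<close>

lemma braid3: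
  assumes "i \<in> J" "j \<in> J" "i \<noteq> j" "a i j = -1" "a j i = -1" "x \<in> S"
  shows "sr i 1 (sr j 1 (sr i 1 x)) = sr j 1 (sr i 1 (sr j 1 x))"
proof (rule sr_intertwine[of i j "\<lambda>x. sr i 1 (sr j 1 x)", OF assms(1,2)])
  show "linear_within S (\<lambda>x. sr i 1 (sr j 1 x))" using linear_within_comp sr_linear sr_closed assms by blast
  note c = adp_closed[of _ _ _ 1]
  show "sr i 1 (sr j 1 (E i y)) = E j (sr i 1 (sr j 1 y))" if "y \<in> S" for y
  proof -
    have "sr j 1 (E i y) = adp E i j 1 (sr j 1 y)" using sr_string1(1)[OF assms(1-3,5) that] adp_swap[of j i] by simp
    then show ?thesis using sr_string1(2)[OF assms(2,1) assms(3)[symmetric] assms(4)] sr_closed that assms by metis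
  qed
  show "sr i 1 (sr j 1 (F i y)) = F j (sr i 1 (sr j 1 y))" if "y \<in> S" for y
  proof -
    have "sr j 1 (F i y) = - adp F i j 1 (sr j 1 y)" using sr_string1(3)[OF assms(1-3,5) that] by simp
    then have "sr i 1 (sr j 1 (F i y)) = - sr i 1 (adp F i j 1 (sr j 1 y))"
      using sr_minus[OF assms(1)] c[OF assms(1,2)] sr_closed[OF assms(2) that] by metis
    also have "\<dots> = F j (sr i 1 (sr j 1 y))"
      unfolding sr_string1(4)[OF assms(2,1) assms(3)[symmetric] assms(4) sr_closed[OF assms(2) that]] by simp
    finally show ?thesis .
  qed
qed (rule assms)

text \<open>Here the product of three lifts commutes with \<open>E j\<close> and \<open>F j\<close>,
  hence with the lift of \<open>j\<close>.\<close>

lemma braid4: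
  assumes "i \<in> J" "j \<in> J" "i \<noteq> j" "a i j = -1" "a j i = -2" "x \<in> S"
  shows "sr i 1 (sr j 1 (sr i 1 (sr j 1 x))) = sr j 1 (sr i 1 (sr j 1 (sr i 1 x)))"
proof (rule sr_intertwine[of j j "\<lambda>x. sr i 1 (sr j 1 (sr i 1 x))", OF assms(2,2)])
  show "linear_within S (\<lambda>x. sr i 1 (sr j 1 (sr i 1 x)))"
    by (rule linear_within_comp[OF sr_linear[OF assms(1)] linear_within_comp[OF sr_linear[OF assms(2)] sr_linear[OF assms(1)] sr_closed[OF assms(1)]]])
      (auto intro: sr_closed assms)
  fix y assume y: "y \<in> S"
  note ij = assms(1-3) and ji = assms(2,1) assms(3)[symmetric]
  define y1 where "y1 = sr i 1 y"
  define y2 where "y2 = sr j 1 y1"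
  have yS: "y1 \<in> S" "y2 \<in> S" using sr_closed y assms by (auto simp: y1_def y2_def)
  note c = adp_closed[OF assms(2,1), of _ 1] adp_closed[OF assms(1,2), of _ 1]
  have "sr i 1 (E j y) = adp E j i 1 y1" using sr_string1(1)[OF ji assms(4) y] by (simp add: y1_def)
  then have "sr j 1 (sr i 1 (E j y)) = - adp E j i 1 y2" using sr_string2(1)[OF ij assms(5) yS(1)] by (simp add: y2_def)
  also have "\<dots> = adp E i j 1 y2" by simp
  finally show "sr i 1 (sr j 1 (sr i 1 (E j y))) = E j (sr i 1 (sr j 1 (sr i 1 y)))"
    using sr_string1(2)[OF ji assms(4) yS(2)] by (simp only: y1_def y2_def)
  have "sr i 1 (F j y) = - adp F j i 1 y1" using sr_string1(3)[OF ji assms(4) y] by (simp add: y1_def)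
  then have "sr j 1 (sr i 1 (F j y)) = - sr j 1 (adp F j i 1 y1)" using sr_minus[OF assms(2)] c yS by metis
  also have "\<dots> = adp F j i 1 y2" using sr_string2(2)[OF ij assms(5) yS(1)] by (simp add: y2_def)
  also have "\<dots> = - adp F i j 1 y2" by simp
  finally have "sr i 1 (sr j 1 (sr i 1 (F j y))) = - sr i 1 (adp F i j 1 y2)" using sr_minus[OF assms(1)] c yS by metis
  then show "sr i 1 (sr j 1 (sr i 1 (F j y))) = F j (sr i 1 (sr j 1 (sr i 1 y)))"
    using sr_string1(4)[OF ji assms(4) yS(2)] by (simp add: y1_def y2_def)
qed (rule assms)

text \<open>\<open>K\<close> is \<open>H i\<close> corrected so as to commute with
  \<open>E j\<close> and \<open>F j\<close>, hence with the lift, while \<open>H j\<close> changes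
  sign under it.\<close>

lemma sr_weight:
  assumes j: "j \<in> J" and x: "x \<in> S" and w: "H i x = \<mu> *\<^sub>R x" "H j x = \<nu> *\<^sub>R x"
  shows "H i (sr j 1 x) = (\<mu> - of_int (a i j) * \<nu>) *\<^sub>R sr j 1 x"
proof -
  interpret Z: sl2_module S "E j" "F j" "H j" using sl2 j by blast
  have dj: "a j j = 2" using diag j by blast
  define K where "K = (\<lambda>x. H i x - (of_int (a i j) / 2) *\<^sub>R H j x)"
  have K: "linear K" unfolding K_def using linear_compose_sub[OF linH linear_compose_scale_right[OF linH]] .
  have "sr j 1 (K x) = K (sr j 1 x)" unfolding sr_def
    by (rule Z.conj1[OF K])
      (auto simp: K_def HE HF linear_diff[OF linE] linear_diff[OF linF] linear_scale[OF linE] linear_scale[OF linF] dj x algebra_simps)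
  moreover have "K x = (\<mu> - of_int (a i j) / 2 * \<nu>) *\<^sub>R x" unfolding K_def w by (simp add: scaleR_diff_left)
  ultimately have "K (sr j 1 x) = (\<mu> - of_int (a i j) / 2 * \<nu>) *\<^sub>R sr j 1 x" using sr_scale[OF j x] by simp
  moreover have "H j (sr j 1 x) = - \<nu> *\<^sub>R sr j 1 x"
    using Z.sb_H[OF x] Z.sb_scale[OF x, of 1 \<nu>] w(2) unfolding sr_def by (metis add.inverse_inverse scaleR_minus_left)
  ultimately have "H i (sr j 1 x) = (\<mu> - of_int (a i j) / 2 * \<nu>) *\<^sub>R sr j 1 x + (of_int (a i j) / 2) *\<^sub>R (- \<nu> *\<^sub>R sr j 1 x)"
    unfolding K_def by (metis diff_add_cancel)
  also have "\<dots> = (\<mu> - of_int (a i j) * \<nu>) *\<^sub>R sr j 1 x"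
    unfolding scaleR_scaleR scaleR_add_left[symmetric] by (rule arg_cong2[where f = scaleR]) (simp_all add: field_simps)
  finally show ?thesis .
qed

end

subsection \<open>Functions on words\<close>

text \<open>A function on words stands for a section of the line bundle of weight \<open>l\<close> on the flag variety, through the values
  at a base point of its images under products of raising operators. The raising operators \<open>wE\<close> then do not depend on
  \<open>l\<close>, the lowering operators \<open>wF\<close> are forced by the commutation relations, and the product of sections becomes the
  shuffle product \<open>sh\<close>.\<close>

typedef 'i wf = "UNIV :: ('i list \<Rightarrow> real) set" morphisms ev Wf by simp

lemma ev_Wf [simp]: "ev (Wf f) = f" by (simp add: Wf_inverse)

lemma wf_eqI: "(\<And>w. ev x w = ev y w) \<Longrightarrow> x = y"
  by (metis ev_inject ext)

instantiation wf :: (type) real_vector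
begin
definition "0 = Wf (\<lambda>_. 0)"
definition "x + y = Wf (\<lambda>w. ev x w + ev y w)"
definition "- x = Wf (\<lambda>w. - ev x w)"
definition "x - y = Wf (\<lambda>w. ev x w - ev y w)"
definition "c *\<^sub>R x = Wf (\<lambda>w. c * ev x w)"
instance
  by standard (auto intro!: wf_eqI simp: zero_wf_def plus_wf_def uminus_wf_def minus_wf_def scaleR_wf_def algebra_simps)
end

lemma ev_simps [simp]: "ev 0 w = 0" "ev (x + y) w = ev x w + ev y w" "ev (- x) w = - ev x w"
  "ev (x - y) w = ev x w - ev y w" "ev (c *\<^sub>R x) w = c * ev x w"
  by (simp_all add: zero_wf_def plus_wf_def uminus_wf_def minus_wf_def scaleR_wf_def)

definition wE :: "'i \<Rightarrow> 'i wf \<Rightarrow> 'i wf" where "wE j x = Wf (\<lambda>w. ev x (j # w))"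

text \<open>Raising by the letters of \<open>w\<close> brings the coefficient at \<open>w\<close> to
  the base point, where the weight is \<open>l\<close>. So this coefficient has weight
  \<open>l\<close> minus the roots of the letters.\<close>

definition wc :: "('i \<Rightarrow> 'i \<Rightarrow> int) \<Rightarrow> ('i \<Rightarrow> real) \<Rightarrow> 'i \<Rightarrow> 'i list \<Rightarrow> real" where
  "wc a l i w = l i - (\<Sum>m\<leftarrow>w. of_int (a i m))"

definition wH :: "('i \<Rightarrow> 'i \<Rightarrow> int) \<Rightarrow> ('i \<Rightarrow> real) \<Rightarrow> 'i \<Rightarrow> 'i wf \<Rightarrow> 'i wf" where
  "wH a l i x = Wf (\<lambda>w. wc a l i w * ev x w)"

text \<open>The second clause is the commutator of the raising operator \<open>j\<close> with the
  lowering operator \<open>i\<close>, evaluated at \<open>w\<close>; the value 0 at the empty word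
  says that lowered sections vanish at the base point.\<close>

primrec wFv :: "('i \<Rightarrow> 'i \<Rightarrow> int) \<Rightarrow> ('i \<Rightarrow> real) \<Rightarrow> 'i \<Rightarrow> 'i list \<Rightarrow> 'i wf \<Rightarrow> real" where
  "wFv a l i [] = (\<lambda>x. 0)"
| "wFv a l i (j # w) = (\<lambda>x. wFv a l i w (wE j x) + (if i = j then ev (wH a l i x) w else 0))"

definition wF :: "('i \<Rightarrow> 'i \<Rightarrow> int) \<Rightarrow> ('i \<Rightarrow> real) \<Rightarrow> 'i \<Rightarrow> 'i wf \<Rightarrow> 'i wf" where
  "wF a l i x = Wf (\<lambda>w. wFv a l i w x)"

text \<open>The recursion is the Leibniz rule, so every \<open>wE j\<close> is a derivation of
  \<open>sh\<close> by construction.\<close>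

primrec shv :: "'i list \<Rightarrow> 'i wf \<Rightarrow> 'i wf \<Rightarrow> real" where
  "shv [] = (\<lambda>x y. ev x [] * ev y [])"
| "shv (j # w) = (\<lambda>x y. shv w (wE j x) y + shv w x (wE j y))"

definition sh :: "'i wf \<Rightarrow> 'i wf \<Rightarrow> 'i wf" where "sh x y = Wf (\<lambda>w. shv w x y)"

primrec wEs :: "'i list \<Rightarrow> 'i wf \<Rightarrow> 'i wf" where
  "wEs [] = (\<lambda>x. x)"
| "wEs (j # u) = (\<lambda>x. wEs u (wE j x))"

definition wd :: "'i wf" where "wd = Wf (\<lambda>w. if w = [] then 1 else 0)"

lemma ev_wE [simp]: "ev (wE j x) w = ev x (j # w)" by (simp add: wE_def)
lemma ev_wH: "ev (wH a l i x) w = wc a l i w * ev x w" by (simp add: wH_def)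
lemma ev_wF_Nil [simp]: "ev (wF a l i x) [] = 0" by (simp add: wF_def)
lemma ev_wF_Cons [simp]: "ev (wF a l i x) (j # w) = ev (wF a l i (wE j x)) w + (if i = j then ev (wH a l i x) w else 0)"
  by (simp add: wF_def)
lemma ev_sh_Nil [simp]: "ev (sh x y) [] = ev x [] * ev y []" by (simp add: sh_def)
lemma ev_sh_Cons [simp]: "ev (sh x y) (j # w) = ev (sh (wE j x) y) w + ev (sh x (wE j y)) w" by (simp add: sh_def)
lemma ev_wEs [simp]: "ev (wEs u x) w = ev x (u @ w)" by (induction u arbitrary: x) auto
lemma wc_Nil [simp]: "wc a l i [] = l i" by (simp add: wc_def)
lemma wc_Cons [simp]: "wc a l i (j # w) = wc a l i w - of_int (a i j)" by (simp add: wc_def)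
lemma linear_wE: "linear (wE j)" by (intro linearI) (auto intro: wf_eqI)
lemma linear_wH: "linear (wH a l i)" by (intro linearI) (auto intro!: wf_eqI simp: ev_wH algebra_simps)
lemma linear_wEs: "linear (wEs u)" by (intro linearI) (auto intro: wf_eqI)

lemmas wE_simps [simp] = linear_add[OF linear_wE] linear_scale[OF linear_wE] linear_0[OF linear_wE] linear_diff[OF linear_wE] linear_neg[OF linear_wE]
lemmas wH_simps [simp] = linear_add[OF linear_wH] linear_scale[OF linear_wH] linear_0[OF linear_wH] linear_diff[OF linear_wH] linear_neg[OF linear_wH]
lemmas wEs_simps [simp] = linear_add[OF linear_wEs] linear_scale[OF linear_wEs] linear_0[OF linear_wEs] linear_diff[OF linear_wEs]

lemma linear_wF: "linear (wF a l i)"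
proof (rule linearI)
  show "wF a l i (x + y) = wF a l i x + wF a l i y" for x y
  proof (rule wf_eqI)
    fix w show "ev (wF a l i (x + y)) w = ev (wF a l i x + wF a l i y) w"
      by (induction w arbitrary: x y) (auto simp: algebra_simps)
  qed
  show "wF a l i (c *\<^sub>R x) = c *\<^sub>R wF a l i x" for c x
  proof (rule wf_eqI)
    fix w show "ev (wF a l i (c *\<^sub>R x)) w = ev (c *\<^sub>R wF a l i x) w"
      by (induction w arbitrary: x) (auto simp: algebra_simps)
  qed
qed

lemmas wF_simps [simp] = linear_add[OF linear_wF] linear_scale[OF linear_wF] linear_0[OF linear_wF] linear_diff[OF linear_wF] linear_neg[OF linear_wF]

lemma sh_add_left: "sh (x + y) z = sh x z + sh y z"
proof (rule wf_eqI)
  fix w show "ev (sh (x + y) z) w = ev (sh x z + sh y z) w" by (induction w arbitrary: x y z) (auto simp: algebra_simps)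
qed
lemma sh_add_right: "sh z (x + y) = sh z x + sh z y"
proof (rule wf_eqI)
  fix w show "ev (sh z (x + y)) w = ev (sh z x + sh z y) w" by (induction w arbitrary: x y z) (auto simp: algebra_simps)
qed
lemma sh_scale_left: "sh (c *\<^sub>R x) z = c *\<^sub>R sh x z"
proof (rule wf_eqI)
  fix w show "ev (sh (c *\<^sub>R x) z) w = ev (c *\<^sub>R sh x z) w" by (induction w arbitrary: x z) (auto simp: algebra_simps)
qed
lemma sh_scale_right: "sh z (c *\<^sub>R x) = c *\<^sub>R sh z x"
proof (rule wf_eqI)
  fix w show "ev (sh z (c *\<^sub>R x)) w = ev (c *\<^sub>R sh z x) w" by (induction w arbitrary: x z) (auto simp: algebra_simps)
qed
lemma sh_0 [simp]: "sh 0 z = 0" "sh z 0 = 0" using sh_scale_left[of 0] sh_scale_right[of _ 0] by (metis scaleR_zero_left)+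
lemma sh_minus: "sh (- x) z = - sh x z" "sh z (- x) = - sh z x"
  using sh_scale_left[of "- 1" x z] sh_scale_right[of z "- 1" x] by simp_all
lemma sh_diff: "sh (x - y) z = sh x z - sh y z" "sh z (x - y) = sh z x - sh z y"
  using sh_add_left[of x "- y" z] sh_add_right[of z x "- y"] by (simp_all add: sh_minus)
lemmas sh_simps = sh_add_left sh_add_right sh_scale_left sh_scale_right sh_minus sh_diff

lemma wE_sh: "wE j (sh x y) = sh (wE j x) y + sh x (wE j y)" by (rule wf_eqI) simp

lemma wE_wH: "wE k (wH a l i x) = wH a l i (wE k x) - of_int (a i k) *\<^sub>R wE k x"
  by (rule wf_eqI) (simp add: ev_wH algebra_simps)

lemma wH_sh: "wH a (\<lambda>i. l i + m i) i (sh x y) = sh (wH a l i x) y + sh x (wH a m i y)"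
proof (rule wf_eqI)
  fix w show "ev (wH a (\<lambda>i. l i + m i) i (sh x y)) w = ev (sh (wH a l i x) y + sh x (wH a m i y)) w"
  proof (induction w arbitrary: x y)
    case Nil
    then show ?case by (simp add: ev_wH algebra_simps)
  next
    case (Cons k w)
    have "ev (wH a (\<lambda>i. l i + m i) i (sh x y)) (k # w) = ev (wH a (\<lambda>i. l i + m i) i (sh (wE k x) y)) w + ev (wH a (\<lambda>i. l i + m i) i (sh x (wE k y))) w
      - of_int (a i k) * (ev (sh (wE k x) y) w + ev (sh x (wE k y)) w)" by (simp add: ev_wH algebra_simps)
    then show ?case unfolding Cons by (simp add: wE_wH sh_simps algebra_simps)
  qed
qed

lemma wF_sh: "wF a (\<lambda>i. l i + m i) i (sh x y) = sh (wF a l i x) y + sh x (wF a m i y)"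
proof (rule wf_eqI)
  have c: "wE k (wF a l i x) = wF a l i (wE k x) + (if i = k then wH a l i x else 0)" for k l x by (rule wf_eqI) simp
  fix w show "ev (wF a (\<lambda>i. l i + m i) i (sh x y)) w = ev (sh (wF a l i x) y + sh x (wF a m i y)) w"
  proof (induction w arbitrary: x y)
    case (Cons k w)
    have "ev (wF a (\<lambda>i. l i + m i) i (sh x y)) (k # w) = ev (wF a (\<lambda>i. l i + m i) i (sh (wE k x) y)) w
      + ev (wF a (\<lambda>i. l i + m i) i (sh x (wE k y))) w + (if i = k then ev (wH a (\<lambda>i. l i + m i) i (sh x y)) w else 0)"
      by (simp add: wE_sh)
    then show ?case unfolding Cons by (simp add: c wH_sh sh_simps)
  qed simp
qed

lemma wf_module: "pre_module a wE (wF a l) (wH a l)"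
proof (rule pre_module.intro)
  show EF: "wE i (wF a l j x) = wF a l j (wE i x) + (if i = j then wH a l i x else 0)" for i j x by (rule wf_eqI) auto
  show "wH a l i (wE j x) = wE j (wH a l i x) + of_int (a i j) *\<^sub>R wE j x" for i j x by (simp add: wE_wH)
  show "wH a l i (wF a l j x) = wF a l j (wH a l i x) - of_int (a i j) *\<^sub>R wF a l j x" for i j x
  proof (rule wf_eqI)
    fix w show "ev (wH a l i (wF a l j x)) w = ev (wF a l j (wH a l i x) - of_int (a i j) *\<^sub>R wF a l j x) w"
    proof (induction w arbitrary: x)
      case (Cons k w)
      have "ev (wH a l i (wF a l j x)) (k # w) = ev (wH a l i (wF a l j (wE k x))) w - of_int (a i k) * ev (wF a l j (wE k x)) w
        + (if j = k then (wc a l i w - of_int (a i k)) * ev (wH a l j x) w else 0)" by (simp add: ev_wH algebra_simps)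
      then show ?case unfolding Cons by (cases "j = k") (simp_all add: wE_wH ev_wH algebra_simps)
    qed (simp add: ev_wH)
  qed
qed (rule linear_wE linear_wF linear_wH)+

lemma shv_support: "shv w x y \<noteq> 0 \<Longrightarrow> \<exists>u v. ev x u \<noteq> 0 \<and> ev y v \<noteq> 0 \<and> length u + length v = length w \<and> set u \<union> set v = set w"
proof (induction w arbitrary: x y)
  case Nil
  then show ?case by (intro exI[of _ "[]"]) auto
next
  case (Cons j w)
  then have "shv w (wE j x) y \<noteq> 0 \<or> shv w x (wE j y) \<noteq> 0" by auto
  then show ?case
  proof
    assume "shv w (wE j x) y \<noteq> 0"
    from Cons.IH[OF this] obtain u v where "ev x (j # u) \<noteq> 0" "ev y v \<noteq> 0" "length u + length v = length w" "set u \<union> set v = set w" by auto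
    then show ?thesis by (intro exI[of _ "j # u"] exI[of _ v]) auto
  next
    assume "shv w x (wE j y) \<noteq> 0"
    from Cons.IH[OF this] obtain u v where "ev x u \<noteq> 0" "ev y (j # v) \<noteq> 0" "length u + length v = length w" "set u \<union> set v = set w" by auto
    then show ?thesis by (rule_tac x = u in exI, rule_tac x = "j # v" in exI) auto
  qed
qed

lemma wFv_support: "wFv a l i w x \<noteq> 0 \<Longrightarrow> \<exists>u. ev x u \<noteq> 0 \<and> Suc (length u) = length w \<and> set w \<subseteq> insert i (set u)"
proof (induction w arbitrary: x)
  case (Cons j w)
  then have "wFv a l i w (wE j x) \<noteq> 0 \<or> (i = j \<and> ev (wH a l i x) w \<noteq> 0)" by (auto split: if_splits)
  then show ?case
  proof
    assume "wFv a l i w (wE j x) \<noteq> 0"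
    from Cons.IH[OF this] obtain u where "ev x (j # u) \<noteq> 0" "Suc (length u) = length w" "set w \<subseteq> insert i (set u)" by auto
    then show ?thesis by (intro exI[of _ "j # u"]) auto
  next
    assume "i = j \<and> ev (wH a l i x) w \<noteq> 0"
    then show ?thesis by (intro exI[of _ w]) (auto simp: ev_wH)
  qed
qed simp

lemma wE_wd [simp]: "wE j wd = 0" by (rule wf_eqI) (simp add: wd_def)
lemma wH_wd: "wH a l i wd = l i *\<^sub>R wd" by (rule wf_eqI) (simp add: wd_def ev_wH)
lemma wd_nonzero: "wd \<noteq> 0"
proof
  assume "(wd :: 'a wf) = 0"
  then have "ev (wd :: 'a wf) [] = 0" by simp
  then show False by (simp add: wd_def)
qed

text \<open>The vector \<open>y (Suc n)\<close> is killed by all raising operators and vanishes at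
  the empty word. Such a function is zero: the model has no spurious singular vectors.\<close>

lemma nil_wF_wd:
  assumes "a i i = 2" "l i = real n"
  shows "nil (wF a l i) wd"
proof -
  interpret pre_module a wE "wF a l" "wH a l" by (rule wf_module)
  define y where "y = (\<lambda>m. (wF a l i ^^ m) wd)"
  have y: "y (Suc m) = wF a l i (y m)" "y 0 = wd" for m by (simp_all add: y_def)
  have h: "wH a l i (y m) = (l i - 2 * real m) *\<^sub>R y m" for m
  proof (induction m)
    case (Suc m)
    have "wH a l i (y (Suc m)) = wF a l i (wH a l i (y m)) - 2 *\<^sub>R wF a l i (y m)" by (simp add: y HF assms)
    then show ?case unfolding Suc by (simp add: y algebra_simps)
  qed (simp add: y wH_wd)
  have e: "wE i (y (Suc m)) = (real (Suc m) * (l i - real m)) *\<^sub>R y m" for m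
  proof (induction m)
    case 0
    then show ?case by (simp add: y EF wH_wd)
  next
    case (Suc m)
    have "wE i (y (Suc (Suc m))) = wF a l i (wE i (y (Suc m))) + wH a l i (y (Suc m))" by (simp add: y EF)
    also have "\<dots> = (real (Suc m) * (l i - real m) + (l i - 2 * real (Suc m))) *\<^sub>R y (Suc m)"
      unfolding Suc h by (simp add: y scaleR_add_left)
    also have "real (Suc m) * (l i - real m) + (l i - 2 * real (Suc m)) = real (Suc (Suc m)) * (l i - real (Suc m))"
      by (simp add: algebra_simps)
    finally show ?case .
  qed
  have o: "wE k (y m) = 0" if "k \<noteq> i" for k m using that by (induction m) (auto simp: y EF)
  have "y (Suc n) = 0"
  proof (rule wf_eqI)
    fix w
    show "ev (y (Suc n)) w = ev 0 w"
    proof (cases w)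
      case Nil
      then show ?thesis by (simp add: y)
    next
      case (Cons k u)
      have "wE k (y (Suc n)) = 0" using e[of n] o[of k] assms(2) by (cases "k = i") auto
      then show ?thesis using Cons by (metis ev_simps(1) ev_wE)
    qed
  qed
  then show ?thesis unfolding nil_def y_def by blast
qed

lemma nil_sh:
  assumes D: "linear D1" "linear D2" "linear D3" "\<And>x y. D3 (sh x y) = sh (D1 x) y + sh x (D2 y)"
  shows "nil D1 x \<Longrightarrow> nil D2 y \<Longrightarrow> nil D3 (sh x y)"
proof -
  have "(D1 ^^ n) x = 0 \<Longrightarrow> (D2 ^^ m) y = 0 \<Longrightarrow> nil D3 (sh x y)" for n m
  proof (induction "n + m" arbitrary: n m x y rule: less_induct)
    case less
    show ?case
    proof (cases "n = 0 \<or> m = 0")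
      case True
      then show ?thesis using less.prems nil_0 by auto
    next
      case False
      then obtain n' m' where nm: "n = Suc n'" "m = Suc m'" by (meson not0_implies_Suc)
      have "(D1 ^^ n') (D1 x) = 0" "(D2 ^^ m') (D2 y) = 0" using less.prems unfolding nm by (simp_all add: funpow_swap1)
      then have "nil D3 (sh (D1 x) y)" "nil D3 (sh x (D2 y))" using less.hyps[of n' m] less.hyps[of n m'] less.prems nm by auto
      then show ?thesis using nil_step nil_add[OF D(3)] D(4) by metis
    qed
  qed
  then show "nil D1 x \<Longrightarrow> nil D2 y \<Longrightarrow> nil D3 (sh x y)" unfolding nil_def by blast
qed

lemma adp_sh:
  assumes "\<And>i. linear (E i)" "\<And>i x y. E i (sh x y) = sh (E i x) y + sh x (E i y)"
  shows "adp E i j n (sh x y) = sh (adp E i j n x) y + sh x (adp E i j n y)"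
proof -
  have l: "linear (adp E i j n)" for n
  proof (induction n)
    case (Suc n)
    have "linear (\<lambda>x. E i (adp E i j n x))" "linear (\<lambda>x. adp E i j n (E i x))"
      using linear_compose[OF Suc assms(1)] linear_compose[OF assms(1) Suc] by (simp_all add: comp_def)
    then show ?case by (simp add: linear_compose_sub)
  qed (simp add: assms)
  show ?thesis
    by (induction n arbitrary: x y) (simp_all add: assms linear_add[OF assms(1)] linear_add[OF l] sh_simps algebra_simps)
qed

lemma ex_sh:
  assumes D: "linear D1" "linear D2" "linear D3" "\<And>x y. D3 (sh x y) = sh (D1 x) y + sh x (D2 y)" and n: "nil D1 x" "nil D2 y"
  shows "ex t D3 (sh x y) = sh (ex t D1 x) (ex t D2 y)"
proof -
  obtain N M where N: "(D1 ^^ N) x = 0" and M: "(D2 ^^ M) y = 0" using n by (auto simp: nil_def)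
  have sl: "sh (\<Sum>k\<in>A. f k) z = (\<Sum>k\<in>A. sh (f k) z)" and sr: "sh z (\<Sum>k\<in>A. f k) = (\<Sum>k\<in>A. sh z (f k))"
    if "finite A" for A and f :: "nat \<Rightarrow> 'a wf" and z using that by (induction A) (auto simp: sh_simps)
  define u where "u = (\<lambda>k l. (t ^ k / fact k * (t ^ l / fact l)) *\<^sub>R sh ((D1 ^^ k) x) ((D2 ^^ l) y))"
  have "t *\<^sub>R D3 (u k l) = real (Suc k) *\<^sub>R u (Suc k) l + real (Suc l) *\<^sub>R u k (Suc l)" for k l
  proof -
    have "t *\<^sub>R D3 (u k l) = (t * (t ^ k / fact k * (t ^ l / fact l))) *\<^sub>R sh ((D1 ^^ Suc k) x) ((D2 ^^ l) y)
      + (t * (t ^ k / fact k * (t ^ l / fact l))) *\<^sub>R sh ((D1 ^^ k) x) ((D2 ^^ Suc l) y)"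
      unfolding u_def by (simp add: linear_scale[OF D(3)] D(4) scaleR_add_right)
    also have "(t * (t ^ k / fact k * (t ^ l / fact l))) *\<^sub>R sh ((D1 ^^ Suc k) x) ((D2 ^^ l) y) = real (Suc k) *\<^sub>R u (Suc k) l"
      unfolding u_def scaleR_scaleR by (rule arg_cong2[where f = scaleR]) (simp_all add: field_simps del: of_nat_Suc)
    also have "(t * (t ^ k / fact k * (t ^ l / fact l))) *\<^sub>R sh ((D1 ^^ k) x) ((D2 ^^ Suc l) y) = real (Suc l) *\<^sub>R u k (Suc l)"
      unfolding u_def scaleR_scaleR by (rule arg_cong2[where f = scaleR]) (simp_all add: field_simps del: of_nat_Suc)
    finally show ?thesis .
  qed
  then have "ex t D3 (u 0 0) = (\<Sum>k<N. \<Sum>l<M. u k l)"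
    by (rule ex_array[OF D(3)])
      (auto simp: u_def funpow_zero_mono[OF D(1) N] funpow_zero_mono[OF D(2) M] nil_sh[OF D n])
  then show ?thesis unfolding ex_sum[OF D(1) N] ex_sum[OF D(2) M] u_def
    by (simp add: sl sr sh_simps scaleR_sum_right, subst sum.swap, simp add: mult.commute)
qed

locale cartan_letters =
  fixes a :: "'i \<Rightarrow> 'i \<Rightarrow> int" and J :: "'i set"
  assumes aJ_diag: "i \<in> J \<Longrightarrow> a i i = 2"
    and aJ_nonpos: "i \<in> J \<Longrightarrow> j \<in> J \<Longrightarrow> i \<noteq> j \<Longrightarrow> a i j \<le> 0"
    and aJ_zero: "i \<in> J \<Longrightarrow> j \<in> J \<Longrightarrow> a i j = 0 \<longleftrightarrow> a j i = 0"
begin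

text \<open>The bound on word lengths gives nilpotency of the raising operators, and the letters are
  confined to \<open>J\<close> because only those are subject to the remaining conditions.\<close>

definition good :: "('i \<Rightarrow> real) \<Rightarrow> 'i wf \<Rightarrow> bool" where
  "good l x \<longleftrightarrow> (\<exists>N. \<forall>w. ev x w \<noteq> 0 \<longrightarrow> length w < N) \<and> (\<forall>w. ev x w \<noteq> 0 \<longrightarrow> set w \<subseteq> J) \<and>
     (\<forall>i\<in>J. nil (wF a l i) x) \<and> (\<forall>i\<in>J. \<forall>j\<in>J. i \<noteq> j \<longrightarrow> adp wE i j (nat (1 - a i j)) x = 0)"

lemma goodI:
  assumes "\<And>w. ev x w \<noteq> 0 \<Longrightarrow> length w < N" "\<And>w. ev x w \<noteq> 0 \<Longrightarrow> set w \<subseteq> J" "\<And>i. i \<in> J \<Longrightarrow> nil (wF a l i) x"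
    "\<And>i j. i \<in> J \<Longrightarrow> j \<in> J \<Longrightarrow> i \<noteq> j \<Longrightarrow> adp wE i j (nat (1 - a i j)) x = 0"
  shows "good l x"
  unfolding good_def using assms by (intro conjI exI[of _ N]) simp_all

lemma goodD:
  assumes "good l x"
  shows "\<exists>N. \<forall>w. ev x w \<noteq> 0 \<longrightarrow> length w < N" "ev x w \<noteq> 0 \<Longrightarrow> set w \<subseteq> J" "i \<in> J \<Longrightarrow> nil (wF a l i) x"
    "i \<in> J \<Longrightarrow> j \<in> J \<Longrightarrow> i \<noteq> j \<Longrightarrow> adp wE i j (nat (1 - a i j)) x = 0"
  using assms unfolding good_def by simp_all

text \<open>The integrable functions: the largest set of good functions that is stable under the operators \<open>wE j\<close>.\<close>

definition Q :: "('i \<Rightarrow> real) \<Rightarrow> 'i wf set" where "Q l = {x. \<forall>u. good l (wEs u x)}"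

lemma linear_adpE: "linear (adp wE i j n)" using pre_module.linear_adp[OF wf_module] .

lemma good_0: "good l 0"
  using nil_0 linear_0[OF linear_adpE] by (auto simp: good_def)

lemma good_add: assumes "good l x" "good l y" shows "good l (x + y)"
proof -
  obtain N where N0: "\<forall>w. ev x w \<noteq> 0 \<longrightarrow> length w < N" using goodD(1)[OF assms(1)] by (rule exE)
  note N = N0[rule_format]
  obtain M where M0: "\<forall>w. ev y w \<noteq> 0 \<longrightarrow> length w < M" using goodD(1)[OF assms(2)] by (rule exE)
  note M = M0[rule_format]
  have c: "ev x w \<noteq> 0 \<or> ev y w \<noteq> 0" if "ev (x + y) w \<noteq> 0" for w using that by auto
  show ?thesis
  proof (rule goodI)
    show "length w < N + M" if "ev (x + y) w \<noteq> 0" for w using c[OF that] N[of w] M[of w] by (cases "ev x w = 0") auto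
    show "set w \<subseteq> J" if "ev (x + y) w \<noteq> 0" for w using c[OF that] goodD(2)[OF assms(1), of w] goodD(2)[OF assms(2), of w] by (cases "ev x w = 0") auto
    show "nil (wF a l i) (x + y)" if "i \<in> J" for i using nil_add[OF linear_wF goodD(3)[OF assms(1) that] goodD(3)[OF assms(2) that]] .
    show "adp wE i j (nat (1 - a i j)) (x + y) = 0" if "i \<in> J" "j \<in> J" "i \<noteq> j" for i j
      unfolding linear_add[OF linear_adpE] goodD(4)[OF assms(1) that] goodD(4)[OF assms(2) that] by simp
  qed
qed

lemma good_scale: assumes "good l x" shows "good l (c *\<^sub>R x)"
proof -
  obtain N where N0: "\<forall>w. ev x w \<noteq> 0 \<longrightarrow> length w < N" using goodD(1)[OF assms] by (rule exE)
  note N = N0[rule_format]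
  show ?thesis
  proof (rule goodI)
    show "nil (wF a l i) (c *\<^sub>R x)" if "i \<in> J" for i using nil_scale[OF linear_wF goodD(3)[OF assms that]] .
    show "adp wE i j (nat (1 - a i j)) (c *\<^sub>R x) = 0" if "i \<in> J" "j \<in> J" "i \<noteq> j" for i j
      unfolding linear_scale[OF linear_adpE] goodD(4)[OF assms that] by simp
  qed (use N goodD(2)[OF assms] in auto)
qed

lemma good_wH: assumes "good l x" shows "good l (wH a l k x)"
proof -
  interpret pre_module a wE "wF a l" "wH a l" by (rule wf_module)
  obtain N where N0: "\<forall>w. ev x w \<noteq> 0 \<longrightarrow> length w < N" using goodD(1)[OF assms] by (rule exE)
  note N = N0[rule_format]
  show ?thesis
  proof (rule goodI)
    show "nil (wF a l i) (wH a l k x)" if i: "i \<in> J" for i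
      by (rule nil_commutator[where S = UNIV and X = "wH a l k" and Y = "\<lambda>x. of_int (a k i) *\<^sub>R wF a l i x"])
        (use goodD(3)[OF assms i] in \<open>simp_all add: linear_wF HF nil_app nil_scale\<close>)
    show "adp wE i j (nat (1 - a i j)) (wH a l k x) = 0" if "i \<in> J" "j \<in> J" "i \<noteq> j" for i j
      using adp_H[of k i j "nat (1 - a i j)" x] unfolding goodD(4)[OF assms that] by simp
  qed (use N goodD(2)[OF assms] in \<open>auto simp: ev_wH\<close>)
qed

lemma subspace_Q: "subspace (Q l)"
  by (rule subspaceI) (auto simp: Q_def good_0 good_add good_scale)

lemma Q_E: assumes "x \<in> Q l" shows "wE j x \<in> Q l"
proof -
  have "good l (wEs (j # u) x)" for u using assms unfolding Q_def by blast
  then show ?thesis unfolding Q_def by simp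
qed

lemma Q_good: assumes "x \<in> Q l" shows "good l x"
proof -
  have "good l (wEs [] x)" using assms unfolding Q_def by blast
  then show ?thesis by simp
qed

lemma Q_coinduct:
  assumes "x \<in> X" "\<And>x. x \<in> X \<Longrightarrow> good l x" "\<And>x j. x \<in> X \<Longrightarrow> wE j x \<in> X"
  shows "x \<in> Q l"
proof -
  have "wEs u x \<in> X" if "x \<in> X" for u x using that by (induction u arbitrary: x) (auto simp: assms(3))
  then show ?thesis using assms(1,2) by (auto simp: Q_def)
qed

lemma Q_H: "x \<in> Q l \<Longrightarrow> wH a l k x \<in> Q l"
proof -
  have "good l (wEs u (wH a l k x + c *\<^sub>R x))" if "x \<in> Q l" for u x c
    using that
  proof (induction u arbitrary: x c)
    case Nil
    then show ?case using good_add[OF good_wH[OF Q_good] good_scale[OF Q_good]] by simp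
  next
    case (Cons j u)
    have "wE j (wH a l k x + c *\<^sub>R x) = wH a l k (wE j x) + (c - of_int (a k j)) *\<^sub>R wE j x"
      by (simp add: wE_wH algebra_simps)
    then show ?case using Cons.IH[OF Q_E[OF Cons.prems, of j]] by simp
  qed
  from this[where c = 0] show "x \<in> Q l \<Longrightarrow> wH a l k x \<in> Q l" by (simp add: Q_def)
qed

text \<open>By \<open>serre_commutes\<close> for the dual structure this operator commutes with all
  \<open>wE k\<close>. Since it also vanishes at the empty word, it is zero on every
  function.\<close>

lemma serre_wF:
  assumes "i \<in> J" "j \<in> J" "i \<noteq> j"
  shows "adp (wF a l) i j (nat (1 - a i j)) x = 0"
proof (rule wf_eqI)
  interpret pre_module a wE "wF a l" "wH a l" by (rule wf_module)
  have c: "wE k (adp (wF a l) i j (nat (1 - a i j)) x) = adp (wF a l) i j (nat (1 - a i j)) (wE k x)" for k x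
    using pre_module.serre_commutes[OF dual aJ_diag[OF assms(1)] assms(3) aJ_nonpos[OF assms]] aJ_zero[OF assms(1,2)] by blast
  have n: "ev (adp (wF a l) i j n x) [] = 0" for n x by (induction n arbitrary: x) auto
  fix w
  show "ev (adp (wF a l) i j (nat (1 - a i j)) x) w = ev 0 w"
  proof (induction w arbitrary: x)
    case (Cons k w)
    then show ?case using c[of k x] by (metis ev_simps(1) ev_wE)
  qed (simp add: n)
qed

text \<open>Descent through the iterated commutators: the one at the Serre exponent is zero, each
  earlier one has a nilpotent commutator with \<open>wF a l i\<close>, and the first of them is
  \<open>wF a l k\<close>.\<close>

lemma nil_wF:
  assumes i: "i \<in> J" and k: "k \<in> J" and x: "nil (wF a l i) x"
  shows "nil (wF a l i) (wF a l k x)"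
proof (cases "k = i")
  case True
  then show ?thesis using nil_app[OF linear_wF x] by simp
next
  case False
  interpret pre_module a wE "wF a l" "wH a l" by (rule wf_module)
  define M where "M = nat (1 - a i k)"
  have "nil (wF a l i) (adp (wF a l) i k (M - d) y)" if "nil (wF a l i) y" for d y
    using that
  proof (induction d arbitrary: y)
    case 0
    then show ?case using serre_wF[OF i k] False nil_0 by (simp add: M_def)
  next
    case (Suc d)
    show ?case
    proof (cases "M \<le> d")
      case True
      then show ?thesis using Suc by simp
    next
      case False
      then have M: "M - d = Suc (M - Suc d)" by simp
      show ?thesis
        by (rule nil_commutator[where S = UNIV and X = "adp (wF a l) i k (M - Suc d)" and Y = "adp (wF a l) i k (M - d)"])
          (use Suc in \<open>auto simp: M linear_wF linear_0[OF pre_module.linear_adp[OF dual]]\<close>)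
    qed
  qed
  from this[OF x, of M] show ?thesis by simp
qed

lemma good_F: assumes "x \<in> Q l" "i \<in> J" shows "good l (wF a l i x)"
proof -
  interpret pre_module a wE "wF a l" "wH a l" by (rule wf_module)
  have g: "good l x" using assms Q_good by blast
  obtain N where N0: "\<forall>w. ev x w \<noteq> 0 \<longrightarrow> length w < N" using goodD(1)[OF g] by (rule exE)
  note N = N0[rule_format]
  have s: "\<exists>u. ev x u \<noteq> 0 \<and> Suc (length u) = length w \<and> set w \<subseteq> insert i (set u)" if "ev (wF a l i x) w \<noteq> 0" for w
    using wFv_support[of a l i w x] that by (simp add: wF_def)
  show ?thesis
  proof (rule goodI)
    show "length w < Suc N" if "ev (wF a l i x) w \<noteq> 0" for w using s[OF that] N by fastforce
    show "set w \<subseteq> J" if "ev (wF a l i x) w \<noteq> 0" for w using s[OF that] goodD(2)[OF g] assms(2) by fastforce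
    show "nil (wF a l j) (wF a l i x)" if "j \<in> J" for j using nil_wF[OF that assms(2) goodD(3)[OF g that]] .
    show "adp wE j k (nat (1 - a j k)) (wF a l i x) = 0" if "j \<in> J" "k \<in> J" "j \<noteq> k" for j k
    proof -
      have "wF a l i (adp wE j k (nat (1 - a j k)) x) = adp wE j k (nat (1 - a j k)) (wF a l i x)"
        using serre_commutes[OF aJ_diag[OF that(1)] that(3) aJ_nonpos[OF that]] aJ_zero[OF that(1,2)] by blast
      then show ?thesis unfolding goodD(4)[OF g that] by simp
    qed
  qed
qed

text \<open>Raising a lowered function gives a lowered function plus a weight term. Adding elements
  of \<open>Q l\<close> makes the set stable under raising, as coinduction requires.\<close>

lemma Q_F: assumes "x \<in> Q l" "i \<in> J" shows "wF a l i x \<in> Q l"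
proof (rule Q_coinduct[where X = "{wF a l i x + y | x y. x \<in> Q l \<and> y \<in> Q l}"])
  interpret pre_module a wE "wF a l" "wH a l" by (rule wf_module)
  show "wF a l i x \<in> {wF a l i x + y | x y. x \<in> Q l \<and> y \<in> Q l}" using assms subspace_0[OF subspace_Q] by force
  show "good l z" if "z \<in> {wF a l i x + y | x y. x \<in> Q l \<and> y \<in> Q l}" for z
    using that good_add good_F[OF _ assms(2)] Q_good by blast
  show "wE j z \<in> {wF a l i x + y | x y. x \<in> Q l \<and> y \<in> Q l}" if z: "z \<in> {wF a l i x + y | x y. x \<in> Q l \<and> y \<in> Q l}" for z j
  proof -
    obtain x y where xy: "z = wF a l i x + y" "x \<in> Q l" "y \<in> Q l" using z by blast
    have "wE j z = wF a l i (wE j x) + ((if j = i then wH a l j x else 0) + wE j y)" unfolding xy(1) by (simp add: EF)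
    moreover have "(if j = i then wH a l j x else 0) + wE j y \<in> Q l"
      using xy Q_H Q_E subspace_add[OF subspace_Q] subspace_0[OF subspace_Q] by auto
    ultimately show ?thesis using Q_E[OF xy(2)] by blast
  qed
qed

lemma good_sh:
  assumes "x \<in> Q l" "y \<in> Q m"
  shows "good (\<lambda>i. l i + m i) (sh x y)"
proof -
  note g = Q_good[OF assms(1)] Q_good[OF assms(2)]
  obtain N where N0: "\<forall>w. ev x w \<noteq> 0 \<longrightarrow> length w < N" using goodD(1)[OF g(1)] by (rule exE)
  note N = N0[rule_format]
  obtain M where M0: "\<forall>w. ev y w \<noteq> 0 \<longrightarrow> length w < M" using goodD(1)[OF g(2)] by (rule exE)
  note M = M0[rule_format]
  have s: "length w < N + M \<and> set w \<subseteq> J" if w: "ev (sh x y) w \<noteq> 0" for w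
  proof -
    obtain u v where uv: "ev x u \<noteq> 0" "ev y v \<noteq> 0" "length u + length v = length w" "set u \<union> set v = set w"
      using shv_support[of w x y] w by (auto simp: sh_def)
    show ?thesis using N[OF uv(1)] M[OF uv(2)] goodD(2)[OF g(1) uv(1)] goodD(2)[OF g(2) uv(2)] uv(3,4) by auto
  qed
  show ?thesis
  proof (rule goodI)
    show "nil (wF a (\<lambda>i. l i + m i) i) (sh x y)" if "i \<in> J" for i
      using nil_sh[OF linear_wF linear_wF linear_wF wF_sh goodD(3)[OF g(1) that] goodD(3)[OF g(2) that]] .
    show "adp wE i j (nat (1 - a i j)) (sh x y) = 0" if "i \<in> J" "j \<in> J" "i \<noteq> j" for i j
      unfolding adp_sh[of wE, OF linear_wE wE_sh] goodD(4)[OF g(1) that] goodD(4)[OF g(2) that] by simp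
  qed (use s in auto)
qed

lemma Q_sh:
  assumes "x \<in> Q l" "y \<in> Q m"
  shows "sh x y \<in> Q (\<lambda>i. l i + m i)"
proof -
  have "good (\<lambda>i. l i + m i) (wEs u (sh x y))" if "x \<in> Q l" "y \<in> Q m" for u x y
    using that
  proof (induction u arbitrary: x y)
    case Nil
    then show ?case using good_sh by simp
  next
    case (Cons j u)
    have "wEs (j # u) (sh x y) = wEs u (sh (wE j x) y) + wEs u (sh x (wE j y))" by (simp add: wE_sh)
    then show ?case using good_add[OF Cons.IH[OF Q_E[OF Cons.prems(1), of j] Cons.prems(2)] Cons.IH[OF Cons.prems(1) Q_E[OF Cons.prems(2), of j]]] by simp
  qed
  then show ?thesis using assms by (simp add: Q_def)
qed

lemma Q_wd: assumes "\<And>i. i \<in> J \<Longrightarrow> \<exists>n. l i = real n" shows "wd \<in> Q l"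
proof (rule Q_coinduct[where X = "{0, wd}"])
  have z: "adp wE i j n wd = 0" for i j :: 'i and n by (induction n) (auto simp: linear_0[OF linear_adpE])
  have "good l wd"
  proof (rule goodI)
    show "nil (wF a l i) wd" if "i \<in> J" for i
      using assms[OF that] nil_wF_wd[where a = a and l = l and i = i] aJ_diag[OF that] by blast
    show "adp wE i j (nat (1 - a i j)) wd = 0" for i j by (rule z)
  qed (auto simp: wd_def split: if_splits)
  then show "good l x" if "x \<in> {0, wd}" for x using that good_0 by auto
qed auto

lemma nil_wE: assumes x: "x \<in> Q l" shows "nil (wE i) x"
proof -
  obtain N where N0: "\<forall>w. ev x w \<noteq> 0 \<longrightarrow> length w < N" using goodD(1)[OF Q_good[OF x]] by (rule exE)
  note N = N0[rule_format]
  have p: "(wE i ^^ n) y = wEs (replicate n i) y" for n y by (induction n arbitrary: y) (simp_all add: funpow_Suc_right del: funpow.simps(2))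
  have "ev x (replicate N i @ w) = 0" for w using N[of "replicate N i @ w"] by auto
  then have "(wE i ^^ N) x = 0" unfolding p by (intro wf_eqI) simp
  then show ?thesis by (auto simp: nil_def)
qed

lemma Q_module: "km_module a wE (wF a l) (wH a l) J (Q l)"
proof (rule km_module.intro[OF wf_module km_module_axioms.intro])
  show "adp wE i j (nat (1 - a i j)) x = 0" if "i \<in> J" "j \<in> J" "i \<noteq> j" "x \<in> Q l" for i j x
    using goodD(4)[OF Q_good[OF that(4)] that(1-3)] .
  show "nil (wF a l i) x" if "i \<in> J" "x \<in> Q l" for i x using goodD(3)[OF Q_good[OF that(2)] that(1)] .
  show "a i j \<le> 0" if "i \<in> J" "j \<in> J" "i \<noteq> j" for i j using aJ_nonpos[OF that] .
  show "adp (wF a l) i j (nat (1 - a i j)) x = 0" if "i \<in> J" "j \<in> J" "i \<noteq> j" for i j x using serre_wF[OF that] .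
qed (simp_all only: aJ_diag subspace_Q Q_E Q_F nil_wE)

end

lemma wf_ext: assumes "ev x [] = ev y []" "\<And>k. wE k x = wE k y" shows "x = y"
proof (rule wf_eqI)
  fix w show "ev x w = ev y w"
  proof (cases w)
    case (Cons k u)
    then show ?thesis using assms(2)[of k] by (metis ev_wE)
  qed (simp add: assms)
qed

lemma sh_commute: "sh x y = sh y x"
proof (rule wf_eqI)
  fix w show "ev (sh x y) w = ev (sh y x) w" by (induction w arbitrary: x y) simp_all
qed

section \<open>Extremal vectors and Pluecker relations\<close>

text \<open>The bound on products leaves the rank 2 types \<open>A_1 x A_1\<close>,
  \<open>A_2\<close> and \<open>B_2\<close>, those in which the lifts satisfy the proved braid
  relations.\<close>

locale root_datum_part = root_datum I a coroot
  for I :: "'i set" and a :: "'i \<Rightarrow> 'i \<Rightarrow> int" and coroot :: "'i \<Rightarrow> 'v::real_vector" +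
  fixes J :: "'i set"
  assumes J_sub: "J \<subseteq> I" and J_prod: "i \<in> J \<Longrightarrow> j \<in> J \<Longrightarrow> i \<noteq> j \<Longrightarrow> a i j * a j i \<le> 2"
begin

lemma J_I [simp]: "i \<in> J \<Longrightarrow> i \<in> I" using J_sub by blast
lemma lists_J_I [simp]: "ks \<in> lists J \<Longrightarrow> ks \<in> lists I" using J_sub by (auto simp: lists_eq_set)
lemma finite_J: "finite J" using finite_subset[OF J_sub] by simp

sublocale cartan_letters a J
proof (rule cartan_letters.intro)
  show "a i i = 2" if "i \<in> J" for i using that by simp
  show "a i j \<le> 0" if "i \<in> J" "j \<in> J" "i \<noteq> j" for i j using that cartan_nonpos by simp
  show "a i j = 0 \<longleftrightarrow> a j i = 0" if "i \<in> J" "j \<in> J" for i j using that cartan_zero by simp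
qed

sublocale K: km_module a wE "wF a l" "wH a l" J "Q l" for l by (rule Q_module)

definition R :: "('i \<Rightarrow> real) \<Rightarrow> 'i \<Rightarrow> real \<Rightarrow> 'i wf \<Rightarrow> 'i wf" where
  "R l j e = km_module.sr wE (wF a l) j e"

primrec srw :: "('i \<Rightarrow> real) \<Rightarrow> 'i list \<Rightarrow> 'i wf \<Rightarrow> 'i wf" where
  "srw l [] x = x"
| "srw l (j # ks) x = R l j 1 (srw l ks x)"

definition om :: "'i \<Rightarrow> 'i \<Rightarrow> real" where "om k i = (if i = k then 1 else 0)"

text \<open>The extremal vector of weight \<open>word ks\<close> applied to the fundamental weight \<open>k\<close>.\<close>

definition V :: "'i \<Rightarrow> 'i list \<Rightarrow> 'i wf" where "V k ks = srw (om k) ks wd"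

lemmas R_closed = K.sr_closed[folded R_def]
lemmas R_scale = K.sr_scale[folded R_def]
lemmas R_inv = K.sr_inv[folded R_def]
lemmas R_linear = K.sr_linear[folded R_def]

lemma srw_append: "srw l (xs @ ys) x = srw l xs (srw l ys x)" by (induction xs) auto
lemma srw_closed: "ks \<in> lists J \<Longrightarrow> x \<in> Q l \<Longrightarrow> srw l ks x \<in> Q l" by (induction ks) (auto intro: R_closed)
lemma wd_Q: "wd \<in> Q (om k)" by (rule Q_wd) (auto simp: om_def intro: exI[of _ 0] exI[of _ 1])
lemma V_Q: "ks \<in> lists J \<Longrightarrow> V k ks \<in> Q (om k)" unfolding V_def by (rule srw_closed[OF _ wd_Q])

lemma R_0: "j \<in> J \<Longrightarrow> R l j e 0 = 0" using R_scale[of j 0 l e 0] subspace_0[OF subspace_Q] by simp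

lemma srw_zero: "ks \<in> lists J \<Longrightarrow> x \<in> Q l \<Longrightarrow> srw l ks x = 0 \<Longrightarrow> x = 0"
proof (induction ks)
  case (Cons j ks)
  have j: "j \<in> J" and ks: "ks \<in> lists J" using Cons.prems(1) by auto
  have "R l j (- 1) (R l j 1 (srw l ks x)) = srw l ks x" using R_inv[OF j srw_closed[OF ks Cons.prems(2)]] .
  then have "srw l ks x = 0" using Cons.prems(3) R_0[OF j] by simp
  then show ?case using Cons ks by blast
qed simp

lemma V_nonzero: "ks \<in> lists J \<Longrightarrow> V k ks \<noteq> 0"
  unfolding V_def using srw_zero[OF _ wd_Q] wd_nonzero by blast

lemma srw_weight:
  assumes "ks \<in> lists J" "x \<in> Q l" "linear f" "\<And>i. i \<in> I \<Longrightarrow> wH a l i x = f (coroot i) *\<^sub>R x" "i \<in> I"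
  shows "wH a l i (srw l ks x) = f (word (rev ks) (coroot i)) *\<^sub>R srw l ks x"
  using assms(1,5)
proof (induction ks arbitrary: i rule: list.induct)
  case Nil
  then show ?case using assms(4) by simp
next
  case (Cons j ks)
  have j: "j \<in> J" and ks: "ks \<in> lists J" using Cons.prems(1) by auto
  have "wH a l i (R l j 1 (srw l ks x)) = (f (word (rev ks) (coroot i)) - of_int (a i j) * f (word (rev ks) (coroot j))) *\<^sub>R R l j 1 (srw l ks x)"
    unfolding R_def using K.sr_weight[OF j srw_closed[OF ks assms(2)] Cons.IH[OF ks Cons.prems(2)] Cons.IH[OF ks J_I[OF j]]] .
  also have "f (word (rev ks) (coroot i)) - of_int (a i j) * f (word (rev ks) (coroot j)) = f (word (rev (j # ks)) (coroot i))"
    using Cons.prems(2) by (simp add: srefl_def linear_diff[OF linear_word] linear_scale[OF linear_word] linear_diff[OF assms(3)] linear_scale[OF assms(3)])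
  finally show ?case by simp
qed

lemma V_weight:
  assumes "ks \<in> lists J" "k \<in> I" "i \<in> I"
  shows "wH a (om k) i (V k ks) = fund_weight k (word (rev ks) (coroot i)) *\<^sub>R V k ks"
  unfolding V_def by (rule srw_weight[OF assms(1) wd_Q linear_fund_weight _ assms(3)])
    (use assms(2) in \<open>auto simp: wH_wd fund_weight_coroot om_def\<close>)

lemma form_nondegenerate: "(\<And>i. i \<in> I \<Longrightarrow> form z (coroot i) = 0) \<Longrightarrow> z = 0"
proof (rule ccontr)
  assume a: "\<And>i. i \<in> I \<Longrightarrow> form z (coroot i) = 0" "z \<noteq> 0"
  have s: "form z (sum f A) = (\<Sum>i\<in>A. form z (f i))" if "finite A" for f :: "'i \<Rightarrow> 'v" and A using that by (induction A) auto
  have "form z z = form z (\<Sum>i\<in>I. fund_weight i z *\<^sub>R coroot i)" using expand[of z] by simp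
  also have "\<dots> = 0" using a(1) by (simp add: s)
  finally show False using form_pos[OF a(2)] by simp
qed

text \<open>A nonzero vector \<open>wE t (V k ks)\<close> would give, after applying the inverse of \<open>word ks\<close>, a vector whose weight
  exceeds the highest weight by a positive root.\<close>

lemma V_killed:
  assumes ks: "ks \<in> lists J" and k: "k \<in> J" and t: "t \<in> J" and pos: "nonneg (word (rev ks) (coroot t))"
  shows "wE t (V k ks) = 0"
proof (rule ccontr)
  assume nz: "wE t (V k ks) \<noteq> 0"
  define x where "x = wE t (V k ks)"
  define f where "f = (\<lambda>h. fund_weight k (word (rev ks) h) + root t h)"
  have f: "linear f" unfolding f_def
    using linear_compose_add[OF linear_compose[OF linear_word linear_fund_weight] linear_root] by (simp add: comp_def)
  have xQ: "x \<in> Q (om k)" unfolding x_def using Q_E[OF V_Q[OF ks]] .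
  have w: "wH a (om k) i x = f (coroot i) *\<^sub>R x" if "i \<in> I" for i
    unfolding x_def f_def K.HE V_weight[OF ks J_I[OF k] that] using that by (simp add: scaleR_add_left)
  have rk: "rev ks \<in> lists J" using ks by auto
  define y where "y = srw (om k) (rev ks) x"
  have "x \<noteq> 0" using nz x_def by simp
  then have "y \<noteq> 0" using srw_zero[OF rk xQ] y_def by metis
  then obtain u where u: "ev y u \<noteq> 0" using wf_eqI[of y 0] by auto
  have yQ: "y \<in> Q (om k)" unfolding y_def using srw_closed[OF rk xQ] .
  have uJ: "set u \<subseteq> J" using goodD(2)[OF Q_good[OF yQ] u] .
  define b where "b = word (rev ks) (coroot t)"
  have bform: "form b h = form (coroot t) (word ks h)" for h
  proof -
    have "word ks b = coroot t" unfolding b_def using fun_cong[OF word_rev_right[of ks], of "coroot t"] ks by simp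
    then show ?thesis using form_weyl[of "word ks" b h] ks weyl_word by auto
  qed
  \<comment> \<open>Through \<open>form\<close>, \<open>symmetrizer m\<close> times
    \<open>coroot m\<close> represents \<open>root m\<close>, so \<open>z\<close> represents the sum
    of the roots of the letters of \<open>u\<close> and of the transform of \<open>root t\<close>.
    Comparing weights at \<open>u\<close> makes this sum of nonnegative terms zero.\<close>
  define z where "z = (\<Sum>m\<leftarrow>u. symmetrizer m *\<^sub>R coroot m) + symmetrizer t *\<^sub>R b"
  have fl: "form (\<Sum>m\<leftarrow>v. symmetrizer m *\<^sub>R coroot m) h = (\<Sum>m\<leftarrow>v. root m h)" if "set v \<subseteq> J" for v h
    using that
  proof (induction v)
    case (Cons m v)
    then have "symmetrizer m > 0" "m \<in> I" using symmetrizer_pos by auto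
    then show ?case using Cons form_coroot[of m h] by (simp add: form_sym[of "coroot m"])
  qed (use form_scale_left[of 0 0 h] in simp)
  have "form z (coroot i) = 0" if i: "i \<in> I" for i
  proof -
    have "wH a (om k) i y = f (word ks (coroot i)) *\<^sub>R y" unfolding y_def using srw_weight[OF rk xQ f w i] by simp
    then have "wc a (om k) i u * ev y u = f (word ks (coroot i)) * ev y u" by (metis ev_wH ev_simps(5))
    then have "wc a (om k) i u = f (word ks (coroot i))" using u by simp
    moreover have "f (word ks (coroot i)) = om k i + root t (word ks (coroot i))"
      unfolding f_def using fun_cong[OF word_rev_left[of ks], of "coroot i"] ks k i by (simp add: fund_weight_coroot om_def)
    ultimately have "(\<Sum>m\<leftarrow>u. of_int (a i m)) + root t (word ks (coroot i)) = 0" by (simp add: wc_def)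
    moreover have "(\<Sum>m\<leftarrow>u. of_int (a i m)) = (\<Sum>m\<leftarrow>u. root m (coroot i))" using i by simp
    moreover have "symmetrizer t * form b (coroot i) = root t (word ks (coroot i))"
      unfolding bform form_sym[of "coroot t"] using form_coroot[of t] symmetrizer_pos[of t] t by simp
    ultimately show ?thesis unfolding z_def using fl[OF uJ] by simp
  qed
  then have z: "z = 0" by (rule form_nondegenerate)
  have n1: "nonneg (\<Sum>m\<leftarrow>v. symmetrizer m *\<^sub>R coroot m)" if "set v \<subseteq> J" for v
    using that by (induction v) (auto intro!: nonneg_add nonneg_scale nonneg_coroot simp: symmetrizer_pos less_imp_le)
  have "nonneg (symmetrizer t *\<^sub>R b)" using pos nonneg_scale symmetrizer_pos[of t] t unfolding b_def by (simp add: less_imp_le)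
  moreover have "- (symmetrizer t *\<^sub>R b) = (\<Sum>m\<leftarrow>u. symmetrizer m *\<^sub>R coroot m)" using z unfolding z_def add.commute[of _ "symmetrizer t *\<^sub>R b"] by (rule minus_unique)
  ultimately have "symmetrizer t *\<^sub>R b = 0" using nonneg_antisym n1[OF uJ] by metis
  then have "b = 0" using symmetrizer_pos[of t] t by simp
  moreover have "b \<noteq> 0" unfolding b_def using weyl_coroot_nonzero[OF weyl_word, of "rev ks" t] rk t by simp
  ultimately show False by blast
qed

lemma R_highest:
  assumes "s \<in> J" "x \<in> Q l" "wE s x = 0" "wH a l s x = real c *\<^sub>R x"
  shows "R l s 1 x = (1 / fact c) *\<^sub>R ((wF a l s) ^^ c) x"
    "R l s (- 1) x = (- 1) ^ c *\<^sub>R (1 / fact c) *\<^sub>R ((wF a l s) ^^ c) x"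
proof -
  interpret Z: sl2_module "Q l" "wE s" "wF a l s" "wH a l s" using K.sl2[OF assms(1)] .
  show "R l s 1 x = (1 / fact c) *\<^sub>R ((wF a l s) ^^ c) x"
    using Z.sb_highest[OF assms(2-4), of 1] unfolding R_def K.sr_def Z.fd_def by simp
  show "R l s (- 1) x = (- 1) ^ c *\<^sub>R (1 / fact c) *\<^sub>R ((wF a l s) ^^ c) x"
    using Z.sb_highest[OF assms(2-4), of "- 1"] unfolding R_def K.sr_def Z.fd_def by simp
qed

lemma R_fixed:
  assumes "s \<in> J" "x \<in> Q l" "wE s x = 0" "wH a l s x = 0"
  shows "R l s 1 x = x" "R l s (- 1) x = x"
  using R_highest[OF assms(1-3), of 0] assms(4) by simp_all

lemma V_snoc_other: assumes "ks \<in> lists J" "c \<in> J" "k \<in> J" "c \<noteq> k" shows "V k (ks @ [c]) = V k ks"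
  unfolding V_def srw_append using R_fixed(1)[OF assms(2) wd_Q] assms(4) by (simp add: wH_wd om_def)

text \<open>Exponentials of derivations are multiplicative.\<close>

lemma R_sh:
  assumes j: "j \<in> J" and xy: "x \<in> Q l" "y \<in> Q m"
  shows "R (\<lambda>i. l i + m i) j e (sh x y) = sh (R l j e x) (R m j e y)"
proof -
  interpret X: sl2_module "Q l" "wE j" "wF a l j" "wH a l j" using K.sl2[OF j] .
  interpret Y: sl2_module "Q m" "wE j" "wF a m j" "wH a m j" using K.sl2[OF j] .
  have E: "ex t (wE j) (sh x y) = sh (ex t (wE j) x) (ex t (wE j) y)" if "x \<in> Q l" "y \<in> Q m" for t x y
    by (rule ex_sh[OF linear_wE linear_wE linear_wE wE_sh nil_wE[OF that(1)] nil_wE[OF that(2)]])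
  have F: "ex t (wF a (\<lambda>i. l i + m i) j) (sh x y) = sh (ex t (wF a l j) x) (ex t (wF a m j) y)" if "x \<in> Q l" "y \<in> Q m" for t x y
    by (rule ex_sh[OF linear_wF linear_wF linear_wF wF_sh X.nilF[OF that(1)] Y.nilF[OF that(2)]])
  show ?thesis unfolding R_def K.sr_eq[OF j] using xy by (simp add: E F X.exE_closed Y.exE_closed X.exF_closed Y.exF_closed)
qed

lemma srw_sh: "ks \<in> lists J \<Longrightarrow> x \<in> Q l \<Longrightarrow> y \<in> Q m \<Longrightarrow> srw (\<lambda>i. l i + m i) ks (sh x y) = sh (srw l ks x) (srw m ks y)"
  by (induction ks) (auto simp: R_sh srw_closed)

lemma alt_small: "alt 2 s t = [t, s]" "alt 3 s t = [s, t, s]" "alt 4 s t = [t, s, t, s]"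
proof -
  have "(2::nat) = Suc (Suc 0)" "(3::nat) = Suc (Suc (Suc 0))" "(4::nat) = Suc (Suc (Suc (Suc 0)))" by simp_all
  moreover have "alt (Suc (Suc 0)) s t = [t, s]" "alt (Suc (Suc (Suc 0))) s t = [s, t, s]"
    "alt (Suc (Suc (Suc (Suc 0)))) s t = [t, s, t, s]" by simp_all
  ultimately show "alt 2 s t = [t, s]" "alt 3 s t = [s, t, s]" "alt 4 s t = [t, s, t, s]" by metis+
qed

lemma srw_braid:
  assumes "s \<in> J" "t \<in> J" "s \<noteq> t" "x \<in> Q l"
  shows "srw l (alt (mm s t) s t) x = srw l (alt (mm s t) t s) x"
proof -
  have I: "s \<in> I" "t \<in> I" using assms by auto
  show ?thesis
    using I(1,2) assms(3)
  proof (cases rule: cartan_cases)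
    case 1
    then show ?thesis using K.braid2[OF assms(1-3) 1(1) assms(4)] by (simp add: mm_def R_def alt_small)
  next
    case 2
    then show ?thesis using K.braid3[OF assms(1-3) 2 assms(4)] by (simp add: mm_def R_def alt_small)
  next
    case 3
    then show ?thesis using K.braid4[OF assms(1-3) 3 assms(4)] by (simp add: mm_def R_def alt_small)
  next
    case 4
    then show ?thesis using K.braid4[OF assms(2,1) assms(3)[symmetric] 4(2,1) assms(4)] by (simp add: mm_def R_def alt_small)
  next
    case 5
    then show ?thesis using J_prod[OF assms(1-3)] by simp
  next
    case 6
    then show ?thesis using J_prod[OF assms(1-3)] by simp
  qed
qed

lemma wF_wd_zero: assumes "l j = 0" shows "wF a l j wd = 0"
  by (rule wf_ext) (use assms in \<open>auto simp: K.EF wH_wd\<close>)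

lemma V_Nil: "V k [] = wd" by (simp add: V_def)

text \<open>The vectors involved belong to the two three-dimensional representations of type
  \<open>A_2\<close>. An identity of functions is tested at the empty word and after each raising
  operator, where it becomes immediate.\<close>

lemma pluecker3:
  assumes ij: "i \<in> J" "j \<in> J" "i \<noteq> j" "a i j = -1" "a j i = -1"
  shows "sh (V i [i]) (V j [j]) = sh (V i []) (V j [i, j]) + sh (V i [j, i]) (V j [])"
proof -
  have half: "\<exists>A1 A2. V i [i] = A1 \<and> V i [j, i] = A2 \<and> ev A1 [] = 0 \<and> ev A2 [] = 0 \<and>
      (\<forall>k. wE k A1 = (if k = i then wd else 0)) \<and> (\<forall>k. wE k A2 = (if k = j then A1 else 0))"
    if ij: "i \<in> J" "j \<in> J" "i \<noteq> j" "a j i = -1" for i j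
  proof -
    let ?l = "om i"
    have l: "?l i = 1" "?l j = 0" using ij by (auto simp: om_def)
    have d: "a i i = 2" "a j j = 2" using ij aJ_diag by auto
    define A1 where "A1 = wF a ?l i wd"
    define A2 where "A2 = wF a ?l j A1"
    have Q: "A1 \<in> Q ?l" unfolding A1_def using Q_F[OF wd_Q ij(1)] .
    have E1: "wE k A1 = (if k = i then wd else 0)" for k unfolding A1_def by (auto simp: K.EF wH_wd l)
    have H1: "wH a ?l j A1 = A1" unfolding A1_def by (simp add: K.HF wH_wd l ij)
    have E2: "wE k A2 = (if k = j then A1 else 0)" for k
      unfolding A2_def using ij(3) by (auto simp: K.EF E1 H1 wF_wd_zero l)
    have "V i [i] = A1" unfolding V_def using R_highest(1)[OF ij(1) wd_Q, of i 1] by (simp add: wH_wd l A1_def)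
    moreover have "V i [j, i] = A2" using R_highest(1)[OF ij(2) Q, of 1] E1 H1 ij(3) \<open>V i [i] = A1\<close> unfolding V_def by (simp add: A2_def)
    ultimately show ?thesis using E1 E2 by (intro exI[of _ A1] exI[of _ A2]) (simp add: A1_def A2_def)
  qed
  obtain A1 A2 where A: "V i [i] = A1" "V i [j, i] = A2" "ev A1 [] = 0" "ev A2 [] = 0" "\<And>k. wE k A1 = (if k = i then wd else 0)" "\<And>k. wE k A2 = (if k = j then A1 else 0)"
    using half[OF ij(1-3,5)] by blast
  obtain C1 C2 where C: "V j [j] = C1" "V j [i, j] = C2" "ev C1 [] = 0" "ev C2 [] = 0" "\<And>k. wE k C1 = (if k = j then wd else 0)" "\<And>k. wE k C2 = (if k = i then C1 else 0)"
    using half[OF ij(2,1) ij(3)[symmetric] ij(4)] by blast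
  show ?thesis unfolding A(1,2) C(1,2) V_Nil
    by (rule wf_ext) (use ij(3) in \<open>auto simp: A C wE_sh\<close>)
qed

text \<open>Type \<open>B_2\<close>, with the five-dimensional representation at \<open>i\<close>
  and the spin representation at \<open>j\<close>. The function \<open>B\<close> is the zero weight
  vector of the former; it is not extremal, and has to be eliminated when magnitudes are
  compared.\<close>

lemma pluecker4:
  assumes ij: "i \<in> J" "j \<in> J" "i \<noteq> j" "a i j = -1" "a j i = -2"
  shows "\<exists>B\<in>Q (om i).
    sh (V i [i]) (V j [j]) = sh (V i []) (V j [i, j]) + sh B (V j []) \<and>
    sh B (V j [j]) = sh (V i [j, i]) (V j []) + sh (V i []) (V j [j, i, j]) \<and>
    sh B (V j [i, j]) = sh (V i [i]) (V j [j, i, j]) + sh (V i [i, j, i]) (V j []) \<and>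
    sh (V i [j, i]) (V j [i, j]) = sh (V i [i, j, i]) (V j [j]) + sh B (V j [j, i, j]) \<and>
    sh (V i [i]) (V i [j, i]) = sh (V i []) (V i [i, j, i]) + sh B B"
proof -
  let ?l = "om i" let ?n = "om j"
  have l: "?l i = 1" "?l j = 0" "?n i = 0" "?n j = 1" using ij by (auto simp: om_def)
  have d: "a i i = 2" "a j j = 2" using ij aJ_diag by auto
  note rel = K.EF K.HF wH_wd l d ij(4,5)
  define A1 where "A1 = wF a ?l i wd"
  define B where "B = wF a ?l j A1"
  \<comment> \<open>\<open>A1\<close> has weight 2 for \<open>j\<close>, so \<open>wE j\<close>
    sends \<open>B\<close> to twice \<open>A1\<close>; halving makes the relations have coefficient
    1.\<close>
  define B' where "B' = (1/2) *\<^sub>R B"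
  define A2 where "A2 = (1/2) *\<^sub>R wF a ?l j B"
  define A3 where "A3 = wF a ?l i A2"
  define C1 where "C1 = wF a ?n j wd"
  define C2 where "C2 = wF a ?n i C1"
  define C3 where "C3 = wF a ?n j C2"
  have e0: "ev A1 [] = 0" "ev B' [] = 0" "ev A2 [] = 0" "ev A3 [] = 0" "ev C1 [] = 0" "ev C2 [] = 0" "ev C3 [] = 0"
    by (simp_all add: A1_def B'_def B_def A2_def A3_def C1_def C2_def C3_def)
  have QA1: "A1 \<in> Q ?l" unfolding A1_def using Q_F[OF wd_Q ij(1)] .
  have QB: "B \<in> Q ?l" unfolding B_def using Q_F[OF QA1 ij(2)] .
  have QB': "B' \<in> Q ?l" unfolding B'_def using subspace_scale[OF subspace_Q QB] .
  have QA2: "A2 \<in> Q ?l" unfolding A2_def using subspace_scale[OF subspace_Q Q_F[OF QB ij(2)]] .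
  have QC1: "C1 \<in> Q ?n" unfolding C1_def using Q_F[OF wd_Q ij(2)] .
  have QC2: "C2 \<in> Q ?n" unfolding C2_def using Q_F[OF QC1 ij(1)] .
  have EA1: "wE k A1 = (if k = i then wd else 0)" for k unfolding A1_def by (auto simp: rel)
  have HA1: "wH a ?l j A1 = 2 *\<^sub>R A1" "wH a ?l i A1 = - A1" unfolding A1_def by (simp_all add: rel scaleR_2)
  have EB: "wE k B = (if k = j then 2 *\<^sub>R A1 else 0)" for k
    unfolding B_def using ij(3) by (auto simp: rel EA1 HA1 wF_wd_zero)
  have EB': "wE k B' = (if k = j then A1 else 0)" for k unfolding B'_def by (simp add: EB)
  have HB: "wH a ?l j B = 0" "wH a ?l i B = 0" unfolding B_def by (simp_all add: rel HA1)
  have EA2: "wE k A2 = (if k = j then 2 *\<^sub>R B' else 0)" for k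
    unfolding A2_def by (auto simp: rel EB HB B'_def) (simp add: B_def)
  have F1: "wF a ?l i A1 = 0"
    by (rule wf_ext) (auto simp: rel EA1 HA1 A1_def[symmetric])
  have FB: "wF a ?l i B = 0"
    by (rule wf_ext) (auto simp: rel EB HB F1)
  have HA2: "wH a ?l i A2 = A2" unfolding A2_def by (simp add: rel HB)
  have EA3: "wE k A3 = (if k = i then A2 else 0)" for k
    unfolding A3_def using ij(3) by (auto simp: rel EA2 HA2 B'_def FB)
  have EC1: "wE k C1 = (if k = j then wd else 0)" for k unfolding C1_def by (auto simp: rel)
  have HC1: "wH a ?n i C1 = C1" "wH a ?n j C1 = - C1" unfolding C1_def by (simp_all add: rel scaleR_2)
  have EC2: "wE k C2 = (if k = i then C1 else 0)" for k
    unfolding C2_def using ij(3) by (auto simp: rel EC1 HC1 wF_wd_zero)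
  have FC1: "wF a ?n j C1 = 0"
    by (rule wf_ext) (auto simp: rel EC1 HC1 C1_def[symmetric])
  have HC2: "wH a ?n j C2 = C2" unfolding C2_def by (simp add: rel HC1 scaleR_2)
  have EC3: "wE k C3 = (if k = j then C2 else 0)" for k
    unfolding C3_def using ij(3) by (auto simp: rel EC2 HC2 FC1)
  have V1: "V i [i] = A1" unfolding V_def using R_highest(1)[OF ij(1) wd_Q, of i 1] by (simp add: wH_wd l A1_def)
  have V2: "V i [j, i] = A2" using R_highest(1)[OF ij(2) QA1, of 2] EA1 HA1 ij(3) V1
    unfolding V_def by (simp add: A2_def B_def numeral_2_eq_2)
  have V3: "V i [i, j, i] = A3" using R_highest(1)[OF ij(1) QA2, of 1] EA2 HA2 ij(3) V2
    unfolding V_def by (simp add: A3_def)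
  have W1: "V j [j] = C1" unfolding V_def using R_highest(1)[OF ij(2) wd_Q, of j 1] by (simp add: wH_wd l C1_def)
  have W2: "V j [i, j] = C2" using R_highest(1)[OF ij(1) QC1, of 1] EC1 HC1 ij(3) W1
    unfolding V_def by (simp add: C2_def)
  have W3: "V j [j, i, j] = C3" using R_highest(1)[OF ij(2) QC2, of 1] EC2 HC2 ij(3) W2
    unfolding V_def by (simp add: C3_def)
  note E = EA1 EB' EA2 EA3 EC1 EC2 EC3
  \<comment> \<open>Raising reduces each of \<open>I2\<close>, \<open>I3\<close>, \<open>I4\<close>
    to the preceding identity, which dictates the order.\<close>
  have I1: "sh A1 C1 = sh wd C2 + sh B' wd"
    by (rule wf_ext) (use ij(3) in \<open>auto simp: e0 E wE_sh\<close>)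
  have I2: "sh B' C1 = sh A2 wd + sh wd C3"
    by (rule wf_ext) (use ij(3) in \<open>auto simp: e0 E wE_sh I1 sh_scale_left sh_add_left scaleR_2\<close>)
  have I3: "sh B' C2 = sh A1 C3 + sh A3 wd"
    by (rule wf_ext) (use ij(3) in \<open>auto simp: e0 E wE_sh I2 sh_scale_left sh_add_left scaleR_2\<close>)
  have I4: "sh A2 C2 = sh A3 C1 + sh B' C3"
    by (rule wf_ext) (use ij(3) in \<open>auto simp: e0 E wE_sh I3 sh_scale_left sh_add_left scaleR_2\<close>)
  have I5: "sh A1 A2 = sh wd A3 + sh B' B'"
    by (rule wf_ext) (use ij(3) in \<open>auto simp: e0 E wE_sh sh_scale_right sh_add_right scaleR_2 sh_commute[of A1 B']\<close>)
  show ?thesis unfolding V1 V2 V3 W1 W2 W3 V_Nil using QB'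
    by (rule bexI[rotated]) (intro conjI I1 I2 I3 I4 I5)
qed

end

subsection \<open>Orders of magnitude\<close>

text \<open>The lower bound with \<open>c > 0\<close> also records positivity, which is what makes
  the order of a sum the minimum of the orders.\<close>

definition magnitude :: "(real \<Rightarrow> real) \<Rightarrow> int \<Rightarrow> bool" where
  "magnitude f m \<longleftrightarrow> (\<exists>c>0. \<exists>C. \<forall>q. 0 < q \<and> q \<le> 1 \<longrightarrow> c * q powr m \<le> f q \<and> f q \<le> C * q powr m)"

lemma magnitudeI:
  assumes "c > 0" "\<And>q. 0 < q \<Longrightarrow> q \<le> 1 \<Longrightarrow> c * q powr m \<le> f q" "\<And>q. 0 < q \<Longrightarrow> q \<le> 1 \<Longrightarrow> f q \<le> C * q powr m"
  shows "magnitude f m"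
  unfolding magnitude_def using assms by blast

lemma magnitudeD:
  assumes "magnitude f m"
  shows "\<exists>c C. c > 0 \<and> C > 0 \<and> (\<forall>q. 0 < q \<longrightarrow> q \<le> 1 \<longrightarrow> c * q powr m \<le> f q) \<and> (\<forall>q. 0 < q \<longrightarrow> q \<le> 1 \<longrightarrow> f q \<le> C * q powr m)"
proof -
  obtain c C where c: "c > 0" "\<forall>q. 0 < q \<and> q \<le> 1 \<longrightarrow> c * q powr m \<le> f q \<and> f q \<le> C * q powr m"
    using assms unfolding magnitude_def by blast
  from c(2)[rule_format, of 1] have "c \<le> C" by simp
  then show ?thesis using c by (intro exI[of _ c] exI[of _ C]) auto
qed

lemma magnitude_pos: assumes "magnitude f m" "0 < q" "q \<le> 1" shows "f q > 0"
proof -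
  obtain c C where c0: "c > 0" "C > 0" "\<forall>q. 0 < q \<longrightarrow> q \<le> 1 \<longrightarrow> c * q powr m \<le> f q" "\<forall>q. 0 < q \<longrightarrow> q \<le> 1 \<longrightarrow> f q \<le> C * q powr m"
    using magnitudeD[OF assms(1)] by blast
  note c = c0(1,2) c0(3,4)[rule_format]
  note c = c(1,3)
  have "0 < c * q powr m" using c(1) assms(2) by simp
  then show ?thesis using c(2)[OF assms(2,3)] by linarith
qed

lemma magnitude_cong: "(\<And>q. 0 < q \<Longrightarrow> q \<le> 1 \<Longrightarrow> f q = g q) \<Longrightarrow> magnitude f m \<longleftrightarrow> magnitude g m"
  unfolding magnitude_def by auto

lemma magnitude_powr: "\<theta> > 0 \<Longrightarrow> magnitude (\<lambda>q. \<theta> * q powr m) m"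
  by (rule magnitudeI[of \<theta> _ _ \<theta>]) auto

lemma magnitude_mult: assumes "magnitude f m" "magnitude g n" shows "magnitude (\<lambda>q. f q * g q) (m + n)"
proof -
  obtain c C where c0: "c > 0" "C > 0" "\<forall>q. 0 < q \<longrightarrow> q \<le> 1 \<longrightarrow> c * q powr m \<le> f q" "\<forall>q. 0 < q \<longrightarrow> q \<le> 1 \<longrightarrow> f q \<le> C * q powr m"
    using magnitudeD[OF assms(1)] by blast
  note c = c0(1,2) c0(3,4)[rule_format]
  obtain d D where d0: "d > 0" "D > 0" "\<forall>q. 0 < q \<longrightarrow> q \<le> 1 \<longrightarrow> d * q powr n \<le> g q" "\<forall>q. 0 < q \<longrightarrow> q \<le> 1 \<longrightarrow> g q \<le> D * q powr n"
    using magnitudeD[OF assms(2)] by blast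
  note d = d0(1,2) d0(3,4)[rule_format]
  show ?thesis
  proof (rule magnitudeI[of "c * d" _ _ "C * D"])
    fix q :: real assume q: "0 < q" "q \<le> 1"
    have "(c * q powr m) * (d * q powr n) \<le> f q * g q"
      using c d q magnitude_pos[OF assms(1) q] by (intro mult_mono) (auto simp: less_imp_le)
    then show "c * d * q powr real_of_int (m + n) \<le> f q * g q" by (simp add: powr_add mult_ac)
    have "f q * g q \<le> (C * q powr m) * (D * q powr n)"
      using c d q magnitude_pos[OF assms(1) q] magnitude_pos[OF assms(2) q] by (intro mult_mono) (auto simp: less_imp_le)
    then show "f q * g q \<le> C * D * q powr real_of_int (m + n)" by (simp add: powr_add mult_ac)
  qed (use c d in simp)
qed

lemma magnitude_solve:
  assumes "magnitude f m" "magnitude h n" "\<And>q. 0 < q \<Longrightarrow> q \<le> 1 \<Longrightarrow> f q * g q = h q"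
  shows "magnitude g (n - m)"
proof -
  obtain c C where c0: "c > 0" "C > 0" "\<forall>q. 0 < q \<longrightarrow> q \<le> 1 \<longrightarrow> c * q powr m \<le> f q" "\<forall>q. 0 < q \<longrightarrow> q \<le> 1 \<longrightarrow> f q \<le> C * q powr m"
    using magnitudeD[OF assms(1)] by blast
  note c = c0(1,2) c0(3,4)[rule_format]
  obtain d D where d0: "d > 0" "D > 0" "\<forall>q. 0 < q \<longrightarrow> q \<le> 1 \<longrightarrow> d * q powr n \<le> h q" "\<forall>q. 0 < q \<longrightarrow> q \<le> 1 \<longrightarrow> h q \<le> D * q powr n"
    using magnitudeD[OF assms(2)] by blast
  note d = d0(1,2) d0(3,4)[rule_format]
  show ?thesis
  proof (rule magnitudeI[of "d / C" _ _ "D / c"])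
    fix q :: real assume q: "0 < q" "q \<le> 1"
    have f: "f q > 0" and h: "h q > 0" using magnitude_pos assms q by auto
    have g: "g q = h q / f q" using assms(3)[OF q] f by (simp add: field_simps)
    have "(d * q powr n) / (C * q powr m) \<le> h q / f q"
      using c d q f h by (intro frac_le) (auto simp: less_imp_le)
    then show "d / C * q powr real_of_int (n - m) \<le> g q" unfolding g by (simp add: powr_diff)
    have "h q / f q \<le> (D * q powr n) / (c * q powr m)"
      using c d q f h by (intro frac_le) (auto simp: less_imp_le)
    then show "g q \<le> D / c * q powr real_of_int (n - m)" unfolding g by (simp add: powr_diff)
  qed (use c d in simp)
qed

lemma magnitude_add: assumes "magnitude f m" "magnitude g n" shows "magnitude (\<lambda>q. f q + g q) (min m n)"
proof -
  have *: "magnitude (\<lambda>q. f q + g q) m" if mn: "m \<le> n" and fm: "magnitude f m" and gn: "magnitude g n" for f g m n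
  proof -
    obtain c C where c0: "c > 0" "C > 0" "\<forall>q. 0 < q \<longrightarrow> q \<le> 1 \<longrightarrow> c * q powr m \<le> f q" "\<forall>q. 0 < q \<longrightarrow> q \<le> 1 \<longrightarrow> f q \<le> C * q powr m"
      using magnitudeD[OF fm] by blast
    note c = c0(1,2) c0(3,4)[rule_format]
    obtain d D where d0: "d > 0" "D > 0" "\<forall>q. 0 < q \<longrightarrow> q \<le> 1 \<longrightarrow> d * q powr n \<le> g q" "\<forall>q. 0 < q \<longrightarrow> q \<le> 1 \<longrightarrow> g q \<le> D * q powr n"
      using magnitudeD[OF gn] by blast
    note d = d0(1,2) d0(3,4)[rule_format]
    show ?thesis
    proof (rule magnitudeI[of c _ _ "C + D"])
      fix q :: real assume q: "0 < q" "q \<le> 1"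
      show "c * q powr m \<le> f q + g q" using c(3)[OF q] magnitude_pos[OF gn q] by linarith
      have "q powr n \<le> q powr m" using powr_mono'[of m n q] q mn by simp
      then have "D * q powr n \<le> D * q powr m" using d by simp
      then show "f q + g q \<le> (C + D) * q powr m" using c(4)[OF q] d(4)[OF q] by (simp add: distrib_right)
    qed (use c in simp)
  qed
  show ?thesis
  proof (cases "m \<le> n")
    case True
    then show ?thesis using *[OF True assms] by (simp add: min_def)
  next
    case False
    then show ?thesis using *[of n m g f] assms by (simp add: min_def add.commute)
  qed
qed

lemma magnitude_power: assumes "magnitude f m" shows "magnitude (\<lambda>q. f q ^ k) (int k * m)"
proof (induction k)
  case 0
  show ?case using magnitude_powr[of 1 0] by (simp add: magnitude_def)
next
  case (Suc k)
  then show ?case using magnitude_mult[OF assms Suc] by (simp add: algebra_simps)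
qed

lemma magnitude_le:
  assumes "magnitude f m" "\<And>q. 0 < q \<Longrightarrow> q \<le> 1 \<Longrightarrow> f q \<le> C * q powr real_of_int n"
  shows "n \<le> m"
proof (rule ccontr)
  assume "\<not> n \<le> m"
  then have nm: "real_of_int m \<le> real_of_int n - 1" by simp
  obtain c D where c0: "c > 0" "D > 0" "\<forall>q. 0 < q \<longrightarrow> q \<le> 1 \<longrightarrow> c * q powr m \<le> f q" "\<forall>q. 0 < q \<longrightarrow> q \<le> 1 \<longrightarrow> f q \<le> D * q powr m"
    using magnitudeD[OF assms(1)] by blast
  note c = c0(1,2) c0(3,4)[rule_format]
  note c = c(1,3)
  \<comment> \<open>Chosen so that \<open>c / q\<close> exceeds \<open>C\<close>; the bound
    \<open>\<bar>C\<bar> + 1\<close> serves every sign of \<open>C\<close>.\<close>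
  define q where "q = min 1 (c / (2 * (\<bar>C\<bar> + 1)))"
  have q: "0 < q" "q \<le> 1" using c(1) by (auto simp: q_def)
  have "c * q powr (real_of_int n - 1) \<le> c * q powr m"
    using powr_mono'[OF nm, of q] q c(1) by simp
  also have "\<dots> \<le> C * q powr n" using c(2)[OF q] assms(2)[OF q] by linarith
  finally have "c * q powr n / q \<le> C * q powr n" using q by (simp add: powr_diff)
  then have "(c / q) * q powr n \<le> C * q powr n" by simp
  moreover have "q powr n > 0" using q by simp
  ultimately have "c / q \<le> C" using mult_le_cancel_right_pos by blast
  moreover have "q \<le> c / (2 * (\<bar>C\<bar> + 1))" by (simp add: q_def)
  then have "2 * (\<bar>C\<bar> + 1) \<le> c / q" using q c(1) by (simp add: field_simps)
  ultimately show False using abs_ge_self[of C] by (smt (verit))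
qed

subsection \<open>Finite differences\<close>

primrec fdiff :: "nat \<Rightarrow> (nat \<Rightarrow> real) \<Rightarrow> nat \<Rightarrow> real" where
  "fdiff 0 f = f"
| "fdiff (Suc c) f = fdiff c (\<lambda>n. f (Suc n) - f n)"

lemma fdiff_sum: "fdiff c (\<lambda>n. \<Sum>l\<in>A. e l * g l n) n = (\<Sum>l\<in>A. e l * fdiff c (g l) n)"
  by (induction c arbitrary: g) (simp_all add: sum_subtractf[symmetric] right_diff_distrib[symmetric])

lemma fdiff_power: "l \<le> c \<Longrightarrow> fdiff c (\<lambda>n. real n ^ l) n = (if l = c then fact c else 0)"
proof (induction c arbitrary: l)
  case (Suc c)
  show ?case
  proof (cases l)
    case 0
    have z: "fdiff c (\<lambda>n. 0) n = 0" for c by (induction c) simp_all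
    show ?thesis using 0 z by simp
  next
    case (Suc k)
    have e: "real (Suc n) ^ l - real n ^ l = (\<Sum>j\<le>k. real (l choose j) * real n ^ j)" for n
      using binomial_ring[of "real n" 1 l] unfolding Suc by (simp add: add.commute)
    have "fdiff (Suc c) (\<lambda>n. real n ^ l) n = (\<Sum>j\<le>k. real (l choose j) * fdiff c (\<lambda>n. real n ^ j) n)"
      by (simp only: fdiff.simps e fdiff_sum)
    also have "\<dots> = (\<Sum>j\<le>k. if j = c then real (l choose c) * fact c else 0)"
      using Suc.IH Suc.prems Suc by (intro sum.cong) auto
    also have "\<dots> = (if l = Suc c then fact (Suc c) else 0)"
      using Suc.prems Suc by (auto simp: sum.delta')
    finally show ?thesis .
  qed
qed simp

lemma fdiff_bound: "(\<And>j. j \<le> n + c \<Longrightarrow> \<bar>f j\<bar> \<le> K) \<Longrightarrow> \<bar>fdiff c f n\<bar> \<le> 2 ^ c * K"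
proof (induction c arbitrary: f K)
  case (Suc c)
  have "\<bar>f (Suc j) - f j\<bar> \<le> 2 * K" if "j \<le> n + c" for j
    using Suc.prems[of j] Suc.prems[of "Suc j"] that by simp
  then have "\<bar>fdiff c (\<lambda>n. f (Suc n) - f n) n\<bar> \<le> 2 ^ c * (2 * K)" by (rule Suc.IH)
  then show ?case by simp
qed simp

subsection \<open>Flags\<close>

context root_datum_part
begin

text \<open>A point of the affine cone over the flag variety, given as a character of the graded
  ring of sections. Its values at the vectors \<open>V k ks\<close> are the generalised
  minors.\<close>

definition flag :: "(('i \<Rightarrow> real) \<Rightarrow> 'i wf \<Rightarrow> real) \<Rightarrow> bool" where
  "flag \<xi> \<longleftrightarrow> (\<forall>l. linear_within (Q l) (\<xi> l)) \<and>
     (\<forall>l m x y. x \<in> Q l \<longrightarrow> y \<in> Q m \<longrightarrow> \<xi> (\<lambda>i. l i + m i) (sh x y) = \<xi> l x * \<xi> m y)"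

lemma flag_linear: "flag \<xi> \<Longrightarrow> linear_within (Q l) (\<xi> l)" by (simp add: flag_def)
lemma flag_sh: "flag \<xi> \<Longrightarrow> x \<in> Q l \<Longrightarrow> y \<in> Q m \<Longrightarrow> \<xi> (\<lambda>i. l i + m i) (sh x y) = \<xi> l x * \<xi> m y" by (simp add: flag_def)
lemma flag_add: "flag \<xi> \<Longrightarrow> x \<in> Q l \<Longrightarrow> y \<in> Q l \<Longrightarrow> \<xi> l (x + y) = \<xi> l x + \<xi> l y"
  using linear_withinD(1)[OF flag_linear] by blast
lemma flag_scale: "flag \<xi> \<Longrightarrow> x \<in> Q l \<Longrightarrow> \<xi> l (c *\<^sub>R x) = c * \<xi> l x"
  using linear_withinD(2)[OF flag_linear] by (metis real_scaleR_def)

text \<open>The base point moved by the torus element with coordinates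
  \<open>\<tau>\<close>.\<close>

lemma flag_base: "flag (\<lambda>l x. (\<Prod>i\<in>J. \<tau> i powr l i) * ev x [])"
  by (auto simp: flag_def linear_within_def powr_add prod.distrib algebra_simps)

lemma flag_base_wd: assumes "k \<in> J" "\<tau> k > 0" shows "(\<Prod>i\<in>J. \<tau> i powr om k i) * ev wd [] = \<tau> k \<or> (\<exists>i\<in>J. \<tau> i \<le> 0)"
proof (cases "\<exists>i\<in>J. \<tau> i \<le> 0")
  case False
  then have "(\<Prod>i\<in>J. \<tau> i powr om k i) = (\<Prod>i\<in>J. if i = k then \<tau> k else 1)"
    by (intro prod.cong) (auto simp: om_def not_le)
  then show ?thesis using assms finite_J by (simp add: wd_def)
qed simp

lemma flag_transform:
  assumes f: "flag \<xi>" and lin: "\<And>l. linear_within (Q l) (T l)" and cl: "\<And>l x. x \<in> Q l \<Longrightarrow> T l x \<in> Q l"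
    and m: "\<And>l m x y. x \<in> Q l \<Longrightarrow> y \<in> Q m \<Longrightarrow> T (\<lambda>i. l i + m i) (sh x y) = sh (T l x) (T m y)"
  shows "flag (\<lambda>l x. \<xi> l (T l x))"
  unfolding flag_def linear_within_def
  using linear_withinD[OF lin] by (auto simp: cl m flag_sh[OF f] flag_add[OF f] flag_scale[OF f])

lemma flag_srw: "flag \<xi> \<Longrightarrow> ks \<in> lists J \<Longrightarrow> flag (\<lambda>l x. \<xi> l (srw l ks x))"
proof (induction ks rule: list.induct)
  case (Cons j ks)
  have lin: "linear_within (Q l) (srw l xs)" if "xs \<in> lists J" for l xs
    using that
  proof (induction xs rule: list.induct)
    case (Cons j xs)
    then show ?case using K.linear_within_comp[OF R_linear[of j l 1], of "srw l xs"] srw_closed by auto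
  qed (simp add: linear_within_def)
  show ?case
    by (rule flag_transform[OF Cons.prems(1)]) (use Cons.prems lin[of "j # ks"] srw_closed srw_sh in \<open>auto simp del: srw.simps\<close>)
qed simp

lemma flag_step:
  assumes f: "flag \<xi>" and s: "s \<in> J"
  shows "flag (\<lambda>l x. \<xi> l (ex b (wE s) (R l s (- 1) x)))"
proof (rule flag_transform[OF f])
  fix l
  interpret Z: sl2_module "Q l" "wE s" "wF a l s" "wH a l s" using K.sl2[OF s] .
  show "linear_within (Q l) (\<lambda>x. ex b (wE s) (R l s (- 1) x))"
    by (rule K.linear_within_comp[OF _ R_linear[OF s] R_closed[OF s]]) (simp add: linear_within_def Z.exE_add Z.exE_scale)
  show "ex b (wE s) (R l s (- 1) x) \<in> Q l" if "x \<in> Q l" for x using that by (simp add: Z.exE_closed R_closed s)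
next
  fix l m x y assume "x \<in> Q l" "y \<in> Q m"
  then show "ex b (wE s) (R (\<lambda>i. l i + m i) s (- 1) (sh x y)) = sh (ex b (wE s) (R l s (- 1) x)) (ex b (wE s) (R m s (- 1) y))"
    unfolding R_sh[OF s \<open>x \<in> Q l\<close> \<open>y \<in> Q m\<close>]
    by (intro ex_sh[OF linear_wE linear_wE linear_wE wE_sh] nil_wE) (auto intro: R_closed s)
qed

lemma pluecker3_flag:
  assumes f: "flag \<xi>" and ij: "i \<in> J" "j \<in> J" "i \<noteq> j" "a i j = -1" "a j i = -1"
  defines "A \<equiv> \<lambda>ks. \<xi> (om i) (V i ks)" and "C \<equiv> \<lambda>ks. \<xi> (om j) (V j ks)"
  shows "A [i] * C [j] = A [] * C [i, j] + A [j, i] * C []"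
proof -
  have "\<xi> (\<lambda>k. om i k + om j k) (sh (V i [i]) (V j [j])) = \<xi> (\<lambda>k. om i k + om j k) (sh (V i []) (V j [i, j]) + sh (V i [j, i]) (V j []))"
    using pluecker3[OF ij] by simp
  then show ?thesis unfolding A_def C_def using ij by (simp add: flag_add[OF f] Q_sh V_Q flag_sh[OF f])
qed

lemma pluecker4_flag:
  assumes f: "flag \<xi>" and ij: "i \<in> J" "j \<in> J" "i \<noteq> j" "a i j = -1" "a j i = -2"
  defines "A \<equiv> \<lambda>ks. \<xi> (om i) (V i ks)" and "C \<equiv> \<lambda>ks. \<xi> (om j) (V j ks)"
  shows "\<exists>b. A [i] * C [j] = A [] * C [i, j] + b * C [] \<and> b * C [j] = A [j, i] * C [] + A [] * C [j, i, j] \<and>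
    b * C [i, j] = A [i] * C [j, i, j] + A [i, j, i] * C [] \<and> A [j, i] * C [i, j] = A [i, j, i] * C [j] + b * C [j, i, j] \<and>
    A [i] * A [j, i] = A [] * A [i, j, i] + b * b"
proof -
  obtain B where B: "B \<in> Q (om i)" and e: "sh (V i [i]) (V j [j]) = sh (V i []) (V j [i, j]) + sh B (V j [])"
    "sh B (V j [j]) = sh (V i [j, i]) (V j []) + sh (V i []) (V j [j, i, j])"
    "sh B (V j [i, j]) = sh (V i [i]) (V j [j, i, j]) + sh (V i [i, j, i]) (V j [])"
    "sh (V i [j, i]) (V j [i, j]) = sh (V i [i, j, i]) (V j [j]) + sh B (V j [j, i, j])"
    "sh (V i [i]) (V i [j, i]) = sh (V i []) (V i [i, j, i]) + sh B B"
    using pluecker4[OF ij] by blast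
  have L: "xs \<in> lists {i, j} \<Longrightarrow> V k xs \<in> Q (om k)" for k xs using V_Q[of xs k] ij by (auto simp: lists_eq_set)
  have t: "\<xi> l1 x1 * \<xi> m1 y1 = \<xi> l2 x2 * \<xi> m2 y2 + \<xi> l3 x3 * \<xi> m3 y3"
    if "sh x1 y1 = sh x2 y2 + sh x3 y3" "x1 \<in> Q l1" "y1 \<in> Q m1" "x2 \<in> Q l2" "y2 \<in> Q m2" "x3 \<in> Q l3" "y3 \<in> Q m3"
      "l2 = l1" "m2 = m1" "l3 = l1" "m3 = m1" for x1 y1 x2 y2 x3 y3 l1 m1 l2 m2 l3 m3
  proof -
    have "\<xi> (\<lambda>k. l1 k + m1 k) (sh x1 y1) = \<xi> (\<lambda>k. l1 k + m1 k) (sh x2 y2 + sh x3 y3)" using that(1) by simp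
    then show ?thesis using that(2-) by (simp add: flag_add[OF f] Q_sh flag_sh[OF f])
  qed
  show ?thesis
    unfolding A_def C_def
    by (rule exI[of _ "\<xi> (om i) B"], intro conjI; rule t; (rule e B L | simp)+)
qed

end

section \<open>Solving the rank 2 relations for orders of magnitude\<close>

text \<open>Each equation selected has one unknown times a known positive minor on the left and only
  sums of products on the right, solved first for the nonextremal \<open>b\<close>. Substituting the
  order of \<open>b\<close> turns the results into the tropical hypotheses. This version knows the
  side with \<open>C1\<close> and \<open>A2\<close>, the next one the side with \<open>A1\<close>
  and \<open>C2\<close>.\<close>

lemma magnitude_solve4a:
  fixes a0 a1 a2 a3 c0 c1 c2 c3 :: int
  assumes as: "magnitude A0 a0" "magnitude C0 c0" "magnitude C1 c1" "magnitude A2 a2" "magnitude C3 c3" "magnitude A3 a3"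
    and eq: "\<And>q. 0 < q \<Longrightarrow> q \<le> 1 \<Longrightarrow> C1 q * b q = A2 q * C0 q + A0 q * C3 q"
      "\<And>q. 0 < q \<Longrightarrow> q \<le> 1 \<Longrightarrow> A2 q * A1 q = A0 q * A3 q + b q * b q"
      "\<And>q. 0 < q \<Longrightarrow> q \<le> 1 \<Longrightarrow> A2 q * C2 q = A3 q * C1 q + b q * C3 q"
    and t: "c2 + c1 + a2 = min (2 * c1 + a3) (min (2 * c3 + a0) (c3 + c0 + a2))"
      "a1 + 2 * c1 + a2 = min (2 * c3 + 2 * a0) (min (2 * c0 + 2 * a2) (a0 + 2 * c1 + a3))"
  shows "magnitude A1 a1" "magnitude C2 c2"
proof -
  have b: "magnitude b (min (a2 + c0) (a0 + c3) - c1)"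
    by (rule magnitude_solve[OF as(3) magnitude_add[OF magnitude_mult[OF as(4,2)] magnitude_mult[OF as(1,5)]] eq(1)])
  have "magnitude A1 (min (a0 + a3) (min (a2 + c0) (a0 + c3) - c1 + (min (a2 + c0) (a0 + c3) - c1)) - a2)"
    by (rule magnitude_solve[OF as(4) magnitude_add[OF magnitude_mult[OF as(1,6)] magnitude_mult[OF b b]] eq(2)])
  moreover have "min (a0 + a3) (min (a2 + c0) (a0 + c3) - c1 + (min (a2 + c0) (a0 + c3) - c1)) - a2 = a1"
    using t(2) by linarith
  ultimately show "magnitude A1 a1" by simp
  have "magnitude C2 (min (a3 + c1) (min (a2 + c0) (a0 + c3) - c1 + c3) - a2)"
    by (rule magnitude_solve[OF as(4) magnitude_add[OF magnitude_mult[OF as(6,3)] magnitude_mult[OF b as(5)]] eq(3)])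
  moreover have "min (a3 + c1) (min (a2 + c0) (a0 + c3) - c1 + c3) - a2 = c2"
    using t(1) by linarith
  ultimately show "magnitude C2 c2" by simp
qed

lemma magnitude_solve4b:
  fixes a0 a1 a2 a3 c0 c1 c2 c3 :: int
  assumes as: "magnitude A0 a0" "magnitude C0 c0" "magnitude A1 a1" "magnitude C2 c2" "magnitude A3 a3" "magnitude C3 c3"
    and eq: "\<And>q. 0 < q \<Longrightarrow> q \<le> 1 \<Longrightarrow> C2 q * b q = A1 q * C3 q + A3 q * C0 q"
      "\<And>q. 0 < q \<Longrightarrow> q \<le> 1 \<Longrightarrow> A1 q * C1 q = A0 q * C2 q + b q * C0 q"
      "\<And>q. 0 < q \<Longrightarrow> q \<le> 1 \<Longrightarrow> C2 q * A2 q = A3 q * C1 q + b q * C3 q"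
    and t: "c1 + c2 + a1 = min (2 * c2 + a0) (min (2 * c0 + a3) (c0 + c3 + a1))"
      "a2 + 2 * c2 + a1 = min (2 * c0 + 2 * a3) (min (2 * c3 + 2 * a1) (a3 + 2 * c2 + a0))"
  shows "magnitude C1 c1" "magnitude A2 a2"
proof -
  have b: "magnitude b (min (a1 + c3) (a3 + c0) - c2)"
    by (rule magnitude_solve[OF as(4) magnitude_add[OF magnitude_mult[OF as(3,6)] magnitude_mult[OF as(5,2)]] eq(1)])
  have "magnitude C1 (min (a0 + c2) (min (a1 + c3) (a3 + c0) - c2 + c0) - a1)"
    by (rule magnitude_solve[OF as(3) magnitude_add[OF magnitude_mult[OF as(1,4)] magnitude_mult[OF b as(2)]] eq(2)])
  moreover have "min (a0 + c2) (min (a1 + c3) (a3 + c0) - c2 + c0) - a1 = c1"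
    using t(1) by linarith
  ultimately show C1: "magnitude C1 c1" by simp
  have "magnitude A2 (min (a3 + c1) (min (a1 + c3) (a3 + c0) - c2 + c3) - c2)"
    by (rule magnitude_solve[OF as(4) magnitude_add[OF magnitude_mult[OF as(5) C1] magnitude_mult[OF b as(6)]] eq(3)])
  moreover have "min (a3 + c1) (min (a1 + c3) (a3 + c0) - c2 + c3) - c2 = a2"
    using t by linarith
  ultimately show "magnitude A2 a2" by simp
qed

context root_datum
begin

lemma chamber_other:
  assumes "w \<in> weyl" "c \<in> I" "k \<in> I" "c \<noteq> k"
  shows "chamber_weight (w \<circ> srefl c) k = chamber_weight w k"
  using assms by (auto simp: chamber_weight_def inv_comp fun_eq_iff srefl_def fund_weight_coroot)

text \<open>Seen from the longest element of a rank 2 coset, the relations take the form they have at the shortest one.\<close>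

lemma tropical3:
  assumes w: "w \<in> weyl" and ij: "i \<in> I" "j \<in> I" "i \<noteq> j" "a i j = -1" "a j i = -1"
    and T: "T = w \<circ> word [i, j, i]" and p: "tropical_pluecker_at M w i j"
  defines "m \<equiv> \<lambda>ks k. M (chamber_weight (T \<circ> word ks) k)"
  shows "m [i] i + m [j] j = min (m [] i + m [i, j] j) (m [j, i] i + m [] j)"
proof -
  have "mm i j = Suc (Suc (Suc 0))" using ij by (simp add: mm_def)
  then have "word [i, j, i] = word [j, i, j]" using braid[OF ij(1-3)] by simp
  then have "T = w \<circ> word [j, i, j]" using T by (simp only:)
  then have T1: "T = w \<circ> srefl i \<circ> srefl j \<circ> srefl i" and T2: "T = w \<circ> srefl j \<circ> srefl i \<circ> srefl j"
    using T by (simp_all only: word_Cons word_Nil comp_id o_assoc)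
  note o = chamber_other w ij(1-3) ij(3)[symmetric] o_assoc
  have "m [] i = M (chamber_weight (w \<circ> word [j, i]) i)" "m [i] i = M (chamber_weight (w \<circ> word [i]) i)" "m [i, j] j = M (chamber_weight w j)"
    unfolding m_def T2 by (simp_all add: o, simp_all add: T2[symmetric] T1 o)
  moreover have "m [] j = M (chamber_weight (w \<circ> word [i, j]) j)" "m [j] j = M (chamber_weight (w \<circ> word [j]) j)" "m [j, i] i = M (chamber_weight w i)"
    unfolding m_def T1 by (simp_all add: o, simp_all add: T1[symmetric] T2 o)
  ultimately show ?thesis using p ij(4,5) unfolding tropical_pluecker_at_def Let_def by simp
qed

lemma tropical4:
  assumes w: "w \<in> weyl" and ij: "i \<in> I" "j \<in> I" "i \<noteq> j" "a i j = -1" "a j i = -2"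
    and T: "T = w \<circ> word [i, j, i, j]" and p: "tropical_pluecker_at M w i j" "tropical_pluecker_at M w j i"
  defines "m \<equiv> \<lambda>ks k. M (chamber_weight (T \<circ> word ks) k)"
  shows "m [j] j + m [i, j] j + m [i] i = min (2 * m [i, j] j + m [] i) (min (2 * m [] j + m [i, j, i] i) (m [] j + m [j, i, j] j + m [i] i))"
    "m [j, i] i + 2 * m [i, j] j + m [i] i = min (2 * m [] j + 2 * m [i, j, i] i) (min (2 * m [j, i, j] j + 2 * m [i] i) (m [i, j, i] i + 2 * m [i, j] j + m [] i))"
    "m [i, j] j + m [j] j + m [j, i] i = min (2 * m [j] j + m [i, j, i] i) (min (2 * m [j, i, j] j + m [] i) (m [j, i, j] j + m [] j + m [j, i] i))"
    "m [i] i + 2 * m [j] j + m [j, i] i = min (2 * m [j, i, j] j + 2 * m [] i) (min (2 * m [] j + 2 * m [j, i] i) (m [] i + 2 * m [j] j + m [i, j, i] i))"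
proof -
  have "mm i j = Suc (Suc (Suc (Suc 0)))" using ij by (simp add: mm_def)
  then have "word [i, j, i, j] = word [j, i, j, i]" using braid[OF ij(1-3)] by simp
  then have "T = w \<circ> word [j, i, j, i]" using T by (simp only:)
  then have T1: "T = w \<circ> srefl i \<circ> srefl j \<circ> srefl i \<circ> srefl j" and T2: "T = w \<circ> srefl j \<circ> srefl i \<circ> srefl j \<circ> srefl i"
    using T by (simp_all only: word_Cons word_Nil comp_id o_assoc)
  note o = chamber_other w ij(1-3) ij(3)[symmetric] o_assoc
  have "m [] i = M (chamber_weight (w \<circ> word [i, j, i]) i)" "m [j, i] i = M (chamber_weight (w \<circ> word [i]) i)"
    "m [j] j = M (chamber_weight (w \<circ> word [i, j]) j)" "m [j, i, j] j = M (chamber_weight w j)"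
    unfolding m_def T1 by (simp_all add: o)
  moreover have "m [] j = M (chamber_weight (w \<circ> word [j, i, j]) j)" "m [i, j] j = M (chamber_weight (w \<circ> word [j]) j)"
    "m [i] i = M (chamber_weight (w \<circ> word [j, i]) i)" "m [i, j, i] i = M (chamber_weight w i)"
    unfolding m_def T2 by (simp_all add: o)
  ultimately show "m [j] j + m [i, j] j + m [i] i = min (2 * m [i, j] j + m [] i) (min (2 * m [] j + m [i, j, i] i) (m [] j + m [j, i, j] j + m [i] i))"
    "m [j, i] i + 2 * m [i, j] j + m [i] i = min (2 * m [] j + 2 * m [i, j, i] i) (min (2 * m [j, i, j] j + 2 * m [i] i) (m [i, j, i] i + 2 * m [i, j] j + m [] i))"
    "m [i, j] j + m [j] j + m [j, i] i = min (2 * m [j] j + m [i, j, i] i) (min (2 * m [j, i, j] j + m [] i) (m [j, i, j] j + m [] j + m [j, i] i))"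
    "m [i] i + 2 * m [j] j + m [j, i] i = min (2 * m [j, i, j] j + 2 * m [] i) (min (2 * m [] j + 2 * m [j, i] i) (m [] i + 2 * m [j] j + m [i, j, i] i))"
    using p ij(4,5) unfolding tropical_pluecker_at_def Let_def by (simp_all add: add_ac)
qed

text \<open>Flags are read from the longest element \<open>T\<close> of a coset, whereas the
  tropical relations are imposed at its shortest element.\<close>

lemma coset_bottom:
  assumes T: "T \<in> weyl" and st: "s \<in> I" "t \<in> I" "s \<noteq> t" and d: "len (T \<circ> word (alt (mm s t) s t)) + mm s t = len T"
  obtains w where "w \<in> weyl" "len w < len (w \<circ> srefl s)" "len w < len (w \<circ> srefl t)"
    "T = w \<circ> word (alt (mm s t) s t)" "T = w \<circ> word (alt (mm s t) t s)"
proof -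
  define m where "m = mm s t"
  have b: "word (alt m s t) = word (alt m t s)" unfolding m_def using braid[OF st] .
  define w where "w = T \<circ> word (alt m s t)"
  have L: "alt k s t \<in> lists I" "alt k t s \<in> lists I" for k using alt_lists st by auto
  have w: "w \<in> weyl" unfolding w_def using weyl_comp[OF T weyl_word[OF L(1)]] .
  have "word (alt m s t) \<circ> word (rev (alt m s t)) = id" using word_rev_right[OF L(1)] .
  then have "T = w \<circ> word (rev (alt m s t))" unfolding w_def by (metis comp_assoc comp_id)
  moreover have "word (rev (alt m s t)) = word (alt m s t)"
    by (cases "even m") (simp_all only: rev_alt if_True if_False b)
  ultimately have Te1: "T = w \<circ> word (alt m s t)" by (simp only:)
  then have Te2: "T = w \<circ> word (alt m t s)" by (simp only: b)
  have lT: "len T = len w + m" using d unfolding w_def m_def by simp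
  have "m \<noteq> 0" unfolding m_def by (simp add: mm_def Let_def)
  then obtain k where k: "m = Suc k" using not0_implies_Suc by blast
  have asc: "len w < len (w \<circ> srefl c)" if c: "c \<in> I" and v: "v \<in> lists I" "length v = k" "T = w \<circ> word (c # v)" for c v
  proof -
    have "T = (w \<circ> srefl c) \<circ> word v" using v(3) by (simp add: o_assoc)
    then have "len T \<le> len (w \<circ> srefl c) + k"
      using len_comp_le[of "w \<circ> srefl c" "word v"] w c weyl_word[OF v(1)] len_word_le[OF v(1)] v(2) by simp
    then show ?thesis using lT k by simp
  qed
  have c1: "T = w \<circ> word ((if even k then s else t) # alt k s t)" using Te1 unfolding k alt.simps .
  have c2: "T = w \<circ> word ((if even k then t else s) # alt k t s)" using Te2 unfolding k alt.simps .
  have "len w < len (w \<circ> srefl s) \<and> len w < len (w \<circ> srefl t)"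
  proof (cases "even k")
    case True
    then have "T = w \<circ> word (s # alt k s t)" "T = w \<circ> word (t # alt k t s)" using c1 c2 by (simp_all only: if_True)
    from asc[OF st(1) L(1) length_alt this(1)] asc[OF st(2) L(2) length_alt this(2)] show ?thesis by (rule conjI)
  next
    case False
    then have "T = w \<circ> word (s # alt k t s)" "T = w \<circ> word (t # alt k s t)" using c1 c2 by (simp_all only: if_False)
    from asc[OF st(1) L(2) length_alt this(1)] asc[OF st(2) L(1) length_alt this(2)] show ?thesis by (rule conjI)
  qed
  then show thesis using that[OF w _ _ Te1[unfolded m_def] Te2[unfolded m_def]] by blast
qed

end

context root_datum_part
begin

definition good_at :: "(('v \<Rightarrow> real) \<Rightarrow> int) \<Rightarrow> ('v \<Rightarrow> 'v) \<Rightarrow> (real \<Rightarrow> ('i \<Rightarrow> real) \<Rightarrow> 'i wf \<Rightarrow> real) \<Rightarrow> 'i \<Rightarrow> 'i list \<Rightarrow> bool" where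
  "good_at M T X i p \<longleftrightarrow> magnitude (\<lambda>q. X q (om i) (V i p)) (M (chamber_weight (T \<circ> word p) i))"

lemma good_at_strip:
  assumes "T \<in> weyl" "p \<in> lists J" "c \<in> J" "i \<in> J" "c \<noteq> i"
  shows "good_at M T X i (p @ [c]) \<longleftrightarrow> good_at M T X i p"
proof -
  have "chamber_weight (T \<circ> word (p @ [c])) i = chamber_weight (T \<circ> word p) i"
    unfolding word_snoc o_assoc using chamber_other[of "T \<circ> word p" c i] weyl_word[of p] assms by simp
  then show ?thesis unfolding good_at_def V_snoc_other[OF assms(2,3,4,5)] by simp
qed

text \<open>Both words have the same product and trailing letters other than \<open>i\<close> are
  irrelevant, so only minors strictly between top and bottom are new. The Pluecker relations
  determine their orders, and the tropical relations say that these are the entries of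
  \<open>M\<close>.\<close>

lemma good_at_rank2:
  assumes T: "T \<in> weyl" and st: "s \<in> J" "t \<in> J" "s \<noteq> t" and X: "\<And>q. 0 < q \<Longrightarrow> q \<le> 1 \<Longrightarrow> flag (X q)"
    and M: "tropical_pluecker M" and d: "len (T \<circ> word (alt (mm s t) s t)) + mm s t = len T"
    and known: "\<And>i xs ys. i \<in> J \<Longrightarrow> alt (mm s t) s t = xs @ ys \<Longrightarrow> good_at M T X i xs"
    and i: "i \<in> J" and xs: "alt (mm s t) t s = xs @ ys"
  shows "good_at M T X i xs"
proof -
  have I: "s \<in> I" "t \<in> I" using st by auto
  obtain w where w: "w \<in> weyl" "len w < len (w \<circ> srefl s)" "len w < len (w \<circ> srefl t)"
    "T = w \<circ> word (alt (mm s t) s t)" "T = w \<circ> word (alt (mm s t) t s)"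
    by (rule coset_bottom[OF T I st(3) d])
  have tp: "tropical_pluecker_at M w s t" "tropical_pluecker_at M w t s"
    using M w(1-3) I st(3) unfolding tropical_pluecker_def by auto
  define P where "P = good_at M T X"
  have strip: "P i (p @ [c]) \<longleftrightarrow> P i p" if "p \<in> lists {s, t}" "c \<in> {s, t}" "i \<in> J" "c \<noteq> i" for i p c
    unfolding P_def by (rule good_at_strip[OF T]) (use that st in \<open>auto simp: lists_eq_set\<close>)
  have swap: "P i (alt (mm s t) t s) = P i (alt (mm s t) s t)" for i
    unfolding P_def good_at_def V_def srw_braid[OF st wd_Q] braid[OF I st(3)] ..
  have kn: "P i xs" if "i \<in> J" "alt (mm s t) s t = xs @ ys" for i xs ys using known that unfolding P_def .
  have "P i xs"
    using I st(3)
  proof (cases rule: cartan_cases)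
    case 1
    then have m: "mm s t = 2" by (simp add: mm_def)
    note k = kn[unfolded m alt_small] and sw = swap[unfolded m alt_small] and xs = xs[unfolded m alt_small]
    have G1: "P i [s]" if "i \<in> J" for i
    proof (cases "i = s")
      case True
      then show ?thesis using sw[of s] k[of s "[t, s]" "[]"] strip[of "[s]" t s] st by simp
    qed (use that strip[of "[]" s i] k[of i "[]" "[t, s]"] in simp)
    have "P i [s, t]" using sw k[of i "[t, s]" "[]"] i by simp
    then show ?thesis using xs G1[OF i] k[of i "[]" "[t, s]"] i by (auto simp: Cons_eq_append_conv)
  next
    case 2
    then have m: "mm s t = 3" by (simp add: mm_def)
    note k = kn[unfolded m alt_small] and sw = swap[unfolded m alt_small] and xs = xs[unfolded m alt_small]
    have K: "P i []" "P i [s]" "P i [s, t]" "P i [s, t, s]" if "i \<in> J" for i using k[OF that, of "[]"] k[OF that, of "[s]"] k[OF that, of "[s, t]"] k[OF that, of "[s, t, s]"] by simp_all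
    have G3: "P i [t, s, t]" if "i \<in> J" for i using sw[of i] K(4)[OF that] by simp
    have A2: "P s [t, s]" using G3[OF st(1)] strip[of "[t, s]" t s] st by simp
    have C1: "P t [t]"
    proof -
      have "tropical_pluecker_at M w s t" "T = w \<circ> word [s, t, s]" using tp w(4) unfolding m alt_small by auto
      note tr = tropical3[OF w(1) I st(3) 2 this(2,1)]
      show ?thesis unfolding P_def good_at_def
      proof (rule back_subst[of "magnitude _"])
        show "magnitude (\<lambda>q. X q (om t) (V t [t])) (min (M (chamber_weight (T \<circ> word []) s) + M (chamber_weight (T \<circ> word [s, t]) t))
           (M (chamber_weight (T \<circ> word [t, s]) s) + M (chamber_weight (T \<circ> word []) t)) - M (chamber_weight (T \<circ> word [s]) s))"
          by (rule magnitude_solve[OF K(2)[OF st(1), unfolded P_def good_at_def]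
              magnitude_add[OF magnitude_mult[OF K(1)[OF st(1), unfolded P_def good_at_def] K(3)[OF st(2), unfolded P_def good_at_def]]
                magnitude_mult[OF A2[unfolded P_def good_at_def] K(1)[OF st(2), unfolded P_def good_at_def]]]])
            (rule pluecker3_flag[OF X st 2])
      qed (use tr in simp)
    qed
    have G1: "P i [t]" if "i \<in> J" for i
      using C1 that strip[of "[]" t i] K(1)[OF that] by (cases "i = t") auto
    have G2: "P i [t, s]" if "i \<in> J" for i
      using A2 that strip[of "[t]" s i] G1[OF that] by (cases "i = s") auto
    show ?thesis using xs K(1)[OF i] G1[OF i] G2[OF i] G3[OF i] by (auto simp: Cons_eq_append_conv)
  next
    case 5
    then show ?thesis using J_prod[OF st] by simp
  next
    case 6
    then show ?thesis using J_prod[OF st] by simp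
  next
    case 3
    then have m: "mm s t = 4" by (simp add: mm_def)
    note k = kn[unfolded m alt_small] and sw = swap[unfolded m alt_small] and xs = xs[unfolded m alt_small]
    have K: "P i []" "P i [t]" "P i [t, s]" "P i [t, s, t]" "P i [t, s, t, s]" if "i \<in> J" for i
      using k[OF that, of "[]"] k[OF that, of "[t]"] k[OF that, of "[t, s]"] k[OF that, of "[t, s, t]"] k[OF that, of "[t, s, t, s]"] by simp_all
    have G4: "P i [s, t, s, t]" if "i \<in> J" for i using sw[of i] K(5)[OF that] by simp
    have A3: "P s [s, t, s]" using G4[OF st(1)] strip[of "[s, t, s]" t s] st by simp
    have "T = w \<circ> word [s, t, s, t]" using w(5) unfolding m alt_small .
    note tr = tropical4[OF w(1) I st(3) 3 this tp]
    \<comment> \<open>The nonextremal minor is found for each \<open>q\<close> separately; choosing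
      it as a function of \<open>q\<close> allows its order to be computed.\<close>
    have "\<forall>q. \<exists>b. 0 < q \<longrightarrow> q \<le> 1 \<longrightarrow> (\<lambda>A C. A [s] * C [t] = A [] * C [s, t] + b * C [] \<and> b * C [t] = A [t, s] * C [] + A [] * C [t, s, t] \<and>
      b * C [s, t] = A [s] * C [t, s, t] + A [s, t, s] * C [] \<and> A [t, s] * C [s, t] = A [s, t, s] * C [t] + b * C [t, s, t] \<and>
      A [s] * A [t, s] = A [] * A [s, t, s] + b * b) (\<lambda>p. X q (om s) (V s p)) (\<lambda>p. X q (om t) (V t p))"
      using pluecker4_flag[OF X st 3] by blast
    from choice[OF this] obtain b where b: "\<And>q. 0 < q \<Longrightarrow> q \<le> 1 \<Longrightarrow> (\<lambda>A C. A [s] * C [t] = A [] * C [s, t] + b q * C [] \<and> b q * C [t] = A [t, s] * C [] + A [] * C [t, s, t] \<and>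
      b q * C [s, t] = A [s] * C [t, s, t] + A [s, t, s] * C [] \<and> A [t, s] * C [s, t] = A [s, t, s] * C [t] + b q * C [t, s, t] \<and>
      A [s] * A [t, s] = A [] * A [s, t, s] + b q * b q) (\<lambda>p. X q (om s) (V s p)) (\<lambda>p. X q (om t) (V t p))" by blast
    have e: "X q (om t) (V t [t]) * b q = X q (om s) (V s [t, s]) * X q (om t) (V t []) + X q (om s) (V s []) * X q (om t) (V t [t, s, t])"
      "X q (om s) (V s [t, s]) * X q (om s) (V s [s]) = X q (om s) (V s []) * X q (om s) (V s [s, t, s]) + b q * b q"
      "X q (om s) (V s [t, s]) * X q (om t) (V t [s, t]) = X q (om s) (V s [s, t, s]) * X q (om t) (V t [t]) + b q * X q (om t) (V t [t, s, t])"
      if "0 < q" "q \<le> 1" for q using b[OF that] by (simp_all add: mult.commute)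
    have X12a: "P s [s]"
      unfolding P_def good_at_def by (rule magnitude_solve4a(1)[OF K(1)[OF st(1), unfolded P_def good_at_def] K(1)[OF st(2), unfolded P_def good_at_def] K(2)[OF st(2), unfolded P_def good_at_def]
         K(3)[OF st(1), unfolded P_def good_at_def] K(4)[OF st(2), unfolded P_def good_at_def] A3[unfolded P_def good_at_def] e(1) e(2) e(3) tr(3,4)]; assumption)
    have X12b: "P t [s, t]"
      unfolding P_def good_at_def by (rule magnitude_solve4a(2)[OF K(1)[OF st(1), unfolded P_def good_at_def] K(1)[OF st(2), unfolded P_def good_at_def] K(2)[OF st(2), unfolded P_def good_at_def]
         K(3)[OF st(1), unfolded P_def good_at_def] K(4)[OF st(2), unfolded P_def good_at_def] A3[unfolded P_def good_at_def] e(1) e(2) e(3) tr(3,4)]; assumption)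
    note X12 = X12a X12b
    have G1: "P i [s]" if "i \<in> J" for i
      using X12(1) that strip[of "[]" s i] K(1)[OF that] by (cases "i = s") auto
    have G2: "P i [s, t]" if "i \<in> J" for i
      using X12(2) that strip[of "[s]" t i] G1[OF that] by (cases "i = t") auto
    have G3: "P i [s, t, s]" if "i \<in> J" for i
      using A3 that strip[of "[s, t]" s i] G2[OF that] by (cases "i = s") auto
    show ?thesis using xs K(1)[OF i] G1[OF i] G2[OF i] G3[OF i] G4[OF i] by (auto simp: Cons_eq_append_conv)
  next
    case 4
    then have m: "mm s t = 4" by (simp add: mm_def)
    note k = kn[unfolded m alt_small] and sw = swap[unfolded m alt_small] and xs = xs[unfolded m alt_small]
    have K: "P i []" "P i [t]" "P i [t, s]" "P i [t, s, t]" "P i [t, s, t, s]" if "i \<in> J" for i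
      using k[OF that, of "[]"] k[OF that, of "[t]"] k[OF that, of "[t, s]"] k[OF that, of "[t, s, t]"] k[OF that, of "[t, s, t, s]"] by simp_all
    have G4: "P i [s, t, s, t]" if "i \<in> J" for i using sw[of i] K(5)[OF that] by simp
    have C3: "P s [s, t, s]" using G4[OF st(1)] strip[of "[s, t, s]" t s] st by simp
    have "T = w \<circ> word [t, s, t, s]" using w(4) unfolding m alt_small .
    note tr = tropical4[OF w(1) I(2,1) st(3)[symmetric] 4(2,1) this tp(2,1)]
    have "\<forall>q. \<exists>b. 0 < q \<longrightarrow> q \<le> 1 \<longrightarrow> (\<lambda>A C. A [t] * C [s] = A [] * C [t, s] + b * C [] \<and> b * C [s] = A [s, t] * C [] + A [] * C [s, t, s] \<and>
      b * C [t, s] = A [t] * C [s, t, s] + A [t, s, t] * C [] \<and> A [s, t] * C [t, s] = A [t, s, t] * C [s] + b * C [s, t, s] \<and>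
      A [t] * A [s, t] = A [] * A [t, s, t] + b * b) (\<lambda>p. X q (om t) (V t p)) (\<lambda>p. X q (om s) (V s p))"
      using pluecker4_flag[OF X st(2,1) st(3)[symmetric] 4(2,1)] by blast
    from choice[OF this] obtain b where b: "\<And>q. 0 < q \<Longrightarrow> q \<le> 1 \<Longrightarrow> (\<lambda>A C. A [t] * C [s] = A [] * C [t, s] + b q * C [] \<and> b q * C [s] = A [s, t] * C [] + A [] * C [s, t, s] \<and>
      b q * C [t, s] = A [t] * C [s, t, s] + A [t, s, t] * C [] \<and> A [s, t] * C [t, s] = A [t, s, t] * C [s] + b q * C [s, t, s] \<and>
      A [t] * A [s, t] = A [] * A [t, s, t] + b q * b q) (\<lambda>p. X q (om t) (V t p)) (\<lambda>p. X q (om s) (V s p))" by blast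
    have e: "X q (om s) (V s [t, s]) * b q = X q (om t) (V t [t]) * X q (om s) (V s [s, t, s]) + X q (om t) (V t [t, s, t]) * X q (om s) (V s [])"
      "X q (om t) (V t [t]) * X q (om s) (V s [s]) = X q (om t) (V t []) * X q (om s) (V s [t, s]) + b q * X q (om s) (V s [])"
      "X q (om s) (V s [t, s]) * X q (om t) (V t [s, t]) = X q (om t) (V t [t, s, t]) * X q (om s) (V s [s]) + b q * X q (om s) (V s [s, t, s])"
      if "0 < q" "q \<le> 1" for q using b[OF that] by (simp_all add: mult.commute)
    have X12a: "P s [s]"
      unfolding P_def good_at_def by (rule magnitude_solve4b(1)[OF K(1)[OF st(2), unfolded P_def good_at_def] K(1)[OF st(1), unfolded P_def good_at_def] K(2)[OF st(2), unfolded P_def good_at_def]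
         K(3)[OF st(1), unfolded P_def good_at_def] K(4)[OF st(2), unfolded P_def good_at_def] C3[unfolded P_def good_at_def] e(1) e(2) e(3) tr(1,2)]; assumption)
    have X12b: "P t [s, t]"
      unfolding P_def good_at_def by (rule magnitude_solve4b(2)[OF K(1)[OF st(2), unfolded P_def good_at_def] K(1)[OF st(1), unfolded P_def good_at_def] K(2)[OF st(2), unfolded P_def good_at_def]
         K(3)[OF st(1), unfolded P_def good_at_def] K(4)[OF st(2), unfolded P_def good_at_def] C3[unfolded P_def good_at_def] e(1) e(2) e(3) tr(1,2)]; assumption)
    note X12 = X12a X12b
    have G1: "P i [s]" if "i \<in> J" for i
      using X12(1) that strip[of "[]" s i] K(1)[OF that] by (cases "i = s") auto
    have G2: "P i [s, t]" if "i \<in> J" for i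
      using X12(2) that strip[of "[s]" t i] G1[OF that] by (cases "i = t") auto
    have G3: "P i [s, t, s]" if "i \<in> J" for i
      using C3 that strip[of "[s, t]" s i] G2[OF that] by (cases "i = s") auto
    show ?thesis using xs K(1)[OF i] G1[OF i] G2[OF i] G3[OF i] G4[OF i] by (auto simp: Cons_eq_append_conv)
  qed
  then show ?thesis by (simp add: P_def)
qed

end

section \<open>Realising a datum along reduced words\<close>

context root_datum
begin

text \<open>One equation for two facts: \<open>ks\<close> is reduced, and it leads from
  \<open>Y\<close> downward in the right weak order.\<close>

definition down :: "('v \<Rightarrow> 'v) \<Rightarrow> 'i list \<Rightarrow> bool" where
  "down Y ks \<longleftrightarrow> len (Y \<circ> word ks) + length ks = len Y"

lemma len_word_drop:
  assumes "Y \<in> weyl" "ks \<in> lists I" shows "len Y \<le> len (Y \<circ> word ks) + length ks"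
proof -
  have r: "rev ks \<in> lists I" using assms by auto
  have "Y = (Y \<circ> word ks) \<circ> word (rev ks)" using word_rev_right[OF assms(2)] by (metis comp_assoc comp_id)
  then have "len Y \<le> len (Y \<circ> word ks) + len (word (rev ks))"
    using len_comp_le[of "Y \<circ> word ks" "word (rev ks)"] weyl_word[OF r] weyl_word[OF assms(2)] assms(1) by simp
  then show ?thesis using len_word_le[OF r] by simp
qed

lemma down_append:
  assumes "Y \<in> weyl" "xs \<in> lists I" "ys \<in> lists I"
  shows "down Y (xs @ ys) \<longleftrightarrow> down Y xs \<and> down (Y \<circ> word xs) ys"
proof -
  have W: "Y \<circ> word xs \<in> weyl" using weyl_comp[OF assms(1) weyl_word[OF assms(2)]] .
  show ?thesis using len_word_drop[OF assms(1,2)] len_word_drop[OF W assms(3)]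
    unfolding down_def word_append o_assoc length_append by linarith
qed

lemma down_reduced: assumes "Y \<in> weyl" "ks \<in> lists I" "down Y ks" shows "reduced ks"
proof -
  have r: "inv (word ks) \<in> weyl" using weyl_inv weyl_word assms(2) by blast
  have "Y = (Y \<circ> word ks) \<circ> inv (word ks)" using weyl_inv_right[OF weyl_word[OF assms(2)]] by (metis comp_assoc comp_id)
  then have "len Y \<le> len (Y \<circ> word ks) + len (word ks)"
    using len_comp_le[of "Y \<circ> word ks" "inv (word ks)"] r len_inv[OF weyl_word[OF assms(2)]] weyl_comp[OF assms(1) weyl_word[OF assms(2)]] by simp
  then show ?thesis using assms(2,3) len_word_le[OF assms(2)] unfolding reduced_def down_def by simp
qed

lemma reduced_Cons_nonneg: assumes "reduced (s # ks)" shows "nonneg (word (rev ks) (coroot s))"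
proof -
  have I: "s \<in> I" "ks \<in> lists I" using reduced_lists[OF assms] by auto
  have r: "rev ks \<in> lists I" "rev (s # ks) \<in> lists I" using I by auto
  have "len (word (rev (s # ks))) = length (s # ks)"
    using len_inv[OF weyl_word[OF reduced_lists[OF assms]]] inv_word[OF reduced_lists[OF assms]] reduced_len[OF assms] by simp
  then have "reduced (rev ks @ [s])" using r unfolding reduced_def by simp
  then have "len (word (rev ks)) < len (word (rev ks) \<circ> srefl s)" by (rule reduced_snoc_ascent)
  then show ?thesis using ascent_iff[OF weyl_word[OF r(1)] I(1)] by blast
qed

end

lemma alt_mem: assumes "k \<ge> 2" shows "s \<in> set (alt k s t)" "t \<in> set (alt k s t)"
proof -
  define l where "l = k - 2"
  have k: "k = Suc (Suc l)" using assms unfolding l_def by simp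
  have "alt k s t = alt l s t @ [t] @ [s]" unfolding k alt_last by simp
  then show "s \<in> set (alt k s t)" "t \<in> set (alt k s t)" by simp_all
qed

context root_datum_part
begin

text \<open>All prefixes are recorded, since a braid move in the middle of the word uses the minors
  on the whole replaced stretch.\<close>

definition state where
  "state M Y X ks \<longleftrightarrow> (\<forall>xs ys i. i \<in> J \<longrightarrow> ks = xs @ ys \<longrightarrow> good_at M Y X i xs)"

lemma stateD: "state M Y X ks \<Longrightarrow> i \<in> J \<Longrightarrow> ks = xs @ ys \<Longrightarrow> good_at M Y X i xs" by (simp add: state_def)

lemma good_at_shift: "good_at M Y X i (xs @ p) \<longleftrightarrow> good_at M (Y \<circ> word xs) (\<lambda>q l x. X q l (srw l xs x)) i p"
  unfolding good_at_def V_def srw_append word_append o_assoc ..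

text \<open>Prefixes ending before the block are unchanged, and those ending after it have the same
  minors by the braid relation for the lifts. Those ending inside are treated by
  \<open>good_at_rank2\<close>, at the vertex reached by \<open>xs\<close> and with the flag
  transported by \<open>srw\<close>.\<close>

lemma state_braid:
  assumes Y: "Y \<in> weyl" and X: "\<And>q. 0 < q \<Longrightarrow> q \<le> 1 \<Longrightarrow> flag (X q)" and M: "tropical_pluecker M"
    and st: "s \<in> J" "t \<in> J" "s \<noteq> t" and L: "xs \<in> lists J" "ys \<in> lists J"
    and d: "down Y (xs @ alt (mm s t) s t @ ys)" and S: "state M Y X (xs @ alt (mm s t) s t @ ys)"
  shows "state M Y X (xs @ alt (mm s t) t s @ ys)"
  unfolding state_def
proof (intro allI impI)
  fix zs ws i
  assume i: "i \<in> J" and e: "xs @ alt (mm s t) t s @ ys = zs @ ws"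
  have AL: "alt (mm s t) s t \<in> lists J" "alt (mm s t) t s \<in> lists J" using set_alt[of "mm s t" s t] set_alt[of "mm s t" t s] st by auto
  define T where "T = Y \<circ> word xs"
  have T: "T \<in> weyl" unfolding T_def using weyl_comp[OF Y weyl_word[OF lists_J_I[OF L(1)]]] .
  have dT: "down T (alt (mm s t) s t)"
    using d down_append[OF Y, of xs "alt (mm s t) s t @ ys"] down_append[OF T, of "alt (mm s t) s t" ys] L AL unfolding T_def by simp
  define X' where "X' = (\<lambda>q l x. X q l (srw l xs x))"
  consider us where "xs = zs @ us" | us vs where "zs = xs @ us" "alt (mm s t) t s = us @ vs" | vs where "zs = xs @ alt (mm s t) t s @ vs" "ys = vs @ ws"
    using e unfolding append_eq_append_conv2 by blast
  then show "good_at M Y X i zs"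
  proof cases
    case 1
    then show ?thesis using stateD[OF S i, of zs "us @ alt (mm s t) s t @ ys"] by simp
  next
    case 2
    have "good_at M T X' i us"
    proof (rule good_at_rank2[OF T st _ M _ _ i 2(2)])
      show "flag (X' q)" if "0 < q" "q \<le> 1" for q unfolding X'_def using flag_srw[OF X[OF that] L(1)] .
      show "len (T \<circ> word (alt (mm s t) s t)) + mm s t = len T" using dT unfolding down_def by simp
      show "good_at M T X' j p" if "j \<in> J" "alt (mm s t) s t = p @ r" for j p r
        using stateD[OF S that(1), of "xs @ p" "r @ ys"] that(2) unfolding good_at_shift T_def X'_def by simp
    qed
    then show ?thesis unfolding 2(1) good_at_shift T_def X'_def .
  next
    case 3
    have vJ: "vs \<in> lists J" using L(2) 3(2) by simp
    have "good_at M Y X i (xs @ alt (mm s t) s t @ vs)" using stateD[OF S i, of "xs @ alt (mm s t) s t @ vs" ws] 3(2) by simp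
    then show ?thesis unfolding 3(1) good_at_def V_def srw_append word_append
      using srw_braid[OF st srw_closed[OF vJ wd_Q]] braid[of s t] st by simp
  qed
qed

lemma state_matsumoto:
  assumes "(braid_step mm)\<^sup>*\<^sup>* ks ls" and Y: "Y \<in> weyl" and X: "\<And>q. 0 < q \<Longrightarrow> q \<le> 1 \<Longrightarrow> flag (X q)" and M: "tropical_pluecker M"
    and ks: "ks \<in> lists J" "down Y ks" "state M Y X ks"
  shows "state M Y X ls"
proof -
  have "ls \<in> lists J \<and> down Y ls \<and> state M Y X ls"
    using assms(1)
  proof (induction rule: rtranclp_induct)
    case base
    show ?case using ks by simp
  next
    case (step y z)
    from step.hyps(2) show ?case
    proof (cases rule: braid_step.cases)
      case (braid_stepI s t xs ys)
      have "mm s t \<ge> 2" by (simp add: mm_def Let_def)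
      then have st: "s \<in> J" "t \<in> J" using step.IH alt_mem(1)[of "mm s t" s t] alt_mem(2)[of "mm s t" t s] unfolding braid_stepI(1) by (auto simp: lists_eq_set)
      have L: "xs \<in> lists J" "ys \<in> lists J" using step.IH unfolding braid_stepI(1) by auto
      have AL: "alt (mm s t) t s \<in> lists J" using set_alt[of "mm s t" t s] st by auto
      have w: "word y = word z" unfolding braid_stepI(1,2) word_append using braid[of s t] st braid_stepI(3) by simp
      have "down Y z" using step.IH w unfolding down_def braid_stepI(1,2) by simp
      moreover have "state M Y X z" unfolding braid_stepI(2)
        by (rule state_braid[OF Y X M st braid_stepI(3) L]) (use step.IH braid_stepI(1) in auto)
      ultimately show ?thesis using L AL unfolding braid_stepI(2) by simp
    qed
  qed
  then show ?thesis by blast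
qed

text \<open>The minor at \<open>Y \<omega>_s\<close> is affine in the parameter, with slope
  \<open>- X q (om s) wd\<close>. This is the parameter at which the minor equals
  \<open>\<kappa> q\<close>.\<close>

definition bend :: "'i \<Rightarrow> (real \<Rightarrow> real) \<Rightarrow> (real \<Rightarrow> ('i \<Rightarrow> real) \<Rightarrow> 'i wf \<Rightarrow> real) \<Rightarrow> real \<Rightarrow> real" where
  "bend s \<kappa> X q = - (\<kappa> q + X q (om s) (wF a (om s) s wd)) / X q (om s) wd"

definition extend :: "'i \<Rightarrow> (real \<Rightarrow> real) \<Rightarrow> (real \<Rightarrow> ('i \<Rightarrow> real) \<Rightarrow> 'i wf \<Rightarrow> real) \<Rightarrow> real \<Rightarrow> ('i \<Rightarrow> real) \<Rightarrow> 'i wf \<Rightarrow> real" where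
  "extend s \<kappa> X = (\<lambda>q l x. X q l (ex (bend s \<kappa> X q) (wE s) (R l s (- 1) x)))"

text \<open>For prefixes beginning with \<open>s\<close> nothing changes: the inverse lift removes
  the letter, and the exponential fixes \<open>V i p\<close>, which \<open>wE s\<close> kills by
  \<open>V_killed\<close>. For the empty prefix only \<open>i = s\<close> is new, and there
  \<open>bend\<close> prescribes the value.\<close>

lemma state_extend:
  assumes Y: "Y \<in> weyl" and s: "s \<in> J" and ks: "ks \<in> lists J" and r: "reduced (s # ks)"
    and X: "\<And>q. 0 < q \<Longrightarrow> q \<le> 1 \<Longrightarrow> flag (X q)" and S: "state M (Y \<circ> srefl s) X ks"
    and k: "magnitude \<kappa> (M (chamber_weight Y s))"
  shows "state M Y (extend s \<kappa> X) (s # ks)"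
  unfolding state_def
proof (intro allI impI)
  fix xs ys i
  assume i: "i \<in> J" and e: "s # ks = xs @ ys"
  have nil: "good_at M (Y \<circ> srefl s) X j []" if "j \<in> J" for j using stateD[OF S that, of "[]"] by simp
  show "good_at M Y (extend s \<kappa> X) i xs"
  proof (cases xs)
    case Nil
    show ?thesis
    proof (cases "i = s")
      case False
      have "R (om i) s (- 1) wd = wd" using R_fixed(2)[OF s wd_Q] False by (simp add: wH_wd om_def)
      then have "extend s \<kappa> X q (om i) (V i []) = X q (om i) (V i [])" for q
        unfolding extend_def V_Nil using ex_fixed[OF linear_wE wE_wd, of "bend s \<kappa> X q" s for q] by simp
      then show ?thesis using nil[OF i] chamber_other[of Y s i] Y s i False unfolding Nil good_at_def by simp
    next
      case True
      have 1: "R (om s) s (- 1) wd = - wF a (om s) s wd"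
        using R_highest(2)[OF s wd_Q, of s 1] by (simp add: wH_wd om_def)
      have E: "wE s (- wF a (om s) s wd) = - wd" by (simp add: K.EF wH_wd om_def)
      have "(wE s ^^ 2) (- wF a (om s) s wd) = 0" using E by (simp add: numeral_2_eq_2)
      then have 2: "ex b (wE s) (- wF a (om s) s wd) = - wF a (om s) s wd + b *\<^sub>R (- wd)" for b
        unfolding ex_sum[OF linear_wE \<open>(wE s ^^ 2) (- wF a (om s) s wd) = 0\<close>] using E by (simp add: numeral_2_eq_2)
      have "extend s \<kappa> X q (om s) (V s []) = \<kappa> q" if q: "0 < q" "q \<le> 1" for q
      proof -
        have p: "X q (om s) wd > 0" using magnitude_pos[OF nil[OF s, unfolded good_at_def V_Nil] q] .
        have FQ: "wF a (om s) s wd \<in> Q (om s)" using Q_F[OF wd_Q s] .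
        define b where "b = bend s \<kappa> X q"
        have "X q (om s) ((- 1) *\<^sub>R wF a (om s) s wd + (- b) *\<^sub>R wd) = - X q (om s) (wF a (om s) s wd) - b * X q (om s) wd"
          unfolding flag_add[OF X[OF q] subspace_scale[OF subspace_Q FQ] subspace_scale[OF subspace_Q wd_Q]]
            flag_scale[OF X[OF q] FQ] flag_scale[OF X[OF q] wd_Q] by simp
        then have "extend s \<kappa> X q (om s) (V s []) = - X q (om s) (wF a (om s) s wd) - b * X q (om s) wd"
          unfolding extend_def V_Nil 1 2 b_def by simp
        then show ?thesis using p unfolding b_def bend_def by (simp add: field_simps)
      qed
      then show ?thesis using k magnitude_cong[of "\<lambda>q. extend s \<kappa> X q (om s) (V s [])" \<kappa>] unfolding Nil True good_at_def by simp
    qed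
  next
    case (Cons s' p)
    then have xs: "xs = s # p" and kp: "ks = p @ ys" using e by auto
    have pJ: "p \<in> lists J" using ks kp by simp
    have "reduced (s # p)" using reduced_appendD(1)[of "s # p" ys] r kp by simp
    then have z: "wE s (V i p) = 0" using V_killed[OF pJ i s] reduced_Cons_nonneg by blast
    have "R (om i) s (- 1) (V i (s # p)) = V i p" unfolding V_def srw.simps using R_inv[OF s srw_closed[OF pJ wd_Q]] .
    then have "extend s \<kappa> X q (om i) (V i xs) = X q (om i) (V i p)" for q
      unfolding extend_def xs using ex_fixed[OF linear_wE z] by simp
    then show ?thesis using stateD[OF S i kp] unfolding good_at_def xs by (simp add: o_assoc)
  qed
qed

lemma flag_extend: "s \<in> J \<Longrightarrow> flag (X q) \<Longrightarrow> flag (extend s \<kappa> X q)"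
  unfolding extend_def using flag_step by blast

text \<open>Built upward from the lower end of the chain. There a torus translate of the base point
  has any prescribed orders, and each letter adds one vertex with one new chamber weight.\<close>

lemma flags_exist:
  assumes "ks \<in> lists J" "Y \<in> weyl" "down Y ks"
  shows "\<exists>X. (\<forall>q. 0 < q \<longrightarrow> q \<le> 1 \<longrightarrow> flag (X q)) \<and> state M Y X ks"
  using assms
proof (induction ks arbitrary: Y rule: list.induct)
  case Nil
  define \<tau> where "\<tau> = (\<lambda>q i. q powr real_of_int (M (chamber_weight Y i)))"
  define X where "X = (\<lambda>q (l :: 'i \<Rightarrow> real) (x :: 'i wf). (\<Prod>i\<in>J. \<tau> q i powr l i) * ev x [])"
  have "X q (om i) (V i []) = \<tau> q i" if "0 < q" "i \<in> J" for q i
    unfolding X_def V_Nil using flag_base_wd[OF that(2), of "\<tau> q"] that by (auto simp: \<tau>_def not_le)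
  then have "good_at M Y X i []" if "i \<in> J" for i
    unfolding good_at_def using magnitude_powr[of 1] magnitude_cong[of "\<lambda>q. X q (om i) (V i [])" "\<tau>' i" for \<tau>'] that
    by (simp add: \<tau>_def magnitude_def)
  then have "state M Y X []" by (simp add: state_def)
  moreover have "flag (X q)" for q unfolding X_def by (rule flag_base)
  ultimately show ?case by blast
next
  case (Cons s ks)
  have sk: "s \<in> J" "ks \<in> lists J" using Cons.prems by auto
  have d: "down (Y \<circ> srefl s) ks" using down_append[of Y "[s]" ks] Cons.prems sk by simp
  have "\<exists>X. (\<forall>q. 0 < q \<longrightarrow> q \<le> 1 \<longrightarrow> flag (X q)) \<and> state M (Y \<circ> srefl s) X ks"
    using Cons.IH sk d Cons.prems by simp
  then obtain X where X: "\<And>q. 0 < q \<Longrightarrow> q \<le> 1 \<Longrightarrow> flag (X q)" "state M (Y \<circ> srefl s) X ks" by blast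
  have r: "reduced (s # ks)" using down_reduced Cons.prems lists_J_I by blast
  have "state M Y (extend s (\<lambda>q. 1 * q powr real_of_int (M (chamber_weight Y s))) X) (s # ks)"
    by (rule state_extend[OF _ sk r X magnitude_powr]) (use Cons.prems in auto)
  then show ?case using flag_extend[OF sk(1)] X(1) by blast
qed

text \<open>The minor at \<open>gw\<close> is a polynomial of degree \<open>c\<close> in the parameter of the last step, and its leading coefficient is
  the minor at \<open>s # gw\<close>; a finite difference bounds the latter by the positive values of the former.\<close>

lemma slope:
  assumes Y: "Y \<in> weyl" and M: "tropical_pluecker M" and L: "s # gw @ us \<in> lists J" "gw @ vs \<in> lists J"
    and w: "word (s # gw @ us) = word (gw @ vs)" and len: "length (s # gw @ us) = length (gw @ vs)"
    and d: "down Y (s # gw @ us)" and k: "k \<in> J" and c: "fund_weight k (word (rev gw) (coroot s)) = real c"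
  shows "M (chamber_weight (Y \<circ> word gw) k) \<le> M (chamber_weight (Y \<circ> word (s # gw)) k)
      + int c * (M (chamber_weight Y s) - M (chamber_weight (Y \<circ> srefl s) s))"
proof -
  have s: "s \<in> J" and gJ: "gw \<in> lists J" and uJ: "gw @ us \<in> lists J" using L by auto
  have red: "reduced (s # gw @ us)" using down_reduced[OF Y lists_J_I[OF L(1)] d] .
  have red2: "reduced (gw @ vs)" using red w len L(2) lists_J_I unfolding reduced_def by metis
  have bs: "(braid_step mm)\<^sup>*\<^sup>* (s # gw @ us) (gw @ vs)" using matsumoto[OF red red2 w] .
  have Ys: "Y \<circ> srefl s \<in> weyl" using Y s by simp
  have ds: "down (Y \<circ> srefl s) (gw @ us)" using down_append[OF Y, of "[s]" "gw @ us"] d s uJ by simp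
  obtain X where X: "\<And>q. 0 < q \<Longrightarrow> q \<le> 1 \<Longrightarrow> flag (X q)" and SX: "state M (Y \<circ> srefl s) X (gw @ us)"
    using flags_exist[OF uJ Ys ds, of M] by blast
  define x where "x = M (chamber_weight Y s)"
  define v where "v = V k gw"
  have vQ: "v \<in> Q (om k)" unfolding v_def using V_Q[OF gJ] .
  \<comment> \<open>All these prescribed values have order \<open>x\<close>, whatever
    \<open>n\<close> is, and \<open>Suc n\<close> keeps them positive at
    \<open>n = 0\<close>.\<close>
  define \<kappa> where "\<kappa> = (\<lambda>n q. real (Suc n) * q powr real_of_int x)"
  have up: "\<exists>C. \<forall>q. 0 < q \<longrightarrow> q \<le> 1 \<longrightarrow> 0 \<le> extend s (\<kappa> n) X q (om k) v \<and>
      extend s (\<kappa> n) X q (om k) v \<le> C * q powr real_of_int (M (chamber_weight (Y \<circ> word gw) k))" for n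
  proof -
    have fx: "flag (extend s (\<kappa> n) X q)" if "0 < q" "q \<le> 1" for q
      using flag_extend[where X = X and q = q, OF s X[OF that]] .
    have "state M Y (extend s (\<kappa> n) X) (s # gw @ us)"
      by (rule state_extend[OF Y s uJ red X SX]) (simp_all add: \<kappa>_def x_def magnitude_powr del: of_nat_Suc)
    \<comment> \<open>Only after the braid moves is \<open>gw\<close> a prefix of the word, so that
      the order and positivity of its minor are known.\<close>
    then have "state M Y (extend s (\<kappa> n) X) (gw @ vs)"
      by (rule state_matsumoto[OF bs Y fx M L(1) d, rotated -1])
    then have as: "magnitude (\<lambda>q. extend s (\<kappa> n) X q (om k) v) (M (chamber_weight (Y \<circ> word gw) k))"
      using stateD[of M Y "extend s (\<kappa> n) X" "gw @ vs" k gw vs] k unfolding good_at_def v_def by simp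
    show ?thesis using magnitudeD[OF as] magnitude_pos[OF as] less_imp_le by metis
  qed
  then obtain C where C: "\<And>n q. 0 < q \<Longrightarrow> q \<le> 1 \<Longrightarrow> 0 \<le> extend s (\<kappa> n) X q (om k) v"
    "\<And>n q. 0 < q \<Longrightarrow> q \<le> 1 \<Longrightarrow> extend s (\<kappa> n) X q (om k) v \<le> C n * q powr real_of_int (M (chamber_weight (Y \<circ> word gw) k))"
    by metis
  have rsg: "reduced (s # gw)" using reduced_appendD(1)[of "s # gw" us] red by simp
  have Ev: "wE s v = 0" unfolding v_def using V_killed[OF gJ k s reduced_Cons_nonneg[OF rsg]] .
  have Hv: "wH a (om k) s v = real c *\<^sub>R v" unfolding v_def using V_weight[OF gJ, of k s] k s c by simp
  interpret Z: sl2_module "Q (om k)" "wE s" "wF a (om k) s" "wH a (om k) s" using K.sl2[OF s] .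
  define y where "y = R (om k) s (- 1) v"
  have yQ: "y \<in> Q (om k)" unfolding y_def using R_closed[OF s vQ] .
  have y: "y = (- 1) ^ c *\<^sub>R Z.fd v c" unfolding y_def R_highest(2)[OF s vQ Ev Hv] Z.fd_def by simp
  have Ec: "(wE s ^^ c) y = ((- 1) ^ c * fact c) *\<^sub>R v"
  proof -
    have "(1 / fact c) *\<^sub>R (wE s ^^ c) (Z.fd v (0 + c)) = real ((c - 0) choose c) *\<^sub>R Z.fd v 0"
      by (rule Z.E_power_fd[OF vQ Ev Hv]) simp
    then have "(1 / fact c) *\<^sub>R (wE s ^^ c) (Z.fd v c) = v" by (simp add: Z.fd_def)
    then have "fact c *\<^sub>R ((1 / fact c) *\<^sub>R (wE s ^^ c) (Z.fd v c)) = fact c *\<^sub>R v" by (rule arg_cong)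
    then have "(wE s ^^ c) (Z.fd v c) = fact c *\<^sub>R v" by simp
    then show ?thesis unfolding y by (simp add: linear_scale[OF funpow_linear[OF linear_wE]])
  qed
  have Ec1: "(wE s ^^ Suc c) y = 0" unfolding funpow.simps comp_def Ec using Ev by simp
  \<comment> \<open>The parameter is affine in \<open>n\<close> and \<open>wE s\<close> kills
    \<open>y\<close> after \<open>c + 1\<close> steps, so the minor is a polynomial of degree at
    most \<open>c\<close> in \<open>n\<close>. The sign of the inverse lift cancels the sign of
    \<open>u\<close> in the leading coefficient.\<close>
  have val: "\<exists>e. (\<forall>n. extend s (\<kappa> n) X q (om k) v = (\<Sum>l\<in>{..c}. e l * real n ^ l))
      \<and> e c = X q (om k) v * (q powr real_of_int x) ^ c / X q (om s) wd ^ c" if q: "0 < q" "q \<le> 1" for q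
  proof -
    note fl = X[OF q]
    define D where "D = X q (om s) wd"
    define u where "u = - (q powr real_of_int x) / D"
    define b0 where "b0 = - (q powr real_of_int x + X q (om s) (wF a (om s) s wd)) / D"
    define z where "z = ex b0 (wE s) y"
    have zQ: "z \<in> Q (om k)" unfolding z_def using Z.exE_closed[OF yQ] .
    have "bend s (\<kappa> n) X q = real n * u + b0" for n
      unfolding bend_def \<kappa>_def u_def b0_def D_def by (simp add: distrib_right add_divide_distrib diff_divide_distrib)
    then have "extend s (\<kappa> n) X q (om k) v = X q (om k) (ex (real n * u) (wE s) z)" for n
      unfolding extend_def z_def y_def[symmetric] using ex_ex[OF linear_wE nil_wE[OF yQ]] by simp
    moreover have zc: "(wE s ^^ m) z = ex b0 (wE s) ((wE s ^^ m) y)" for m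
    proof (induction m)
      case (Suc m)
      have "(wE s ^^ m) y \<in> Q (om k)" using funpow_closed[of "Q (om k)" "wE s"] Q_E yQ by blast
      then have "wE s (ex b0 (wE s) ((wE s ^^ m) y)) = ex b0 (wE s) (wE s ((wE s ^^ m) y))"
        using Z.E_conj1[OF linear_wE, of _ "(wE s ^^ m) y" b0] by simp
      then show ?case using Suc by simp
    qed (simp add: z_def)
    have z1: "(wE s ^^ Suc c) z = 0" unfolding zc Ec1 using ex_fixed[OF linear_wE, of s 0] by simp
    have z2: "(wE s ^^ c) z = ((- 1) ^ c * fact c) *\<^sub>R v"
      unfolding zc Ec by (rule ex_fixed[OF linear_wE]) (simp add: Ev)
    define e where "e = (\<lambda>l. u ^ l / fact l * X q (om k) ((wE s ^^ l) z))"
    have "X q (om k) (ex (real n * u) (wE s) z) = (\<Sum>l\<in>{..c}. e l * real n ^ l)" for n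
    proof -
      have "X q (om k) (ex (real n * u) (wE s) z) = (\<Sum>l<Suc c. ((real n * u) ^ l / fact l) *\<^sub>R X q (om k) ((wE s ^^ l) z))"
        unfolding ex_sum[OF linear_wE z1]
        by (rule linear_within_sum[OF flag_linear[OF fl] subspace_Q]) (use funpow_closed[of "Q (om k)" "wE s"] Q_E zQ in blast)
      then show ?thesis unfolding lessThan_Suc_atMost e_def by (simp add: power_mult_distrib mult_ac)
    qed
    moreover have "e c = X q (om k) v * (q powr real_of_int x) ^ c / D ^ c"
      unfolding e_def z2 flag_scale[OF fl vQ] u_def
      by (simp add: power_divide power_minus[of "q powr real_of_int x"] power_mult_distrib[symmetric] flip: mult.assoc)
    ultimately show ?thesis unfolding D_def by auto
  qed
  \<comment> \<open>The \<open>c\<close>-th difference at 0 involves only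
    \<open>n = 0, ..., c\<close>, where the minor lies between 0 and a constant times the same power
    of \<open>q\<close>.\<close>
  have lead: "fact c * (X q (om k) v * (q powr real_of_int x) ^ c / X q (om s) wd ^ c)
      \<le> (2 ^ c * (\<Sum>n\<le>c. \<bar>C n\<bar>)) * q powr real_of_int (M (chamber_weight (Y \<circ> word gw) k))" if q: "0 < q" "q \<le> 1" for q
  proof -
    obtain e where e: "\<And>n. extend s (\<kappa> n) X q (om k) v = (\<Sum>l\<in>{..c}. e l * real n ^ l)"
      and ec: "e c = X q (om k) v * (q powr real_of_int x) ^ c / X q (om s) wd ^ c" using val[OF q] by blast
    define m where "m = q powr real_of_int (M (chamber_weight (Y \<circ> word gw) k))"
    have m: "m \<ge> 0" by (simp add: m_def)
    have "fdiff c (\<lambda>n. \<Sum>l\<in>{..c}. e l * real n ^ l) 0 = (\<Sum>l\<in>{..c}. e l * (if l = c then fact c else 0))"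
      unfolding fdiff_sum by (intro sum.cong refl) (simp add: fdiff_power)
    also have "\<dots> = e c * fact c" by (simp add: sum.delta' if_distrib cong: if_cong)
    finally have 1: "fdiff c (\<lambda>n. \<Sum>l\<in>{..c}. e l * real n ^ l) 0 = e c * fact c" .
    have bd: "\<bar>\<Sum>l\<in>{..c}. e l * real j ^ l\<bar> \<le> (\<Sum>n\<le>c. \<bar>C n\<bar>) * m" if "j \<le> 0 + c" for j
    proof -
      have "\<bar>C j\<bar> \<le> (\<Sum>n\<le>c. \<bar>C n\<bar>)" using that by (intro member_le_sum) auto
      then have "C j * m \<le> (\<Sum>n\<le>c. \<bar>C n\<bar>) * m" using m by (intro mult_right_mono) auto
      then show ?thesis using C[OF q, of j] unfolding e[symmetric] m_def by simp
    qed
    have "\<bar>e c * fact c\<bar> \<le> 2 ^ c * ((\<Sum>n\<le>c. \<bar>C n\<bar>) * m)" unfolding 1[symmetric] by (rule fdiff_bound, rule bd)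
    then show ?thesis unfolding ec[symmetric] m_def by (simp add: mult_ac)
  qed
  have a1: "magnitude (\<lambda>q. X q (om k) v) (M (chamber_weight (Y \<circ> word (s # gw)) k))"
    using stateD[OF SX k, of gw us] unfolding good_at_def v_def by (simp add: o_assoc)
  have a2: "magnitude (\<lambda>q. X q (om s) wd) (M (chamber_weight (Y \<circ> srefl s) s))"
    using stateD[OF SX s, of "[]"] unfolding good_at_def V_Nil by simp
  have a3: "magnitude (\<lambda>q. (q powr real_of_int x) ^ c) (int c * x)" using magnitude_power[OF magnitude_powr[of 1 x], of c] by simp
  have a4: "magnitude (\<lambda>q. fact c * (X q (om k) v * (q powr real_of_int x) ^ c)) (0 + (M (chamber_weight (Y \<circ> word (s # gw)) k) + int c * x))"
    by (rule magnitude_mult[OF _ magnitude_mult[OF a1 a3]]) (rule magnitudeI[of "fact c" _ _ "fact c"], auto)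
  have "magnitude (\<lambda>q. fact c * (X q (om k) v * (q powr real_of_int x) ^ c / X q (om s) wd ^ c))
     (0 + (M (chamber_weight (Y \<circ> word (s # gw)) k) + int c * x) - int c * M (chamber_weight (Y \<circ> srefl s) s))"
    by (rule magnitude_solve[OF magnitude_power[OF a2] a4]) (use magnitude_pos[OF a2] in \<open>force simp: field_simps\<close>)
  from magnitude_le[OF this lead] show ?thesis unfolding x_def by (simp add: algebra_simps)
qed

end

subsection \<open>Vertices of MV polytopes\<close>

context root_datum
begin

text \<open>The part of a BZ datum that makes \<open>M\<close> the support function of a convex
  polytope with vertices \<open>\<mu>\<close>.\<close>

definition vertex_data :: "(('v \<Rightarrow> real) \<Rightarrow> int) \<Rightarrow> (('v \<Rightarrow> 'v) \<Rightarrow> 'v) \<Rightarrow> bool" where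
  "vertex_data M \<mu> \<longleftrightarrow> edge_inequalities M \<and> (\<forall>v\<in>weyl. \<forall>i\<in>I. of_int (M (chamber_weight v i)) = chamber_weight v i (\<mu> v))"

lemma vertex_value: "vertex_data M \<mu> \<Longrightarrow> v \<in> weyl \<Longrightarrow> i \<in> I \<Longrightarrow> fund_weight i (inv v (\<mu> v)) = of_int (M (chamber_weight v i))"
  by (auto simp: vertex_data_def chamber_weight_def)

lemma edge_nonneg: "vertex_data M \<mu> \<Longrightarrow> w \<in> weyl \<Longrightarrow> s \<in> I \<Longrightarrow> edge_length M w s \<ge> 0"
  by (auto simp: vertex_data_def edge_inequalities_def)

lemma inv_weyl_srefl: "w \<in> weyl \<Longrightarrow> s \<in> I \<Longrightarrow> inv (w \<circ> srefl s) h = srefl s (inv w h)"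
  by (simp add: inv_comp)

lemma edge_vertex:
  assumes m: "vertex_data M \<mu>" and w: "w \<in> weyl" and s: "s \<in> I"
  shows "\<mu> (w \<circ> srefl s) = \<mu> w + of_int (edge_length M w s) *\<^sub>R w (coroot s)"
proof -
  define x where "x = inv w (\<mu> w)"
  define y where "y = inv w (\<mu> (w \<circ> srefl s))"
  have ws: "w \<circ> srefl s \<in> weyl" using w s by simp
  have X: "fund_weight j x = of_int (M (chamber_weight w j))" if "j \<in> I" for j
    unfolding x_def using vertex_value[OF m w that] .
  have Y: "fund_weight j (srefl s y) = of_int (M (chamber_weight (w \<circ> srefl s) j))" if "j \<in> I" for j
    using vertex_value[OF m ws that] unfolding inv_weyl_srefl[OF w s] y_def .
  have Yj: "fund_weight j y = of_int (M (chamber_weight w j))" if "j \<in> I" "j \<noteq> s" for j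
    using Y[OF that(1)] chamber_other[OF w s that(1)] that s by (simp add: srefl_def fund_weight_coroot)
  have "root s y = 2 * fund_weight s y + (\<Sum>j\<in>I - {s}. of_int (a j s) * of_int (M (chamber_weight w j)))"
    unfolding root_def using s Yj by (simp add: sum.remove[of I s])
  then have "fund_weight s y = of_int (M (chamber_weight w s)) + of_int (edge_length M w s)"
    using Y[OF s] s unfolding edge_length_def by (simp add: srefl_def fund_weight_coroot)
  then have "y = x + of_int (edge_length M w s) *\<^sub>R coroot s"
    using X Yj s by (intro fund_weight_eqI) (auto simp: fund_weight_coroot)
  then have "w y = w x + of_int (edge_length M w s) *\<^sub>R w (coroot s)"
    using w by (simp add: linear_add[OF weyl_linear] linear_scale[OF weyl_linear])
  then show ?thesis unfolding x_def y_def using w by simp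
qed

lemma edge_length_sym: assumes "w \<in> weyl" "s \<in> I" shows "edge_length M (w \<circ> srefl s) s = edge_length M w s"
proof -
  have "(\<Sum>j\<in>I - {s}. a j s * M (chamber_weight (w \<circ> srefl s) j)) = (\<Sum>j\<in>I - {s}. a j s * M (chamber_weight w j))"
    using chamber_other assms by (intro sum.cong) auto
  then show ?thesis unfolding edge_length_def srefl_comp_self'[OF assms(2)] by simp
qed

lemma srefl_commute: "s \<in> I \<Longrightarrow> c \<in> I \<Longrightarrow> a c s = 0 \<Longrightarrow> srefl s \<circ> srefl c = srefl c \<circ> srefl s"
  using cartan_zero[of c s] by (auto simp: srefl_def fun_eq_iff)

text \<open>Opposite edges of a rectangular face: \<open>srefl s\<close> affects only the chamber
  weight at \<open>s\<close>, which enters with coefficient \<open>a s c = 0\<close>.\<close>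

lemma edge_length_commute:
  assumes w: "w \<in> weyl" and s: "s \<in> I" "c \<in> I" "s \<noteq> c" "a c s = 0"
  shows "edge_length M (w \<circ> srefl s) c = edge_length M w c"
proof -
  have z: "a s c = 0" using cartan_zero s by blast
  have "w \<circ> srefl s \<circ> srefl c = w \<circ> srefl c \<circ> srefl s" using srefl_commute[OF s(1,2,4)] by (metis comp_assoc)
  then have "chamber_weight (w \<circ> srefl s \<circ> srefl c) c = chamber_weight (w \<circ> srefl c) c"
    using chamber_other[of "w \<circ> srefl c" s c] w s by simp
  moreover have "(\<Sum>j\<in>I - {c}. a j c * M (chamber_weight (w \<circ> srefl s) j)) = (\<Sum>j\<in>I - {c}. a j c * M (chamber_weight w j))"
  proof (rule sum.cong[OF refl])
    fix j assume "j \<in> I - {c}"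
    then show "a j c * M (chamber_weight (w \<circ> srefl s) j) = a j c * M (chamber_weight w j)"
      using chamber_other[OF w s(1), of j] z by (cases "j = s") auto
  qed
  ultimately show ?thesis unfolding edge_length_def using chamber_other[OF w s(1,2,3)] by simp
qed

lemma vertex_path:
  assumes m: "vertex_data M \<mu>" and v: "v \<in> weyl"
  shows "reduced ks \<Longrightarrow> nonneg (inv v (\<mu> (v \<circ> word ks) - \<mu> v))"
proof (induction ks rule: rev_induct)
  case Nil
  then show ?case using v by (simp add: linear_0[OF weyl_linear])
next
  case (snoc c ks)
  have r: "reduced ks" and c: "c \<in> I" using reduced_appendD(1)[OF snoc.prems] reduced_lists[OF snoc.prems] by auto
  have kW: "word ks \<in> weyl" using weyl_word[OF reduced_lists[OF r]] .
  have W: "v \<circ> word ks \<in> weyl" using weyl_comp[OF v kW] .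
  have "\<mu> (v \<circ> word (ks @ [c])) - \<mu> v = (\<mu> (v \<circ> word ks) - \<mu> v) + of_int (edge_length M (v \<circ> word ks) c) *\<^sub>R v (word ks (coroot c))"
    unfolding word_snoc o_assoc edge_vertex[OF m W c] by simp
  then have "inv v (\<mu> (v \<circ> word (ks @ [c])) - \<mu> v) = inv v (\<mu> (v \<circ> word ks) - \<mu> v) + of_int (edge_length M (v \<circ> word ks) c) *\<^sub>R word ks (coroot c)"
    using v by (simp only: linear_add[OF weyl_linear] linear_scale[OF weyl_linear] weyl_inv weyl_inv_left')
  moreover have "nonneg (word ks (coroot c))" using reduced_snoc_ascent[OF snoc.prems] ascent_iff[OF kW c] by blast
  moreover have "nonneg (inv v (\<mu> (v \<circ> word ks) - \<mu> v))" using snoc.IH[OF r] unfolding comp_def .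
  ultimately have "nonneg (inv v (\<mu> (v \<circ> word (ks @ [c])) - \<mu> v))" using edge_nonneg[OF m W c] by (simp only: nonneg_add nonneg_scale of_int_0_le_iff)
  then show ?case unfolding comp_def .
qed

text \<open>By \<open>vertex_path\<close> every vertex lies in the cone at \<open>\<mu> v\<close>
  spanned by the \<open>v\<close>-images of the positive coroots, on which the chamber weights of
  \<open>v\<close> are nonnegative.\<close>

lemma vertex_min:
  assumes m: "vertex_data M \<mu>" and v: "v \<in> weyl" "u \<in> weyl" and i: "i \<in> I"
  shows "chamber_weight v i (\<mu> v) \<le> chamber_weight v i (\<mu> u)"
proof -
  obtain ks where ks: "reduced ks" "word ks = inv v \<circ> u" by (rule obtain_reduced[of "inv v \<circ> u"]) (use v in auto)
  have "v \<circ> word ks = u" unfolding ks(2) using v by (simp add: o_assoc)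
  then have "nonneg (inv v (\<mu> u - \<mu> v))" using vertex_path[OF m v(1) ks(1)] by simp
  then show ?thesis using i v by (simp add: nonneg_def chamber_weight_def linear_diff[OF weyl_linear])
qed

text \<open>Membership in \<open>MV_polytopes_highest\<close> brings vertex data of its own, to be
  identified with the given ones. The minimum of a chamber weight over the hull depends only on the
  hull, and these minima are the coordinates of the vertices.\<close>

lemma vertex_unique:
  assumes "vertex_data M \<mu>" "vertex_data M' \<mu>'" and P: "convex hull (\<mu> ` weyl) = convex hull (\<mu>' ` weyl)" and v: "v \<in> weyl"
  shows "\<mu> v = \<mu>' v"
proof -
  have *: "chamber_weight v i (\<mu> v) \<le> chamber_weight v i (\<mu>' v)"
    if m: "vertex_data M \<mu>" and P: "convex hull (\<mu> ` weyl) = convex hull (\<mu>' ` weyl)" and i: "i \<in> I" for M \<mu> \<mu>' i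
  proof -
    let ?H = "{x. chamber_weight v i (\<mu> v) \<le> chamber_weight v i x}"
    have l: "linear (chamber_weight v i)" unfolding chamber_weight_def
      using linear_compose[OF weyl_linear[OF weyl_inv[OF v]] linear_fund_weight] .
    have "convex ?H"
    proof (rule convexI)
      fix x y :: 'v and p q :: real
      assume xy: "x \<in> ?H" "y \<in> ?H" and pq: "0 \<le> p" "0 \<le> q" "p + q = 1"
      have "chamber_weight v i (\<mu> v) = p * chamber_weight v i (\<mu> v) + q * chamber_weight v i (\<mu> v)"
        using pq by (metis distrib_right mult_1)
      also have "\<dots> \<le> p * chamber_weight v i x + q * chamber_weight v i y"
        using xy pq by (intro add_mono mult_left_mono) auto
      finally show "p *\<^sub>R x + q *\<^sub>R y \<in> ?H" by (simp add: linear_add[OF l] linear_scale[OF l])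
    qed
    moreover have "\<mu> ` weyl \<subseteq> ?H" using vertex_min[OF m v _ i] by auto
    ultimately have "convex hull (\<mu> ` weyl) \<subseteq> ?H" by (simp add: hull_minimal)
    moreover have "\<mu>' v \<in> convex hull (\<mu> ` weyl)" unfolding P using v by (simp add: hull_inc)
    ultimately show ?thesis by blast
  qed
  have "fund_weight i (inv v (\<mu> v)) = fund_weight i (inv v (\<mu>' v))" if "i \<in> I" for i
    using *[OF assms(1) P that] *[OF assms(2) P[symmetric] that] by (simp add: chamber_weight_def)
  then have "inv v (\<mu> v) = inv v (\<mu>' v)" by (rule fund_weight_eqI)
  then show ?thesis using v by (metis weyl_inv_right')
qed

lemma vertex_down:
  assumes m: "vertex_data M \<mu>" and Y: "Y \<in> weyl" and ks: "ks \<in> lists I" and d: "down Y ks"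
  shows "nonneg (\<mu> Y - \<mu> (Y \<circ> word ks))"
  using ks d
proof (induction ks rule: rev_induct)
  case (snoc c ks)
  have c: "c \<in> I" and k: "ks \<in> lists I" using snoc.prems by auto
  have dd: "down Y ks" "down (Y \<circ> word ks) [c]" using down_append[OF Y k, of "[c]"] snoc.prems(2) c by auto
  have W: "Y \<circ> word ks \<in> weyl" using weyl_comp[OF Y weyl_word[OF k]] .
  have IH: "nonneg (\<mu> Y - \<mu> (Y \<circ> word ks))" using snoc.IH[OF k dd(1)] unfolding comp_def .
  have "nonneg (- (Y \<circ> word ks) (coroot c))" using dd(2) descent_iff[OF W c] by (simp add: down_def)
  then have "nonneg ((\<mu> Y - \<mu> (Y \<circ> word ks)) + of_int (edge_length M (Y \<circ> word ks) c) *\<^sub>R (- (Y \<circ> word ks) (coroot c)))"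
    using IH edge_nonneg[OF m W c] by (intro nonneg_add nonneg_scale) auto
  moreover have "\<mu> Y - \<mu> (Y \<circ> word (ks @ [c])) = (\<mu> Y - \<mu> (Y \<circ> word ks)) + of_int (edge_length M (Y \<circ> word ks) c) *\<^sub>R (- (Y \<circ> word ks) (coroot c))"
    unfolding word_snoc o_assoc edge_vertex[OF m W c] by simp
  ultimately have "nonneg (\<mu> Y - \<mu> (Y \<circ> word (ks @ [c])))" by (simp only:)
  then show ?case unfolding comp_def .
qed simp

text \<open>Vertices decrease along a descending chain, so equal ends force equality in
  between.\<close>

lemma vertex_prefix:
  assumes m: "vertex_data M \<mu>" and Y: "Y \<in> weyl" and ks: "xs \<in> lists I" "ys \<in> lists I" and d: "down Y (xs @ ys)"
    and e: "\<mu> (Y \<circ> word (xs @ ys)) = \<mu> Y"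
  shows "\<mu> (Y \<circ> word xs) = \<mu> Y"
proof -
  have W: "Y \<circ> word xs \<in> weyl" using weyl_comp[OF Y weyl_word[OF ks(1)]] .
  have dd: "down Y xs" "down (Y \<circ> word xs) ys" using down_append[OF Y ks] d by auto
  have 1: "nonneg (\<mu> Y - \<mu> (Y \<circ> word xs))" using vertex_down[OF m Y ks(1) dd(1)] .
  have "nonneg (\<mu> (Y \<circ> word xs) - \<mu> (Y \<circ> word (xs @ ys)))" using vertex_down[OF m W ks(2) dd(2)] by (simp add: o_assoc)
  then have "nonneg (- (\<mu> Y - \<mu> (Y \<circ> word xs)))" unfolding e by simp
  then have "\<mu> Y - \<mu> (Y \<circ> word xs) = 0" using nonneg_antisym 1 by blast
  then show ?thesis by simp
qed

lemma edge_zero: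
  assumes "vertex_data M \<mu>" "w \<in> weyl" "s \<in> I"
  shows "\<mu> (w \<circ> srefl s) = \<mu> w \<longleftrightarrow> edge_length M w s = 0"
  using edge_vertex[OF assms] weyl_coroot_nonzero[OF assms(2,3)] by simp

lemma vertex_commute:
  assumes m: "vertex_data M \<mu>" and Y: "Y \<in> weyl" and s: "s \<in> I" and bs: "bs \<in> lists {b \<in> I. b \<noteq> s \<and> a b s = 0}"
    and d: "down Y bs" and e: "\<mu> (Y \<circ> word bs) = \<mu> Y"
  shows "\<mu> (Y \<circ> srefl s \<circ> word bs) = \<mu> (Y \<circ> srefl s) \<and> Y \<circ> srefl s \<circ> word bs = Y \<circ> word bs \<circ> srefl s"
  using bs d e
proof (induction bs rule: rev_induct)
  case (snoc b bs)
  have b: "b \<in> I" "b \<noteq> s" "a b s = 0" and k: "bs \<in> lists {b \<in> I. b \<noteq> s \<and> a b s = 0}" using snoc.prems(1) by auto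
  have kI: "bs \<in> lists I" using k by (auto simp: lists_eq_set)
  have d: "down Y bs" using down_append[OF Y kI, of "[b]"] snoc.prems(2) b by simp
  have p3: "\<mu> (Y \<circ> word (bs @ [b])) = \<mu> Y" using snoc.prems(3) unfolding comp_def .
  have b1: "[b] \<in> lists I" using b by simp
  have e: "\<mu> (Y \<circ> word bs) = \<mu> Y" by (rule vertex_prefix[OF m Y kI b1 snoc.prems(2) p3])
  have W: "Y \<circ> word bs \<in> weyl" using weyl_comp[OF Y weyl_word[OF kI]] .
  have IH: "\<mu> (Y \<circ> srefl s \<circ> word bs) = \<mu> (Y \<circ> srefl s)" "Y \<circ> srefl s \<circ> word bs = Y \<circ> word bs \<circ> srefl s"
    using snoc.IH[OF k d] e unfolding comp_def by auto
  have "\<mu> (Y \<circ> word bs \<circ> srefl b) = \<mu> (Y \<circ> word bs)" using p3 e unfolding word_snoc o_assoc by simp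
  then have "edge_length M (Y \<circ> word bs) b = 0" using edge_zero[OF m W b(1)] by simp
  then have "edge_length M (Y \<circ> word bs \<circ> srefl s) b = 0" using edge_length_commute[OF W s b(1) b(2)[symmetric] b(3)] by simp
  then have "\<mu> (Y \<circ> word bs \<circ> srefl s \<circ> srefl b) = \<mu> (Y \<circ> word bs \<circ> srefl s)" using edge_zero[OF m, of "Y \<circ> word bs \<circ> srefl s" b] W s b by simp
  moreover have \<mu>s: "\<mu> (Y \<circ> word bs \<circ> srefl s) = \<mu> (Y \<circ> srefl s)" using IH by (simp only:)
  moreover have "Y \<circ> word bs \<circ> srefl s \<circ> srefl b = Y \<circ> word (bs @ [b]) \<circ> srefl s"
    using srefl_commute[OF s b(1,3)] unfolding word_snoc o_assoc by (metis comp_assoc)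
  ultimately have "\<mu> (Y \<circ> srefl s \<circ> word (bs @ [b])) = \<mu> (Y \<circ> srefl s) \<and> Y \<circ> srefl s \<circ> word (bs @ [b]) = Y \<circ> word (bs @ [b]) \<circ> srefl s"
    unfolding word_snoc o_assoc using IH \<mu>s by (simp only: o_assoc)
  then show ?case unfolding comp_def .
qed simp

lemma word_filter:
  assumes "ks \<in> lists I" "\<And>x y. x \<in> I \<Longrightarrow> y \<in> I \<Longrightarrow> x \<in> A \<Longrightarrow> y \<notin> A \<Longrightarrow> a x y = 0"
  shows "word ks = word (filter (\<lambda>x. x \<notin> A) ks @ filter (\<lambda>x. x \<in> A) ks)"
  using assms(1)
proof (induction ks rule: list.induct)
  case (Cons k ks)
  have k: "k \<in> I" "ks \<in> lists I" using Cons.prems by auto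
  have sw: "srefl k \<circ> word bs = word bs \<circ> srefl k" if "bs \<in> lists I" "\<forall>b\<in>set bs. b \<notin> A" "k \<in> A" for bs
    using that(1,2)
  proof (induction bs rule: list.induct)
    case (Cons b bs)
    have c: "srefl k \<circ> srefl b = srefl b \<circ> srefl k"
      using srefl_commute[of k b] cartan_zero[of b k] assms(2)[of k b] Cons.prems k that(3) by auto
    have i: "srefl k \<circ> word bs = word bs \<circ> srefl k" using Cons unfolding comp_def by simp
    have "srefl k \<circ> word (b # bs) = srefl k \<circ> srefl b \<circ> word bs" by (simp only: word_Cons o_assoc)
    also have "\<dots> = srefl b \<circ> (srefl k \<circ> word bs)" unfolding c by (simp only: o_assoc)
    also have "\<dots> = word (b # bs) \<circ> srefl k" unfolding i by (simp only: word_Cons o_assoc)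
    finally show ?case unfolding comp_def .
  qed simp
  define bs where "bs = filter (\<lambda>x. x \<notin> A) ks"
  define as where "as = filter (\<lambda>x. x \<in> A) ks"
  have "word ks = word (bs @ as)" using Cons.IH[OF k(2)] unfolding as_def bs_def .
  then have IH: "word ks = word bs \<circ> word as" by (simp only: word_append)
  have bs: "bs \<in> lists I" "\<forall>b\<in>set bs. b \<notin> A" using k by (auto simp: bs_def)
  have "word (k # ks) = word (filter (\<lambda>x. x \<notin> A) (k # ks) @ filter (\<lambda>x. x \<in> A) (k # ks))"
  proof (cases "k \<in> A")
    case True
    have f: "filter (\<lambda>x. x \<notin> A) (k # ks) = bs" "filter (\<lambda>x. x \<in> A) (k # ks) = k # as" using True by (simp_all add: as_def bs_def)
    show ?thesis unfolding f word_append word_Cons IH o_assoc sw[OF bs True] ..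
  next
    case False
    have f: "filter (\<lambda>x. x \<notin> A) (k # ks) = k # bs" "filter (\<lambda>x. x \<in> A) (k # ks) = as" using False by (simp_all add: as_def bs_def)
    show ?thesis unfolding f word_append word_Cons IH o_assoc ..
  qed
  then show ?case unfolding comp_def .
qed simp

text \<open>Letters outside \<open>A\<close> commute with \<open>s\<close> and with the letters in
  \<open>A\<close>, so they can be moved to the front. They lead from \<open>Y\<close> to
  \<open>Y'\<close> without moving the vertex on either side of the wall of \<open>s\<close>, and
  only the word in \<open>A\<close> remains.\<close>

lemma shadow_split:
  assumes m: "vertex_data M \<mu>" and Y: "Y \<in> weyl" and s: "s \<in> I" "s \<in> A" and ks: "ks \<in> lists I"
    and sep: "\<And>x y. x \<in> I \<Longrightarrow> y \<in> I \<Longrightarrow> x \<in> A \<Longrightarrow> y \<notin> A \<Longrightarrow> a x y = 0"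
    and d: "down Y (s # ks)" "down Y ks" and e: "\<mu> (Y \<circ> word ks) = \<mu> Y"
    and claim: "\<And>Y gw. Y \<in> weyl \<Longrightarrow> gw \<in> lists (I \<inter> A) \<Longrightarrow> down Y (s # gw) \<Longrightarrow> down Y gw \<Longrightarrow> \<mu> (Y \<circ> word gw) = \<mu> Y \<Longrightarrow>
      \<mu> (Y \<circ> srefl s \<circ> word gw) = \<mu> (Y \<circ> srefl s)"
  shows "\<mu> (Y \<circ> srefl s \<circ> word ks) = \<mu> (Y \<circ> srefl s)"
proof -
  define bs where "bs = filter (\<lambda>x. x \<notin> A) ks"
  define as where "as = filter (\<lambda>x. x \<in> A) ks"
  have L: "bs \<in> lists I" "as \<in> lists I" "as \<in> lists (I \<inter> A)" "bs \<in> lists {b \<in> I. b \<noteq> s \<and> a b s = 0}"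
    using ks sep[OF s(1)] cartan_zero[OF s(1)] s by (auto simp: as_def bs_def)
  have w: "word ks = word (bs @ as)" unfolding as_def bs_def using word_filter[OF ks sep] by blast
  have w2: "word (s # ks) = word (bs @ s # as)"
    using word_filter[of "s # ks" A] sep s ks unfolding as_def bs_def by simp
  have len: "length ks = length bs + length as" unfolding as_def bs_def using sum_length_filter_compl[of "\<lambda>x. x \<in> A" ks] by simp
  have d1: "down Y (bs @ as)" using d(2) w len unfolding down_def by simp
  have d2: "down Y (bs @ s # as)" using d(1) len unfolding down_def w2 by simp
  define Y' where "Y' = Y \<circ> word bs"
  have Y': "Y' \<in> weyl" unfolding Y'_def using weyl_comp[OF Y weyl_word[OF L(1)]] .
  have db: "down Y bs" "down Y' as" using down_append[OF Y L(1,2)] d1 unfolding Y'_def by auto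
  have ds: "down Y' (s # as)" using down_append[OF Y L(1), of "s # as"] d2 L s unfolding Y'_def by simp
  have eb: "\<mu> Y' = \<mu> Y" unfolding Y'_def using vertex_prefix[OF m Y L(1,2) d1] e w by simp
  have "\<mu> (Y' \<circ> word as) = \<mu> Y'" using e w eb unfolding Y'_def by (simp add: o_assoc)
  then have 1: "\<mu> (Y' \<circ> srefl s \<circ> word as) = \<mu> (Y' \<circ> srefl s)" using claim[OF Y' L(3) ds db(2)] by blast
  have 2: "\<mu> (Y \<circ> srefl s \<circ> word bs) = \<mu> (Y \<circ> srefl s)" "Y \<circ> srefl s \<circ> word bs = Y' \<circ> srefl s"
    using vertex_commute[OF m Y s(1) L(4) db(1)] eb unfolding Y'_def by auto
  have "Y \<circ> srefl s \<circ> word ks = Y' \<circ> srefl s \<circ> word as" unfolding w word_append o_assoc 2(2) ..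
  then show ?thesis using 1 2 by simp
qed

end

section \<open>Transfer of vanishing edges without triple bonds\<close>

context root_datum_part
begin

lemma down_bounded: "Y \<in> weyl \<Longrightarrow> down Y ks \<Longrightarrow> length ks \<le> len Y" by (simp add: down_def)

text \<open>A longest chain in \<open>J\<close> below \<open>Y\<close> ends at the minimal
  representative of the coset of the parabolic subgroup, where lengths add. So all chains can be
  continued to that element, and words with different beginnings obtain a common product, as braid
  moves require.\<close>

lemma down_extend:
  assumes Y: "Y \<in> weyl"
  shows "\<exists>u. \<forall>ks. ks \<in> lists J \<longrightarrow> down Y ks \<longrightarrow> (\<exists>us. ks @ us \<in> lists J \<and> down Y (ks @ us) \<and> word (ks @ us) = u)"
proof -
  define n where "n = Max (length ` {ks \<in> lists J. down Y ks})"
  have sub: "length ` {ks \<in> lists J. down Y ks} \<subseteq> {..len Y}" using down_bounded[OF Y] by auto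
  have fin: "finite (length ` {ks \<in> lists J. down Y ks})" using finite_subset[OF sub] by simp
  have "down Y []" by (simp add: down_def)
  then have "n \<in> length ` {ks \<in> lists J. down Y ks}" unfolding n_def by (intro Max_in fin) auto
  then obtain k0 where k0: "k0 \<in> lists J" "down Y k0" "length k0 = n" by auto
  have mx: "length ks \<le> n" if "ks \<in> lists J" "down Y ks" for ks unfolding n_def using fin that by (intro Max_ge) auto
  define Y' where "Y' = Y \<circ> word k0"
  have k0W: "word k0 \<in> weyl" using weyl_word k0 lists_J_I by blast
  have Y': "Y' \<in> weyl" unfolding Y'_def using weyl_comp[OF Y k0W] .
  have pos: "nonneg (Y' (coroot j))" if j: "j \<in> J" for j
  proof (rule ccontr)
    assume "\<not> nonneg (Y' (coroot j))"
    then have "len (Y' \<circ> srefl j) < len Y'" using ascent_iff[OF Y' J_I[OF j]] len_right_neq[OF Y' J_I[OF j]] by (meson nat_neq_iff)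
    then have "down Y' [j]" using ascent_or_descent[OF Y' J_I[OF j]] by (auto simp: down_def)
    then have "down Y (k0 @ [j])" using down_append[OF Y, of k0 "[j]"] k0 j unfolding Y'_def by simp
    then show False using mx[of "k0 @ [j]"] k0 j by simp
  qed
  have add: "len (Y' \<circ> word xs) = len Y' + length xs" if "xs \<in> lists J" "reduced xs" for xs
    using that
  proof (induction xs rule: rev_induct)
    case (snoc c xs)
    have c: "c \<in> J" and x: "xs \<in> lists J" using snoc.prems(1) by auto
    have r: "reduced xs" using reduced_appendD(1)[OF snoc.prems(2)] .
    have xW: "word xs \<in> weyl" using weyl_word x lists_J_I by blast
    define h where "h = word xs (coroot c)"
    have hp: "nonneg h" unfolding h_def using reduced_snoc_ascent[OF snoc.prems(2)] ascent_iff[OF xW J_I[OF c]] by blast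
    have h0: "fund_weight i h = 0" if "i \<in> I" "i \<notin> J" for i
    proof -
      have "xs \<in> lists (I - {i})" using x that by (auto simp: lists_eq_set)
      then have "fund_weight i h = fund_weight i (coroot c)" unfolding h_def using fund_weight_word[OF that(1)] by blast
      then show ?thesis using that c by (auto simp: fund_weight_coroot)
    qed
    have "Y' h = (\<Sum>i\<in>I. fund_weight i h *\<^sub>R Y' (coroot i))"
      by (subst expand[of h]) (simp add: linear_sum[OF weyl_linear[OF Y']] linear_scale[OF weyl_linear[OF Y']])
    moreover have "nonneg (\<Sum>i\<in>K. fund_weight i h *\<^sub>R Y' (coroot i))" if "finite K" "K \<subseteq> I" for K
      using that
    proof (induction K rule: finite_induct)
      case (insert i K)
      have "nonneg (fund_weight i h *\<^sub>R Y' (coroot i))"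
        using h0[of i] pos[of i] hp insert.prems by (cases "i \<in> J") (auto simp: nonneg_def intro!: mult_nonneg_nonneg)
      then show ?case using insert by (simp add: nonneg_add)
    qed simp
    ultimately have "nonneg (Y' h)" by simp
    then have "len (Y' \<circ> word xs) < len (Y' \<circ> word xs \<circ> srefl c)"
      using ascent_iff[of "Y' \<circ> word xs" c] weyl_comp[OF Y' xW] c by (simp add: h_def)
    then have "len (Y' \<circ> word xs \<circ> srefl c) = Suc (len (Y' \<circ> word xs))"
      using ascent_or_descent[of "Y' \<circ> word xs" c] weyl_comp[OF Y' xW] c by simp
    moreover have "len (Y' \<circ> word xs) = len Y' + length xs" using snoc.IH[OF x r] unfolding comp_def .
    ultimately have "len (Y' \<circ> word (xs @ [c])) = len Y' + length (xs @ [c])" unfolding word_snoc o_assoc by simp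
    then show ?case unfolding comp_def .
  qed simp
  have "\<exists>us. ks @ us \<in> lists J \<and> down Y (ks @ us) \<and> word (ks @ us) = word k0" if k: "ks \<in> lists J" "down Y ks" for ks
  proof -
    have kI: "ks \<in> lists I" "rev ks \<in> lists I" using k by auto
    define z where "z = word (rev ks @ k0)"
    have zW: "z \<in> weyl" unfolding z_def using weyl_word[of "rev ks @ k0"] kI k0 by auto
    obtain us where us: "reduced us" "word us = z" "length us = len z" by (rule obtain_reduced[OF zW])
    have uJ: "us \<in> lists J"
      by (rule reduced_support[OF J_sub _ us(1), of "rev ks @ k0"]) (use us(2) k k0 z_def in auto)
    have wz: "word ks \<circ> z = word k0" unfolding z_def word_append o_assoc word_rev_right[OF kI(1)] by simp
    have "Y \<circ> word ks = Y' \<circ> inv z"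
    proof -
      have "Y' \<circ> inv z = Y \<circ> (word ks \<circ> z) \<circ> inv z" unfolding wz Y'_def ..
      then show ?thesis using zW by (simp add: comp_assoc)
    qed
    moreover have "inv z = word (rev us)" using inv_word[OF reduced_lists[OF us(1)]] us(2) by simp
    moreover have "reduced (rev us)" using us reduced_lists[OF us(1)] len_inv[OF zW] \<open>inv z = word (rev us)\<close> by (auto simp: reduced_def)
    moreover have "rev us \<in> lists J" using uJ by (simp add: lists_eq_set)
    ultimately have "len (Y \<circ> word ks) = len Y' + length us" using add[of "rev us"] by (simp only: length_rev)
    moreover have "Y \<circ> word (ks @ us) = Y'" unfolding word_append o_assoc us(2) Y'_def by (simp only: comp_assoc wz)
    ultimately have "down Y (ks @ us)" using k(2) unfolding down_def by simp
    then show ?thesis using uJ k wz us(2) by (intro exI[of _ us]) auto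
  qed
  then show ?thesis by blast
qed

text \<open>Since \<open>\<mu> (Y \<circ> word gw) = \<mu> Y\<close>, the left side of
  \<open>slope\<close> is a coordinate of \<open>\<mu> Y\<close>. The inequality then says that the
  chamber weight at \<open>G\<close> is at most its minimum when evaluated at
  \<open>\<mu> (Y \<circ> srefl s)\<close>.\<close>

lemma shadow_J:
  assumes m: "vertex_data M \<mu>" and M: "tropical_pluecker M" and Y: "Y \<in> weyl" and s: "s \<in> J" and gw: "gw \<in> lists J"
    and d: "down Y (s # gw)" "down Y gw" and e: "\<mu> (Y \<circ> word gw) = \<mu> Y"
  shows "\<mu> (Y \<circ> srefl s \<circ> word gw) = \<mu> (Y \<circ> srefl s)"
proof -
  obtain u where u: "\<And>ks. ks \<in> lists J \<Longrightarrow> down Y ks \<Longrightarrow> \<exists>us. ks @ us \<in> lists J \<and> down Y (ks @ us) \<and> word (ks @ us) = u"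
    using down_extend[OF Y] by blast
  obtain us where us: "(s # gw) @ us \<in> lists J" "down Y ((s # gw) @ us)" "word ((s # gw) @ us) = u" using u[of "s # gw"] s gw d(1) by auto
  obtain vs where vs: "gw @ vs \<in> lists J" "down Y (gw @ vs)" "word (gw @ vs) = u" using u[OF gw d(2)] by blast
  have sI: "s \<in> I" and gI: "gw \<in> lists I" "rev gw \<in> lists I" using s gw by auto
  have gW: "word gw \<in> weyl" using weyl_word[OF gI(1)] .
  have len: "length ((s # gw) @ us) = length (gw @ vs)" using us(2,3) vs(2,3) unfolding down_def by simp
  have rsg: "reduced (s # gw)" using down_reduced[OF Y _ d(1)] sI gI by simp
  have pos: "nonneg (word (rev gw) (coroot s))" using reduced_Cons_nonneg[OF rsg] .
  define x where "x = inv Y (\<mu> Y)"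
  define E where "E = edge_length M Y s"
  define y where "y = \<mu> (Y \<circ> srefl s)"
  have Ys: "Y \<circ> srefl s \<in> weyl" using Y sI by simp
  define G where "G = Y \<circ> srefl s \<circ> word gw"
  have G: "G \<in> weyl" unfolding G_def using weyl_comp[OF Ys gW] .
  have Yg: "Y \<circ> word gw \<in> weyl" using weyl_comp[OF Y gW] .
  have ig: "inv (word gw) = word (rev gw)" using inv_word[OF gI(1)] .
  have yx: "inv Y y = x + of_int E *\<^sub>R coroot s"
    unfolding y_def edge_vertex[OF m Y sI] x_def E_def using Y by (simp add: linear_add[OF weyl_linear] linear_scale[OF weyl_linear])
  have sy: "srefl s (inv Y y) = x - (root s x + of_int E) *\<^sub>R coroot s"
    unfolding yx srefl_def using sI by (simp add: algebra_simps) (simp add: scaleR_add_left[symmetric])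
  have cG: "chamber_weight G k y = fund_weight k (word (rev gw) (srefl s (inv Y y)))" for k
    unfolding chamber_weight_def G_def using inv_comp[OF Ys gW] inv_comp[OF Y weyl_srefl[OF sI]] sI ig by simp
  \<comment> \<open>Coordinates in the chamber of \<open>G\<close>: \<open>vertex_min\<close> gives
    one inequality, \<open>slope\<close> the other. For \<open>k\<close> outside \<open>J\<close>
    the chamber weight is the same at both elements.\<close>
  have "fund_weight k (inv G y) = fund_weight k (inv G (\<mu> G))" if k: "k \<in> I" for k
  proof -
    have ge: "of_int (M (chamber_weight G k)) \<le> chamber_weight G k y"
      using vertex_min[OF m G Ys k] vertex_value[OF m G k] by (simp add: y_def chamber_weight_def)
    have "chamber_weight G k y \<le> of_int (M (chamber_weight G k))"
    proof (cases "k \<in> J")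
      case False
      have "chamber_weight w k = chamber_weight (w \<circ> word xs) k" if "w \<in> weyl" "xs \<in> lists J" for w xs
        using that(2)
      proof (induction xs rule: rev_induct)
        case (snoc c xs)
        have c: "c \<in> I" "c \<noteq> k" "xs \<in> lists J" using snoc.prems False by auto
        have "w \<circ> word xs \<in> weyl" using weyl_comp[OF that(1) weyl_word] c(3) by simp
        then have "chamber_weight (w \<circ> word (xs @ [c])) k = chamber_weight (w \<circ> word xs) k"
          unfolding word_snoc o_assoc using chamber_other[OF _ c(1) k c(2)] by blast
        moreover have "chamber_weight w k = chamber_weight (w \<circ> word xs) k" using snoc.IH[OF c(3)] unfolding comp_def .
        ultimately have "chamber_weight w k = chamber_weight (w \<circ> word (xs @ [c])) k" by (simp only:)
        then show ?case unfolding comp_def .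
      qed simp
      then have "chamber_weight G k = chamber_weight (Y \<circ> srefl s) k" unfolding G_def using Ys gw by metis
      then show ?thesis using vertex_value[OF m Ys k] by (simp add: chamber_weight_def y_def)
    next
      case True
      define c where "c = fund_weight k (word (rev gw) (coroot s))"
      have "c \<ge> 0" using pos k unfolding c_def nonneg_def by blast
      \<comment> \<open>\<open>c\<close> is the weight under \<open>wH a (om k) s\<close> of the
        nonzero vector \<open>V k gw\<close> killed by \<open>wE s\<close>, hence a natural
        number.\<close>
      obtain n where n: "c = real n"
      proof -
        have v: "V k gw \<in> Q (om k)" "wE s (V k gw) = 0" "wH a (om k) s (V k gw) = c *\<^sub>R V k gw"
          using V_Q[OF gw] V_killed[OF gw True s pos] V_weight[OF gw k sI] unfolding c_def by auto
        show thesis using sl2_module.weight_nat[OF K.sl2[OF s] v V_nonzero[OF gw]] that by blast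
      qed
      have "M (chamber_weight (Y \<circ> word gw) k) \<le> M (chamber_weight (Y \<circ> word (s # gw)) k)
          + int n * (M (chamber_weight Y s) - M (chamber_weight (Y \<circ> srefl s) s))"
        by (rule slope[OF Y M _ vs(1) _ _ _ True n[unfolded c_def]]) (use us vs len in auto)
      then have sl: "real_of_int (M (chamber_weight (Y \<circ> word gw) k)) \<le> of_int (M (chamber_weight G k))
          + c * (of_int (M (chamber_weight Y s)) - of_int (M (chamber_weight (Y \<circ> srefl s) s)))"
        unfolding n G_def by (simp add: o_assoc) (metis of_int_add of_int_diff of_int_le_iff of_int_mult of_int_of_nat_eq)
      have 1: "of_int (M (chamber_weight (Y \<circ> word gw) k)) = fund_weight k (word (rev gw) x)"
        using vertex_value[OF m Yg k] unfolding e x_def using inv_comp[OF Y gW] ig by simp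
      have 2: "of_int (M (chamber_weight Y s)) = fund_weight s x" using vertex_value[OF m Y sI] by (simp add: x_def)
      have 3: "of_int (M (chamber_weight (Y \<circ> srefl s) s)) = fund_weight s x - (root s x + of_int E)"
        using vertex_value[OF m Ys sI] sy inv_weyl_srefl[OF Y sI] sI by (simp add: y_def fund_weight_coroot)
      have 4: "chamber_weight G k y = fund_weight k (word (rev gw) x) - (root s x + of_int E) * c"
        unfolding cG sy c_def by (simp add: linear_diff[OF linear_word] linear_scale[OF linear_word])
      show ?thesis using sl unfolding 1 2 3 4 by (simp add: algebra_simps)
    qed
    then show ?thesis using ge vertex_value[OF m G k] by (simp add: chamber_weight_def)
  qed
  then have "inv G y = inv G (\<mu> G)" by (rule fund_weight_eqI)
  then have "y = \<mu> G" using G by (metis weyl_inv_right')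
  then show ?thesis by (simp add: y_def G_def)
qed

end

subsection \<open>Type $G_2$\<close>

context
  fixes t1 t2 t3 t4 t5 t6 p1 p2 p3 p4 p5 p6 :: int
  assumes nonneg: "t1 \<ge> 0" "t2 \<ge> 0" "t3 \<ge> 0" "t4 \<ge> 0" "t5 \<ge> 0" "t6 \<ge> 0"
    and tr: "[p1, p2, p3, p4, p5, p6] = G2_transition t1 t2 t3 t4 t5 t6"
begin

text \<open>Naming the partial minima lets linear arithmetic treat them as variables with bounds
  instead of splitting nested minima.\<close>

lemma G2_minima:
  "\<exists>m n r1 r2 r3 r4 u v. m = min t1 t3 \<and> n = min t3 t5 \<and>
    r1 = min (t1 + t2 + 2 * t3 + t4) (min (t1 + t2 + 2 * n + t6) (m + t4 + 2 * t5 + t6)) \<and>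
    r2 = min (2 * t1 + 2 * t2 + 3 * t3 + t4) (min (2 * t1 + 2 * t2 + 3 * n + t6) (min (2 * m + 2 * t4 + 3 * t5 + t6) (t1 + t2 + t4 + 2 * t5 + t6 + (m + n)))) \<and>
    r3 = min (3 * t1 + 2 * t2 + 3 * t3 + t4) (min (3 * t1 + 2 * t2 + 3 * n + t6) (min (3 * m + 2 * t4 + 3 * t5 + t6) (2 * t1 + t2 + t4 + 2 * t5 + t6 + (m + n)))) \<and>
    u = min (t1 + t2 + 3 * t3 + t4) (min (t1 + t2 + 3 * n + t6) (m + n + t4 + 2 * t5 + t6)) \<and>
    v = min (t1 + t2 + 2 * n) (m + t4 + 2 * t5) \<and>
    r4 = min (2 * t1 + 2 * t2 + 3 * t3 + t4 + u) (2 * t6 + 3 * v) \<and>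
    p1 = t2 + 3 * t3 + 2 * t4 + 3 * t5 + t6 - r3 \<and> p2 = r3 - r2 \<and> p3 = 3 * r2 - r3 - r4 \<and> p4 = r4 - r1 - r2 \<and>
    p5 = 3 * r1 - r4 \<and> p6 = t1 + t2 + 2 * t3 + t4 + t5 - r1"
proof -
  define m where "m = min t1 t3"
  define n where "n = min t3 t5"
  define r1 where "r1 = min (t1 + t2 + 2 * t3 + t4) (min (t1 + t2 + 2 * n + t6) (m + t4 + 2 * t5 + t6))"
  define r2 where "r2 = min (2 * t1 + 2 * t2 + 3 * t3 + t4) (min (2 * t1 + 2 * t2 + 3 * n + t6) (min (2 * m + 2 * t4 + 3 * t5 + t6) (t1 + t2 + t4 + 2 * t5 + t6 + (m + n))))"
  define r3 where "r3 = min (3 * t1 + 2 * t2 + 3 * t3 + t4) (min (3 * t1 + 2 * t2 + 3 * n + t6) (min (3 * m + 2 * t4 + 3 * t5 + t6) (2 * t1 + t2 + t4 + 2 * t5 + t6 + (m + n))))"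
  define u where "u = min (t1 + t2 + 3 * t3 + t4) (min (t1 + t2 + 3 * n + t6) (m + n + t4 + 2 * t5 + t6))"
  define v where "v = min (t1 + t2 + 2 * n) (m + t4 + 2 * t5)"
  define r4 where "r4 = min (2 * t1 + 2 * t2 + 3 * t3 + t4 + u) (2 * t6 + 3 * v)"
  have M: "Min {x, y} = min x y" "Min {x, y, z} = min x (min y z)" "Min {x, y, z, w} = min x (min y (min z w))" for x y z w :: int by simp_all
  have "[p1, p2, p3, p4, p5, p6] = [t2 + 3 * t3 + 2 * t4 + 3 * t5 + t6 - r3, r3 - r2, 3 * r2 - r3 - r4, r4 - r1 - r2, 3 * r1 - r4,
      t1 + t2 + 2 * t3 + t4 + t5 - r1]"
    using tr unfolding G2_transition_def Let_def M m_def[symmetric] n_def[symmetric] r1_def[symmetric] r2_def[symmetric]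
      r3_def[symmetric] u_def[symmetric] v_def[symmetric] r4_def[symmetric] .
  then have e: "p1 = t2 + 3 * t3 + 2 * t4 + 3 * t5 + t6 - r3" "p2 = r3 - r2" "p3 = 3 * r2 - r3 - r4" "p4 = r4 - r1 - r2"
    "p5 = 3 * r1 - r4" "p6 = t1 + t2 + 2 * t3 + t4 + t5 - r1" by (simp_all only: list.inject)
  show ?thesis
    by (rule exI[of _ m], rule exI[of _ n], rule exI[of _ r1], rule exI[of _ r2], rule exI[of _ r3], rule exI[of _ r4], rule exI[of _ u], rule exI[of _ v])
      (intro conjI m_def n_def r1_def r2_def r3_def r4_def u_def v_def e)
qed

text \<open>The zeros are shifted by one place. Bounding each minimum by its first entry suffices,
  because with the last \<open>p\<close> equal to zero these bounds already force the corresponding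
  \<open>t\<close> to be at most zero.\<close>

lemma G2_tail_back:
  shows "p6 = 0 \<Longrightarrow> t5 = 0" "p5 = 0 \<Longrightarrow> p6 = 0 \<Longrightarrow> t4 = 0" "p4 = 0 \<Longrightarrow> p5 = 0 \<Longrightarrow> p6 = 0 \<Longrightarrow> t3 = 0"
    "p3 = 0 \<Longrightarrow> p4 = 0 \<Longrightarrow> p5 = 0 \<Longrightarrow> p6 = 0 \<Longrightarrow> t2 = 0"
    "p2 = 0 \<Longrightarrow> p3 = 0 \<Longrightarrow> p4 = 0 \<Longrightarrow> p5 = 0 \<Longrightarrow> p6 = 0 \<Longrightarrow> t1 = 0"
proof -
  obtain m n r1 r2 r3 r4 u v where d: "m = min t1 t3" "n = min t3 t5"
    "r1 = min (t1 + t2 + 2 * t3 + t4) (min (t1 + t2 + 2 * n + t6) (m + t4 + 2 * t5 + t6))"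
    "r2 = min (2 * t1 + 2 * t2 + 3 * t3 + t4) (min (2 * t1 + 2 * t2 + 3 * n + t6) (min (2 * m + 2 * t4 + 3 * t5 + t6) (t1 + t2 + t4 + 2 * t5 + t6 + (m + n))))"
    "r3 = min (3 * t1 + 2 * t2 + 3 * t3 + t4) (min (3 * t1 + 2 * t2 + 3 * n + t6) (min (3 * m + 2 * t4 + 3 * t5 + t6) (2 * t1 + t2 + t4 + 2 * t5 + t6 + (m + n))))"
    "u = min (t1 + t2 + 3 * t3 + t4) (min (t1 + t2 + 3 * n + t6) (m + n + t4 + 2 * t5 + t6))"
    "v = min (t1 + t2 + 2 * n) (m + t4 + 2 * t5)"
    "r4 = min (2 * t1 + 2 * t2 + 3 * t3 + t4 + u) (2 * t6 + 3 * v)"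
    and e: "p2 = r3 - r2" "p3 = 3 * r2 - r3 - r4" "p4 = r4 - r1 - r2" "p5 = 3 * r1 - r4" "p6 = t1 + t2 + 2 * t3 + t4 + t5 - r1"
    using G2_minima by blast
  have b: "r1 \<le> t1 + t2 + 2 * t3 + t4" "r2 \<le> 2 * t1 + 2 * t2 + 3 * t3 + t4" "r3 \<le> 3 * t1 + 2 * t2 + 3 * t3 + t4"
    "r4 \<le> 2 * t1 + 2 * t2 + 3 * t3 + t4 + u" "u \<le> t1 + t2 + 3 * t3 + t4" unfolding d(3-6,8) by (rule min.cobounded1)+
  show "p6 = 0 \<Longrightarrow> t5 = 0" "p5 = 0 \<Longrightarrow> p6 = 0 \<Longrightarrow> t4 = 0" "p4 = 0 \<Longrightarrow> p5 = 0 \<Longrightarrow> p6 = 0 \<Longrightarrow> t3 = 0"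
    "p3 = 0 \<Longrightarrow> p4 = 0 \<Longrightarrow> p5 = 0 \<Longrightarrow> p6 = 0 \<Longrightarrow> t2 = 0"
    "p2 = 0 \<Longrightarrow> p3 = 0 \<Longrightarrow> p4 = 0 \<Longrightarrow> p5 = 0 \<Longrightarrow> p6 = 0 \<Longrightarrow> t1 = 0"
    using b e nonneg by linarith+
qed

text \<open>For \<open>p5\<close> down to \<open>p2\<close>, nonnegativity gives one inequality and
  a comparison of \<open>r1\<close> with the other minima the opposite one. With all of these zero,
  \<open>r1 = r2 = r3 = 0\<close> and \<open>p1\<close> vanishes as well.\<close>

lemma G2_tail:
  assumes pos: "p1 \<ge> 0" "p2 \<ge> 0" "p3 \<ge> 0" "p4 \<ge> 0" "p5 \<ge> 0"
  shows "t6 = 0 \<Longrightarrow> p5 = 0" "t5 = 0 \<Longrightarrow> t6 = 0 \<Longrightarrow> p4 = 0" "t4 = 0 \<Longrightarrow> t5 = 0 \<Longrightarrow> t6 = 0 \<Longrightarrow> p3 = 0"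
    "t3 = 0 \<Longrightarrow> t4 = 0 \<Longrightarrow> t5 = 0 \<Longrightarrow> t6 = 0 \<Longrightarrow> p2 = 0"
    "t2 = 0 \<Longrightarrow> t3 = 0 \<Longrightarrow> t4 = 0 \<Longrightarrow> t5 = 0 \<Longrightarrow> t6 = 0 \<Longrightarrow> p1 = 0"
proof -
  obtain m n r1 r2 r3 r4 u v where d: "m = min t1 t3" "n = min t3 t5"
    "r1 = min (t1 + t2 + 2 * t3 + t4) (min (t1 + t2 + 2 * n + t6) (m + t4 + 2 * t5 + t6))"
    "r2 = min (2 * t1 + 2 * t2 + 3 * t3 + t4) (min (2 * t1 + 2 * t2 + 3 * n + t6) (min (2 * m + 2 * t4 + 3 * t5 + t6) (t1 + t2 + t4 + 2 * t5 + t6 + (m + n))))"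
    "r3 = min (3 * t1 + 2 * t2 + 3 * t3 + t4) (min (3 * t1 + 2 * t2 + 3 * n + t6) (min (3 * m + 2 * t4 + 3 * t5 + t6) (2 * t1 + t2 + t4 + 2 * t5 + t6 + (m + n))))"
    "u = min (t1 + t2 + 3 * t3 + t4) (min (t1 + t2 + 3 * n + t6) (m + n + t4 + 2 * t5 + t6))"
    "v = min (t1 + t2 + 2 * n) (m + t4 + 2 * t5)"
    "r4 = min (2 * t1 + 2 * t2 + 3 * t3 + t4 + u) (2 * t6 + 3 * v)"
    and e: "p1 = t2 + 3 * t3 + 2 * t4 + 3 * t5 + t6 - r3" "p2 = r3 - r2" "p3 = 3 * r2 - r3 - r4" "p4 = r4 - r1 - r2" "p5 = 3 * r1 - r4"
    using G2_minima by blast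
  have mn: "m \<le> t1" "m \<le> t3" "n \<le> t3" "n \<le> t5" "m \<ge> 0" "n \<ge> 0" using nonneg unfolding d(1,2) by simp_all
  have r1: "r1 \<le> t1 + t2 + 2 * n + t6" "r1 \<le> m + t4 + 2 * t5 + t6" unfolding d(3) by simp_all
  have M: "x \<le> min x y \<or> y \<le> min x y" "x \<le> min x (min y z) \<or> y \<le> min x (min y z) \<or> z \<le> min x (min y z)"
    "x \<le> min x (min y (min z w)) \<or> y \<le> min x (min y (min z w)) \<or> z \<le> min x (min y (min z w)) \<or> w \<le> min x (min y (min z w))"
    for x y z w :: int by linarith+
  have u: "t1 + t2 + 3 * t3 + t4 \<le> u \<or> t1 + t2 + 3 * n + t6 \<le> u \<or> m + n + t4 + 2 * t5 + t6 \<le> u" unfolding d(6) by (rule M)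
  have v: "t1 + t2 + 2 * n \<le> v \<or> m + t4 + 2 * t5 \<le> v" unfolding d(7) by (rule M)
  have r4: "2 * t1 + 2 * t2 + 3 * t3 + t4 + u \<le> r4 \<or> 2 * t6 + 3 * v \<le> r4" unfolding d(8) by (rule M)
  have r2: "2 * t1 + 2 * t2 + 3 * t3 + t4 \<le> r2 \<or> 2 * t1 + 2 * t2 + 3 * n + t6 \<le> r2 \<or> 2 * m + 2 * t4 + 3 * t5 + t6 \<le> r2
    \<or> t1 + t2 + t4 + 2 * t5 + t6 + (m + n) \<le> r2" unfolding d(4) by (rule M)
  have r3: "3 * t1 + 2 * t2 + 3 * t3 + t4 \<le> r3 \<or> 3 * t1 + 2 * t2 + 3 * n + t6 \<le> r3 \<or> 3 * m + 2 * t4 + 3 * t5 + t6 \<le> r3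
    \<or> 2 * t1 + t2 + t4 + 2 * t5 + t6 + (m + n) \<le> r3" unfolding d(5) by (rule M)
  show 1: "p5 = 0" if "t6 = 0"
  proof -
    have "3 * r1 \<le> r4" by (insert r4 u v r1 mn nonneg that, elim disjE; linarith)
    then show ?thesis using e pos by linarith
  qed
  show 2: "p4 = 0" if "t5 = 0" "t6 = 0"
  proof -
    have "r4 = 3 * r1" using 1[OF that(2)] e by linarith
    moreover have "2 * r1 \<le> r2" by (insert r2 r1 mn that nonneg, elim disjE; linarith)
    ultimately show ?thesis using e pos by linarith
  qed
  show 3: "p3 = 0" if "t4 = 0" "t5 = 0" "t6 = 0"
  proof -
    have "r4 = 3 * r1" "r2 = 2 * r1" using 1[OF that(3)] 2[OF that(2,3)] e by linarith+
    moreover have "3 * r1 \<le> r3" by (insert r3 r1 mn that nonneg, elim disjE; linarith)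
    ultimately show ?thesis using e pos by linarith
  qed
  show 4: "p2 = 0" if "t3 = 0" "t4 = 0" "t5 = 0" "t6 = 0"
  proof -
    have "r4 = 3 * r1" "r2 = 2 * r1" "r3 = 3 * r1" using 1[OF that(4)] 2[OF that(3,4)] 3[OF that(2-4)] e by linarith+
    moreover have "r1 \<le> 0" using r1 mn that by linarith
    ultimately show ?thesis using e pos by linarith
  qed
  show "p1 = 0" if "t2 = 0" "t3 = 0" "t4 = 0" "t5 = 0" "t6 = 0"
  proof -
    have "r3 = 3 * r1" "r2 = 2 * r1" "r3 = r2" using 1[OF that(5)] 2[OF that(4,5)] 3[OF that(3-5)] 4[OF that(2-5)] e by linarith+
    then show ?thesis using e that by linarith
  qed
qed

end

context root_datum
begin

text \<open>A third node attached to a triple bond would make the symmetrised form nonpositive on a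
  nonzero vector.\<close>

lemma G2_isolated:
  assumes ij: "i \<in> I" "j \<in> I" "i \<noteq> j" "a i j * a j i = 3" and k: "k \<in> I" "k \<noteq> i" "k \<noteq> j"
  shows "a i k = 0"
proof (rule ccontr)
  assume nz: "a i k \<noteq> 0"
  have neg: "a i k \<le> -1" "a k i \<le> -1" "a i j \<le> 0" "a j i \<le> 0" "a j k \<le> 0" "a k j \<le> 0"
    using cartan_nonpos cartan_zero[of i k] nz ij k by (smt (verit))+
  let ?d = symmetrizer
  have d: "?d i > 0" "?d j > 0" "?d k > 0" using symmetrizer_pos ij k by auto
  have sy: "?d j * of_int (a j i) = ?d i * of_int (a i j)" "?d k * of_int (a k i) = ?d i * of_int (a i k)"
    using symmetrizer_sym ij k by auto
  \<comment> \<open>With entry 2 at the centre \<open>i\<close> and the negated Cartan entries at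
    its neighbours, the form is at most \<open>2 * ?d i * (4 - 3 - 1) = 0\<close>.\<close>
  define x where "x = (\<lambda>m. if m = i then 2 else if m = j then - real_of_int (a j i) else if m = k then - real_of_int (a k i) else 0)"
  have x: "x i = 2" "x j = - of_int (a j i)" "x k = - of_int (a k i)" using ij k by (auto simp: x_def)
  have z: "x m = 0" if "m \<notin> {i, j, k}" for m using that by (auto simp: x_def)
  have r: "(\<Sum>m\<in>I. f m) = f i + f j + f k" if "\<And>m. m \<notin> {i, j, k} \<Longrightarrow> f m = 0" for f :: "'i \<Rightarrow> real"
  proof -
    have "(\<Sum>m\<in>I. f m) = (\<Sum>m\<in>{i, j, k}. f m)" by (rule sum.mono_neutral_right) (use that ij k in auto)
    then show ?thesis using ij k by (simp add: add.assoc)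
  qed
  have "0 < (\<Sum>p\<in>I. \<Sum>m\<in>I. ?d p * of_int (a p m) * x p * x m)" using symmetrizer_definite[of i x] ij x by simp
  also have "\<dots> = (\<Sum>p\<in>I. ?d p * of_int (a p i) * x p * x i + ?d p * of_int (a p j) * x p * x j + ?d p * of_int (a p k) * x p * x k)"
    by (intro sum.cong refl r) (simp add: z)
  also have "\<dots> = (?d i * of_int (a i i) * x i * x i + ?d i * of_int (a i j) * x i * x j + ?d i * of_int (a i k) * x i * x k)
     + (?d j * of_int (a j i) * x j * x i + ?d j * of_int (a j j) * x j * x j + ?d j * of_int (a j k) * x j * x k)
     + (?d k * of_int (a k i) * x k * x i + ?d k * of_int (a k j) * x k * x j + ?d k * of_int (a k k) * x k * x k)"
    by (rule r) (simp add: z)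
  also have "\<dots> \<le> 8 * ?d i - 2 * ?d i * of_int (a i j * a j i) - 2 * ?d i * of_int (a i k * a k i)"
  proof -
    have jk: "?d j * of_int (a j k) * x j * x k \<le> 0" "?d k * of_int (a k j) * x k * x j \<le> 0"
      using neg d unfolding x by (simp_all add: mult_le_0_iff mult_nonneg_nonneg mult_nonneg_nonpos zero_le_mult_iff)
    have 1: "?d j * of_int (a j i) * x j * x i = - 2 * (?d i * of_int (a i j)) * of_int (a j i)" unfolding sy(1) x by simp
    have 2: "?d j * of_int (a j j) * x j * x j = 2 * (?d i * of_int (a i j)) * of_int (a j i)"
      unfolding sy(1)[symmetric] x using ij by simp
    have 3: "?d k * of_int (a k i) * x k * x i = - 2 * (?d i * of_int (a i k)) * of_int (a k i)" unfolding sy(2) x by simp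
    have 4: "?d k * of_int (a k k) * x k * x k = 2 * (?d i * of_int (a i k)) * of_int (a k i)"
      unfolding sy(2)[symmetric] x using k by simp
    have e: "?d i * of_int (a i i) * x i * x i = 8 * ?d i" "?d i * of_int (a i j) * x i * x j = - 2 * (?d i * of_int (a i j)) * of_int (a j i)"
      "?d i * of_int (a i k) * x i * x k = - 2 * (?d i * of_int (a i k)) * of_int (a k i)"
      "2 * ?d i * of_int (a i j * a j i) = 2 * (?d i * of_int (a i j)) * of_int (a j i)"
      "2 * ?d i * of_int (a i k * a k i) = 2 * (?d i * of_int (a i k)) * of_int (a k i)" unfolding x of_int_mult using ij(1) by simp_all
    show ?thesis unfolding 1 2 3 4 e using jk by linarith
  qed
  also have "\<dots> \<le> 0"
  proof -
    have "a i k * a k i \<ge> 1" using mult_mono'[of 1 "- a i k" 1 "- a k i"] neg by simp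
    then have "(1::real) \<le> of_int (a i k * a k i)" by (simp only: of_int_1_le_iff)
    then have "2 * ?d i * 1 \<le> 2 * ?d i * of_int (a i k * a k i)" by (rule mult_left_mono) (use d in simp)
    then show ?thesis unfolding ij(4) by simp
  qed
  finally show False by simp
qed

lemma reduced_not_repeat: "\<not> reduced (c # c # ks)"
proof
  assume r: "reduced (c # c # ks)"
  then have I: "c \<in> I" "ks \<in> lists I" using reduced_lists[OF r] by auto
  then have "word (c # c # ks) = word ks" by (auto simp: fun_eq_iff)
  then show False using len_word_le[OF I(2)] reduced_len[OF r] by simp
qed

lemma word_G2:
  assumes "s \<in> I" "t \<in> I" "s \<noteq> t" "a s t * a t s = 3"
  shows "mm s t = 6" "word [s, t, s, t, s, t] = word [t, s, t, s, t, s]"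
proof -
  have 6: "(6::nat) = Suc (Suc (Suc (Suc (Suc (Suc 0)))))" by simp
  show mm: "mm s t = 6" using assms(4) by (simp add: mm_def)
  have "alt 6 t s = [s, t, s, t, s, t]" "alt 6 s t = [t, s, t, s, t, s]" unfolding 6 by simp_all
  then show "word [s, t, s, t, s, t] = word [t, s, t, s, t, s]" using braid[OF assms(1-3)] unfolding mm by (simp only:)
qed

text \<open>A reduced word in two letters alternates, and the braid relation of length six shortens
  an alternating word of seven letters.\<close>

lemma reduced_G2:
  assumes st: "s \<in> I" "t \<in> I" "s \<noteq> t" "a s t * a t s = 3" and gw: "gw \<in> lists {s, t}" and r: "reduced (s # gw)"
  shows "\<exists>l\<le>5. gw = take l [t, s, t, s, t]"
proof -
  have *: "ks = [] \<or> (\<exists>ls. ks = y # ls \<and> ls \<in> lists {s, t} \<and> reduced (y # ls))"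
    if "reduced (x # ks)" "ks \<in> lists {s, t}" "{x, y} = {s, t}" for x y ks
  proof (cases ks)
    case (Cons z ls)
    then have "z \<noteq> x" using that(1) reduced_not_repeat by blast
    then have "z = y" using that(2,3) Cons by auto
    then show ?thesis using Cons that(2) reduced_appendD(2)[of "[x]" ks] that(1) by auto
  qed simp
  have no: "\<not> reduced (s # t # s # t # s # t # s # ks)" for ks
  proof
    assume "reduced (s # t # s # t # s # t # s # ks)"
    then have r7: "reduced [s, t, s, t, s, t, s]" using reduced_appendD(1)[of "[s, t, s, t, s, t, s]" ks] by simp
    have "word ([s, t, s, t, s, t] @ [s]) = word ([t, s, t, s, t, s] @ [s])" unfolding word_append word_G2(2)[OF st] ..
    also have "\<dots> = word [t, s, t, s, t]" using st by (auto simp: fun_eq_iff)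
    finally have "word [s, t, s, t, s, t, s] = word [t, s, t, s, t]" by simp
    then show False using reduced_len[OF r7] len_word_le[of "[t, s, t, s, t]"] st by simp
  qed
  show ?thesis
  proof (rule ccontr)
    assume n: "\<not> (\<exists>l\<le>5. gw = take l [t, s, t, s, t])"
    have nl: "gw \<noteq> take l [t, s, t, s, t]" if "l \<le> 5" for l using n that by blast
    have st2: "{s, t} = {s, t}" "{t, s} = {s, t}" by auto
    obtain k1 where k1: "gw = t # k1" "k1 \<in> lists {s, t}" "reduced (t # k1)" using *[OF r gw st2(1)] nl[of 0] by auto
    obtain k2 where k2: "k1 = s # k2" "k2 \<in> lists {s, t}" "reduced (s # k2)" using *[OF k1(3,2) st2(2)] nl[of 1] k1 by auto
    obtain k3 where k3: "k2 = t # k3" "k3 \<in> lists {s, t}" "reduced (t # k3)" using *[OF k2(3,2) st2(1)] nl[of 2] k1 k2 by auto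
    obtain k4 where k4: "k3 = s # k4" "k4 \<in> lists {s, t}" "reduced (s # k4)" using *[OF k3(3,2) st2(2)] nl[of 3] k1 k2 k3 by auto
    obtain k5 where k5: "k4 = t # k5" "k5 \<in> lists {s, t}" "reduced (t # k5)" using *[OF k4(3,2) st2(1)] nl[of 4] k1 k2 k3 k4 by auto
    obtain k6 where k6: "k5 = s # k6" using *[OF k5(3,2) st2(2)] nl[of 5] k1 k2 k3 k4 k5 by auto
    show False using no[of k6] r unfolding k1(1) k2(1) k3(1) k4(1) k5(1) k6 by simp
  qed
qed

text \<open>In the dodecagon of the coset, the paths from \<open>Y\<close> and from
  \<open>Y \<circ> srefl s\<close> along \<open>gw\<close> run down opposite sides. The second one
  starts one edge lower, which is exactly the shift by one place in \<open>G2_tail\<close> and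
  \<open>G2_tail_back\<close>.\<close>

lemma shadow_G2:
  assumes m: "vertex_data M \<mu>" and M: "tropical_pluecker M" and Y: "Y \<in> weyl"
    and st: "s \<in> I" "t \<in> I" "s \<noteq> t" "a s t * a t s = 3" and gw: "gw \<in> lists {s, t}"
    and d: "down Y (s # gw)" "down Y gw" and e: "\<mu> (Y \<circ> word gw) = \<mu> Y"
  shows "\<mu> (Y \<circ> srefl s \<circ> word gw) = \<mu> (Y \<circ> srefl s)"
proof (cases "gw = []")
  case False
  have gI: "gw \<in> lists I" using gw st by (auto simp: lists_eq_set)
  have r: "reduced (s # gw)" using down_reduced[OF Y _ d(1)] st gI by simp
  obtain l where l: "l \<le> 5" "gw = take l [t, s, t, s, t]" using reduced_G2[OF st gw r] by blast
  then have l0: "l > 0" using False by (cases l) auto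
  have ds: "down Y [s]" using down_append[OF Y, of "[s]" gw] d(1) gI st by simp
  have dt: "down Y [t]" using down_append[OF Y, of "[t]" "tl gw"] d(2) gI st l l0 by (cases l) (auto simp: lists_eq_set)
  have len: "len (Y \<circ> srefl s) < len Y" "len (Y \<circ> srefl t) < len Y" using ds dt by (auto simp: down_def)
  have mm: "mm s t = 6" using word_G2[OF st] by blast
  have 6: "(6::nat) = Suc (Suc (Suc (Suc (Suc (Suc 0)))))" by simp
  have al: "alt 6 t s = [s, t, s, t, s, t]" "alt 6 s t = [t, s, t, s, t, s]" unfolding 6 by simp_all
  obtain w' where w': "w' \<in> weyl" "Y = w' \<circ> word [s, t, s, t, s, t]" "len Y = len w' + 6"
    using rank2_descents[OF Y st(1-3) len] unfolding mm al by blast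
  have "Y \<circ> word [t, s, t, s, t, s] = w'" unfolding w'(2) using st by (auto simp: fun_eq_iff)
  then have "len (Y \<circ> word (alt (mm s t) s t)) + mm s t = len Y" unfolding mm al using w'(3) by simp
  then obtain w where w: "w \<in> weyl" "len w < len (w \<circ> srefl s)" "len w < len (w \<circ> srefl t)" "Y = w \<circ> word [t, s, t, s, t, s]" "Y = w \<circ> word [s, t, s, t, s, t]"
    using coset_bottom[OF Y st(1-3)] unfolding mm al by metis
  have tp: "tropical_pluecker_at M w s t" "tropical_pluecker_at M w t s" using M w(1-3) st(1-3) unfolding tropical_pluecker_def by auto
  define E where "E = (\<lambda>ks k. edge_length M (w \<circ> word ks) k)"
  have Epos: "E ks k \<ge> 0" if "ks \<in> lists {s, t}" "k \<in> {s, t}" for ks k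
    unfolding E_def using edge_nonneg[OF m] weyl_comp[OF w(1) weyl_word, of ks] that st by (auto simp: lists_eq_set)
  have tail: "(E [s,t,s,t,s] t = 0 \<longrightarrow> E [t,s,t,s] t = 0) \<and>
     (E [s,t,s,t] s = 0 \<longrightarrow> E [s,t,s,t,s] t = 0 \<longrightarrow> E [t,s,t] s = 0) \<and>
     (E [s,t,s] t = 0 \<longrightarrow> E [s,t,s,t] s = 0 \<longrightarrow> E [s,t,s,t,s] t = 0 \<longrightarrow> E [t,s] t = 0) \<and>
     (E [s,t] s = 0 \<longrightarrow> E [s,t,s] t = 0 \<longrightarrow> E [s,t,s,t] s = 0 \<longrightarrow> E [s,t,s,t,s] t = 0 \<longrightarrow> E [t] s = 0) \<and>
     (E [s] t = 0 \<longrightarrow> E [s,t] s = 0 \<longrightarrow> E [s,t,s] t = 0 \<longrightarrow> E [s,t,s,t] s = 0 \<longrightarrow> E [s,t,s,t,s] t = 0 \<longrightarrow> E [] t = 0)"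
  proof -
    have pos: "E [] s \<ge> 0" "E [s] t \<ge> 0" "E [s,t] s \<ge> 0" "E [s,t,s] t \<ge> 0" "E [s,t,s,t] s \<ge> 0" "E [s,t,s,t,s] t \<ge> 0"
      "E [] t \<ge> 0" "E [t] s \<ge> 0" "E [t,s] t \<ge> 0" "E [t,s,t] s \<ge> 0" "E [t,s,t,s] t \<ge> 0" "E [t,s,t,s,t] s \<ge> 0"
      by (rule Epos; simp)+
    \<comment> \<open>The transition map is stated for one of the two orderings, so it is read
      forward or backward depending on which entry is \<open>-3\<close>.\<close>
    consider "a s t = -3" "a t s = -1" | "a t s = -3" "a s t = -1"
      by (rule cartan_cases[OF st(1-3)]) (use st(4) in auto)
    then show ?thesis
    proof cases
      case 1
      have "[E [] t, E [t] s, E [t,s] t, E [t,s,t] s, E [t,s,t,s] t, E [t,s,t,s,t] s] =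
         G2_transition (E [] s) (E [s] t) (E [s,t] s) (E [s,t,s] t) (E [s,t,s,t] s) (E [s,t,s,t,s] t)"
        using tp(1) 1 unfolding tropical_pluecker_at_def Let_def E_def by simp
      from G2_tail[OF pos(1-6) this pos(7-11)] show ?thesis by blast
    next
      case 2
      have "[E [] s, E [s] t, E [s,t] s, E [s,t,s] t, E [s,t,s,t] s, E [s,t,s,t,s] t] =
         G2_transition (E [] t) (E [t] s) (E [t,s] t) (E [t,s,t] s) (E [t,s,t,s] t) (E [t,s,t,s,t] s)"
        using tp(2) 2 unfolding tropical_pluecker_at_def Let_def E_def by simp
      from G2_tail_back[OF pos(7-12) this] show ?thesis by blast
    qed
  qed
  define D where "D = (\<lambda>ks k. edge_length M (Y \<circ> word ks) k)"
  have W: "w \<circ> word ks \<in> weyl" if "ks \<in> lists {s, t}" for ks using weyl_comp[OF w(1) weyl_word, of ks] that st by (auto simp: lists_eq_set)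
  have ES: "edge_length M (w \<circ> word (ks @ [k])) k = E ks k" if "ks \<in> lists {s, t}" "k \<in> {s, t}" for ks k
    unfolding E_def word_snoc o_assoc using edge_length_sym[OF W[OF that(1)]] that st by auto
  have V: "Y \<circ> word [t] = w \<circ> word [s,t,s,t,s]" "Y \<circ> word [t,s] = w \<circ> word [s,t,s,t]" "Y \<circ> word [t,s,t] = w \<circ> word [s,t,s]"
    "Y \<circ> word [t,s,t,s] = w \<circ> word [s,t]" "Y \<circ> word [t,s,t,s,t] = w \<circ> word [s]"
    unfolding w(5) using st by (auto simp: fun_eq_iff)
  have U: "Y \<circ> word [s] = w \<circ> word [t,s,t,s,t]" "Y \<circ> word [s,t] = w \<circ> word [t,s,t,s]" "Y \<circ> word [s,t,s] = w \<circ> word [t,s,t]"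
    "Y \<circ> word [s,t,s,t] = w \<circ> word [t,s]" "Y \<circ> word [s,t,s,t,s] = w \<circ> word [t]" "Y \<circ> word [s,t,s,t,s,t] = w \<circ> word []"
    unfolding w(4) using st by (auto simp: fun_eq_iff)
  have step: "\<mu> (w \<circ> word (ks @ [k])) = \<mu> (w \<circ> word ks) \<longleftrightarrow> E ks k = 0" if "ks \<in> lists {s, t}" "k \<in> {s, t}" for ks k
    unfolding E_def word_snoc o_assoc using edge_zero[OF m W[OF that(1)], of k] that st by auto
  have VE: "\<mu> Y = \<mu> (w \<circ> word [s,t,s,t,s]) \<longleftrightarrow> E [s,t,s,t,s] t = 0" "\<mu> (w \<circ> word [s,t,s,t,s]) = \<mu> (w \<circ> word [s,t,s,t]) \<longleftrightarrow> E [s,t,s,t] s = 0"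
    "\<mu> (w \<circ> word [s,t,s,t]) = \<mu> (w \<circ> word [s,t,s]) \<longleftrightarrow> E [s,t,s] t = 0" "\<mu> (w \<circ> word [s,t,s]) = \<mu> (w \<circ> word [s,t]) \<longleftrightarrow> E [s,t] s = 0"
    "\<mu> (w \<circ> word [s,t]) = \<mu> (w \<circ> word [s]) \<longleftrightarrow> E [s] t = 0"
    using step[of "[s,t,s,t,s]" t] step[of "[s,t,s,t]" s] step[of "[s,t,s]" t] step[of "[s,t]" s] step[of "[s]" t] w(5) by simp_all
  have UE: "\<mu> (w \<circ> word [t,s,t,s,t]) = \<mu> (w \<circ> word [t,s,t,s]) \<longleftrightarrow> E [t,s,t,s] t = 0"
    "\<mu> (w \<circ> word [t,s,t,s]) = \<mu> (w \<circ> word [t,s,t]) \<longleftrightarrow> E [t,s,t] s = 0" "\<mu> (w \<circ> word [t,s,t]) = \<mu> (w \<circ> word [t,s]) \<longleftrightarrow> E [t,s] t = 0"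
    "\<mu> (w \<circ> word [t,s]) = \<mu> (w \<circ> word [t]) \<longleftrightarrow> E [t] s = 0" "\<mu> (w \<circ> word [t]) = \<mu> (w \<circ> word []) \<longleftrightarrow> E [] t = 0"
    using step[of "[t,s,t,s]" t] step[of "[t,s,t]" s] step[of "[t,s]" t] step[of "[t]" s] step[of "[]" t] by simp_all
  have pre: "\<mu> (Y \<circ> word xs) = \<mu> Y" if "gw = xs @ ys" for xs ys
    by (rule vertex_prefix[OF m Y, of xs ys]) (use gI d(2) e in \<open>simp_all add: that del: word_append\<close>)
  have goal: "Y \<circ> srefl s \<circ> word gw = Y \<circ> word (s # gw)" by (simp add: o_assoc)
  have s1: "Y \<circ> srefl s = Y \<circ> word [s]" by simp
  consider "gw = [t]" | "gw = [t,s]" | "gw = [t,s,t]" | "gw = [t,s,t,s]" | "gw = [t,s,t,s,t]"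
    using l l0 by (auto simp: le_Suc_eq numeral_eq_Suc)
  then show ?thesis
  proof cases
    case 1
    have h1: "\<mu> (w \<circ> word [s,t,s,t,s]) = \<mu> Y" unfolding V[symmetric] by (rule pre[of _ "[]"]) (simp add: 1)
    note z1 = iffD1[OF VE(1) h1[symmetric]]
    have y1: "E [t,s,t,s] t = 0" using tail z1 by simp
    show ?thesis unfolding goal unfolding s1 1 U by (simp only: iffD2[OF UE(1) y1])
  next
    case 2
    have h1: "\<mu> (w \<circ> word [s,t,s,t,s]) = \<mu> Y" unfolding V[symmetric] by (rule pre[of _ "[s]"]) (simp add: 2)
    have h2: "\<mu> (w \<circ> word [s,t,s,t]) = \<mu> Y" unfolding V[symmetric] by (rule pre[of _ "[]"]) (simp add: 2)
    note z1 = iffD1[OF VE(1) h1[symmetric]]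
    note z2 = iffD1[OF VE(2) trans[OF h1 h2[symmetric]]]
    have y1: "E [t,s,t,s] t = 0" using tail z1 z2 by simp
    have y2: "E [t,s,t] s = 0" using tail z1 z2 by simp
    show ?thesis unfolding goal unfolding s1 2 U by (simp only: iffD2[OF UE(1) y1] iffD2[OF UE(2) y2])
  next
    case 3
    have h1: "\<mu> (w \<circ> word [s,t,s,t,s]) = \<mu> Y" unfolding V[symmetric] by (rule pre[of _ "[s,t]"]) (simp add: 3)
    have h2: "\<mu> (w \<circ> word [s,t,s,t]) = \<mu> Y" unfolding V[symmetric] by (rule pre[of _ "[t]"]) (simp add: 3)
    have h3: "\<mu> (w \<circ> word [s,t,s]) = \<mu> Y" unfolding V[symmetric] by (rule pre[of _ "[]"]) (simp add: 3)
    note z1 = iffD1[OF VE(1) h1[symmetric]]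
    note z2 = iffD1[OF VE(2) trans[OF h1 h2[symmetric]]]
    note z3 = iffD1[OF VE(3) trans[OF h2 h3[symmetric]]]
    have y1: "E [t,s,t,s] t = 0" using tail z1 z2 z3 by simp
    have y2: "E [t,s,t] s = 0" using tail z1 z2 z3 by simp
    have y3: "E [t,s] t = 0" using tail z1 z2 z3 by simp
    show ?thesis unfolding goal unfolding s1 3 U by (simp only: iffD2[OF UE(1) y1] iffD2[OF UE(2) y2] iffD2[OF UE(3) y3])
  next
    case 4
    have h1: "\<mu> (w \<circ> word [s,t,s,t,s]) = \<mu> Y" unfolding V[symmetric] by (rule pre[of _ "[s,t,s]"]) (simp add: 4)
    have h2: "\<mu> (w \<circ> word [s,t,s,t]) = \<mu> Y" unfolding V[symmetric] by (rule pre[of _ "[t,s]"]) (simp add: 4)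
    have h3: "\<mu> (w \<circ> word [s,t,s]) = \<mu> Y" unfolding V[symmetric] by (rule pre[of _ "[s]"]) (simp add: 4)
    have h4: "\<mu> (w \<circ> word [s,t]) = \<mu> Y" unfolding V[symmetric] by (rule pre[of _ "[]"]) (simp add: 4)
    note z1 = iffD1[OF VE(1) h1[symmetric]]
    note z2 = iffD1[OF VE(2) trans[OF h1 h2[symmetric]]]
    note z3 = iffD1[OF VE(3) trans[OF h2 h3[symmetric]]]
    note z4 = iffD1[OF VE(4) trans[OF h3 h4[symmetric]]]
    have y1: "E [t,s,t,s] t = 0" using tail z1 z2 z3 z4 by simp
    have y2: "E [t,s,t] s = 0" using tail z1 z2 z3 z4 by simp
    have y3: "E [t,s] t = 0" using tail z1 z2 z3 z4 by simp
    have y4: "E [t] s = 0" using tail z1 z2 z3 z4 by simp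
    show ?thesis unfolding goal unfolding s1 4 U by (simp only: iffD2[OF UE(1) y1] iffD2[OF UE(2) y2] iffD2[OF UE(3) y3] iffD2[OF UE(4) y4])
  next
    case 5
    have h1: "\<mu> (w \<circ> word [s,t,s,t,s]) = \<mu> Y" unfolding V[symmetric] by (rule pre[of _ "[s,t,s,t]"]) (simp add: 5)
    have h2: "\<mu> (w \<circ> word [s,t,s,t]) = \<mu> Y" unfolding V[symmetric] by (rule pre[of _ "[t,s,t]"]) (simp add: 5)
    have h3: "\<mu> (w \<circ> word [s,t,s]) = \<mu> Y" unfolding V[symmetric] by (rule pre[of _ "[s,t]"]) (simp add: 5)
    have h4: "\<mu> (w \<circ> word [s,t]) = \<mu> Y" unfolding V[symmetric] by (rule pre[of _ "[t]"]) (simp add: 5)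
    have h5: "\<mu> (w \<circ> word [s]) = \<mu> Y" unfolding V[symmetric] by (rule pre[of _ "[]"]) (simp add: 5)
    note z1 = iffD1[OF VE(1) h1[symmetric]]
    note z2 = iffD1[OF VE(2) trans[OF h1 h2[symmetric]]]
    note z3 = iffD1[OF VE(3) trans[OF h2 h3[symmetric]]]
    note z4 = iffD1[OF VE(4) trans[OF h3 h4[symmetric]]]
    note z5 = iffD1[OF VE(5) trans[OF h4 h5[symmetric]]]
    have y1: "E [t,s,t,s] t = 0" using tail z1 z2 z3 z4 z5 by simp
    have y2: "E [t,s,t] s = 0" using tail z1 z2 z3 z4 z5 by simp
    have y3: "E [t,s] t = 0" using tail z1 z2 z3 z4 z5 by simp
    have y4: "E [t] s = 0" using tail z1 z2 z3 z4 z5 by simp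
    have y5: "E [] t = 0" using tail z1 z2 z3 z4 z5 by simp
    show ?thesis unfolding goal unfolding s1 5 U by (simp only: iffD2[OF UE(1) y1] iffD2[OF UE(2) y2] iffD2[OF UE(3) y3] iffD2[OF UE(4) y4] iffD2[OF UE(5) y5])
  qed
qed simp

text \<open>The nodes on no triple bond form a union of components, and a node on a triple bond has
  only its partner as a neighbour; either way \<open>shadow_split\<close> applies.\<close>

lemma shadow:
  assumes m: "vertex_data M \<mu>" and M: "tropical_pluecker M" and Y: "Y \<in> weyl" and s: "s \<in> I" and gw: "gw \<in> lists I"
    and d: "down Y (s # gw)" "down Y gw" and e: "\<mu> (Y \<circ> word gw) = \<mu> Y"
  shows "\<mu> (Y \<circ> srefl s \<circ> word gw) = \<mu> (Y \<circ> srefl s)"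
proof -
  define J where "J = {i \<in> I. \<forall>j\<in>I. a i j * a j i \<noteq> 3}"
  show ?thesis
  proof (cases "s \<in> J")
    case True
    interpret P: root_datum_part I a coroot J
    proof (unfold_locales)
      show "J \<subseteq> I" by (auto simp: J_def)
      show "a i j * a j i \<le> 2" if "i \<in> J" "j \<in> J" "i \<noteq> j" for i j
      proof -
        have "a i j * a j i \<noteq> 3" "a i j * a j i < 4" using that cartan_product[of i j] by (auto simp: J_def)
        then show ?thesis by linarith
      qed
    qed
    show ?thesis
    proof (rule shadow_split[OF m Y s True gw _ d e])
      show "a x y = 0" if xy: "x \<in> I" "y \<in> I" "x \<in> J" "y \<notin> J" for x y
      proof -
        obtain z where z: "z \<in> I" "a y z * a z y = 3" using xy(2,4) unfolding J_def by blast
        have "x \<noteq> y" using xy by blast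
        moreover have "x \<noteq> z"
        proof
          assume "x = z"
          then have "a x y * a y x = 3" using z by (simp add: mult.commute)
          then show False using xy(2,3) unfolding J_def by blast
        qed
        moreover have "y \<noteq> z" using z(2) cartan_diag[OF xy(2)] by force
        ultimately have "a y x = 0" using G2_isolated[OF xy(2) z(1) _ z(2) xy(1)] by simp
        then show ?thesis using cartan_zero xy by blast
      qed
      fix Y gw assume h: "Y \<in> weyl" "gw \<in> lists (I \<inter> J)" "down Y (s # gw)" "down Y gw" "\<mu> (Y \<circ> word gw) = \<mu> Y"
      have "gw \<in> lists J" using h(2) by (auto simp: lists_eq_set)
      then show "\<mu> (Y \<circ> srefl s \<circ> word gw) = \<mu> (Y \<circ> srefl s)" using P.shadow_J[OF m M h(1) True _ h(3,4,5)] by blast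
    qed
  next
    case False
    then obtain t where t: "t \<in> I" "a s t * a t s = 3" using s by (auto simp: J_def)
    have st: "s \<noteq> t" using t s by auto
    show ?thesis
    proof (rule shadow_split[OF m Y s _ gw _ d e, of "{s, t}"])
      show "a x y = 0" if "x \<in> I" "y \<in> I" "x \<in> {s, t}" "y \<notin> {s, t}" for x y
        using G2_isolated[OF s t(1) st t(2) that(2)] G2_isolated[OF t(1) s st[symmetric] _ that(2)] t(2) that by (auto simp: mult.commute)
      fix Y gw assume h: "Y \<in> weyl" "gw \<in> lists (I \<inter> {s, t})" "down Y (s # gw)" "down Y gw" "\<mu> (Y \<circ> word gw) = \<mu> Y"
      have "gw \<in> lists {s, t}" using h(2) by (auto simp: lists_eq_set)
      then show "\<mu> (Y \<circ> srefl s \<circ> word gw) = \<mu> (Y \<circ> srefl s)" using shadow_G2[OF m M h(1) s t(1) st t(2) _ h(3,4,5)] by blast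
    qed simp
  qed
qed

section \<open>The downward induction\<close>

lemma vertex_residual:
  assumes m: "vertex_data M \<mu>" and M: "tropical_pluecker M" and js: "js \<in> lists I" "len (word js) = length js"
    and top: "\<mu> (word js) = \<mu> w0" and v: "v \<in> weyl"
  shows "\<mu> (v \<circ> residual v js) = \<mu> v"
  using v
proof (induction "len w0 - len v" arbitrary: v rule: less_induct)
  case less
  have v: "v \<in> weyl" using less.prems .
  have lw: "len x \<le> len w0" if "x \<in> weyl" for x
  proof -
    have "len (w0 \<circ> x) + len x = len w0" using len_w0[OF that] .
    then show ?thesis by linarith
  qed
  show ?case
  \<comment> \<open>An element without ascents is \<open>w0\<close>, where the claim is the
    hypothesis \<open>top\<close> by \<open>residual_id\<close>.\<close>
  proof (cases "\<exists>s\<in>I. len v < len (v \<circ> srefl s)")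
    case False
    then have "len (v \<circ> srefl s) < len v" if "s \<in> I" for s using len_right_neq[OF v that] that by (meson nat_neq_iff)
    then have "len (v \<circ> x) + len x = len v" if "x \<in> weyl" for x using len_all_descents[OF v] that by blast
    from this[of "inv v \<circ> w0"] have "len w0 + len (inv v \<circ> w0) = len v" using v w0_weyl by (simp add: o_assoc)
    then have "len (inv v \<circ> w0) = 0" using lw[OF v] by linarith
    then have "inv v \<circ> w0 = id" using len_eq_0 v w0_weyl by simp
    then have "v \<circ> (inv v \<circ> w0) = v" by simp
    then have vw: "v = w0" using v by (simp add: o_assoc)
    have "w0 \<circ> residual w0 js = word js" unfolding residual_id[OF js] using w0_weyl by (simp add: o_assoc)
    then show ?thesis using top unfolding vw by simp
  next
    case True
    then obtain s where s: "s \<in> I" "len v < len (v \<circ> srefl s)" by blast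
    define Y where "Y = v \<circ> srefl s"
    have Y: "Y \<in> weyl" unfolding Y_def using v s by simp
    have vY: "v = Y \<circ> srefl s" unfolding Y_def using s by simp
    have lY: "len Y = Suc (len v)" using ascent_or_descent[OF v s(1)] s(2) unfolding Y_def by linarith
    define z where "z = residual v js"
    have z: "z \<in> weyl" unfolding z_def using residual_weyl v js by blast
    have lz: "len (v \<circ> z) + len z = len v" unfolding z_def using residual_props(1)[OF v js] .
    have lY2: "len (Y \<circ> residual Y js) + len (residual Y js) = len Y" using residual_props(1)[OF Y js] .
    have "len w0 - len Y < len w0 - len v" using lY lw[OF Y] by linarith
    then have IH: "\<mu> (Y \<circ> residual Y js) = \<mu> Y" using less.hyps[OF _ Y] by blast
    obtain gw where gw: "reduced gw" "word gw = z" "length gw = len z" by (rule obtain_reduced[OF z])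
    have gI: "gw \<in> lists I" using reduced_lists[OF gw(1)] .
    have dv: "down v gw" using lz gw by (simp add: down_def)
    have dsY: "down Y (s # gw)" using down_append[OF Y, of "[s]" gw] dv vY lY s gI by (simp add: down_def)
    have ra: "(residual Y js = srefl s \<circ> z) \<or> (residual Y js = z)"
      using residual_ascent[OF v s js(1)] unfolding Y_def z_def by blast
    have "\<mu> (v \<circ> z) = \<mu> v"
      using ra
    proof
      \<comment> \<open>The chain from \<open>Y\<close> to \<open>Y \<circ> residual Y js\<close>
        passes through \<open>v\<close>, so \<open>vertex_prefix\<close> applies at its first
        letter.\<close>
      assume r: "residual Y js = srefl s \<circ> z"
      have e: "Y \<circ> residual Y js = v \<circ> z" unfolding r vY by (simp add: o_assoc)
      have "\<mu> (Y \<circ> word ([s] @ gw)) = \<mu> Y" using IH unfolding r word_append gw(2) by simp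
      then have "\<mu> (Y \<circ> word [s]) = \<mu> Y" using vertex_prefix[OF m Y, of "[s]" gw] dsY s gI by simp
      then show ?thesis using IH unfolding e by (simp add: vY)
    next
      assume r: "residual Y js = z"
      have "down Y gw" using lY2 gw unfolding r down_def by simp
      moreover have "\<mu> (Y \<circ> word gw) = \<mu> Y" using IH unfolding r gw(2) .
      ultimately have "\<mu> (Y \<circ> srefl s \<circ> word gw) = \<mu> (Y \<circ> srefl s)" using shadow[OF m M Y s(1) gI dsY] by blast
      then show ?thesis unfolding gw(2) vY[symmetric] .
    qed
    then show ?thesis unfolding z_def .
  qed
qed

theorem vertices_max_below:
  assumes w: "w \<in> weyl" and P: "P \<in> MV_polytopes_highest w" and \<mu>: "MV_polytope P \<mu>" and v: "v \<in> weyl"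
  shows "\<mu> v = \<mu> (max_below v w)"
proof -
  obtain M where M: "BZ_datum M" "\<forall>v\<in>weyl. \<forall>i\<in>I. of_int (M (chamber_weight v i)) = chamber_weight v i (\<mu> v)"
    and h: "P = convex hull (\<mu> ` weyl)" using \<mu> unfolding MV_polytope_def by blast
  obtain \<mu>' where \<mu>': "MV_polytope P \<mu>'" "\<mu>' w = \<mu>' w0" using P unfolding MV_polytopes_highest_def by blast
  obtain M' where M': "BZ_datum M'" "\<forall>v\<in>weyl. \<forall>i\<in>I. of_int (M' (chamber_weight v i)) = chamber_weight v i (\<mu>' v)"
    and h': "P = convex hull (\<mu>' ` weyl)" using \<mu>'(1) unfolding MV_polytope_def by blast
  have m: "vertex_data M \<mu>" and m': "vertex_data M' \<mu>'" using M M' unfolding vertex_data_def BZ_datum_def by auto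
  have tp: "tropical_pluecker M" using M unfolding BZ_datum_def by blast
  have eq: "\<mu> x = \<mu>' x" if "x \<in> weyl" for x using vertex_unique[OF m m' _ that] h h' by simp
  have top: "\<mu> w = \<mu> w0" using eq[OF w] eq[OF w0_weyl] \<mu>'(2) by simp
  obtain js where js: "reduced js" "word js = w" "length js = len w" by (rule obtain_reduced[OF w])
  have jl: "js \<in> lists I" "len (word js) = length js" using js(1) unfolding reduced_def by auto
  show ?thesis using vertex_residual[OF m tp jl _ v] max_below_residual[OF v jl] top js(2) by simp
qed

end

theorem mainTheorem1:
  fixes I :: "'i set"
    and a :: "'i \<Rightarrow> 'i \<Rightarrow> int"
    and coroot :: "'i \<Rightarrow> 'v::real_vector"
    and w :: "'v \<Rightarrow> 'v"
    and P :: "'v set"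
    and \<mu> :: "('v \<Rightarrow> 'v) \<Rightarrow> 'v"
  assumes "root_datum I a coroot"
    and "w \<in> root_datum.weyl I a coroot"
    and "P \<in> root_datum.MV_polytopes_highest I a coroot w"
    and "root_datum.MV_polytope I a coroot P \<mu>"
  shows "\<forall>v \<in> root_datum.weyl I a coroot. \<mu> v = \<mu> (root_datum.max_below I a coroot v w)"
  using root_datum.vertices_max_below[OF assms] by blast

end
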